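(* Let $d \geq 2$. Then $$\| \, |\mathfrak{D}|^{\frac{2-d}{4}} (u^2) \|_{L^2(\mathbb{R}^{1+d})}^2 \leq \frac{2^{\frac{2-3d}{2}}\pi^{\frac{2-d}{2}} }{\Gamma(\frac{d}{2})} \|u_0\|_{L^2}^4 \qquad (1)$$ for all solutions $u$ of the free Schrödinger equation $i\partial_t u + \Delta u = 0$ on $\mathbb{R}^{1+d}$ with initial data $u(0)=u_0\in L^2(\mathbb{R}^d)$, and $$\| \, |\mathfrak{D}|^{\frac{4-d}{4}} (u^2) \|_{L^2(\mathbb{R}^{1+d})}^2 \leq \frac{2^{\frac{2-3d}{2}}\pi^{\frac{2-d}{2}} }{\Gamma(\frac{d}{2})} \|u_0\|_{\dot{H}^1}^2\|u_0\|_{L^2}^2 \qquad (2)$$ for all such solutions with initial data $u_0 \in H^1(\mathbb{R}^d)$. In each case the constant is optimal. Nonzero initial data $u_0$ is an extremiser for (1) (that is, equality holds in (1)) if and only if $\widehat{u}_0 \in \mathfrak{G}$, and nonzero initial data $u_0$ is an extremiser for (2) if and only if $\widehat{u}_0 \in \mathfrak{G}_r$.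
   Context: The Fourier transform is $\widehat{f}(\xi) = \int_{\mathbb{R}^d} f(x) e^{-ix \cdot \xi}\,\mathrm{d}x$. The solution of $i\partial_t u+\Delta u=0$, $u(0)=u_0$ is $u(t,\cdot)=e^{it\Delta}u_0$, i.e. the spatial Fourier transform of $u(t,\cdot)$ is $e^{-it|\xi|^2}\widehat{u}_0(\xi)$. Here $\mathfrak{D} = i\partial_t + \frac{1}{2}\Delta$, and $|\mathfrak{D}|^\beta$ is the space-time Fourier multiplier operator with multiplier $|\tau + \frac{1}{2}|\xi|^2|^\beta$, with respect to the space-time Fourier transform $\widetilde{F}(\tau,\xi) = \int_{\mathbb{R}^{1+d}} F(t,x) e^{-i(t\tau + x \cdot \xi)}\, \mathrm{d}t\, \mathrm{d}x$. The homogeneous Sobolev norm is $\|f\|_{\dot{H}^s} = \|(-\Delta)^{\frac{s}{2}} f\|_{L^2(\mathbb{R}^d)}$, where $(-\Delta)^{s/2}$ is the Fourier multiplier $|\xi|^s$, and $H^s = L^2\cap\dot{H}^s$. $\mathfrak{G}$ is the class of functions on $\mathbb{R}^d$ of the form $\eta\mapsto\exp(a|\eta|^2 + b \cdot \eta + c)$ with $a, c \in \mathbb{C}$, $b \in \mathbb{C}^d$ and $\mathrm{Re}(a) < 0$; $\mathfrak{G}_r$ is the class of functions of the form $\eta\mapsto\exp(a|\eta|^2 + i b \cdot \eta + c)$ with $a, c \in \mathbb{C}$, $b \in \mathbb{R}^d$ and $\mathrm{Re}(a) < 0$. Functions are identified when equal almost everywhere. *)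

theory Defs
  imports "HOL-Analysis.Analysis"
begin

section \<open>Square-integrable functions\<close>

text \<open>Functions are identified when they agree almost everywhere; we work with Borel
  representatives, which every Lebesgue class has.\<close>

definition in_L2 :: "('a::euclidean_space \<Rightarrow> complex) \<Rightarrow> bool" where
  "in_L2 f \<longleftrightarrow> f \<in> borel_measurable lborel \<and> integrable lborel (\<lambda>x. (cmod (f x))\<^sup>2)"

definition L2_norm :: "('a::euclidean_space \<Rightarrow> complex) \<Rightarrow> real" where
  "L2_norm f = sqrt (\<integral>x. (cmod (f x))\<^sup>2 \<partial>lborel)"

section \<open>The Fourier transform\<close>

fun iterated_partial :: "'a::euclidean_space list \<Rightarrow> ('a \<Rightarrow> complex) \<Rightarrow> 'a \<Rightarrow> complex" where
  "iterated_partial [] f = f"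
| "iterated_partial (b # bs) f = (\<lambda>x. frechet_derivative (iterated_partial bs f) (at x) b)"

definition schwartz :: "('a::euclidean_space \<Rightarrow> complex) \<Rightarrow> bool" where
  "schwartz f \<longleftrightarrow>
    (\<forall>bs. set bs \<subseteq> Basis \<longrightarrow>
      (\<forall>x. iterated_partial bs f differentiable (at x)) \<and>
      (\<forall>k::nat. bounded (range (\<lambda>x. (1 + norm x) ^ k * cmod (iterated_partial bs f x)))))"

definition fourier_integral :: "('a::euclidean_space \<Rightarrow> complex) \<Rightarrow> 'a \<Rightarrow> complex" where
  "fourier_integral f \<xi> = (\<integral>x. f x * exp (- \<i> * of_real (x \<bullet> \<xi>)) \<partial>lborel)"

text \<open>A function that is integrable against every Schwartz function defines a tempered
  distribution (continuity of the functional is automatic, by Banach--Steinhaus).\<close>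

definition tempered_fun :: "('a::euclidean_space \<Rightarrow> complex) \<Rightarrow> bool" where
  "tempered_fun f \<longleftrightarrow> f \<in> borel_measurable lborel \<and>
    (\<forall>\<phi>. schwartz \<phi> \<longrightarrow> integrable lborel (\<lambda>x. f x * \<phi> x))"

text \<open>\<open>has_fourier f g\<close>: the Fourier transform of \<open>f\<close>, in the sense of tempered distributions,
  is the function \<open>g\<close>, which is then unique up to null sets.  For integrable \<open>f\<close> this is
  the integral above, for square-integrable \<open>f\<close> its Plancherel extension.  The generality
  is needed because \<open>u\<^sup>2\<close> lies in \<open>L\<^sup>\<infinity>\<close> in time with values in \<open>L\<^sup>1\<close> in space and is therefore
  neither integrable nor, a priori, square-integrable on space-time.\<close>

definition has_fourier ::
    "('a::euclidean_space \<Rightarrow> complex) \<Rightarrow> ('a \<Rightarrow> complex) \<Rightarrow> bool" where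
  "has_fourier f g \<longleftrightarrow> tempered_fun f \<and> tempered_fun g \<and>
    (\<forall>\<phi>. schwartz \<phi> \<longrightarrow>
      (\<integral>x. f x * fourier_integral \<phi> x \<partial>lborel) = (\<integral>\<xi>. g \<xi> * \<phi> \<xi> \<partial>lborel))"

section \<open>Fourier multipliers with square-integrable output\<close>

definition is_multiplier_image ::
    "('a::euclidean_space \<Rightarrow> real) \<Rightarrow> ('a \<Rightarrow> complex) \<Rightarrow> ('a \<Rightarrow> complex) \<Rightarrow> bool" where
  "is_multiplier_image m f h \<longleftrightarrow> in_L2 h \<and>
    (\<exists>g. has_fourier f g \<and> has_fourier h (\<lambda>\<xi>. of_real (m \<xi>) * g \<xi>))"

definition in_multiplier_domain ::
    "('a::euclidean_space \<Rightarrow> real) \<Rightarrow> ('a \<Rightarrow> complex) \<Rightarrow> bool" where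
  "in_multiplier_domain m f \<longleftrightarrow> (\<exists>h. is_multiplier_image m f h)"

text \<open>Determined up to null sets on \<open>in_multiplier_domain\<close>, and unspecified elsewhere.\<close>

definition fourier_multiplier ::
    "('a::euclidean_space \<Rightarrow> real) \<Rightarrow> ('a \<Rightarrow> complex) \<Rightarrow> 'a \<Rightarrow> complex" where
  "fourier_multiplier m f = (SOME h. is_multiplier_image m f h)"

text \<open>The multiplier \<open>|\<xi>|\<^sup>s\<close> of \<open>(-\<Delta>)\<^bsup>s/2\<^esup>\<close>. In both multipliers below, the convention
  \<open>0 powr s = 0\<close> only matters on a null set.\<close>

definition riesz_symbol :: "real \<Rightarrow> 'a::euclidean_space \<Rightarrow> real" where
  "riesz_symbol s \<xi> = norm \<xi> powr s"

definition in_H :: "real \<Rightarrow> ('a::euclidean_space \<Rightarrow> complex) \<Rightarrow> bool" where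
  "in_H s f \<longleftrightarrow> in_L2 f \<and> in_multiplier_domain (riesz_symbol s) f"

definition Hdot_norm :: "real \<Rightarrow> ('a::euclidean_space \<Rightarrow> complex) \<Rightarrow> real" where
  "Hdot_norm s f = L2_norm (fourier_multiplier (riesz_symbol s) f)"

text \<open>The symbol of \<open>|\<DD>|\<^sup>\<beta>\<close>, where \<open>\<DD> = i \<partial>\<^sub>t + \<Delta>/2\<close>; points of space-time, and of its
  dual, are pairs with the time variable first.\<close>

definition D_symbol :: "real \<Rightarrow> real \<times> 'a::euclidean_space \<Rightarrow> real" where
  "D_symbol \<beta> = (\<lambda>(\<tau>, \<xi>). \<bar>\<tau> + (norm \<xi>)\<^sup>2 / 2\<bar> powr \<beta>)"

definition D_power ::
    "real \<Rightarrow> (real \<times> 'a::euclidean_space \<Rightarrow> complex) \<Rightarrow> real \<times> 'a \<Rightarrow> complex" where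
  "D_power \<beta> = fourier_multiplier (D_symbol \<beta>)"

section \<open>The free Schroedinger equation\<close>

definition schroedinger_solution ::
    "('a::euclidean_space \<Rightarrow> complex) \<Rightarrow> (real \<times> 'a \<Rightarrow> complex) \<Rightarrow> bool" where
  "schroedinger_solution u0 u \<longleftrightarrow> u \<in> borel_measurable lborel \<and>
    (\<exists>v. has_fourier u0 v \<and>
      (\<forall>t. in_L2 (\<lambda>x. u (t, x)) \<and>
        has_fourier (\<lambda>x. u (t, x)) (\<lambda>\<xi>. exp (- \<i> * of_real (t * (norm \<xi>)\<^sup>2)) * v \<xi>)))"

section \<open>Gaussians\<close>

definition gaussians :: "(real^'n \<Rightarrow> complex) set" where
  "gaussians = {g. \<exists>(a::complex) (b::complex^'n) (c::complex). Re a < 0 \<and>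
    g = (\<lambda>\<eta>. exp (a * of_real ((norm \<eta>)\<^sup>2) + (\<Sum>j\<in>UNIV. b $ j * of_real (\<eta> $ j)) + c))}"

definition gaussians_r :: "(real^'n \<Rightarrow> complex) set" where
  "gaussians_r = {g. \<exists>(a::complex) (b::real^'n) (c::complex). Re a < 0 \<and>
    g = (\<lambda>\<eta>. exp (a * of_real ((norm \<eta>)\<^sup>2) + \<i> * of_real (b \<bullet> \<eta>) + c))}"

section \<open>The two estimates\<close>

definition sharp_constant :: "real \<Rightarrow> real" where
  "sharp_constant d = 2 powr ((2 - 3 * d) / 2) * pi powr ((2 - d) / 2) / Gamma (d / 2)"

text \<open>The solution with given data is unique up to null sets, so the quantifier over \<open>u\<close> only
  ranges over its representatives.\<close>

definition extremiser1 :: "(real^'n \<Rightarrow> complex) \<Rightarrow> bool" where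
  "extremiser1 u0 \<longleftrightarrow> (\<exists>u. schroedinger_solution u0 u \<and>
    (L2_norm (D_power ((2 - real CARD('n)) / 4) (\<lambda>z. (u z)\<^sup>2)))\<^sup>2
      = sharp_constant (real CARD('n)) * L2_norm u0 ^ 4)"

definition extremiser2 :: "(real^'n \<Rightarrow> complex) \<Rightarrow> bool" where
  "extremiser2 u0 \<longleftrightarrow> (\<exists>u. schroedinger_solution u0 u \<and>
    (L2_norm (D_power ((4 - real CARD('n)) / 4) (\<lambda>z. (u z)\<^sup>2)))\<^sup>2
      = sharp_constant (real CARD('n)) * (Hdot_norm 1 u0)\<^sup>2 * (L2_norm u0)\<^sup>2)"

end

theory Submission imports Defs "HOL-Probability.Probability" begin

text \<open>Let \<open>v\<close> be the Fourier transform of \<open>u\<^sub>0\<close> and \<open>w(z, y) = v(z/2 + y) v(z/2 - y)\<close>. At time \<open>t\<close> the spatial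
  transform of \<open>u\<^sup>2\<close> is, up to a constant, the integral of \<open>exp (-it (|z|\<^sup>2/2 + 2|y|\<^sup>2)) w(z, y)\<close> over \<open>y\<close>.
  Hence the space-time transform of \<open>u\<^sup>2\<close> at \<open>(\<tau>, z)\<close> lives on \<open>s = -\<tau> - |z|\<^sup>2/2 > 0\<close>, and it is a power of \<open>s\<close>
  times the average \<open>M(z, s)\<close> of \<open>w(z, y)\<close> over the sphere \<open>2|y|\<^sup>2 = s\<close>. The exponents of \<open>|\<DD>|\<close> are those for
  which the left-hand side becomes the integral of \<open>s\<^sup>j |M|\<^sup>2\<close> against Lebesgue measure in \<open>(z, y)\<close>, with \<open>j = 0\<close>
  and \<open>j = 1\<close> respectively. The same integral of \<open>s\<^sup>j |w|\<^sup>2\<close> is elementary, as \<open>s = |\<xi> - \<eta>|\<^sup>2/2\<close> for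
  \<open>\<xi> = z/2 + y\<close> and \<open>\<eta> = z/2 - y\<close>: it is the product of the norms on the right, minus, when \<open>j = 1\<close>, the square
  of the first moment of \<open>|v|\<^sup>2\<close>. So the deficit in either estimate is the variance of \<open>w\<close> on the spheres, plus
  this squared moment.

  The deficit vanishes only if \<open>v(\<xi>) v(\<eta>)\<close> depends on \<open>\<xi> + \<eta>\<close> and \<open>|\<xi> - \<eta>|\<close> alone. This property passes
  to products with a Gaussian and to Fourier transforms, which gives a continuous function with the same property;
  such a function has no zeros, and its logarithm is a quadratic polynomial with scalar quadratic part. In the
  second estimate the moment must vanish too, which forces the real part of the linear coefficient to be zero.\<close>

section \<open>Gaussians and the Fourier integral\<close>

text \<open>\<open>u^2\<close> is bounded in time with values in L1 of space, so its space-time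
  transform is accessible only through test functions. Transforming the test function in time alone
  turns the evolution into a phase, and its decay in \<open>t\<close> supplies the absolute
  convergence that \<open>u^2\<close> lacks. Energies are extended nonnegative integrals, so the
  variance identity holds before anything is known to be finite; the elementary side then bounds the
  rest. For rigidity, \<open>v\<close> is only an L2 class and its symmetry holds only almost
  everywhere. A Gaussian factor makes it integrable, and the Fourier integral is continuous and
  symmetric at every pair of points. In dimension one the spheres are pairs of points y, -y on which
  w is automatically constant, so nothing could follow; dimension at least 2 enters through a vector
  orthogonal to a given one and through a second coordinate axis. The way back applies the same
  rigidity to the Gaussian just found, so that no complex Gaussian integral is evaluated.\<close>

lemma lborel_distr_translation: "distr lborel lborel (\<lambda>x. t + x) = (lborel :: 'a::euclidean_space measure)"
  using lborel_distr_plus[of t] by (simp cong: distr_cong)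

lemma lborel_distr_reflection: "distr lborel lborel (\<lambda>x. t - x) = (lborel :: 'a::euclidean_space measure)"
  using lborel_affine[of "-1" t] by (simp add: density_1 cong: distr_cong)

lemma
  fixes f :: "'a::euclidean_space \<Rightarrow> 'b::{banach, second_countable_topology}"
  assumes [measurable]: "f \<in> borel_measurable borel"
  shows integral_translation: "(\<integral>x. f (t + x) \<partial>lborel) = (\<integral>x. f x \<partial>lborel)"
    and integrable_translation: "integrable lborel (\<lambda>x. f (t + x)) \<longleftrightarrow> integrable lborel f"
    and integral_reflection: "(\<integral>x. f (t - x) \<partial>lborel) = (\<integral>x. f x \<partial>lborel)"
    and integrable_reflection: "integrable lborel (\<lambda>x. f (t - x)) \<longleftrightarrow> integrable lborel f"
proof -
  show "(\<integral>x. f (t + x) \<partial>lborel) = (\<integral>x. f x \<partial>lborel)"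
    by (subst (2) lborel_distr_translation[of t, symmetric], subst integral_distr) auto
  show "integrable lborel (\<lambda>x. f (t + x)) \<longleftrightarrow> integrable lborel f"
    by (subst (2) lborel_distr_translation[of t, symmetric], subst integrable_distr_eq) auto
  show "(\<integral>x. f (t - x) \<partial>lborel) = (\<integral>x. f x \<partial>lborel)"
    by (subst (2) lborel_distr_reflection[of t, symmetric], subst integral_distr) auto
  show "integrable lborel (\<lambda>x. f (t - x)) \<longleftrightarrow> integrable lborel f"
    by (subst (2) lborel_distr_reflection[of t, symmetric], subst integrable_distr_eq) auto
qed

lemma
  fixes f :: "'a::euclidean_space \<Rightarrow> ennreal"
  assumes [measurable]: "f \<in> borel_measurable borel"
  shows nn_integral_translation: "(\<integral>\<^sup>+x. f (t + x) \<partial>lborel) = (\<integral>\<^sup>+x. f x \<partial>lborel)"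
    and nn_integral_reflection: "(\<integral>\<^sup>+x. f (t - x) \<partial>lborel) = (\<integral>\<^sup>+x. f x \<partial>lborel)"
proof -
  show "(\<integral>\<^sup>+x. f (t + x) \<partial>lborel) = (\<integral>\<^sup>+x. f x \<partial>lborel)"
    by (subst (2) lborel_distr_translation[of t, symmetric], subst nn_integral_distr) auto
  show "(\<integral>\<^sup>+x. f (t - x) \<partial>lborel) = (\<integral>\<^sup>+x. f x \<partial>lborel)"
    by (subst (2) lborel_distr_reflection[of t, symmetric], subst nn_integral_distr) auto
qed

lemma nn_integral_scale:
  fixes f :: "'a::euclidean_space \<Rightarrow> ennreal"
  assumes [measurable]: "f \<in> borel_measurable borel" and "c > 0"
  shows "(\<integral>\<^sup>+x. f x \<partial>lborel) = ennreal (c ^ DIM('a)) * (\<integral>\<^sup>+x. f (c *\<^sub>R x) \<partial>lborel)"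
proof -
  have "(\<integral>\<^sup>+x. f x \<partial>lborel) = (\<integral>\<^sup>+x. f x \<partial>density (distr lborel borel (\<lambda>x. 0 + c *\<^sub>R x)) (\<lambda>_. ennreal (\<bar>c\<bar> ^ DIM('a))))"
    using lborel_affine[of c "0::'a"] assms by simp
  also have "\<dots> = ennreal (c ^ DIM('a)) * (\<integral>\<^sup>+x. f (c *\<^sub>R x) \<partial>lborel)"
    using assms(2) by (simp add: nn_integral_density nn_integral_distr nn_integral_cmult)
  finally show ?thesis .
qed

lemma integral_scale:
  fixes f :: "'a::euclidean_space \<Rightarrow> 'b::{banach, second_countable_topology}"
  assumes [measurable]: "f \<in> borel_measurable borel" and "c > 0"
  shows "(\<integral>x. f x \<partial>lborel) = (c ^ DIM('a)) *\<^sub>R (\<integral>x. f (c *\<^sub>R x) \<partial>lborel)"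
proof -
  have "(\<integral>x. f x \<partial>lborel) = (\<integral>x. f x \<partial>density (distr lborel borel (\<lambda>x. 0 + c *\<^sub>R x)) (\<lambda>_. ennreal (\<bar>c\<bar> ^ DIM('a))))"
    using lborel_affine[of c "0::'a"] assms by simp
  also have "\<dots> = (c ^ DIM('a)) *\<^sub>R (\<integral>x. f (c *\<^sub>R x) \<partial>lborel)"
    using assms(2) by (simp add: integral_density integral_distr)
  finally show ?thesis .
qed

section \<open>Products over coordinates and polynomial weights\<close>

lemma
  fixes f :: "'a::euclidean_space \<Rightarrow> real \<Rightarrow> 'c::{real_normed_field,banach,second_countable_topology}"
  assumes f: "\<And>b. b \<in> Basis \<Longrightarrow> integrable lborel (f b)"
  shows integrable_prod_Basis: "integrable lborel (\<lambda>x. \<Prod>b\<in>Basis. f b (x \<bullet> b))"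
    and integral_prod_Basis: "(\<integral>x. (\<Prod>b\<in>Basis. f b (x \<bullet> b)) \<partial>lborel) = (\<Prod>b\<in>Basis. \<integral>t. f b t \<partial>lborel)"
proof -
  interpret product_sigma_finite "\<lambda>_::'a. lborel :: real measure" ..
  have m[measurable]: "f b \<in> borel_measurable borel" if "b \<in> Basis" for b
    using borel_measurable_integrable[OF f[OF that]] by simp
  have [measurable]: "(\<lambda>x. \<Prod>b\<in>Basis. f b (x \<bullet> b)) \<in> borel_measurable borel"
    by (intro borel_measurable_prod measurable_compose[OF _ m]) simp_all
  have eq: "(\<Prod>b\<in>Basis. f b ((\<Sum>b'\<in>Basis. x b' *\<^sub>R b') \<bullet> b)) = (\<Prod>b\<in>Basis. f b (x b))" for x :: "'a \<Rightarrow> real"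
    by (intro prod.cong) (simp_all)
  show "integrable lborel (\<lambda>x. \<Prod>b\<in>Basis. f b (x \<bullet> b))"
    by (subst lborel_eq, subst integrable_distr_eq)
       (simp_all add: eq product_integrable_prod f)
  show "(\<integral>x. (\<Prod>b\<in>Basis. f b (x \<bullet> b)) \<partial>lborel) = (\<Prod>b\<in>Basis. \<integral>t. f b t \<partial>lborel)"
    by (subst lborel_eq, subst integral_distr)
       (simp_all add: eq product_integral_prod f)
qed

text \<open>The majorant is the product over coordinates of 1 / (1 + x^2), which is integrable
  factor by factor. Each factor costs two powers of \<open>1 + norm x\<close>, whence the exponent
  \<open>2 * DIM('a)\<close> where d + 1 would be optimal.\<close>

lemma integrable_inverse_poly:
  assumes "k \<ge> 2 * DIM('a)"
  shows "integrable lborel (\<lambda>x::'a::euclidean_space. 1 / (1 + norm x) ^ k)"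
proof (rule Bochner_Integration.integrable_bound)
  have "integrable lborel (\<lambda>x::real. inverse (1 + x^2))"
    using integrable_inverse_1_plus_square by (simp add: set_integrable_def)
  then show "integrable lborel (\<lambda>x::'a. \<Prod>b\<in>Basis. inverse (1 + (x \<bullet> b)^2))"
    by (rule integrable_prod_Basis)
  show "AE x::'a in lborel. norm (1 / (1 + norm x) ^ k) \<le> norm (\<Prod>b\<in>Basis. inverse (1 + (x \<bullet> b)\<^sup>2))"
  proof (intro AE_I2)
    fix x :: 'a
    have "(\<Prod>b\<in>(Basis::'a set). 1 + (x \<bullet> b)\<^sup>2) \<le> (\<Prod>b\<in>(Basis::'a set). (1 + norm x)^2)"
    proof (intro prod_mono conjI)
      fix b :: 'a assume "b \<in> Basis"
      then have "(x \<bullet> b)\<^sup>2 \<le> (norm x)\<^sup>2" using Basis_le_norm by (metis abs_ge_zero abs_le_square_iff abs_norm_cancel)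
      also have "1 + (norm x)\<^sup>2 \<le> (1 + norm x)^2" by (simp add: power2_sum)
      finally show "1 + (x \<bullet> b)\<^sup>2 \<le> (1 + norm x)^2" by simp
    qed simp
    also have "\<dots> = (1 + norm x) ^ (2 * DIM('a))" by (simp add: power_mult)
    also have "\<dots> \<le> (1 + norm x) ^ k" by (intro power_increasing assms) auto
    finally have *: "(\<Prod>b\<in>(Basis::'a set). 1 + (x \<bullet> b)\<^sup>2) \<le> (1 + norm x) ^ k" .
    have pos: "(\<Prod>b\<in>(Basis::'a set). 1 + (x \<bullet> b)\<^sup>2) > 0" by (intro prod_pos) (simp add: add_pos_nonneg)
    have "norm (1 / (1 + norm x) ^ k) = inverse ((1 + norm x) ^ k)" by (simp add: divide_inverse)
    also have "\<dots> \<le> inverse (\<Prod>b\<in>(Basis::'a set). 1 + (x \<bullet> b)\<^sup>2)"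
      using * pos by (rule le_imp_inverse_le)
    also have "\<dots> = norm (\<Prod>b\<in>(Basis::'a set). inverse (1 + (x \<bullet> b)\<^sup>2))"
      using pos prod_inversef[of "\<lambda>b. 1 + (x \<bullet> b)\<^sup>2" "Basis :: 'a set"] by (simp add: o_def)
    finally show "norm (1 / (1 + norm x) ^ k) \<le> norm (\<Prod>b\<in>Basis. inverse (1 + (x \<bullet> b)\<^sup>2))" .
  qed
qed simp

section \<open>Gaussian functions and their Fourier transforms\<close>

definition gauss :: "real \<Rightarrow> 'a::euclidean_space \<Rightarrow> real" where
  "gauss s x = exp (- (s * (norm x)\<^sup>2 / 2))"

lemma gauss_measurable[measurable]: "gauss s \<in> borel_measurable borel"
  unfolding gauss_def by measurable

lemma gauss_pos: "gauss s x > 0" and gauss_nonneg: "gauss s x \<ge> 0"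
  by (simp_all add: gauss_def)

lemma gauss_prod: "gauss s (x::'a::euclidean_space) = (\<Prod>b\<in>Basis. exp (- (s * (x \<bullet> b)\<^sup>2 / 2)))"
proof -
  have "(norm x)\<^sup>2 = (\<Sum>b\<in>Basis. (x \<bullet> b)\<^sup>2)"
    unfolding power2_norm_eq_inner by (subst euclidean_inner) (simp add: power2_eq_square)
  then show ?thesis
    by (simp add: gauss_def exp_sum[symmetric] sum_negf sum_distrib_left sum_divide_distrib)
qed

text \<open>The characteristic function of the standard normal distribution is the case
  \<open>s = 1\<close>; the substitution x -> sqrt s * x gives the rest. The parameter
  \<open>s\<close> is an inverse variance, so the transform turns it into
  \<open>1 / s\<close>.\<close>

lemma gauss_real_fourier:
  assumes s: "s > 0"
  shows "integrable lborel (\<lambda>x::real. of_real (exp (- (s * x\<^sup>2 / 2))) * iexp (t * x))"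
    and "(\<integral>x. of_real (exp (- (s * x\<^sup>2 / 2))) * iexp (t * x) \<partial>lborel)
          = of_real (sqrt (2 * pi / s) * exp (- (t\<^sup>2 / (2 * s))))"
proof -
  have std: "(\<integral>x. of_real (exp (- (x\<^sup>2 / 2))) * iexp (u * x) \<partial>lborel) = of_real (sqrt (2 * pi) * exp (- (u\<^sup>2 / 2)))" for u
  proof -
    have "of_real (exp (- (u\<^sup>2 / 2))) = char std_normal_distribution u"
      by (simp add: char_std_normal_distribution)
    also have "\<dots> = (\<integral>x. std_normal_density x *\<^sub>R iexp (u * x) \<partial>lborel)"
      unfolding char_def by (subst integral_density) auto
    also have "\<dots> = (\<integral>x. (1 / sqrt (2 * pi)) *\<^sub>R (of_real (exp (- (x\<^sup>2 / 2))) * iexp (u * x)) \<partial>lborel)"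
      by (intro Bochner_Integration.integral_cong) (simp_all add: std_normal_density_def scaleR_conv_of_real)
    finally have "of_real (exp (- (u\<^sup>2 / 2))) = (1 / sqrt (2 * pi)) *\<^sub>R (\<integral>x. of_real (exp (- (x\<^sup>2 / 2))) * iexp (u * x) \<partial>lborel)"
      by simp
    then show ?thesis by (simp add: scaleR_conv_of_real field_simps)
  qed
  have i0: "integrable lborel (\<lambda>x::real. exp (- (x\<^sup>2 / 2)))"
  proof -
    have "integrable lborel (\<lambda>x. sqrt (2 * pi) * std_normal_density x)"
      by (intro integrable_mult_right) simp
    then show ?thesis by (simp add: std_normal_density_def)
  qed
  have e: "s * x\<^sup>2 = (sqrt s * x)\<^sup>2" for x using s by (simp add: power_mult_distrib)
  have i1: "integrable lborel (\<lambda>x::real. exp (- (s * x\<^sup>2 / 2)))"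
    unfolding e using lborel_integrable_real_affine[OF i0, of "sqrt s" 0] s by simp
  show "integrable lborel (\<lambda>x::real. of_real (exp (- (s * x\<^sup>2 / 2))) * iexp (t * x))"
    by (rule Bochner_Integration.integrable_bound[OF i1]) (auto simp: norm_mult)
  have "(\<integral>x. of_real (exp (- (x\<^sup>2 / 2))) * iexp (t / sqrt s * x) \<partial>lborel)
      = sqrt s *\<^sub>R (\<integral>x. of_real (exp (- (s * x\<^sup>2 / 2))) * iexp (t * x) \<partial>lborel)"
    using s by (subst lborel_integral_real_affine[where c="sqrt s" and t=0]) (simp_all add: power_mult_distrib)
  then show "(\<integral>x. of_real (exp (- (s * x\<^sup>2 / 2))) * iexp (t * x) \<partial>lborel)
          = of_real (sqrt (2 * pi / s) * exp (- (t\<^sup>2 / (2 * s))))"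
    unfolding std using s by (simp add: scaleR_conv_of_real field_simps real_sqrt_divide power_divide)
qed

lemma gauss_integral_exp:
  fixes y :: "'a::euclidean_space"
  assumes s: "s > 0"
  shows "integrable lborel (\<lambda>x. of_real (gauss s x) * exp (\<i> * of_real (x \<bullet> y)))"
    and "(\<integral>x. of_real (gauss s x) * exp (\<i> * of_real (x \<bullet> y)) \<partial>lborel)
          = of_real (sqrt (2 * pi / s) ^ DIM('a) * gauss (1 / s) y)"
proof -
  have eq: "of_real (gauss s x) * exp (\<i> * of_real (x \<bullet> y))
    = (\<Prod>b\<in>Basis. of_real (exp (- (s * (x \<bullet> b)\<^sup>2 / 2))) * iexp ((y \<bullet> b) * (x \<bullet> b)))" for x
  proof -
    have "of_real (gauss s x) = (\<Prod>b\<in>Basis. of_real (exp (- (s * (x \<bullet> b)\<^sup>2 / 2))) :: complex)"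
      by (simp add: gauss_prod)
    moreover have "exp (\<i> * of_real (x \<bullet> y)) = (\<Prod>b\<in>Basis. iexp ((y \<bullet> b) * (x \<bullet> b)))"
      by (simp add: exp_sum[symmetric] sum_distrib_left[symmetric] euclidean_inner[of x y] mult.commute)
    ultimately show ?thesis by (simp only: prod.distrib)
  qed
  show "integrable lborel (\<lambda>x. of_real (gauss s x) * exp (\<i> * of_real (x \<bullet> y)))"
    unfolding eq by (intro integrable_prod_Basis gauss_real_fourier s)
  have "(\<integral>x. of_real (gauss s x) * exp (\<i> * of_real (x \<bullet> y)) \<partial>lborel)
     = (\<Prod>b\<in>(Basis::'a set). of_real (sqrt (2 * pi / s) * exp (- ((y \<bullet> b)\<^sup>2 / (2 * s)))))"
    unfolding eq by (subst integral_prod_Basis) (intro gauss_real_fourier s prod.cong refl)+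
  also have "\<dots> = of_real (sqrt (2 * pi / s) ^ DIM('a) * gauss (1 / s) y)"
    by (simp add: gauss_prod prod.distrib mult.commute[of 2])
  finally show "(\<integral>x. of_real (gauss s x) * exp (\<i> * of_real (x \<bullet> y)) \<partial>lborel)
          = of_real (sqrt (2 * pi / s) ^ DIM('a) * gauss (1 / s) y)" .
qed

lemma integrable_gauss: "s > 0 \<Longrightarrow> integrable lborel (gauss s :: 'a::euclidean_space \<Rightarrow> real)"
  using integrable_norm[OF gauss_integral_exp(1)[of s "0::'a"]] by (simp add: gauss_nonneg)

lemma integral_gauss:
  assumes "s > 0" shows "(\<integral>x. gauss s (x::'a::euclidean_space) \<partial>lborel) = sqrt (2 * pi / s) ^ DIM('a)"
  using gauss_integral_exp(2)[of s "0::'a"] assms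
  by (simp add: gauss_def flip: of_real_eq_iff[where 'a=complex])

lemma fourier_integral_gauss:
  fixes y :: "'a::euclidean_space"
  assumes "s > 0"
  shows "fourier_integral (\<lambda>x. of_real (gauss s x)) y = of_real (sqrt (2 * pi / s) ^ DIM('a) * gauss (1 / s) y)"
  using gauss_integral_exp(2)[OF assms, of "- y"] by (simp add: fourier_integral_def gauss_def)

section \<open>The Fourier integral and the multiplication formula\<close>

lemma fourier_integral_measurable[measurable]:
  assumes [measurable]: "f \<in> borel_measurable borel"
  shows "fourier_integral (f :: 'a::euclidean_space \<Rightarrow> complex) \<in> borel_measurable borel"
  unfolding fourier_integral_def[abs_def] by measurable

lemma norm_exp_i[simp]: "cmod (exp (\<i> * of_real x)) = 1" "cmod (exp (- (\<i> * of_real x))) = 1"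
  by (simp_all add: norm_exp_eq_Re)

lemma integrable_fourier_kernel:
  fixes f :: "'a::euclidean_space \<Rightarrow> complex"
  assumes "integrable lborel f"
  shows "integrable lborel (\<lambda>x. f x * exp (- \<i> * of_real (x \<bullet> \<xi>)))"
    "integrable lborel (\<lambda>x. f x * exp (- (\<i> * of_real (x \<bullet> \<xi>))))"
    "integrable lborel (\<lambda>x. f x * exp (\<i> * of_real (x \<bullet> \<xi>)))"
proof -
  have [measurable]: "f \<in> borel_measurable borel"
    using borel_measurable_integrable[OF assms] by simp
  show "integrable lborel (\<lambda>x. f x * exp (- \<i> * of_real (x \<bullet> \<xi>)))"
    "integrable lborel (\<lambda>x. f x * exp (- (\<i> * of_real (x \<bullet> \<xi>))))"
    "integrable lborel (\<lambda>x. f x * exp (\<i> * of_real (x \<bullet> \<xi>)))"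
    by (rule Bochner_Integration.integrable_bound[OF assms]; simp add: norm_mult)+
qed

lemma le_norm_real: "x \<le> y \<Longrightarrow> x \<le> norm (y::real)"
  by simp

text \<open>For the uses of Fubini in which decay in each variable comes from a different factor, so
  that the natural majorant is a product.\<close>

lemma integrable_pair_bound:
  fixes F :: "'a::euclidean_space \<times> 'b::euclidean_space \<Rightarrow> 'c::{banach,second_countable_topology}"
    and a b :: "_ \<Rightarrow> real"
  assumes F: "F \<in> borel_measurable borel" and a: "integrable lborel a" and b: "integrable lborel b"
    and bd: "\<And>x y. norm (F (x, y)) \<le> a x * b y"
  shows "integrable (lborel \<Otimes>\<^sub>M lborel) F"
proof (rule lborel_pair.Fubini_integrable)
  show m: "F \<in> borel_measurable (lborel \<Otimes>\<^sub>M lborel)" using F by (simp add: lborel_prod)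
  have m1: "(\<lambda>y. F (x, y)) \<in> borel_measurable lborel" for x
    using measurable_compose[OF _ F, of "\<lambda>y. (x, y)" lborel] by (simp add: borel_prod[symmetric])
  have i: "integrable lborel (\<lambda>y. norm (F (x, y)))" for x
  proof (rule Bochner_Integration.integrable_bound[OF integrable_mult_right[OF b, of "a x"]])
    show "AE y in lborel. norm (norm (F (x, y))) \<le> norm (a x * b y)"
      using bd by (intro AE_I2 le_norm_real) simp
  qed (use m1 in simp)
  show "AE x in lborel. integrable lborel (\<lambda>y. F (x, y))"
    by (rule AE_I2, rule integrable_norm_cancel[OF i m1])
  show "integrable lborel (\<lambda>x. \<integral>y. norm (F (x, y)) \<partial>lborel)"
  proof (rule Bochner_Integration.integrable_bound)
    show "integrable lborel (\<lambda>x. a x * (\<integral>y. b y \<partial>lborel))" using a by simp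
    show "(\<lambda>x. \<integral>y. norm (F (x, y)) \<partial>lborel) \<in> borel_measurable lborel"
      using lborel.borel_measurable_lebesgue_integral[of "\<lambda>x y. norm (F (x, y))" lborel] m by simp
    have "(\<integral>y. norm (F (x, y)) \<partial>lborel) \<le> (\<integral>y. a x * b y \<partial>lborel)" for x
      by (intro integral_mono i integrable_mult_right b bd)
    then show "AE x in lborel. norm (\<integral>y. norm (F (x, y)) \<partial>lborel) \<le> norm (a x * (\<integral>y. b y \<partial>lborel))"
      by (intro AE_I2 le_norm_real) (simp add: abs_of_nonneg)
  qed
qed

text \<open>Both sides are the same double integral. This identity is the pattern for every
  generalised transform: \<open>l2fourier\<close> and \<open>has_fourier\<close> impose it on a
  class of test functions.\<close>

lemma fourier_multiplication:
  fixes f g :: "'a::euclidean_space \<Rightarrow> complex"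
  assumes f: "integrable lborel f" and g: "integrable lborel g"
  shows "(\<integral>x. f x * fourier_integral g x \<partial>lborel) = (\<integral>x. fourier_integral f x * g x \<partial>lborel)"
proof -
  have [measurable]: "f \<in> borel_measurable borel" "g \<in> borel_measurable borel"
    using borel_measurable_integrable[OF f] borel_measurable_integrable[OF g] by simp_all
  have i: "integrable (lborel \<Otimes>\<^sub>M lborel) (\<lambda>(x, y). f x * (g y * exp (- \<i> * of_real (y \<bullet> x))))"
    by (rule integrable_pair_bound[where a="\<lambda>x. norm (f x)" and b="\<lambda>y. norm (g y)"])
       (simp_all add: f g norm_mult borel_prod[symmetric])
  have "(\<integral>x. f x * fourier_integral g x \<partial>lborel) = (\<integral>x. \<integral>y. f x * (g y * exp (- \<i> * of_real (y \<bullet> x))) \<partial>lborel \<partial>lborel)"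
    unfolding fourier_integral_def by (simp only: integral_mult_right_zero)
  also have "\<dots> = (\<integral>y. \<integral>x. f x * (g y * exp (- \<i> * of_real (y \<bullet> x))) \<partial>lborel \<partial>lborel)"
    using lborel_pair.Fubini_integral[OF i] by simp
  also have "\<dots> = (\<integral>y. (\<integral>x. (f x * exp (- \<i> * of_real (x \<bullet> y))) * g y \<partial>lborel) \<partial>lborel)"
    by (simp add: mult_ac inner_commute)
  also have "\<dots> = (\<integral>x. fourier_integral f x * g x \<partial>lborel)"
    unfolding fourier_integral_def by (simp only: integral_mult_left_zero)
  finally show ?thesis .
qed

section \<open>The heat kernel as an approximate identity; uniqueness and inversion\<close>

definition heat :: "real \<Rightarrow> 'a::euclidean_space \<Rightarrow> real" where
  "heat s x = gauss s x / sqrt (2 * pi / s) ^ DIM('a)"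

lemma heat_measurable[measurable]: "heat s \<in> borel_measurable borel"
  unfolding heat_def by measurable

lemma heat_nonneg: "s > 0 \<Longrightarrow> heat s x \<ge> 0"
  by (simp add: heat_def gauss_nonneg)

lemma integrable_heat: "s > 0 \<Longrightarrow> integrable lborel (heat s :: 'a::euclidean_space \<Rightarrow> real)"
  unfolding heat_def using integrable_gauss[of s] by (intro integrable_divide) auto

lemma integral_heat: "s > 0 \<Longrightarrow> (\<integral>x. heat s (x::'a::euclidean_space) \<partial>lborel) = 1"
  unfolding heat_def using integral_gauss[of s, where 'a='a] by simp

lemma heat_minus: "heat s (- x) = heat s x" "heat s (x - y) = heat s (y - x)"
  by (simp_all add: heat_def gauss_def norm_minus_commute)

lemma heat_bounded: "s > 0 \<Longrightarrow> heat s (x::'a::euclidean_space) \<le> 1 / sqrt (2 * pi / s) ^ DIM('a)"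
  by (simp add: heat_def gauss_def divide_right_mono)

lemma gauss_le_1: "s \<ge> 0 \<Longrightarrow> gauss s x \<le> 1"
  by (simp add: gauss_def)

lemma heat_fourier:
  fixes z :: "'a::euclidean_space"
  assumes s: "s > 0"
  shows "of_real ((2 * pi) ^ DIM('a) * heat s z) = (\<integral>\<xi>. of_real (gauss (1 / s) \<xi>) * exp (\<i> * of_real (\<xi> \<bullet> z)) \<partial>lborel)"
proof -
  have "sqrt (2 * pi / (1 / s)) * sqrt (2 * pi / s) = 2 * pi"
    using s real_sqrt_abs[of "2 * pi"] by (simp add: real_sqrt_mult[symmetric] power2_eq_square)
  then have "(2 * pi) ^ DIM('a) = sqrt (2 * pi / (1 / s)) ^ DIM('a) * sqrt (2 * pi / s) ^ DIM('a)"
    by (simp only: power_mult_distrib[symmetric])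
  then have "(2 * pi) ^ DIM('a) * heat s z = sqrt (2 * pi / (1 / s)) ^ DIM('a) * gauss s z"
    using s by (simp add: heat_def)
  then show ?thesis using gauss_integral_exp(2)[of "1 / s" z] s by simp
qed

text \<open>The multiplication formula against a modulated Gaussian, whose transform is a translated
  heat kernel. The damping makes the bounded function \<open>fourier_integral f\<close> integrable,
  so this is an inversion formula for every integrable \<open>f\<close>. As \<open>s\<close> grows,
  the damping fades on the left and the kernel concentrates on the right.\<close>

lemma fourier_gauss_mean:
  fixes f :: "'a::euclidean_space \<Rightarrow> complex"
  assumes f: "integrable lborel f" and s: "s > 0"
  shows "(\<integral>\<xi>. fourier_integral f \<xi> * exp (\<i> * of_real (x \<bullet> \<xi>)) * of_real (gauss (1 / s) \<xi>) \<partial>lborel)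
       = of_real ((2 * pi) ^ DIM('a)) * (\<integral>y. f y * of_real (heat s (x - y)) \<partial>lborel)"
proof -
  have [measurable]: "f \<in> borel_measurable borel"
    using borel_measurable_integrable[OF f] by simp_all
  let ?g = "\<lambda>\<xi>. exp (\<i> * of_real (x \<bullet> \<xi>)) * of_real (gauss (1 / s) \<xi>) :: complex"
  have g: "integrable lborel ?g"
    using gauss_integral_exp(1)[of "1/s" x] s by (simp add: mult_ac inner_commute)
  have "fourier_integral ?g y = of_real ((2 * pi) ^ DIM('a) * heat s (x - y))" for y
    unfolding fourier_integral_def heat_fourier[OF s]
    by (intro Bochner_Integration.integral_cong) (simp_all add: inner_commute inner_diff algebra_simps flip: exp_add)
  then have "(\<integral>y. f y * of_real ((2 * pi) ^ DIM('a) * heat s (x - y)) \<partial>lborel) = (\<integral>y. fourier_integral f y * ?g y \<partial>lborel)"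
    using fourier_multiplication[OF f g] by simp
  then show ?thesis
    by (simp only: of_real_mult mult.left_commute[of "f _"] integral_mult_right_zero mult.assoc)
qed

text \<open>Rescaling by \<open>sqrt s\<close> moves the parameter from the kernel into the argument
  of \<open>h\<close>, so that one fixed Gaussian dominates the whole sequence.\<close>

lemma heat_convolution_tendsto:
  fixes h :: "'a::euclidean_space \<Rightarrow> complex"
  assumes c: "continuous_on UNIV h" and b: "\<And>x. cmod (h x) \<le> B"
  shows "(\<lambda>n. \<integral>x. h x * of_real (heat (real (Suc n)) (x - y)) \<partial>lborel) \<longlonglongrightarrow> h y"
proof -
  have [measurable]: "h \<in> borel_measurable borel" using c by (rule borel_measurable_continuous_onI)
  have eq: "(\<integral>x. h x * of_real (heat s (x - y)) \<partial>lborel) = (\<integral>w. h (y + (1 / sqrt s) *\<^sub>R w) * of_real (heat 1 w) \<partial>lborel)"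
    if s: "s > 0" for s
  proof -
    have "(\<integral>x. h x * of_real (heat s (x - y)) \<partial>lborel) = (\<integral>z. h (y + z) * of_real (heat s z) \<partial>lborel)"
      by (subst integral_translation[of _ y, symmetric]) simp_all
    also have "\<dots> = ((1 / sqrt s) ^ DIM('a)) *\<^sub>R (\<integral>w. h (y + (1 / sqrt s) *\<^sub>R w) * of_real (heat s ((1 / sqrt s) *\<^sub>R w)) \<partial>lborel)"
      using s by (subst integral_scale[where c="1 / sqrt s"]) simp_all
    also have "\<dots> = (\<integral>w. h (y + (1 / sqrt s) *\<^sub>R w) * of_real (heat 1 w) \<partial>lborel)"
    proof -
      have "gauss s ((1 / sqrt s) *\<^sub>R w) = gauss 1 w" for w :: 'a
        using s by (simp add: gauss_def power_divide)
      moreover have "(1 / sqrt s) ^ DIM('a) / sqrt (2 * pi / s) ^ DIM('a) = 1 / sqrt (2 * pi) ^ DIM('a)"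
        using s by (simp add: power_divide real_sqrt_divide)
      ultimately have "(1 / sqrt s) ^ DIM('a) * heat s ((1 / sqrt s) *\<^sub>R w) = heat 1 w" for w :: 'a
        unfolding heat_def by (metis (no_types, lifting) div_by_1 mult.commute mult.left_neutral times_divide_eq_left times_divide_eq_right)
      then have "of_real ((1 / sqrt s) ^ DIM('a)) * (c * of_real (heat s ((1 / sqrt s) *\<^sub>R w))) = c * of_real (heat 1 w)"
        for w :: 'a and c :: complex
        by (metis mult.left_commute of_real_mult)
      then show ?thesis by (simp only: scaleR_conv_of_real flip: integral_mult_right_zero)
    qed
    finally show ?thesis .
  qed
  have "(\<lambda>n. \<integral>w. h (y + (1 / sqrt (real (Suc n))) *\<^sub>R w) * of_real (heat 1 w) \<partial>lborel) \<longlonglongrightarrow> (\<integral>w. h y * of_real (heat 1 (w::'a)) \<partial>lborel)"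
  proof (rule integral_dominated_convergence[where w="\<lambda>w. B * heat 1 w"])
    show "AE w in lborel. (\<lambda>n. h (y + (1 / sqrt (real (Suc n))) *\<^sub>R w) * of_real (heat 1 w)) \<longlonglongrightarrow> h y * of_real (heat 1 w)"
    proof (intro AE_I2 tendsto_mult tendsto_const)
      fix w
      have "(\<lambda>n. 1 / sqrt (real (Suc n))) \<longlonglongrightarrow> 0"
        by (intro tendsto_divide_0[OF tendsto_const] filterlim_at_top_imp_at_infinity
             filterlim_compose[OF sqrt_at_top] filterlim_compose[OF filterlim_real_sequentially] filterlim_Suc)
      then have "(\<lambda>n. y + (1 / sqrt (real (Suc n))) *\<^sub>R w) \<longlonglongrightarrow> y + 0 *\<^sub>R w"
        by (intro tendsto_intros)
      moreover have "isCont h (y + 0 *\<^sub>R w)" using c by (simp add: continuous_on_eq_continuous_at)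
      ultimately have "(\<lambda>n. h (y + (1 / sqrt (real (Suc n))) *\<^sub>R w)) \<longlonglongrightarrow> h (y + 0 *\<^sub>R w)"
        using isCont_tendsto_compose by blast
      then show "(\<lambda>n. h (y + (1 / sqrt (real (Suc n))) *\<^sub>R w)) \<longlonglongrightarrow> h y" by simp
    qed
    show "integrable lborel (\<lambda>w::'a. B * heat 1 w)" by (intro integrable_mult_right integrable_heat) simp
    show "AE w in lborel. norm (h (y + (1 / sqrt (real (Suc n))) *\<^sub>R w) * of_real (heat 1 w)) \<le> B * heat 1 w" for n
      using b by (simp add: norm_mult heat_nonneg mult_right_mono)
  qed simp_all
  moreover have "(\<integral>w. h y * of_real (heat 1 (w::'a)) \<partial>lborel) = h y"
    by (simp add: integral_heat)
  moreover have "(\<integral>x. h x * of_real (heat (real (Suc n)) (x - y)) \<partial>lborel)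
      = (\<integral>w. h (y + (1 / sqrt (real (Suc n))) *\<^sub>R w) * of_real (heat 1 w) \<partial>lborel)" for n
    by (rule eq) simp
  ultimately show ?thesis by (simp only:)
qed

text \<open>The continuous functions \<open>max 0 (1 - real n * infdist x C)\<close> decrease to the
  indicator of the closed set \<open>C\<close>, and closed sets are a generator stable under
  intersection. The Dynkin class argument gets complements from the fact that \<open>UNIV\<close> is
  closed.\<close>

lemma AE_zero_if_integral_continuous_zero:
  fixes f :: "'a::euclidean_space \<Rightarrow> complex"
  assumes f: "integrable lborel f"
    and z: "\<And>h::'a \<Rightarrow> real. continuous_on UNIV h \<Longrightarrow> (\<And>x. \<bar>h x\<bar> \<le> 1) \<Longrightarrow> (\<integral>x. f x * of_real (h x) \<partial>lborel) = 0"
  shows "AE x in lborel. f x = 0"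
proof (rule sigma_finite_measure.density_zero[OF sigma_finite_lborel f])
  have [measurable]: "f \<in> borel_measurable borel"
    using borel_measurable_integrable[OF f] by simp_all
  have closed: "set_lebesgue_integral lborel C f = 0" if C: "closed C" for C
  proof (cases "C = {}")
    case False
    let ?h = "\<lambda>n x. max 0 (1 - real n * infdist x C)"
    have [measurable]: "C \<in> sets borel" using C by simp
    have ct: "continuous_on UNIV (?h n)" for n by (intro continuous_intros)
    then have [measurable]: "?h n \<in> borel_measurable borel" for n by (rule borel_measurable_continuous_onI)
    have "(\<lambda>n. \<integral>x. f x * of_real (?h n x) \<partial>lborel) \<longlonglongrightarrow> (\<integral>x. f x * of_real (indicator C x) \<partial>lborel)"
    proof (rule integral_dominated_convergence[where w="\<lambda>x. cmod (f x)"])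
      show "AE x in lborel. (\<lambda>n. f x * of_real (?h n x)) \<longlonglongrightarrow> f x * of_real (indicator C x)"
      proof (intro AE_I2 tendsto_mult tendsto_const tendsto_of_real)
        fix x
        show "(\<lambda>n. ?h n x) \<longlonglongrightarrow> indicator C x"
        proof (cases "x \<in> C")
          case False
          then have p: "infdist x C > 0"
            using C \<open>C \<noteq> {}\<close> in_closed_iff_infdist_zero[of C x] infdist_nonneg[of x C] by force
          obtain N where N: "real N * infdist x C > 1" using reals_Archimedean3[OF p] by blast
          have "?h n x = 0" if "n \<ge> N" for n
          proof -
            have "real N * infdist x C \<le> real n * infdist x C" using that p by (intro mult_right_mono) auto
            then show ?thesis using N by simp
          qed
          then show ?thesis using False
            by (intro tendsto_eventually) (auto simp: eventually_sequentially)
        qed simp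
      qed
    qed (use f in \<open>auto simp: norm_mult infdist_nonneg intro!: mult_left_le\<close>)
    moreover have "(\<integral>x. f x * of_real (?h n x) \<partial>lborel) = 0" for n
      by (intro z ct) (auto simp: infdist_nonneg)
    ultimately have "(\<integral>x. f x * of_real (indicator C x) \<partial>lborel) = 0"
      by (simp add: LIMSEQ_const_iff)
    then show ?thesis by (simp add: set_lebesgue_integral_def scaleR_conv_of_real mult.commute)
  qed (simp add: set_lebesgue_integral_def)
  have si: "set_integrable lborel A f" if "A \<in> sets lborel" for A
    using integrable_mult_indicator[OF that f] by (simp add: set_integrable_def)
  fix A :: "'a set" assume "A \<in> sets lborel"
  then have sA: "A \<in> sigma_sets UNIV (Collect closed)" by (simp add: borel_eq_closed sets_measure_of)
  have "Int_stable (Collect closed :: 'a set set)" "Collect closed \<subseteq> Pow (UNIV :: 'a set)"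
    by (auto simp: Int_stable_def)
  then show "set_lebesgue_integral lborel A f = 0" using sA
  proof (induction rule: sigma_sets_induct_disjoint)
    case (basic A) then show ?case using closed by simp
  next
    case empty show ?case by (simp add: set_lebesgue_integral_def)
  next
    case (compl A)
    then have A: "A \<in> sets lborel" by (simp add: borel_eq_closed sets_measure_of)
    have "set_lebesgue_integral lborel UNIV f = set_lebesgue_integral lborel (A \<union> (UNIV - A)) f" by simp
    also have "\<dots> = set_lebesgue_integral lborel A f + set_lebesgue_integral lborel (UNIV - A) f"
      using A by (intro set_integral_Un si) auto
    finally show ?case using compl closed[of UNIV] by simp
  next
    case (union A)
    then have A: "A i \<in> sets lborel" for i by (auto simp: borel_eq_closed sets_measure_of)
    have "set_lebesgue_integral lborel (\<Union>i. A i) f = (\<Sum>i. set_lebesgue_integral lborel (A i) f)"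
      using union(1) A by (intro lebesgue_integral_countable_add si) (auto simp: disjoint_family_on_def)
    then show ?case using union by simp
  qed
qed

text \<open>A bounded continuous \<open>h\<close> times a Gaussian is an integrable test function
  \<open>k\<close>. The integral of \<open>f * k\<close> is the limit of the integrals of
  \<open>f\<close> against heat averages of \<open>k\<close>; by Fubini the kernel falls on
  \<open>f\<close>, where \<open>fourier_gauss_mean\<close> makes it vanish.\<close>

theorem fourier_integral_unique:
  fixes f :: "'a::euclidean_space \<Rightarrow> complex"
  assumes f: "integrable lborel f" and 0: "\<And>\<xi>. fourier_integral f \<xi> = 0"
  shows "AE x in lborel. f x = 0"
proof -
  have [measurable]: "f \<in> borel_measurable borel"
    using borel_measurable_integrable[OF f] by simp_all
  have "AE x in lborel. f x * of_real (gauss 1 x) = 0"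
  proof (rule AE_zero_if_integral_continuous_zero)
    show "integrable lborel (\<lambda>x. f x * of_real (gauss 1 x))"
      by (rule Bochner_Integration.integrable_bound[OF f])
         (auto simp: norm_mult gauss_nonneg intro!: mult_left_le gauss_le_1)
    fix h :: "'a \<Rightarrow> real" assume c: "continuous_on UNIV h" and b: "\<And>x. \<bar>h x\<bar> \<le> 1"
    have [measurable]: "h \<in> borel_measurable borel" using c by (rule borel_measurable_continuous_onI)
    define k where "k x = complex_of_real (h x * gauss 1 x)" for x
    have [measurable]: "k \<in> borel_measurable borel" unfolding k_def by measurable
    have ck: "continuous_on UNIV k" unfolding k_def gauss_def by (intro continuous_intros c) auto
    have nk: "cmod (k x) \<le> gauss 1 x" for x
      using mult_right_mono[OF b[of x] gauss_nonneg[of 1 x]] by (simp add: k_def norm_mult abs_mult gauss_nonneg)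
    have nk1: "cmod (k x) \<le> 1" for x using nk[of x] gauss_le_1[of 1 x] by simp
    have zero: "(\<integral>y. f y * (\<integral>x. k x * of_real (heat s (x - y)) \<partial>lborel) \<partial>lborel) = 0" if s: "s > 0" for s
    proof -
      let ?C = "1 / sqrt (2 * pi / s) ^ DIM('a)"
      have "(\<integral>y. f y * (\<integral>x. k x * of_real (heat s (x - y)) \<partial>lborel) \<partial>lborel)
          = (\<integral>y. \<integral>x. f y * (k x * of_real (heat s (x - y))) \<partial>lborel \<partial>lborel)"
        by (simp only: integral_mult_right_zero)
      also have "\<dots> = (\<integral>x. \<integral>y. f y * (k x * of_real (heat s (x - y))) \<partial>lborel \<partial>lborel)"
      proof -
        have "integrable (lborel \<Otimes>\<^sub>M lborel) (\<lambda>(y, x). f y * (k x * of_real (heat s (x - y))))"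
        proof (rule integrable_pair_bound[where a="\<lambda>y. cmod (f y) * ?C" and b="gauss 1"])
          fix x y :: 'a
          have "cmod (k x) * heat s (x - y) \<le> gauss 1 x * ?C"
            using s by (intro mult_mono nk heat_bounded heat_nonneg gauss_nonneg)
          then show "norm (case (y, x) of (y, x) \<Rightarrow> f y * (k x * of_real (heat s (x - y)))) \<le> cmod (f y) * ?C * gauss 1 x"
            using s mult_left_mono[of _ _ "cmod (f y)"] by (fastforce simp: norm_mult heat_nonneg mult_ac)
        qed (use f integrable_gauss[of 1] in \<open>auto simp: borel_prod[symmetric]\<close>)
        from lborel_pair.Fubini_integral[OF this] show ?thesis by simp
      qed
      also have "\<dots> = (\<integral>x. k x * (\<integral>y. f y * of_real (heat s (x - y)) \<partial>lborel) \<partial>lborel)"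
        by (simp only: mult.left_commute[of "f _"] integral_mult_right_zero)
      also have "\<dots> = 0" using fourier_gauss_mean[OF f s] 0 by simp
      finally show ?thesis .
    qed
    have "(\<lambda>n. \<integral>y. f y * (\<integral>x. k x * of_real (heat (real (Suc n)) (x - y)) \<partial>lborel) \<partial>lborel)
        \<longlonglongrightarrow> (\<integral>y. f y * k y \<partial>lborel)"
    proof (rule integral_dominated_convergence[where w="\<lambda>y. cmod (f y)"])
      show "AE y in lborel. (\<lambda>n. f y * (\<integral>x. k x * of_real (heat (real (Suc n)) (x - y)) \<partial>lborel)) \<longlonglongrightarrow> f y * k y"
        by (intro AE_I2 tendsto_mult tendsto_const heat_convolution_tendsto[OF ck nk1])
      have "cmod (\<integral>x. k x * of_real (heat (real (Suc n)) (x - y)) \<partial>lborel) \<le> 1" for n y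
      proof -
        have i: "integrable lborel (\<lambda>x. heat (real (Suc n)) (x - y))"
          using integrable_heat[of "real (Suc n)"] integrable_translation[of "heat (real (Suc n))" "- y"] by simp
        have "cmod (\<integral>x. k x * of_real (heat (real (Suc n)) (x - y)) \<partial>lborel) \<le> (\<integral>x. heat (real (Suc n)) (x - y) \<partial>lborel)"
          by (rule Bochner_Integration.integral_norm_bound_integral[OF Bochner_Integration.integrable_bound[OF i] i])
             (use nk1 in \<open>auto simp: norm_mult heat_nonneg intro!: mult_left_le_one_le\<close>)
        also have "\<dots> = 1"
          using integral_heat[of "real (Suc n)", where 'a='a] integral_translation[of "heat (real (Suc n))" "- y"] by simp
        finally show ?thesis .
      qed
      then show "AE y in lborel. norm (f y * (\<integral>x. k x * of_real (heat (real (Suc n)) (x - y)) \<partial>lborel)) \<le> cmod (f y)" for n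
        by (auto simp: norm_mult intro!: mult_left_le)
    qed (use f in auto)
    then have "(\<integral>y. f y * k y \<partial>lborel) = 0" using zero by (simp add: LIMSEQ_const_iff)
    then show "(\<integral>x. f x * of_real (gauss 1 x) * of_real (h x) \<partial>lborel) = 0"
      by (simp add: k_def mult_ac)
  qed
  then show ?thesis by (simp add: gauss_def)
qed

text \<open>The damped inversion integral has two limits as the damping is removed: dominated by the
  integrable transform it tends to the undamped integral, and by \<open>fourier_gauss_mean\<close>
  it is a heat average of \<open>f\<close>.\<close>

theorem fourier_inversion:
  fixes f :: "'a::euclidean_space \<Rightarrow> complex"
  assumes f: "integrable lborel f" and F: "integrable lborel (fourier_integral f)"
    and c: "continuous_on UNIV f" and b: "\<And>x. cmod (f x) \<le> B"
  shows "(\<integral>\<xi>. fourier_integral f \<xi> * exp (\<i> * of_real (x \<bullet> \<xi>)) \<partial>lborel) = of_real ((2 * pi) ^ DIM('a)) * f x"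
proof -
  have [measurable]: "f \<in> borel_measurable borel"
    using borel_measurable_integrable[OF f] by simp_all
  let ?L = "\<lambda>n. \<integral>\<xi>. fourier_integral f \<xi> * exp (\<i> * of_real (x \<bullet> \<xi>)) * of_real (gauss (1 / real (Suc n)) \<xi>) \<partial>lborel"
  have "?L \<longlonglongrightarrow> (\<integral>\<xi>. fourier_integral f \<xi> * exp (\<i> * of_real (x \<bullet> \<xi>)) * of_real 1 \<partial>lborel)"
  proof (rule integral_dominated_convergence[where w="\<lambda>\<xi>. cmod (fourier_integral f \<xi>)"])
    have "(\<lambda>n. gauss (1 / real (Suc n)) \<xi>) \<longlonglongrightarrow> 1" for \<xi> :: 'a
    proof -
      have "(\<lambda>n. exp (- (1 / real (Suc n) * (norm \<xi>)\<^sup>2 / 2))) \<longlonglongrightarrow> exp (- (0 * (norm \<xi>)\<^sup>2 / 2))"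
        by (intro tendsto_intros LIMSEQ_Suc[OF lim_1_over_n]) auto
      then show ?thesis by (simp add: gauss_def)
    qed
    then show "AE \<xi> in lborel. (\<lambda>n. fourier_integral f \<xi> * exp (\<i> * of_real (x \<bullet> \<xi>)) * of_real (gauss (1 / real (Suc n)) \<xi>))
        \<longlonglongrightarrow> fourier_integral f \<xi> * exp (\<i> * of_real (x \<bullet> \<xi>)) * of_real 1"
      by (intro AE_I2 tendsto_mult tendsto_const tendsto_of_real)
  qed (use F in \<open>auto simp: norm_mult gauss_nonneg intro!: mult_left_le gauss_le_1\<close>)
  moreover have "?L n = of_real ((2 * pi) ^ DIM('a)) * (\<integral>y. f y * of_real (heat (real (Suc n)) (y - x)) \<partial>lborel)" for n
    using fourier_gauss_mean[OF f, of "real (Suc n)" x] by (simp add: heat_minus(2)[of _ x])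
  then have "?L \<longlonglongrightarrow> of_real ((2 * pi) ^ DIM('a)) * f x"
    by (simp only:) (intro tendsto_mult tendsto_const heat_convolution_tendsto[OF c b])
  ultimately show ?thesis using LIMSEQ_unique by fastforce
qed

section \<open>The Fourier transform on square-integrable functions\<close>

abbreviation L2_sq :: "('a::euclidean_space \<Rightarrow> complex) \<Rightarrow> real" where
  "L2_sq f \<equiv> (\<integral>x. (cmod (f x))\<^sup>2 \<partial>lborel)"

lemma in_L2_measurable: "in_L2 f \<Longrightarrow> f \<in> borel_measurable borel"
  and in_L2_integrable: "in_L2 f \<Longrightarrow> integrable lborel (\<lambda>x. (cmod (f x))\<^sup>2)"
  by (simp_all add: in_L2_def)

lemma in_L2I:
  "f \<in> borel_measurable borel \<Longrightarrow> integrable lborel (\<lambda>x. (cmod (f x))\<^sup>2) \<Longrightarrow> in_L2 f"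
  by (simp add: in_L2_def)

lemma in_L2_bound:
  assumes f: "f \<in> borel_measurable borel" and g: "integrable lborel g" and b: "\<And>x. (cmod (f x))\<^sup>2 \<le> g x"
  shows "in_L2 f"
proof (rule in_L2I[OF f], rule Bochner_Integration.integrable_bound[OF g])
  show "AE x in lborel. norm ((cmod (f x))\<^sup>2) \<le> norm (g x)"
    using b by (intro AE_I2 le_norm_real) simp
qed (use f in simp)

lemma norm_add_sq_le: "(norm (a + b))\<^sup>2 \<le> 2 * (norm a)\<^sup>2 + 2 * (norm (b::'a::real_normed_vector))\<^sup>2"
proof -
  have "(norm (a + b))\<^sup>2 \<le> (norm a + norm b)\<^sup>2" by (intro power_mono norm_triangle_ineq) simp
  also have "\<dots> \<le> 2 * (norm a)\<^sup>2 + 2 * (norm b)\<^sup>2"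
    using sum_squares_bound[of "norm a" "norm b"] by (simp add: power2_sum)
  finally show ?thesis .
qed

lemma in_L2_add_cmult:
  assumes f: "in_L2 f" and g: "in_L2 g"
  shows "in_L2 (\<lambda>x. f x + c * g x)"
proof (rule in_L2_bound)
  show "integrable lborel (\<lambda>x. 2 * (cmod (f x))\<^sup>2 + 2 * ((cmod c)\<^sup>2 * (cmod (g x))\<^sup>2))"
    using f g by (intro Bochner_Integration.integrable_add integrable_mult_right in_L2_integrable)
  show "(cmod (f x + c * g x))\<^sup>2 \<le> 2 * (cmod (f x))\<^sup>2 + 2 * ((cmod c)\<^sup>2 * (cmod (g x))\<^sup>2)" for x
    using norm_add_sq_le[of "f x" "c * g x"] by (simp add: norm_mult power_mult_distrib)
qed (use in_L2_measurable[OF f] in_L2_measurable[OF g] in simp)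

lemma in_L2_diff: "in_L2 f \<Longrightarrow> in_L2 g \<Longrightarrow> in_L2 (\<lambda>x. f x - g x)"
  using in_L2_add_cmult[of f g "-1"] by simp

lemma in_L2_cmult: "in_L2 f \<Longrightarrow> in_L2 (\<lambda>x. c * f x)"
  by (rule in_L2I; use in_L2_measurable[of f] in_L2_integrable[of f] in \<open>simp add: norm_mult power_mult_distrib\<close>)

lemma cnj_measurable[measurable]: "cnj \<in> borel_measurable borel"
  by (intro borel_measurable_continuous_onI continuous_intros)

lemma in_L2_cnj: "in_L2 f \<Longrightarrow> in_L2 (\<lambda>x. cnj (f x))"
  by (rule in_L2I; use in_L2_measurable[of f] in_L2_integrable[of f] in simp)

lemma in_L2_mult_unimodular:
  assumes "in_L2 f" "h \<in> borel_measurable borel" "\<And>x. cmod (h x) = 1"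
  shows "in_L2 (\<lambda>x. h x * f x)" "in_L2 (\<lambda>x. f x * h x)"
proof -
  have [measurable]: "f \<in> borel_measurable borel" "h \<in> borel_measurable borel"
    using assms in_L2_measurable by auto
  show "in_L2 (\<lambda>x. h x * f x)" "in_L2 (\<lambda>x. f x * h x)"
    using in_L2_integrable[OF assms(1)] by (auto intro!: in_L2I simp: norm_mult assms(3))
qed

lemma in_L2_reflect:
  assumes f: "in_L2 f"
  shows "in_L2 (\<lambda>x. f (a - x))" "in_L2 (\<lambda>x. f (- x))" "in_L2 (\<lambda>x. f (a + x))"
proof -
  have *: "(\<lambda>x. (cmod (f x))\<^sup>2) \<in> borel_measurable borel" using in_L2_measurable[OF f] by measurable
  have [measurable]: "f \<in> borel_measurable borel" by (rule in_L2_measurable[OF f])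
  show "in_L2 (\<lambda>x. f (a - x))"
    using integrable_reflection[OF *, of a] in_L2_integrable[OF f] by (intro in_L2I) simp_all
  show "in_L2 (\<lambda>x. f (- x))"
    using integrable_reflection[OF *, of 0] in_L2_integrable[OF f] by (intro in_L2I) simp_all
  show "in_L2 (\<lambda>x. f (a + x))"
    using integrable_translation[OF *, of a] in_L2_integrable[OF f] by (intro in_L2I) simp_all
qed

lemma in_L2_cong_AE:
  assumes f: "in_L2 f" and g: "g \<in> borel_measurable borel" and ae: "AE x in lborel. f x = g x"
  shows "in_L2 g"
proof (rule in_L2I[OF g])
  show "integrable lborel (\<lambda>x. (cmod (g x))\<^sup>2)"
    by (rule integrable_cong_AE_imp[OF in_L2_integrable[OF f]]) (use g ae in auto)
qed

lemma L2_mult_integrable: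
  assumes f: "in_L2 f" and g: "in_L2 g"
  shows "integrable lborel (\<lambda>x. f x * g x)"
proof (rule Bochner_Integration.integrable_bound)
  show "integrable lborel (\<lambda>x. (cmod (f x))\<^sup>2 + (cmod (g x))\<^sup>2)"
    using f g by (intro Bochner_Integration.integrable_add in_L2_integrable)
  have "2 * (cmod (f x) * cmod (g x)) \<le> (cmod (f x))\<^sup>2 + (cmod (g x))\<^sup>2" for x
    using sum_squares_bound[of "cmod (f x)" "cmod (g x)"] by simp
  then have "cmod (f x) * cmod (g x) \<le> (cmod (f x))\<^sup>2 + (cmod (g x))\<^sup>2" for x
    by (smt (verit) mult_nonneg_nonneg norm_ge_zero)
  then show "AE x in lborel. norm (f x * g x) \<le> norm ((cmod (f x))\<^sup>2 + (cmod (g x))\<^sup>2)"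
    by (intro AE_I2 le_norm_real) (simp add: norm_mult)
qed (use in_L2_measurable[OF f] in_L2_measurable[OF g] in simp)

lemma quadratic_nonneg_discriminant:
  fixes a i s :: real
  assumes q: "\<And>t. 0 \<le> a * t\<^sup>2 + 2 * i * t + s" and "a \<ge> 0"
  shows "i\<^sup>2 \<le> s * a"
proof (cases "a = 0")
  case True
  have "i = 0"
  proof (rule ccontr)
    assume "i \<noteq> 0"
    \<comment> \<open>At this point the affine function \<open>2 * i * t + s\<close> takes the value
      -1.\<close>
    then show False using q[of "- (s + 1) / (2 * i)"] True by simp
  qed
  then show ?thesis using True by simp
next
  case False
  then have "a * (- i / a)\<^sup>2 + 2 * i * (- i / a) + s = s - i\<^sup>2 / a"
    by (simp add: power2_eq_square field_simps)
  then show ?thesis using q[of "- i / a"] False assms(2) by (simp add: pos_divide_le_eq)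
qed

lemma L2_Cauchy_Schwarz:
  assumes f: "in_L2 f" and g: "in_L2 g"
  shows "(cmod (\<integral>x. f x * g x \<partial>lborel))\<^sup>2 \<le> L2_sq f * L2_sq g"
proof -
  let ?I = "\<integral>x. cmod (f x) * cmod (g x) \<partial>lborel"
  have i: "integrable lborel (\<lambda>x. cmod (f x) * cmod (g x))"
    using integrable_norm[OF L2_mult_integrable[OF f g]] by (simp add: norm_mult)
  have q: "0 \<le> L2_sq g * t\<^sup>2 + 2 * ?I * t + L2_sq f" for t
  proof -
    have "0 \<le> (\<integral>x. (t * cmod (g x) + cmod (f x))\<^sup>2 \<partial>lborel)" by simp
    also have "\<dots> = (\<integral>x. (cmod (g x))\<^sup>2 * t\<^sup>2 + 2 * t * (cmod (f x) * cmod (g x)) + (cmod (f x))\<^sup>2 \<partial>lborel)"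
      by (intro Bochner_Integration.integral_cong) (simp_all add: power2_eq_square algebra_simps)
    also have "\<dots> = L2_sq g * t\<^sup>2 + 2 * t * ?I + L2_sq f"
      using in_L2_integrable[OF f] in_L2_integrable[OF g] i by simp
    finally show ?thesis by (simp add: mult_ac)
  qed
  have "?I\<^sup>2 \<le> L2_sq f * L2_sq g"
    using q by (intro quadratic_nonneg_discriminant) simp_all
  moreover have "cmod (\<integral>x. f x * g x \<partial>lborel) \<le> ?I"
    using integral_norm_bound[of lborel "\<lambda>x. f x * g x"] by (simp add: norm_mult)
  then have "(cmod (\<integral>x. f x * g x \<partial>lborel))\<^sup>2 \<le> ?I\<^sup>2" by (rule power_mono) simp
  ultimately show ?thesis by linarith
qed

text \<open>A triangle inequality for squared norms. The factor 2 does no harm where the errors are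
  geometric.\<close>

lemma L2_sq_diff_le:
  assumes f: "in_L2 f" and g: "in_L2 g" and h: "in_L2 h"
  shows "L2_sq (\<lambda>x. f x - h x) \<le> 2 * L2_sq (\<lambda>x. f x - g x) + 2 * L2_sq (\<lambda>x. g x - h x)"
proof -
  have "L2_sq (\<lambda>x. f x - h x) \<le> (\<integral>x. 2 * (cmod (f x - g x))\<^sup>2 + 2 * (cmod (g x - h x))\<^sup>2 \<partial>lborel)"
    using norm_add_sq_le[of "f x - g x" "g x - h x" for x]
    by (intro integral_mono in_L2_integrable in_L2_diff Bochner_Integration.integrable_add integrable_mult_right f g h) auto
  also have "\<dots> = 2 * L2_sq (\<lambda>x. f x - g x) + 2 * L2_sq (\<lambda>x. g x - h x)"
    using in_L2_integrable[OF in_L2_diff[OF f g]] in_L2_integrable[OF in_L2_diff[OF g h]] by simp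
  finally show ?thesis .
qed

lemma L2_pairing_tendsto:
  assumes a: "\<And>n. in_L2 (a n)" and l: "in_L2 l" and b: "in_L2 b"
    and lim: "(\<lambda>n. L2_sq (\<lambda>x. a n x - l x)) \<longlonglongrightarrow> 0"
  shows "(\<lambda>n. \<integral>x. a n x * b x \<partial>lborel) \<longlonglongrightarrow> (\<integral>x. l x * b x \<partial>lborel)"
proof -
  have "(\<lambda>n. (cmod ((\<integral>x. a n x * b x \<partial>lborel) - (\<integral>x. l x * b x \<partial>lborel)))\<^sup>2) \<longlonglongrightarrow> 0"
  proof (rule tendsto_sandwich[OF _ _ tendsto_const])
    show "\<forall>\<^sub>F n in sequentially. (cmod ((\<integral>x. a n x * b x \<partial>lborel) - (\<integral>x. l x * b x \<partial>lborel)))\<^sup>2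
        \<le> L2_sq (\<lambda>x. a n x - l x) * L2_sq b"
    proof (intro always_eventually allI)
      fix n
      have "(\<integral>x. a n x * b x \<partial>lborel) - (\<integral>x. l x * b x \<partial>lborel) = (\<integral>x. (a n x - l x) * b x \<partial>lborel)"
        using L2_mult_integrable[OF a b] L2_mult_integrable[OF l b] by (simp add: algebra_simps)
      then show "(cmod ((\<integral>x. a n x * b x \<partial>lborel) - (\<integral>x. l x * b x \<partial>lborel)))\<^sup>2 \<le> L2_sq (\<lambda>x. a n x - l x) * L2_sq b"
        using L2_Cauchy_Schwarz[OF in_L2_diff[OF a l] b, of n] by simp
    qed
    show "(\<lambda>n. L2_sq (\<lambda>x. a n x - l x) * L2_sq b) \<longlonglongrightarrow> 0"
      using tendsto_mult_right[OF lim, of "L2_sq b"] by simp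
  qed simp
  then have "(\<lambda>n. (\<integral>x. a n x * b x \<partial>lborel) - (\<integral>x. l x * b x \<partial>lborel)) \<longlonglongrightarrow> 0"
    by (simp add: tendsto_norm_zero_iff)
  then show ?thesis by (rule LIM_zero_cancel)
qed

text \<open>Completeness of L2 for sequences with geometric steps, including almost everywhere
  convergence. The increments are weighted by \<open>2 ^ n\<close>; against the rate
  \<open>(1 / 4) ^ n\<close> this leaves a convergent series, so \<open>H\<close> is finite almost
  everywhere, and \<open>2 / 2 ^ n\<close> times \<open>H\<close> bounds every pointwise
  tail.\<close>

lemma L2_fast_limit:
  fixes g :: "nat \<Rightarrow> 'a::euclidean_space \<Rightarrow> complex"
  assumes g: "\<And>n. in_L2 (g n)" and C: "\<And>n. L2_sq (\<lambda>x. g (Suc n) x - g n x) \<le> C * (1 / 4) ^ n"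
  obtains l where "in_L2 l" "(\<lambda>n. L2_sq (\<lambda>x. g n x - l x)) \<longlonglongrightarrow> 0" "AE x in lborel. (\<lambda>n. g n x) \<longlonglongrightarrow> l x"
proof -
  have [measurable]: "g n \<in> borel_measurable borel" for n by (rule in_L2_measurable[OF g])
  define H where "H x = (\<Sum>n. ennreal (2 ^ n * (cmod (g (Suc n) x - g n x))\<^sup>2))" for x
  have [measurable]: "H \<in> borel_measurable borel" unfolding H_def by measurable
  have "(\<integral>\<^sup>+x. H x \<partial>lborel) = (\<Sum>n. \<integral>\<^sup>+x. ennreal (2 ^ n * (cmod (g (Suc n) x - g n x))\<^sup>2) \<partial>lborel)"
    unfolding H_def by (intro nn_integral_suminf) simp
  also have "\<dots> \<le> (\<Sum>n. ennreal (C * (1 / 2) ^ n))"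
  proof (intro suminf_le)
    fix n
    have "(\<integral>\<^sup>+x. ennreal (2 ^ n * (cmod (g (Suc n) x - g n x))\<^sup>2) \<partial>lborel) = ennreal (2 ^ n * L2_sq (\<lambda>x. g (Suc n) x - g n x))"
      using in_L2_integrable[OF in_L2_diff[OF g g]] by (subst nn_integral_eq_integral) simp_all
    also have "\<dots> \<le> ennreal (2 ^ n * (C * (1 / 4) ^ n))" by (intro ennreal_leI mult_left_mono C) simp
    also have "2 ^ n * (C * (1 / 4) ^ n) = C * (1 / 2) ^ n"
      using power_mult_distrib[of 2 "1/4::real" n] by simp
    finally show "(\<integral>\<^sup>+x. ennreal (2 ^ n * (cmod (g (Suc n) x - g n x))\<^sup>2) \<partial>lborel) \<le> ennreal (C * (1 / 2) ^ n)" .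
  qed simp_all
  also have "\<dots> < \<infinity>"
  proof -
    have "C \<ge> 0" using order_trans[OF _ C[of 0]] by simp
    moreover have "summable (\<lambda>n. C * (1 / 2) ^ n)" by (intro summable_mult summable_geometric) simp
    ultimately show ?thesis by (subst suminf_ennreal2) simp_all
  qed
  finally have Hfin: "(\<integral>\<^sup>+x. H x \<partial>lborel) < \<infinity>" .
  then have aeH: "AE x in lborel. H x \<noteq> \<infinity>" by (intro nn_integral_noteq_infinite) auto
  \<comment> \<open>Each application of \<open>norm_add_sq_le\<close> doubles the factor in front of
    the remaining increments; the weights \<open>2 ^ i\<close> absorb exactly this doubling.\<close>
  have tail: "(cmod (g (n + k) x - g n x))\<^sup>2 \<le> 2 / 2 ^ n * (\<Sum>i\<in>{n..<n + k}. 2 ^ i * (cmod (g (Suc i) x - g i x))\<^sup>2)" for n k x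
  proof (induction k arbitrary: n)
    case (Suc k)
    let ?d = "\<lambda>i. 2 ^ i * (cmod (g (Suc i) x - g i x))\<^sup>2"
    have "(cmod (g (n + Suc k) x - g n x))\<^sup>2 = (cmod ((g (Suc n) x - g n x) + (g (Suc n + k) x - g (Suc n) x)))\<^sup>2"
      by simp
    also have "\<dots> \<le> 2 * (cmod (g (Suc n) x - g n x))\<^sup>2 + 2 * (cmod (g (Suc n + k) x - g (Suc n) x))\<^sup>2"
      by (rule norm_add_sq_le)
    also have "\<dots> \<le> 2 * (cmod (g (Suc n) x - g n x))\<^sup>2 + 2 * (2 / 2 ^ Suc n * sum ?d {Suc n..<Suc n + k})"
      using Suc[of "Suc n"] by simp
    also have "\<dots> = 2 / 2 ^ n * (?d n + sum ?d {Suc n..<Suc n + k})"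
      by (simp add: field_simps)
    also have "?d n + sum ?d {Suc n..<Suc n + k} = sum ?d {n..<n + Suc k}"
      by (subst sum.atLeast_Suc_lessThan[of n]) simp_all
    finally show ?case .
  qed simp
  have sumH: "ennreal (\<Sum>i\<in>{n..<n + k}. 2 ^ i * (cmod (g (Suc i) x - g i x))\<^sup>2) \<le> H x" for n k x
  proof -
    have "ennreal (\<Sum>i\<in>{n..<n + k}. 2 ^ i * (cmod (g (Suc i) x - g i x))\<^sup>2)
        = (\<Sum>i\<in>{n..<n + k}. ennreal (2 ^ i * (cmod (g (Suc i) x - g i x))\<^sup>2))"
      by (rule sum_ennreal[symmetric]) simp
    also have "\<dots> \<le> H x" unfolding H_def by (intro sum_le_suminf) auto
    finally show ?thesis .
  qed
  have tailH: "ennreal ((cmod (g (n + k) x - g n x))\<^sup>2) \<le> ennreal (2 / 2 ^ n) * H x" for n k x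
  proof -
    have "ennreal ((cmod (g (n + k) x - g n x))\<^sup>2) \<le> ennreal (2 / 2 ^ n) * ennreal (\<Sum>i\<in>{n..<n + k}. 2 ^ i * (cmod (g (Suc i) x - g i x))\<^sup>2)"
      using tail by (subst ennreal_mult[symmetric]) (auto intro!: ennreal_leI sum_nonneg)
    also have "\<dots> \<le> ennreal (2 / 2 ^ n) * H x" by (intro mult_left_mono sumH) simp
    finally show ?thesis .
  qed
  have conv: "convergent (\<lambda>n. g n x)" if fin: "H x \<noteq> \<infinity>" for x
  proof -
    obtain h where h: "H x = ennreal h" "h \<ge> 0" using fin by (cases "H x") auto
    have b: "(cmod (g (n + k) x - g n x))\<^sup>2 \<le> 2 / 2 ^ n * h" for n k
      using tailH[of n k x] h by (simp add: ennreal_mult[symmetric] del: ennreal_numeral ennreal_divide_numeral)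
    have "Cauchy (\<lambda>n. g n x)"
    proof (rule metric_CauchyI)
      fix e :: real assume e: "e > 0"
      have "(\<lambda>n. 2 * (1 / 2) ^ n * h) \<longlonglongrightarrow> 2 * 0 * h" by (intro tendsto_intros) simp
      then have "\<forall>\<^sub>F n in sequentially. 2 * (1 / 2) ^ n * h < (e / 2)\<^sup>2"
        using e by (intro order_tendstoD) auto
      then obtain N where N: "2 * (1 / 2) ^ N * h < (e / 2)\<^sup>2" by (auto simp: eventually_sequentially)
      have d: "dist (g m x) (g N x) < e / 2" if "m \<ge> N" for m
      proof -
        have "(dist (g m x) (g N x))\<^sup>2 < (e / 2)\<^sup>2"
          using b[of N "m - N"] N that by (simp add: dist_norm power_one_over)
        then show ?thesis by (rule power2_less_imp_less) (use e in simp)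
      qed
      show "\<exists>M. \<forall>m\<ge>M. \<forall>n\<ge>M. dist (g m x) (g n x) < e"
      proof (intro exI[of _ N] allI impI)
        fix m n assume "N \<le> m" "N \<le> n"
        then show "dist (g m x) (g n x) < e"
          using dist_triangle_half_l[of "g m x" "g N x" e "g n x"] d by blast
      qed
    qed
    then show ?thesis by (rule Cauchy_convergent)
  qed
  define l where "l x = lim (\<lambda>n. g n x)" for x
  have [measurable]: "l \<in> borel_measurable borel" unfolding l_def by measurable
  have ael: "AE x in lborel. (\<lambda>n. g n x) \<longlonglongrightarrow> l x"
    using aeH by eventually_elim (use conv in \<open>simp add: l_def convergent_LIMSEQ_iff\<close>)
  have main: "AE x in lborel. ennreal ((cmod (g n x - l x))\<^sup>2) \<le> ennreal (2 / 2 ^ n) * H x" for n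
    using ael
  proof eventually_elim
    case (elim x)
    have "(\<lambda>k. ennreal ((cmod (g (n + k) x - g n x))\<^sup>2)) \<longlonglongrightarrow> ennreal ((cmod (l x - g n x))\<^sup>2)"
      using LIMSEQ_ignore_initial_segment[OF elim, of n]
      by (intro tendsto_ennrealI tendsto_intros) (simp add: add.commute)
    then have "ennreal ((cmod (l x - g n x))\<^sup>2) \<le> ennreal (2 / 2 ^ n) * H x"
      by (rule LIMSEQ_le_const2) (use tailH in blast)
    then show ?case by (simp only: norm_minus_commute)
  qed
  have nn: "(\<integral>\<^sup>+x. ennreal ((cmod (g n x - l x))\<^sup>2) \<partial>lborel) \<le> ennreal (2 / 2 ^ n) * (\<integral>\<^sup>+x. H x \<partial>lborel)" for n
    using nn_integral_mono_AE[OF main] by (simp add: nn_integral_cmult)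
  obtain K where K: "(\<integral>\<^sup>+x. H x \<partial>lborel) = ennreal K" "K \<ge> 0" using Hfin by (cases "\<integral>\<^sup>+x. H x \<partial>lborel") auto
  have nn': "(\<integral>\<^sup>+x. ennreal ((cmod (g n x - l x))\<^sup>2) \<partial>lborel) \<le> ennreal (2 / 2 ^ n * K)" for n
    using nn[of n] K(2) unfolding K(1) by (subst ennreal_mult) auto
  have dL2: "in_L2 (\<lambda>x. g n x - l x)" for n
  proof (rule in_L2I, measurable, rule integrableI_nonneg)
    have "(\<integral>\<^sup>+x. ennreal ((cmod (g n x - l x))\<^sup>2) \<partial>lborel) < top"
      using le_less_trans[OF nn'[of n] ennreal_less_top] .
    then show "(\<integral>\<^sup>+x. ennreal ((cmod (g n x - l x))\<^sup>2) \<partial>lborel) < \<infinity>" by simp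
  qed simp_all
  have lL2: "in_L2 l"
    using in_L2_diff[OF g[of 0] dL2[of 0]] by simp
  have "L2_sq (\<lambda>x. g n x - l x) \<le> 2 / 2 ^ n * K" for n
  proof -
    have "ennreal (L2_sq (\<lambda>x. g n x - l x)) \<le> ennreal (2 / 2 ^ n * K)"
      using nn'[of n] in_L2_integrable[OF dL2, of n] by (subst (asm) nn_integral_eq_integral) simp_all
    then show ?thesis using K(2) by (subst (asm) ennreal_le_iff) auto
  qed
  then have "L2_sq (\<lambda>x. g n x - l x) \<le> 2 * (1 / 2) ^ n * K" for n
    by (simp add: power_one_over)
  moreover have "(\<lambda>n. 2 * (1 / 2) ^ n * K) \<longlonglongrightarrow> 2 * 0 * K" by (intro tendsto_intros) simp
  ultimately have "(\<lambda>n. L2_sq (\<lambda>x. g n x - l x)) \<longlonglongrightarrow> 0"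
    by - (rule tendsto_sandwich[OF _ _ tendsto_const[of 0], where h="\<lambda>n. 2 * (1 / 2) ^ n * K"], simp_all)
  then show ?thesis by (rule that[OF lL2 _ ael])
qed

text \<open>The Bochner integral of a non-integrable function is 0 by convention, so the bound is
  unconditional and estimates can be made in \<open>ennreal\<close> before integrability is
  known.\<close>

lemma norm_integral_le_nn_integral:
  fixes f :: "'a \<Rightarrow> 'b::{banach, second_countable_topology}"
  shows "ennreal (norm (integral\<^sup>L M f)) \<le> (\<integral>\<^sup>+x. ennreal (norm (f x)) \<partial>M)"
  by (cases "integrable M f") (simp_all add: integral_norm_bound_ennreal not_integrable_integral_eq)

section \<open>The L2 bound for the Fourier integral\<close>

lemma fourier_integral_cnj: "fourier_integral (\<lambda>x. cnj (f x)) \<xi> = cnj (fourier_integral f (- \<xi>))"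
  unfolding fourier_integral_def by (subst Bochner_Integration.integral_cnj[symmetric]) (simp add: exp_cnj)

lemma fourier_integral_diff:
  assumes "integrable lborel f" "integrable lborel g"
  shows "fourier_integral (\<lambda>x. f x - g x) \<xi> = fourier_integral f \<xi> - fourier_integral g \<xi>"
  unfolding fourier_integral_def
  using integrable_fourier_kernel(1)[OF assms(1), of \<xi>] integrable_fourier_kernel(1)[OF assms(2), of \<xi>]
  by (simp only: left_diff_distrib Bochner_Integration.integral_diff)

lemma fourier_integral_bound:
  assumes "integrable lborel f"
  shows "cmod (fourier_integral f \<xi>) \<le> (\<integral>x. cmod (f x) \<partial>lborel)"
proof -
  have "cmod (fourier_integral f \<xi>) \<le> (\<integral>x. cmod (f x * exp (- \<i> * of_real (x \<bullet> \<xi>))) \<partial>lborel)"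
    unfolding fourier_integral_def by (rule integral_norm_bound)
  then show ?thesis by (simp add: norm_mult)
qed

lemma integrable_fourier_gauss:
  fixes f :: "'a::euclidean_space \<Rightarrow> complex"
  assumes f: "integrable lborel f" and s: "s > 0"
  shows "integrable lborel (\<lambda>\<xi>. fourier_integral f \<xi> * of_real (gauss s \<xi>))"
proof (rule Bochner_Integration.integrable_bound)
  show "integrable lborel (\<lambda>\<xi>::'a. (\<integral>x. cmod (f x) \<partial>lborel) * gauss s \<xi>)"
    by (intro integrable_mult_right integrable_gauss s)
  show "AE \<xi>::'a in lborel. norm (fourier_integral f \<xi> * of_real (gauss s \<xi>)) \<le> norm ((\<integral>x. cmod (f x) \<partial>lborel) * gauss s \<xi>)"
    using fourier_integral_bound[OF f]
    by (intro AE_I2 le_norm_real) (simp add: norm_mult gauss_nonneg mult_right_mono)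
qed (use borel_measurable_integrable[OF f] in measurable)

text \<open>One factor of the squared modulus carries the damping and becomes \<open>G\<close>; the
  conjugate factor is the transform of \<open>cnj f\<close> at the reflected point, so the
  multiplication formula applies. The transform of the reflected \<open>G\<close> is the damped
  inversion integral of \<open>f\<close>.\<close>

lemma fourier_gauss_energy:
  fixes f :: "'a::euclidean_space \<Rightarrow> complex"
  assumes f: "integrable lborel f" and s: "s > 0"
  shows "of_real (\<integral>\<xi>. (cmod (fourier_integral f \<xi>))\<^sup>2 * gauss (1 / s) \<xi> \<partial>lborel)
    = of_real ((2 * pi) ^ DIM('a)) * (\<integral>x. (\<integral>y. f y * of_real (heat s (x - y)) \<partial>lborel) * cnj (f x) \<partial>lborel)"
proof -
  have [measurable]: "f \<in> borel_measurable borel" using borel_measurable_integrable[OF f] by simp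
  define G where "G \<xi> = fourier_integral f \<xi> * of_real (gauss (1 / s) \<xi>)" for \<xi>
  have [measurable]: "G \<in> borel_measurable borel" unfolding G_def by measurable
  have G: "integrable lborel G" unfolding G_def using integrable_fourier_gauss[OF f, of "1 / s"] s by simp
  have Gm: "integrable lborel (\<lambda>\<xi>. G (- \<xi>))" using integrable_reflection[of G 0] G by simp
  have "of_real (\<integral>\<xi>. (cmod (fourier_integral f \<xi>))\<^sup>2 * gauss (1 / s) \<xi> \<partial>lborel) = (\<integral>\<xi>. G \<xi> * cnj (fourier_integral f \<xi>) \<partial>lborel)"
    unfolding G_def by (subst integral_complex_of_real[symmetric], intro Bochner_Integration.integral_cong)
      (simp_all add: complex_norm_square mult_ac del: of_real_power)
  also have "\<dots> = (\<integral>\<xi>. G (- \<xi>) * cnj (fourier_integral f (- \<xi>)) \<partial>lborel)"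
    by (subst integral_reflection[where t=0, symmetric]) simp_all
  also have "\<dots> = (\<integral>\<xi>. G (- \<xi>) * fourier_integral (\<lambda>x. cnj (f x)) \<xi> \<partial>lborel)"
    by (simp add: fourier_integral_cnj)
  also have "\<dots> = (\<integral>x. fourier_integral (\<lambda>\<xi>. G (- \<xi>)) x * cnj (f x) \<partial>lborel)"
    by (rule fourier_multiplication[OF Gm]) (use f in simp)
  also have "\<dots> = (\<integral>x. of_real ((2 * pi) ^ DIM('a)) * ((\<integral>y. f y * of_real (heat s (x - y)) \<partial>lborel) * cnj (f x)) \<partial>lborel)"
  proof (intro Bochner_Integration.integral_cong refl)
    fix x :: 'a
    have "fourier_integral (\<lambda>\<xi>. G (- \<xi>)) x = (\<integral>\<xi>. G \<xi> * exp (\<i> * of_real (x \<bullet> \<xi>)) \<partial>lborel)"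
      unfolding fourier_integral_def
      by (subst integral_reflection[where t=0, symmetric]) (simp_all add: inner_commute)
    also have "\<dots> = of_real ((2 * pi) ^ DIM('a)) * (\<integral>y. f y * of_real (heat s (x - y)) \<partial>lborel)"
      using fourier_gauss_mean[OF f s, of x] by (simp add: G_def mult_ac)
    finally show "fourier_integral (\<lambda>\<xi>. G (- \<xi>)) x * cnj (f x)
      = of_real ((2 * pi) ^ DIM('a)) * ((\<integral>y. f y * of_real (heat s (x - y)) \<partial>lborel) * cnj (f x))" by simp
  qed
  finally show ?thesis by simp
qed

lemma nn_integral_heat_shift:
  assumes s: "s > 0"
  shows "(\<integral>\<^sup>+y. ennreal (heat s (x - y)) \<partial>lborel) = 1" "(\<integral>\<^sup>+y. ennreal (heat s (y - x)) \<partial>lborel) = 1"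
proof -
  have 1: "(\<integral>\<^sup>+y. ennreal (heat s y) \<partial>lborel) = 1"
    using s integrable_heat[OF s] integral_heat[OF s] by (subst nn_integral_eq_integral) (simp_all add: heat_nonneg)
  show "(\<integral>\<^sup>+y. ennreal (heat s (x - y)) \<partial>lborel) = 1"
    using nn_integral_reflection[of "\<lambda>y. ennreal (heat s y)" x] 1 by simp
  then show "(\<integral>\<^sup>+y. ennreal (heat s (y - x)) \<partial>lborel) = 1" by (simp only: heat_minus(2)[of s x])
qed

text \<open>The Schur test: |f(x) f(y)| is at most half the sum of the squares, and the kernel has
  mass 1 in either variable.\<close>

lemma heat_quadratic_form_le:
  fixes f :: "'a::euclidean_space \<Rightarrow> complex"
  assumes f: "in_L2 f" and s: "s > 0"
  shows "cmod (\<integral>x. (\<integral>y. f y * of_real (heat s (x - y)) \<partial>lborel) * cnj (f x) \<partial>lborel) \<le> L2_sq f"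
proof -
  have [measurable]: "f \<in> borel_measurable borel" by (rule in_L2_measurable[OF f])
  have nf: "(\<integral>\<^sup>+x. ennreal ((cmod (f x))\<^sup>2) \<partial>lborel) = ennreal (L2_sq f)"
    using in_L2_integrable[OF f] by (subst nn_integral_eq_integral) simp_all
  have "ennreal (cmod (\<integral>x. (\<integral>y. f y * of_real (heat s (x - y)) \<partial>lborel) * cnj (f x) \<partial>lborel))
     \<le> (\<integral>\<^sup>+x. ennreal (cmod ((\<integral>y. f y * of_real (heat s (x - y)) \<partial>lborel) * cnj (f x))) \<partial>lborel)"
    by (rule norm_integral_le_nn_integral)
  also have "\<dots> \<le> (\<integral>\<^sup>+x. (\<integral>\<^sup>+y. ennreal (((cmod (f x))\<^sup>2 + (cmod (f y))\<^sup>2) * (heat s (x - y) / 2)) \<partial>lborel) \<partial>lborel)"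
  proof (intro nn_integral_mono)
    fix x
    have "ennreal (cmod ((\<integral>y. f y * of_real (heat s (x - y)) \<partial>lborel) * cnj (f x)))
       = ennreal (cmod (\<integral>y. f y * of_real (heat s (x - y)) \<partial>lborel)) * ennreal (cmod (f x))"
      by (simp add: norm_mult ennreal_mult)
    also have "\<dots> \<le> (\<integral>\<^sup>+y. ennreal (cmod (f y * of_real (heat s (x - y)))) \<partial>lborel) * ennreal (cmod (f x))"
      by (intro mult_right_mono norm_integral_le_nn_integral) simp
    also have "\<dots> = (\<integral>\<^sup>+y. ennreal (cmod (f y * of_real (heat s (x - y)))) * ennreal (cmod (f x)) \<partial>lborel)"
      by (rule nn_integral_multc[symmetric]) measurable
    also have "\<dots> \<le> (\<integral>\<^sup>+y. ennreal (((cmod (f x))\<^sup>2 + (cmod (f y))\<^sup>2) * (heat s (x - y) / 2)) \<partial>lborel)"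
    proof (intro nn_integral_mono)
      fix y
      have "2 * (cmod (f x) * cmod (f y)) * (heat s (x - y) / 2) \<le> ((cmod (f x))\<^sup>2 + (cmod (f y))\<^sup>2) * (heat s (x - y) / 2)"
        using sum_squares_bound[of "cmod (f x)" "cmod (f y)"] s heat_nonneg by (intro mult_right_mono) auto
      then show "ennreal (cmod (f y * of_real (heat s (x - y)))) * ennreal (cmod (f x))
          \<le> ennreal (((cmod (f x))\<^sup>2 + (cmod (f y))\<^sup>2) * (heat s (x - y) / 2))"
        using s heat_nonneg[of s "x - y"] by (subst ennreal_mult[symmetric]) (auto intro!: ennreal_leI simp: norm_mult mult_ac)
    qed
    finally show "ennreal (cmod ((\<integral>y. f y * of_real (heat s (x - y)) \<partial>lborel) * cnj (f x)))
       \<le> (\<integral>\<^sup>+y. ennreal (((cmod (f x))\<^sup>2 + (cmod (f y))\<^sup>2) * (heat s (x - y) / 2)) \<partial>lborel)" .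
  qed
  also have "\<dots> = (\<integral>\<^sup>+x. (\<integral>\<^sup>+y. ennreal ((cmod (f x))\<^sup>2 / 2) * ennreal (heat s (x - y)) \<partial>lborel) + (\<integral>\<^sup>+y. ennreal ((cmod (f y))\<^sup>2 / 2) * ennreal (heat s (x - y)) \<partial>lborel) \<partial>lborel)"
  proof (intro nn_integral_cong, subst nn_integral_add[symmetric])
    fix x
    show "(\<integral>\<^sup>+y. ennreal (((cmod (f x))\<^sup>2 + (cmod (f y))\<^sup>2) * (heat s (x - y) / 2)) \<partial>lborel)
      = (\<integral>\<^sup>+y. ennreal ((cmod (f x))\<^sup>2 / 2) * ennreal (heat s (x - y)) + ennreal ((cmod (f y))\<^sup>2 / 2) * ennreal (heat s (x - y)) \<partial>lborel)"
    proof (intro nn_integral_cong)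
      fix y
      have h: "heat s (x - y) \<ge> 0" using s by (rule heat_nonneg)
      have "((cmod (f x))\<^sup>2 + (cmod (f y))\<^sup>2) * (heat s (x - y) / 2) = (cmod (f x))\<^sup>2 / 2 * heat s (x - y) + (cmod (f y))\<^sup>2 / 2 * heat s (x - y)"
        by (simp add: field_simps)
      then show "ennreal (((cmod (f x))\<^sup>2 + (cmod (f y))\<^sup>2) * (heat s (x - y) / 2))
        = ennreal ((cmod (f x))\<^sup>2 / 2) * ennreal (heat s (x - y)) + ennreal ((cmod (f y))\<^sup>2 / 2) * ennreal (heat s (x - y))"
        using h by (simp only: ennreal_plus ennreal_mult mult_nonneg_nonneg divide_nonneg_nonneg zero_le_power2 zero_le_numeral)
    qed
  qed simp_all
  also have "\<dots> = (\<integral>\<^sup>+x. (\<integral>\<^sup>+y. ennreal ((cmod (f x))\<^sup>2 / 2) * ennreal (heat s (x - y)) \<partial>lborel) \<partial>lborel)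
      + (\<integral>\<^sup>+x. (\<integral>\<^sup>+y. ennreal ((cmod (f y))\<^sup>2 / 2) * ennreal (heat s (x - y)) \<partial>lborel) \<partial>lborel)"
    by (rule nn_integral_add) measurable
  also have "(\<integral>\<^sup>+x. (\<integral>\<^sup>+y. ennreal ((cmod (f y))\<^sup>2 / 2) * ennreal (heat s (x - y)) \<partial>lborel) \<partial>lborel)
      = (\<integral>\<^sup>+y. (\<integral>\<^sup>+x. ennreal ((cmod (f y))\<^sup>2 / 2) * ennreal (heat s (x - y)) \<partial>lborel) \<partial>lborel)"
    by (rule lborel_pair.Fubini') measurable
  also have "(\<integral>\<^sup>+y. (\<integral>\<^sup>+x. ennreal ((cmod (f y))\<^sup>2 / 2) * ennreal (heat s (x - y)) \<partial>lborel) \<partial>lborel) = (\<integral>\<^sup>+y. ennreal ((cmod (f y))\<^sup>2 / 2) \<partial>lborel)"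
    by (simp add: nn_integral_cmult nn_integral_heat_shift[OF s])
  also have "(\<integral>\<^sup>+x. (\<integral>\<^sup>+y. ennreal ((cmod (f x))\<^sup>2 / 2) * ennreal (heat s (x - y)) \<partial>lborel) \<partial>lborel) = (\<integral>\<^sup>+y. ennreal ((cmod (f y))\<^sup>2 / 2) \<partial>lborel)"
    by (simp add: nn_integral_cmult nn_integral_heat_shift[OF s])
  also have "(\<integral>\<^sup>+y. ennreal ((cmod (f y))\<^sup>2 / 2) \<partial>lborel) = ennreal (L2_sq f / 2)"
    using in_L2_integrable[OF f] by (subst nn_integral_eq_integral) simp_all
  also have "ennreal (L2_sq f / 2) + ennreal (L2_sq f / 2) = ennreal (L2_sq f)"
    by (subst ennreal_plus[symmetric]) simp_all
  finally show ?thesis by (subst (asm) ennreal_le_iff) simp_all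
qed

text \<open>The damped energies are bounded uniformly in the damping, and Fatou's lemma removes it.
  Equality comes later, in \<open>plancherel\<close>, from the same bound for the inverse
  transform.\<close>

lemma fourier_integral_L2:
  fixes f :: "'a::euclidean_space \<Rightarrow> complex"
  assumes f1: "integrable lborel f" and f2: "in_L2 f"
  shows "in_L2 (fourier_integral f)" and "L2_sq (fourier_integral f) \<le> (2 * pi) ^ DIM('a) * L2_sq f"
proof -
  have [measurable]: "f \<in> borel_measurable borel" by (rule in_L2_measurable[OF f2])
  let ?F = "fourier_integral f"
  let ?K = "(2 * pi) ^ DIM('a) * L2_sq f"
  have i: "integrable lborel (\<lambda>\<xi>. (cmod (?F \<xi>))\<^sup>2 * gauss s \<xi>)" if s: "s > 0" for s
  proof (rule Bochner_Integration.integrable_bound)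
    show "integrable lborel (\<lambda>\<xi>::'a. (\<integral>x. cmod (f x) \<partial>lborel)\<^sup>2 * gauss s \<xi>)"
      by (intro integrable_mult_right integrable_gauss s)
    show "AE \<xi>::'a in lborel. norm ((cmod (?F \<xi>))\<^sup>2 * gauss s \<xi>) \<le> norm ((\<integral>x. cmod (f x) \<partial>lborel)\<^sup>2 * gauss s \<xi>)"
      using fourier_integral_bound[OF f1]
      by (intro AE_I2 le_norm_real) (simp add: gauss_nonneg mult_right_mono power_mono)
  qed measurable
  have b: "(\<integral>\<xi>. (cmod (?F \<xi>))\<^sup>2 * gauss (1 / s) \<xi> \<partial>lborel) \<le> ?K" if s: "s > 0" for s
  proof -
    have nn: "(\<integral>\<xi>. (cmod (?F \<xi>))\<^sup>2 * gauss (1 / s) \<xi> \<partial>lborel) \<ge> 0"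
      by (intro Bochner_Integration.integral_nonneg) (simp add: gauss_nonneg)
    have "cmod (of_real (\<integral>\<xi>. (cmod (?F \<xi>))\<^sup>2 * gauss (1 / s) \<xi> \<partial>lborel)) \<le> ?K"
      unfolding fourier_gauss_energy[OF f1 s] norm_mult norm_of_real
      using heat_quadratic_form_le[OF f2 s] by (subst abs_of_nonneg) (auto intro!: mult_left_mono)
    then show ?thesis using nn by simp
  qed
  have "(\<integral>\<^sup>+\<xi>. ennreal ((cmod (?F \<xi>))\<^sup>2) \<partial>lborel)
     = (\<integral>\<^sup>+\<xi>. liminf (\<lambda>n. ennreal ((cmod (?F \<xi>))\<^sup>2 * gauss (1 / real (Suc n)) \<xi>)) \<partial>lborel)"
  proof (intro nn_integral_cong)
    fix \<xi> :: 'a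
    have "(\<lambda>n. (cmod (?F \<xi>))\<^sup>2 * exp (- (1 / real (Suc n) * (norm \<xi>)\<^sup>2 / 2))) \<longlonglongrightarrow> (cmod (?F \<xi>))\<^sup>2 * exp (- (0 * (norm \<xi>)\<^sup>2 / 2))"
      by (intro tendsto_intros LIMSEQ_Suc[OF lim_1_over_n]) auto
    then have "(\<lambda>n. ennreal ((cmod (?F \<xi>))\<^sup>2 * gauss (1 / real (Suc n)) \<xi>)) \<longlonglongrightarrow> ennreal ((cmod (?F \<xi>))\<^sup>2)"
      unfolding gauss_def by (intro tendsto_ennrealI) simp
    then show "ennreal ((cmod (?F \<xi>))\<^sup>2) = liminf (\<lambda>n. ennreal ((cmod (?F \<xi>))\<^sup>2 * gauss (1 / real (Suc n)) \<xi>))"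
      by (rule lim_imp_Liminf[OF sequentially_bot, symmetric])
  qed
  also have "\<dots> \<le> liminf (\<lambda>n. \<integral>\<^sup>+\<xi>. ennreal ((cmod (?F \<xi>))\<^sup>2 * gauss (1 / real (Suc n)) \<xi>) \<partial>lborel)"
    by (rule nn_integral_liminf) measurable
  also have "\<dots> \<le> ennreal ?K"
  proof (rule Liminf_le)
    have "(\<integral>\<^sup>+\<xi>. ennreal ((cmod (?F \<xi>))\<^sup>2 * gauss (1 / real (Suc n)) \<xi>) \<partial>lborel) \<le> ennreal ?K" for n
      using b[of "real (Suc n)"] i[of "1 / real (Suc n)"]
      by (subst nn_integral_eq_integral) (auto simp: gauss_nonneg intro!: ennreal_leI)
    then show "\<forall>\<^sub>F n in sequentially. (\<integral>\<^sup>+\<xi>. ennreal ((cmod (?F \<xi>))\<^sup>2 * gauss (1 / real (Suc n)) \<xi>) \<partial>lborel) \<le> ennreal ?K"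
      by simp
  qed simp
  finally have fin: "(\<integral>\<^sup>+\<xi>. ennreal ((cmod (?F \<xi>))\<^sup>2) \<partial>lborel) \<le> ennreal ?K" .
  have int: "integrable lborel (\<lambda>\<xi>. (cmod (?F \<xi>))\<^sup>2)"
  proof (rule integrableI_nonneg)
    have "(\<integral>\<^sup>+\<xi>. ennreal ((cmod (?F \<xi>))\<^sup>2) \<partial>lborel) < top" using le_less_trans[OF fin ennreal_less_top] .
    then show "(\<integral>\<^sup>+\<xi>. ennreal ((cmod (?F \<xi>))\<^sup>2) \<partial>lborel) < \<infinity>" by simp
  qed simp_all
  then show "in_L2 ?F" by (intro in_L2I) simp_all
  show "L2_sq ?F \<le> ?K"
    using fin int by (subst (asm) nn_integral_eq_integral) (simp_all add: ennreal_le_iff)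
qed

text \<open>On a ball \<open>cmod (f x)\<close> is at most 1 + |f(x)|^2, so cutting off makes
  \<open>f\<close> integrable. The pointwise bound by \<open>f\<close> keeps the constant sharp when
  the transforms of the truncations are estimated.\<close>

lemma L2_truncation:
  fixes f :: "'a::euclidean_space \<Rightarrow> complex"
  assumes f: "in_L2 f" and e: "e > 0"
  obtains h where "integrable lborel h" "in_L2 h" "\<And>x. cmod (h x) \<le> cmod (f x)" "L2_sq (\<lambda>x. f x - h x) \<le> e"
proof -
  have [measurable]: "f \<in> borel_measurable borel" by (rule in_L2_measurable[OF f])
  define h where "h n x = indicator (cball 0 (real n)) x *\<^sub>R f x" for n x
  have [measurable]: "cball (0::'a) r \<in> sets borel" for r by simp
  have [measurable]: "h n \<in> borel_measurable borel" for n unfolding h_def by measurable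
  have hle: "cmod (h n x) \<le> cmod (f x)" for n x by (simp add: h_def indicator_def)
  have h2: "in_L2 (h n)" for n
    by (rule in_L2_bound[OF _ in_L2_integrable[OF f]]) (simp_all add: power_mono hle)
  have h1: "integrable lborel (h n)" for n
  proof (rule Bochner_Integration.integrable_bound)
    show "integrable lborel (\<lambda>x. indicator (cball 0 (real n)) x + (cmod (f x))\<^sup>2)"
      using in_L2_integrable[OF f] emeasure_lborel_cball_finite[of 0 "real n"]
      by (intro Bochner_Integration.integrable_add) (auto simp: integrable_indicator_iff less_top)
    have "cmod (h n x) \<le> indicator (cball 0 (real n)) x + (cmod (f x))\<^sup>2" for x
    proof -
      have "2 * cmod (f x) \<le> 1 + (cmod (f x))\<^sup>2" using sum_squares_bound[of 1 "cmod (f x)"] by simp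
      then have "cmod (f x) \<le> 1 + (cmod (f x))\<^sup>2" using norm_ge_zero[of "f x"] by linarith
      then show ?thesis by (simp add: h_def indicator_def)
    qed
    then show "AE x in lborel. norm (h n x) \<le> norm (indicator (cball 0 (real n)) x + (cmod (f x))\<^sup>2)"
      by (intro AE_I2 le_norm_real)
  qed simp
  have "(\<lambda>n. L2_sq (\<lambda>x. f x - h n x)) \<longlonglongrightarrow> integral\<^sup>L (lborel :: 'a measure) (\<lambda>x. 0)"
  proof (rule integral_dominated_convergence[where w="\<lambda>x. (cmod (f x))\<^sup>2"])
    show "AE x in lborel. (\<lambda>n. (cmod (f x - h n x))\<^sup>2) \<longlonglongrightarrow> 0"
    proof (rule AE_I2)
      fix x :: 'a
      obtain N where N: "norm x \<le> real N" using real_arch_simple by blast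
      have "(cmod (f x - h n x))\<^sup>2 = 0" if "n \<ge> N" for n
        using N that by (simp add: h_def indicator_def)
      then show "(\<lambda>n. (cmod (f x - h n x))\<^sup>2) \<longlonglongrightarrow> 0"
        by (intro tendsto_eventually) (auto simp: eventually_sequentially)
    qed
    show "AE x in lborel. norm ((cmod (f x - h n x))\<^sup>2) \<le> (cmod (f x))\<^sup>2" for n
      by (rule AE_I2) (simp add: h_def indicator_def)
  qed (use in_L2_integrable[OF f] in simp_all)
  then have "\<forall>\<^sub>F n in sequentially. L2_sq (\<lambda>x. f x - h n x) < e" using e by (intro order_tendstoD(2)) simp
  then obtain n where "L2_sq (\<lambda>x. f x - h n x) < e" by (auto simp: eventually_sequentially)
  then have "L2_sq (\<lambda>x. f x - h n x) \<le> e" by simp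
  then show ?thesis by (rule that[OF h1 h2 hle])
qed

text \<open>The test class, L1 intersected with L2, is one on which the Fourier integral is defined
  and again square integrable. It contains the Schwartz functions, the modulated Gaussians and the
  truncations of L2 functions.\<close>

definition l2fourier :: "('a::euclidean_space \<Rightarrow> complex) \<Rightarrow> ('a \<Rightarrow> complex) \<Rightarrow> bool" where
  "l2fourier f g \<longleftrightarrow> in_L2 f \<and> in_L2 g \<and>
    (\<forall>\<phi>. integrable lborel \<phi> \<and> in_L2 \<phi> \<longrightarrow>
      (\<integral>x. f x * fourier_integral \<phi> x \<partial>lborel) = (\<integral>x. g x * \<phi> x \<partial>lborel))"

lemma l2fourier_L2: "l2fourier f g \<Longrightarrow> in_L2 f" "l2fourier f g \<Longrightarrow> in_L2 g"
  by (simp_all add: l2fourier_def)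

lemma l2fourierD:
  "l2fourier f g \<Longrightarrow> integrable lborel \<phi> \<Longrightarrow> in_L2 \<phi> \<Longrightarrow>
    (\<integral>x. f x * fourier_integral \<phi> x \<partial>lborel) = (\<integral>x. g x * \<phi> x \<partial>lborel)"
  by (simp add: l2fourier_def)

lemma l2fourierI:
  assumes "in_L2 f" "in_L2 g"
    and "\<And>\<phi>. integrable lborel \<phi> \<Longrightarrow> in_L2 \<phi> \<Longrightarrow>
      (\<integral>x. f x * fourier_integral \<phi> x \<partial>lborel) = (\<integral>x. g x * \<phi> x \<partial>lborel)"
  shows "l2fourier f g"
  unfolding l2fourier_def using assms by blast

lemma l2fourier_L1:
  assumes "integrable lborel f" "in_L2 f"
  shows "l2fourier f (fourier_integral f)"
  by (rule l2fourierI[OF assms(2) fourier_integral_L2(1)[OF assms] fourier_multiplication[OF assms(1)]])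

text \<open>Truncations with error \<open>(1 / 4) ^ n\<close> have transforms that converge at the
  same rate, and both sides of the multiplication formula are continuous in L2. The norm bound
  passes to the limit by Fatou's lemma.\<close>

lemma l2fourier_exists_le:
  fixes f :: "'a::euclidean_space \<Rightarrow> complex"
  assumes f: "in_L2 f"
  obtains g where "l2fourier f g" "L2_sq g \<le> (2 * pi) ^ DIM('a) * L2_sq f"
proof -
  let ?c = "(2 * pi) ^ DIM('a)"
  have "\<exists>h. integrable lborel h \<and> in_L2 h \<and> (\<forall>x. cmod (h x) \<le> cmod (f x)) \<and> L2_sq (\<lambda>x. f x - h x) \<le> (1 / 4) ^ n" for n :: nat
  proof -
    obtain h where "integrable lborel h" "in_L2 h" "\<And>x. cmod (h x) \<le> cmod (f x)" "L2_sq (\<lambda>x. f x - h x) \<le> (1 / 4) ^ n"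
      by (rule L2_truncation[OF f, of "(1 / 4) ^ n"]) simp_all
    then show ?thesis by blast
  qed
  then obtain h where h: "\<And>n. integrable lborel (h n)" "\<And>n. in_L2 (h n)"
    "\<And>n x. cmod (h n x) \<le> cmod (f x)" "\<And>n. L2_sq (\<lambda>x. f x - h n x) \<le> (1 / 4) ^ n"
    by metis
  have F: "in_L2 (fourier_integral (h n))" for n by (rule fourier_integral_L2 h)+
  have sym: "L2_sq (\<lambda>x. h n x - f x) = L2_sq (\<lambda>x. f x - h n x)" for n by (simp add: norm_minus_commute)
  have step: "L2_sq (\<lambda>x. h (Suc n) x - h n x) \<le> 4 * (1 / 4) ^ n" for n
  proof -
    have "L2_sq (\<lambda>x. h (Suc n) x - h n x) \<le> 2 * L2_sq (\<lambda>x. h (Suc n) x - f x) + 2 * L2_sq (\<lambda>x. f x - h n x)"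
      by (rule L2_sq_diff_le[OF h(2) f h(2)])
    also have "\<dots> \<le> 2 * (1 / 4) ^ Suc n + 2 * (1 / 4) ^ n"
      using h(4)[of n] h(4)[of "Suc n"] unfolding sym by linarith
    also have "\<dots> \<le> 4 * (1 / 4) ^ n" by simp
    finally show ?thesis .
  qed
  have "L2_sq (\<lambda>x. fourier_integral (h (Suc n)) x - fourier_integral (h n) x) \<le> (?c * 4) * (1 / 4) ^ n" for n
  proof -
    have "L2_sq (\<lambda>x. fourier_integral (h (Suc n)) x - fourier_integral (h n) x)
        = L2_sq (fourier_integral (\<lambda>x. h (Suc n) x - h n x))"
      by (simp add: fourier_integral_diff h)
    also have "\<dots> \<le> ?c * L2_sq (\<lambda>x. h (Suc n) x - h n x)"
      by (intro fourier_integral_L2 in_L2_diff h Bochner_Integration.integrable_diff)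
    also have "\<dots> \<le> ?c * (4 * (1 / 4) ^ n)" by (intro mult_left_mono step) simp
    finally show ?thesis by simp
  qed
  from L2_fast_limit[OF F this] obtain g where g: "in_L2 g"
    "(\<lambda>n. L2_sq (\<lambda>x. fourier_integral (h n) x - g x)) \<longlonglongrightarrow> 0"
    "AE x in lborel. (\<lambda>n. fourier_integral (h n) x) \<longlonglongrightarrow> g x" by blast
  have limh: "(\<lambda>n. L2_sq (\<lambda>x. h n x - f x)) \<longlonglongrightarrow> 0"
    by (rule tendsto_sandwich[OF _ _ tendsto_const[of 0] LIMSEQ_power_zero[of "1/4::real"]]) (use h(4) sym in auto)
  have "l2fourier f g"
  proof (rule l2fourierI[OF f g(1)])
    fix \<phi> :: "'a \<Rightarrow> complex" assume p: "integrable lborel \<phi>" "in_L2 \<phi>"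
    have "(\<lambda>n. \<integral>x. h n x * fourier_integral \<phi> x \<partial>lborel) \<longlonglongrightarrow> (\<integral>x. f x * fourier_integral \<phi> x \<partial>lborel)"
      by (rule L2_pairing_tendsto[OF h(2) f fourier_integral_L2(1)[OF p] limh])
    moreover have "(\<lambda>n. \<integral>x. fourier_integral (h n) x * \<phi> x \<partial>lborel) \<longlonglongrightarrow> (\<integral>x. g x * \<phi> x \<partial>lborel)"
      by (rule L2_pairing_tendsto[OF F g(1) p(2) g(2)])
    moreover have "(\<integral>x. h n x * fourier_integral \<phi> x \<partial>lborel) = (\<integral>x. fourier_integral (h n) x * \<phi> x \<partial>lborel)" for n
      by (rule fourier_multiplication[OF h(1) p(1)])
    ultimately show "(\<integral>x. f x * fourier_integral \<phi> x \<partial>lborel) = (\<integral>x. g x * \<phi> x \<partial>lborel)"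
      using LIMSEQ_unique by simp
  qed
  moreover have "L2_sq g \<le> ?c * L2_sq f"
  proof -
    have [measurable]: "fourier_integral (h n) \<in> borel_measurable borel" for n by (rule in_L2_measurable[OF F])
    have "(\<integral>\<^sup>+x. ennreal ((cmod (g x))\<^sup>2) \<partial>lborel) = (\<integral>\<^sup>+x. liminf (\<lambda>n. ennreal ((cmod (fourier_integral (h n) x))\<^sup>2)) \<partial>lborel)"
    proof (rule nn_integral_cong_AE)
      show "AE x in lborel. ennreal ((cmod (g x))\<^sup>2) = liminf (\<lambda>n. ennreal ((cmod (fourier_integral (h n) x))\<^sup>2))"
        using g(3)
      proof eventually_elim
        case (elim x)
        then have "(\<lambda>n. ennreal ((cmod (fourier_integral (h n) x))\<^sup>2)) \<longlonglongrightarrow> ennreal ((cmod (g x))\<^sup>2)"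
          by (intro tendsto_ennrealI tendsto_intros)
        then show ?case by (rule lim_imp_Liminf[OF sequentially_bot, symmetric])
      qed
    qed
    also have "\<dots> \<le> liminf (\<lambda>n. \<integral>\<^sup>+x. ennreal ((cmod (fourier_integral (h n) x))\<^sup>2) \<partial>lborel)"
      by (rule nn_integral_liminf) measurable
    also have "\<dots> \<le> ennreal (?c * L2_sq f)"
    proof (rule Liminf_le)
      have "(\<integral>\<^sup>+x. ennreal ((cmod (fourier_integral (h n) x))\<^sup>2) \<partial>lborel) \<le> ennreal (?c * L2_sq f)" for n
      proof -
        have "L2_sq (fourier_integral (h n)) \<le> ?c * L2_sq (h n)" by (rule fourier_integral_L2 h)+
        also have "L2_sq (h n) \<le> L2_sq f"
          by (intro integral_mono in_L2_integrable h f power_mono) auto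
        finally have "L2_sq (fourier_integral (h n)) \<le> ?c * L2_sq f" by simp
        then show ?thesis
          using in_L2_integrable[OF F] by (subst nn_integral_eq_integral) (auto intro!: ennreal_leI)
      qed
      then show "\<forall>\<^sub>F n in sequentially. (\<integral>\<^sup>+x. ennreal ((cmod (fourier_integral (h n) x))\<^sup>2) \<partial>lborel) \<le> ennreal (?c * L2_sq f)"
        by simp
    qed simp
    finally show ?thesis
      using in_L2_integrable[OF g(1)] by (subst (asm) nn_integral_eq_integral) (simp_all add: ennreal_le_iff)
  qed
  ultimately show ?thesis using that by blast
qed

text \<open>The test functions for all uniqueness statements. Pairing \<open>f\<close> with every
  \<open>gauss_wave a\<close> gives the Fourier integral of \<open>f\<close> times a Gaussian, so
  uniqueness for integrable functions applies; moreover they are Schwartz functions with explicit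
  transforms.\<close>

definition gauss_wave :: "'a::euclidean_space \<Rightarrow> 'a \<Rightarrow> complex" where
  "gauss_wave a x = of_real (gauss 1 x) * exp (- \<i> * of_real (x \<bullet> a))"

lemma gauss_wave_measurable[measurable]: "gauss_wave a \<in> borel_measurable borel"
  unfolding gauss_wave_def by measurable

lemma norm_gauss_wave: "cmod (gauss_wave a x) = gauss 1 x"
  by (simp add: gauss_wave_def norm_mult gauss_nonneg)

lemma integrable_of_real_gauss: "s > 0 \<Longrightarrow> integrable lborel (\<lambda>x::'a::euclidean_space. complex_of_real (gauss s x))"
  using integrable_gauss[of s] by (intro integrable_of_real) auto

lemma gauss_sq: "(gauss s x)\<^sup>2 = gauss (2 * s) x"
  by (simp add: gauss_def power2_eq_square flip: exp_add)

lemma in_L2_gauss: "s > 0 \<Longrightarrow> in_L2 (\<lambda>x::'a::euclidean_space. complex_of_real (gauss s x))"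
  by (rule in_L2I) (simp_all add: gauss_nonneg gauss_sq integrable_gauss)

lemma integrable_gauss_wave: "integrable lborel (gauss_wave a)"
  unfolding gauss_wave_def by (intro integrable_fourier_kernel integrable_of_real_gauss) simp

lemma in_L2_gauss_wave: "in_L2 (gauss_wave a :: 'a::euclidean_space \<Rightarrow> complex)"
  by (rule in_L2I) (simp_all add: norm_gauss_wave gauss_sq integrable_gauss)

lemma fourier_gauss_wave:
  "fourier_integral (gauss_wave (a::'a::euclidean_space)) \<xi> = of_real (sqrt (2 * pi) ^ DIM('a) * gauss 1 (\<xi> + a))"
proof -
  have "fourier_integral (gauss_wave a) \<xi> = fourier_integral (\<lambda>x. of_real (gauss 1 x)) (\<xi> + a)"
    unfolding fourier_integral_def gauss_wave_def
    by (intro Bochner_Integration.integral_cong) (simp_all add: inner_add_right algebra_simps flip: exp_add)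
  then show ?thesis by (simp add: fourier_integral_gauss)
qed

lemma gauss_shift_L1_L2:
  "integrable lborel (\<lambda>\<xi>::'a::euclidean_space. of_real (gauss 1 (\<xi> + a)) :: complex)"
  "in_L2 (\<lambda>\<xi>::'a::euclidean_space. of_real (gauss 1 (\<xi> + a)) :: complex)"
proof -
  show "integrable lborel (\<lambda>\<xi>::'a. of_real (gauss 1 (\<xi> + a)) :: complex)"
    using integrable_translation[of "\<lambda>\<xi>::'a. of_real (gauss 1 \<xi>) :: complex" a] integrable_of_real_gauss[of 1]
    by (simp add: add.commute)
  show "in_L2 (\<lambda>\<xi>::'a. of_real (gauss 1 (\<xi> + a)) :: complex)"
    using in_L2_reflect(3)[OF in_L2_gauss[of 1], of a] by (simp add: add.commute)
qed

lemma fourier_fourier_gauss_wave: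
  "fourier_integral (fourier_integral (gauss_wave (a::'a::euclidean_space))) x
    = of_real ((2 * pi) ^ DIM('a)) * gauss_wave a (- x)"
proof -
  let ?c = "complex_of_real (sqrt (2 * pi) ^ DIM('a))"
  have [measurable]: "(\<lambda>\<xi>::'a. of_real (gauss 1 (\<xi> + a)) :: complex) \<in> borel_measurable borel" by measurable
  have "fourier_integral (fourier_integral (gauss_wave a)) x
      = (\<integral>\<xi>. ?c * (of_real (gauss 1 (\<xi> + a)) * exp (- \<i> * of_real (\<xi> \<bullet> x))) \<partial>lborel)"
    unfolding fourier_integral_def[of "fourier_integral _"] fourier_gauss_wave by (simp add: mult_ac)
  also have "\<dots> = ?c * (\<integral>\<xi>. of_real (gauss 1 (\<xi> + a)) * exp (- \<i> * of_real (\<xi> \<bullet> x)) \<partial>lborel)"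
    by (rule integral_mult_right_zero)
  also have "(\<integral>\<xi>. of_real (gauss 1 (\<xi> + a)) * exp (- \<i> * of_real (\<xi> \<bullet> x)) \<partial>lborel)
     = (\<integral>\<xi>. of_real (gauss 1 \<xi>) * exp (- \<i> * of_real ((- a + \<xi>) \<bullet> x)) \<partial>lborel)"
    by (subst integral_translation[where t="- a", symmetric]) simp_all
  also have "\<dots> = (\<integral>\<xi>. exp (\<i> * of_real (a \<bullet> x)) * (of_real (gauss 1 \<xi>) * exp (- \<i> * of_real (\<xi> \<bullet> x))) \<partial>lborel)"
    by (intro Bochner_Integration.integral_cong) (simp_all add: inner_add_left inner_diff_left algebra_simps flip: exp_add)
  also have "\<dots> = exp (\<i> * of_real (a \<bullet> x)) * fourier_integral (\<lambda>\<xi>. of_real (gauss 1 \<xi>)) x"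
    unfolding fourier_integral_def by (rule integral_mult_right_zero)
  also have "?c * \<dots> = (?c * ?c) * (of_real (gauss 1 x) * exp (\<i> * of_real (a \<bullet> x)))"
    by (simp add: fourier_integral_gauss)
  also have "of_real (gauss 1 x) * exp (\<i> * of_real (a \<bullet> x)) = gauss_wave a (- x)"
    by (simp add: gauss_wave_def gauss_def inner_commute)
  also have "?c * ?c = of_real ((2 * pi) ^ DIM('a))"
    by (simp only: of_real_mult[symmetric] power_mult_distrib[symmetric]) simp
  finally show ?thesis .
qed

lemma AE_zero_if_gauss_wave_zero:
  fixes f :: "'a::euclidean_space \<Rightarrow> complex"
  assumes f: "integrable lborel (\<lambda>x. f x * gauss_wave 0 x)"
    and z: "\<And>a. (\<integral>x. f x * gauss_wave a x \<partial>lborel) = 0"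
  shows "AE x in lborel. f x = 0"
proof -
  have "AE x in lborel. f x * gauss_wave 0 x = 0"
  proof (rule fourier_integral_unique[OF f])
    fix \<xi>
    show "fourier_integral (\<lambda>x. f x * gauss_wave 0 x) \<xi> = 0"
      using z[of \<xi>] by (simp add: fourier_integral_def gauss_wave_def mult_ac)
  qed
  then show ?thesis by (simp add: gauss_wave_def gauss_def)
qed

lemma AE_eq_if_gauss_wave_eq:
  fixes f g :: "'a::euclidean_space \<Rightarrow> complex"
  assumes f: "\<And>a. integrable lborel (\<lambda>x. f x * gauss_wave a x)"
    and g: "\<And>a. integrable lborel (\<lambda>x. g x * gauss_wave a x)"
    and z: "\<And>a. (\<integral>x. f x * gauss_wave a x \<partial>lborel) = (\<integral>x. g x * gauss_wave a x \<partial>lborel)"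
  shows "AE x in lborel. f x = g x"
proof -
  have "AE x in lborel. f x - g x = 0"
    using f g z by (intro AE_zero_if_gauss_wave_zero) (simp_all add: left_diff_distrib)
  then show ?thesis by simp
qed

lemma l2fourier_unique:
  assumes g: "l2fourier f g" and g': "l2fourier f g'"
  shows "AE x in lborel. g x = g' x"
  using l2fourierD[OF g integrable_gauss_wave in_L2_gauss_wave] l2fourierD[OF g' integrable_gauss_wave in_L2_gauss_wave]
    L2_mult_integrable[OF l2fourier_L2(2)[OF g] in_L2_gauss_wave]
    L2_mult_integrable[OF l2fourier_L2(2)[OF g'] in_L2_gauss_wave]
  by (intro AE_eq_if_gauss_wave_eq) simp_all

lemma l2fourier_cong:
  fixes f :: "'a::euclidean_space \<Rightarrow> complex"
  assumes l: "l2fourier f g" and f: "AE x in lborel. f x = f' x" "f' \<in> borel_measurable borel"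
    and g: "AE x in lborel. g x = g' x" "g' \<in> borel_measurable borel"
  shows "l2fourier f' g'"
proof (rule l2fourierI)
  have [measurable]: "f \<in> borel_measurable borel" "g \<in> borel_measurable borel" "f' \<in> borel_measurable borel" "g' \<in> borel_measurable borel"
    using l f g by (auto intro: in_L2_measurable l2fourier_L2)
  show "in_L2 f'" by (rule in_L2_cong_AE[OF l2fourier_L2(1)[OF l] f(2,1)])
  show "in_L2 g'" by (rule in_L2_cong_AE[OF l2fourier_L2(2)[OF l] g(2,1)])
  fix \<phi> :: "'a \<Rightarrow> complex" assume p: "integrable lborel \<phi>" "in_L2 \<phi>"
  have [measurable]: "\<phi> \<in> borel_measurable borel" using p by (intro in_L2_measurable)
  have "(\<integral>x. f' x * fourier_integral \<phi> x \<partial>lborel) = (\<integral>x. f x * fourier_integral \<phi> x \<partial>lborel)"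
    by (rule integral_cong_AE) (use f in auto)
  also have "\<dots> = (\<integral>x. g x * \<phi> x \<partial>lborel)" by (rule l2fourierD[OF l p])
  also have "\<dots> = (\<integral>x. g' x * \<phi> x \<partial>lborel)"
    by (rule integral_cong_AE) (use g in auto)
  finally show "(\<integral>x. f' x * fourier_integral \<phi> x \<partial>lborel) = (\<integral>x. g' x * \<phi> x \<partial>lborel)" .
qed

lemma L2_sq_cong_AE:
  assumes "in_L2 f" "g \<in> borel_measurable borel" "AE x in lborel. f x = g x"
  shows "L2_sq f = L2_sq g"
  using assms in_L2_measurable[OF assms(1)] by (intro integral_cong_AE) auto

text \<open>Some transform \<open>G\<close> of \<open>g\<close> exists. Tested against a modulated
  Gaussian, two uses of the multiplication formula bring it back to \<open>f\<close>, paired with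
  the double transform of the Gaussian, which is explicit.\<close>

lemma l2fourier_inverse:
  fixes f :: "'a::euclidean_space \<Rightarrow> complex"
  assumes l: "l2fourier f g"
  shows "l2fourier g (\<lambda>x. of_real ((2 * pi) ^ DIM('a)) * f (- x))"
proof -
  let ?c = "complex_of_real ((2 * pi) ^ DIM('a))"
  have f: "in_L2 f" and g: "in_L2 g" using l by (rule l2fourier_L2)+
  have [measurable]: "f \<in> borel_measurable borel" by (rule in_L2_measurable[OF f])
  have fm: "in_L2 (\<lambda>x. ?c * f (- x))" by (intro in_L2_cmult in_L2_reflect f)
  obtain G where G: "l2fourier g G" using l2fourier_exists_le[OF g] by blast
  have "AE x in lborel. G x = ?c * f (- x)"
  proof (rule AE_eq_if_gauss_wave_eq)
    fix a :: 'a
    show "integrable lborel (\<lambda>x. G x * gauss_wave a x)"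
      by (rule L2_mult_integrable[OF l2fourier_L2(2)[OF G] in_L2_gauss_wave])
    show "integrable lborel (\<lambda>x. ?c * f (- x) * gauss_wave a x)"
      by (rule L2_mult_integrable[OF fm in_L2_gauss_wave])
    have eq: "fourier_integral (gauss_wave a) = (\<lambda>\<xi>. of_real (sqrt (2 * pi) ^ DIM('a)) * of_real (gauss 1 (\<xi> + a)))"
      by (rule ext) (simp add: fourier_gauss_wave)
    have 1: "integrable lborel (fourier_integral (gauss_wave a))" "in_L2 (fourier_integral (gauss_wave a))"
      unfolding eq by (intro integrable_mult_right in_L2_cmult gauss_shift_L1_L2)+
    have "(\<integral>x. G x * gauss_wave a x \<partial>lborel) = (\<integral>x. g x * fourier_integral (gauss_wave a) x \<partial>lborel)"
      by (rule l2fourierD[OF G integrable_gauss_wave in_L2_gauss_wave, symmetric])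
    also have "\<dots> = (\<integral>x. f x * fourier_integral (fourier_integral (gauss_wave a)) x \<partial>lborel)"
      by (rule l2fourierD[OF l 1, symmetric])
    also have "\<dots> = (\<integral>x. f x * (?c * gauss_wave a (- x)) \<partial>lborel)"
      by (simp only: fourier_fourier_gauss_wave)
    also have "\<dots> = (\<integral>x. ?c * f (- x) * gauss_wave a x \<partial>lborel)"
      by (subst integral_reflection[where t=0, symmetric]) (simp_all add: mult_ac)
    finally show "(\<integral>x. G x * gauss_wave a x \<partial>lborel) = (\<integral>x. ?c * f (- x) * gauss_wave a x \<partial>lborel)" .
  qed
  then show ?thesis
    by (intro l2fourier_cong[OF G]) (simp_all add: in_L2_measurable[OF g])
qed

text \<open>The inequality of \<open>l2fourier_exists_le\<close> is applied to \<open>f\<close> and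
  then to \<open>g\<close>, whose transform is the reflected \<open>f\<close> times
  \<open>(2 * pi) ^ DIM('a)\<close>; the second use is the reverse inequality.\<close>

lemma plancherel:
  fixes f :: "'a::euclidean_space \<Rightarrow> complex"
  assumes l: "l2fourier f g"
  shows "L2_sq g = (2 * pi) ^ DIM('a) * L2_sq f"
proof -
  let ?c = "(2 * pi) ^ DIM('a)"
  have le: "L2_sq g \<le> ?c * L2_sq f" if l: "l2fourier f g" for f g :: "'a \<Rightarrow> complex"
  proof -
    obtain g' where g': "l2fourier f g'" "L2_sq g' \<le> ?c * L2_sq f" using l2fourier_exists_le[OF l2fourier_L2(1)[OF l]] .
    have "L2_sq g = L2_sq g'"
      by (rule L2_sq_cong_AE[OF _ _ l2fourier_unique[OF l g'(1)]])
         (use l g' l2fourier_L2 in_L2_measurable in blast)+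
    then show ?thesis using g'(2) by simp
  qed
  have "L2_sq (\<lambda>x. of_real ?c * f (- x)) = ?c\<^sup>2 * (\<integral>x. (cmod (f (- x)))\<^sup>2 \<partial>lborel)"
    by (simp add: norm_mult power_mult_distrib norm_power)
  also have "(\<integral>x. (cmod (f (- x)))\<^sup>2 \<partial>lborel) = L2_sq f"
    using integral_reflection[of "\<lambda>x. (cmod (f x))\<^sup>2" 0] in_L2_measurable[OF l2fourier_L2(1)[OF l]] by simp
  finally have "?c\<^sup>2 * L2_sq f \<le> ?c * L2_sq g" using le[OF l2fourier_inverse[OF l]] by simp
  then have "?c * (?c * L2_sq f) \<le> ?c * L2_sq g" by (simp only: power2_eq_square mult.assoc)
  then have "?c * L2_sq f \<le> L2_sq g" by (rule mult_left_le_imp_le) simp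
  then show ?thesis using le[OF l] by simp
qed

section \<open>Linearity, Parseval's identity and the convolution formula\<close>

lemma l2fourier_linear:
  fixes f :: "'a::euclidean_space \<Rightarrow> complex"
  assumes f: "l2fourier f g" and h: "l2fourier h k"
  shows "l2fourier (\<lambda>x. f x + c * h x) (\<lambda>x. g x + c * k x)"
proof (rule l2fourierI)
  show "in_L2 (\<lambda>x. f x + c * h x)" "in_L2 (\<lambda>x. g x + c * k x)"
    using f h by (auto intro!: in_L2_add_cmult dest: l2fourier_L2)
  fix \<phi> :: "'a \<Rightarrow> complex" assume p: "integrable lborel \<phi>" "in_L2 \<phi>"
  note F = fourier_integral_L2(1)[OF p]
  have "(\<integral>x. (f x + c * h x) * fourier_integral \<phi> x \<partial>lborel)
    = (\<integral>x. f x * fourier_integral \<phi> x \<partial>lborel) + c * (\<integral>x. h x * fourier_integral \<phi> x \<partial>lborel)"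
    using L2_mult_integrable[OF l2fourier_L2(1)[OF f] F] L2_mult_integrable[OF l2fourier_L2(1)[OF h] F]
    by (simp add: distrib_right mult.assoc)
  also have "\<dots> = (\<integral>x. (g x + c * k x) * \<phi> x \<partial>lborel)"
    unfolding l2fourierD[OF f p] l2fourierD[OF h p]
    using L2_mult_integrable[OF l2fourier_L2(2)[OF f] p(2)] L2_mult_integrable[OF l2fourier_L2(2)[OF h] p(2)]
    by (simp add: distrib_right mult.assoc)
  finally show "(\<integral>x. (f x + c * h x) * fourier_integral \<phi> x \<partial>lborel) = (\<integral>x. (g x + c * k x) * \<phi> x \<partial>lborel)" .
qed

lemma L2_sq_add_cmult:
  assumes f: "in_L2 f" and h: "in_L2 h"
  shows "L2_sq (\<lambda>x. f x + c * h x) = L2_sq f + (cmod c)\<^sup>2 * L2_sq h + 2 * Re (cnj c * (\<integral>x. f x * cnj (h x) \<partial>lborel))"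
proof -
  note i = L2_mult_integrable[OF f in_L2_cnj[OF h]]
  have ic: "integrable lborel (\<lambda>x. cnj c * (f x * cnj (h x)))" using i by (rule integrable_mult_right)
  have "(cmod (f x + c * h x))\<^sup>2 = (cmod (f x))\<^sup>2 + (cmod c)\<^sup>2 * (cmod (h x))\<^sup>2 + 2 * Re (cnj c * (f x * cnj (h x)))" for x
  proof -
    have "(cmod (a + b))\<^sup>2 = (cmod a)\<^sup>2 + (cmod b)\<^sup>2 + 2 * Re (a * cnj b)" for a b
      by (simp add: cmod_power2) (simp add: power2_eq_square algebra_simps)
    from this[of "f x" "c * h x"] show ?thesis by (simp add: norm_mult power_mult_distrib mult_ac)
  qed
  then have "L2_sq (\<lambda>x. f x + c * h x) = (\<integral>x. ((cmod (f x))\<^sup>2 + (cmod c)\<^sup>2 * (cmod (h x))\<^sup>2) + 2 * Re (cnj c * (f x * cnj (h x))) \<partial>lborel)"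
    by (simp only:)
  also have "\<dots> = (\<integral>x. (cmod (f x))\<^sup>2 + (cmod c)\<^sup>2 * (cmod (h x))\<^sup>2 \<partial>lborel) + (\<integral>x. 2 * Re (cnj c * (f x * cnj (h x))) \<partial>lborel)"
    using in_L2_integrable[OF f] in_L2_integrable[OF h] i
    by (intro Bochner_Integration.integral_add Bochner_Integration.integrable_add integrable_mult_right integrable_Re) simp_all
  also have "(\<integral>x. (cmod (f x))\<^sup>2 + (cmod c)\<^sup>2 * (cmod (h x))\<^sup>2 \<partial>lborel) = L2_sq f + (cmod c)\<^sup>2 * L2_sq h"
    using in_L2_integrable[OF f] in_L2_integrable[OF h] by simp
  also have "(\<integral>x. 2 * Re (cnj c * (f x * cnj (h x))) \<partial>lborel) = 2 * Re (\<integral>x. cnj c * (f x * cnj (h x)) \<partial>lborel)"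
    using ic by (simp only: integral_mult_right_zero integral_Re)
  also have "(\<integral>x. cnj c * (f x * cnj (h x)) \<partial>lborel) = cnj c * (\<integral>x. f x * cnj (h x) \<partial>lborel)"
    by (rule integral_mult_right_zero)
  finally show ?thesis .
qed

text \<open>Polarisation: Plancherel for \<open>f + c * h\<close> equates
  \<open>Re (cnj c * _)\<close> of both sides, and the values 1 and i of \<open>c\<close> give the
  real and imaginary parts.\<close>

lemma parseval:
  fixes f :: "'a::euclidean_space \<Rightarrow> complex"
  assumes f: "l2fourier f g" and h: "l2fourier h k"
  shows "(\<integral>x. g x * cnj (k x) \<partial>lborel) = of_real ((2 * pi) ^ DIM('a)) * (\<integral>x. f x * cnj (h x) \<partial>lborel)"
proof -
  let ?d = "(2 * pi) ^ DIM('a)"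
  let ?G = "\<integral>x. g x * cnj (k x) \<partial>lborel" let ?F = "\<integral>x. f x * cnj (h x) \<partial>lborel"
  have *: "Re (cnj c * ?G) = ?d * Re (cnj c * ?F)" for c
    using plancherel[OF l2fourier_linear[OF f h, of c]] plancherel[OF f] plancherel[OF h]
      L2_sq_add_cmult[OF l2fourier_L2(1)[OF f] l2fourier_L2(1)[OF h], of c]
      L2_sq_add_cmult[OF l2fourier_L2(2)[OF f] l2fourier_L2(2)[OF h], of c]
    by (simp add: algebra_simps)
  show ?thesis
    using *[of 1] *[of \<i>] by (intro complex_eqI) (simp_all del: of_real_power add: Re_complex_of_real)
qed

lemma l2fourier_reflect:
  fixes f :: "'a::euclidean_space \<Rightarrow> complex"
  assumes l: "l2fourier f g"
  shows "l2fourier (\<lambda>x. f (- x)) (\<lambda>x. g (- x))"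
proof (rule l2fourierI)
  have [measurable]: "f \<in> borel_measurable borel" "g \<in> borel_measurable borel"
    using l by (auto intro: in_L2_measurable l2fourier_L2)
  show "in_L2 (\<lambda>x. f (- x))" "in_L2 (\<lambda>x. g (- x))" using l by (auto intro!: in_L2_reflect dest: l2fourier_L2)
  fix \<phi> :: "'a \<Rightarrow> complex" assume p: "integrable lborel \<phi>" "in_L2 \<phi>"
  have [measurable]: "\<phi> \<in> borel_measurable borel" using p by (intro in_L2_measurable)
  have F: "fourier_integral (\<lambda>x. \<phi> (- x)) \<xi> = fourier_integral \<phi> (- \<xi>)" for \<xi>
    unfolding fourier_integral_def by (subst integral_reflection[where t=0, symmetric]) simp_all
  have p': "integrable lborel (\<lambda>x. \<phi> (- x))" "in_L2 (\<lambda>x. \<phi> (- x))"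
    using p integrable_reflection[of \<phi> 0] by (auto intro: in_L2_reflect)
  have "(\<integral>x. f (- x) * fourier_integral \<phi> x \<partial>lborel) = (\<integral>x. f x * fourier_integral (\<lambda>x. \<phi> (- x)) x \<partial>lborel)"
    by (subst integral_reflection[where t=0, symmetric]) (simp_all add: F)
  also have "\<dots> = (\<integral>x. g x * \<phi> (- x) \<partial>lborel)" by (rule l2fourierD[OF l p'])
  also have "\<dots> = (\<integral>x. g (- x) * \<phi> x \<partial>lborel)"
    by (subst integral_reflection[where t=0, symmetric]) simp_all
  finally show "(\<integral>x. f (- x) * fourier_integral \<phi> x \<partial>lborel) = (\<integral>x. g (- x) * \<phi> x \<partial>lborel)" .
qed

lemma l2fourier_surj:
  fixes g :: "'a::euclidean_space \<Rightarrow> complex"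
  assumes g: "in_L2 g"
  obtains f where "l2fourier f g"
proof -
  let ?c = "complex_of_real ((2 * pi) ^ DIM('a))"
  obtain G where G: "l2fourier g G" using l2fourier_exists_le[OF g] by blast
  have "l2fourier (\<lambda>x. G (- x)) (\<lambda>x. ?c * g x)"
    using l2fourier_reflect[OF l2fourier_inverse[OF G]] by simp
  \<comment> \<open>Linearity with both functions equal multiplies by
    \<open>1 + (inverse ?c - 1)\<close>, which removes the factor \<open>?c\<close> left by the
    double transform.\<close>
  from l2fourier_linear[OF this this, of "inverse ?c - 1"]
  have "l2fourier (\<lambda>x. G (- x) + (inverse ?c - 1) * G (- x)) g"
    by (simp add: algebra_simps)
  then show ?thesis by (rule that)
qed

text \<open>Chosen so that Parseval's identity for \<open>f\<close> and this function has the square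
  of \<open>f\<close> times a character on one side and a convolution on the other.\<close>

lemma l2fourier_cnj_modulate:
  fixes f :: "'a::euclidean_space \<Rightarrow> complex"
  assumes l: "l2fourier f g"
  shows "l2fourier (\<lambda>x. cnj (f x) * exp (\<i> * of_real (x \<bullet> \<zeta>))) (\<lambda>\<xi>. cnj (g (\<zeta> - \<xi>)))"
proof (rule l2fourierI)
  have [measurable]: "f \<in> borel_measurable borel" "g \<in> borel_measurable borel"
    using l by (auto intro: in_L2_measurable l2fourier_L2)
  show "in_L2 (\<lambda>x. cnj (f x) * exp (\<i> * of_real (x \<bullet> \<zeta>)))"
    by (intro in_L2_mult_unimodular in_L2_cnj l2fourier_L2(1)[OF l]) simp_all
  show "in_L2 (\<lambda>\<xi>. cnj (g (\<zeta> - \<xi>)))" by (intro in_L2_cnj in_L2_reflect l2fourier_L2(2)[OF l])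
  fix \<phi> :: "'a \<Rightarrow> complex" assume p: "integrable lborel \<phi>" "in_L2 \<phi>"
  have [measurable]: "\<phi> \<in> borel_measurable borel" using p by (intro in_L2_measurable)
  define \<psi> where "\<psi> z = cnj (\<phi> (\<zeta> - z))" for z
  have p': "integrable lborel \<psi>" "in_L2 \<psi>"
    unfolding \<psi>_def using p integrable_reflection[of \<phi> \<zeta>] by (auto intro: in_L2_reflect in_L2_cnj)
  have F: "fourier_integral \<psi> x = cnj (exp (\<i> * of_real (x \<bullet> \<zeta>)) * fourier_integral \<phi> x)" for x
  proof -
    have "fourier_integral \<psi> x = (\<integral>y. cnj (\<phi> (\<zeta> - y) * exp (\<i> * of_real (y \<bullet> x))) \<partial>lborel)"
      unfolding fourier_integral_def \<psi>_def by (simp add: exp_cnj)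
    also have "\<dots> = (\<integral>y. cnj (\<phi> y * exp (\<i> * of_real ((\<zeta> - y) \<bullet> x))) \<partial>lborel)"
      by (subst integral_reflection[where t=\<zeta>, symmetric]) simp_all
    also have "\<dots> = cnj (\<integral>y. exp (\<i> * of_real (x \<bullet> \<zeta>)) * (\<phi> y * exp (- \<i> * of_real (y \<bullet> x))) \<partial>lborel)"
      by (subst Bochner_Integration.integral_cnj, intro arg_cong[where f=cnj] Bochner_Integration.integral_cong)
         (simp_all add: inner_diff_left inner_commute algebra_simps flip: exp_add)
    also have "\<dots> = cnj (exp (\<i> * of_real (x \<bullet> \<zeta>)) * fourier_integral \<phi> x)"
      unfolding fourier_integral_def by (simp only: integral_mult_right_zero)
    finally show ?thesis .
  qed
  have "(\<integral>x. cnj (f x) * exp (\<i> * of_real (x \<bullet> \<zeta>)) * fourier_integral \<phi> x \<partial>lborel)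
      = cnj (\<integral>x. f x * fourier_integral \<psi> x \<partial>lborel)"
    by (subst Bochner_Integration.integral_cnj[symmetric]) (simp add: F mult_ac)
  also have "\<dots> = cnj (\<integral>x. g x * \<psi> x \<partial>lborel)" by (simp only: l2fourierD[OF l p'])
  also have "\<dots> = (\<integral>x. cnj (g x) * \<phi> (\<zeta> - x) \<partial>lborel)"
    by (subst Bochner_Integration.integral_cnj[symmetric]) (simp add: \<psi>_def)
  also have "\<dots> = (\<integral>x. cnj (g (\<zeta> - x)) * \<phi> x \<partial>lborel)"
    by (subst integral_reflection[where t=\<zeta>, symmetric]) simp_all
  finally show "(\<integral>x. cnj (f x) * exp (\<i> * of_real (x \<bullet> \<zeta>)) * fourier_integral \<phi> x \<partial>lborel) = (\<integral>x. cnj (g (\<zeta> - x)) * \<phi> x \<partial>lborel)" .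
qed

lemma fourier_integral_square:
  fixes U :: "'a::euclidean_space \<Rightarrow> complex"
  assumes l: "l2fourier U V"
  shows "of_real ((2 * pi) ^ DIM('a)) * fourier_integral (\<lambda>x. (U x)\<^sup>2) \<zeta> = (\<integral>\<xi>. V \<xi> * V (\<zeta> - \<xi>) \<partial>lborel)"
  using parseval[OF l l2fourier_cnj_modulate[OF l, of \<zeta>]]
  by (simp add: fourier_integral_def exp_cnj power2_eq_square mult_ac)

section \<open>Schwartz functions and tempered Fourier transforms\<close>

lemma schwartz_differentiable:
  "schwartz f \<Longrightarrow> set bs \<subseteq> Basis \<Longrightarrow> iterated_partial bs f differentiable (at x)"
  by (simp add: schwartz_def)

lemma schwartz_continuous:
  "schwartz f \<Longrightarrow> set bs \<subseteq> Basis \<Longrightarrow> continuous_on UNIV (iterated_partial bs f)"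
  by (simp add: continuous_at_imp_continuous_on differentiable_imp_continuous_within schwartz_differentiable)

lemma schwartz_measurable:
  "schwartz f \<Longrightarrow> set bs \<subseteq> Basis \<Longrightarrow> iterated_partial bs f \<in> borel_measurable borel"
  by (rule borel_measurable_continuous_onI[OF schwartz_continuous])

lemma schwartz_bound:
  assumes "schwartz f" "set bs \<subseteq> Basis"
  obtains C where "C \<ge> 0" "\<And>x. cmod (iterated_partial bs f x) \<le> C * (1 / (1 + norm x) ^ k)"
proof -
  have "bounded (range (\<lambda>x. (1 + norm x) ^ k * cmod (iterated_partial bs f x)))"
    using assms by (simp add: schwartz_def)
  then obtain C where C: "\<And>x. norm ((1 + norm x) ^ k * cmod (iterated_partial bs f x)) \<le> C"
    unfolding bounded_iff by blast
  have "cmod (iterated_partial bs f x) \<le> C * (1 / (1 + norm x) ^ k)" for x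
  proof -
    have "0 < (1 + norm x) ^ k" by (simp add: add_pos_nonneg)
    moreover have "(1 + norm x) ^ k * cmod (iterated_partial bs f x) \<le> C"
      using C[of x] abs_ge_self order_trans by fastforce
    ultimately show ?thesis by (simp add: field_simps)
  qed
  moreover have "C \<ge> 0" using C[of 0] norm_ge_zero order_trans by blast
  ultimately show ?thesis using that by blast
qed

lemma schwartz_L1_L2:
  fixes f :: "'a::euclidean_space \<Rightarrow> complex"
  assumes f: "schwartz f" and bs: "set bs \<subseteq> Basis"
  shows "integrable lborel (iterated_partial bs f)" "in_L2 (iterated_partial bs f)"
proof -
  have [measurable]: "iterated_partial bs f \<in> borel_measurable borel" by (rule schwartz_measurable[OF f bs])
  obtain C where C: "C \<ge> 0" "\<And>x. cmod (iterated_partial bs f x) \<le> C * (1 / (1 + norm x) ^ (2 * DIM('a)))"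
    by (rule schwartz_bound[OF f bs, of "2 * DIM('a)"], rule that)
  have i: "integrable lborel (\<lambda>x::'a. C * (1 / (1 + norm x) ^ (2 * DIM('a))))"
    by (intro integrable_mult_right integrable_inverse_poly) simp
  show "integrable lborel (iterated_partial bs f)"
    by (rule Bochner_Integration.integrable_bound[OF i]) (use C in simp_all)
  have i2: "integrable lborel (\<lambda>x::'a. C\<^sup>2 * (1 / (1 + norm x) ^ (4 * DIM('a))))"
    by (intro integrable_mult_right integrable_inverse_poly) simp
  show "in_L2 (iterated_partial bs f)"
  proof (rule in_L2_bound[OF _ i2])
    fix x
    have "(cmod (iterated_partial bs f x))\<^sup>2 \<le> (C * (1 / (1 + norm x) ^ (2 * DIM('a))))\<^sup>2"
      by (intro power_mono C) simp
    also have "\<dots> = C\<^sup>2 * (1 / (1 + norm x) ^ (4 * DIM('a)))"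
      by (simp add: power_mult_distrib power_divide flip: power_mult)
    finally show "(cmod (iterated_partial bs f x))\<^sup>2 \<le> C\<^sup>2 * (1 / (1 + norm x) ^ (4 * DIM('a)))" .
  qed simp
qed

lemmas schwartz_integrable = schwartz_L1_L2(1)[where bs="[]", simplified]
lemmas schwartz_in_L2 = schwartz_L1_L2(2)[where bs="[]", simplified]

text \<open>The polynomial multiples of \<open>gauss_wave a\<close>: a class closed under partial derivatives.\<close>

inductive gauss_poly :: "'a::euclidean_space \<Rightarrow> ('a \<Rightarrow> complex) \<Rightarrow> bool" for a where
  wave: "gauss_poly a (gauss_wave a)"
| add: "gauss_poly a f \<Longrightarrow> gauss_poly a g \<Longrightarrow> gauss_poly a (\<lambda>x. f x + g x)"
| cmult: "gauss_poly a f \<Longrightarrow> gauss_poly a (\<lambda>x. c * f x)"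
| coord: "gauss_poly a f \<Longrightarrow> gauss_poly a (\<lambda>x. of_real (x \<bullet> b) * f x)"

lemma has_derivative_gauss_wave:
  "(gauss_wave a has_derivative (\<lambda>h. (- of_real (x \<bullet> h) - \<i> * of_real (h \<bullet> a)) * gauss_wave a x)) (at x)"
proof -
  have eq: "gauss_wave a = (\<lambda>x. exp (of_real (- (x \<bullet> x) / 2) + - \<i> * of_real (x \<bullet> a)))"
    unfolding gauss_wave_def[abs_def] gauss_def exp_add exp_of_real power2_norm_eq_inner by simp
  have "((\<lambda>x. of_real (- (x \<bullet> x) / 2) + - \<i> * of_real (x \<bullet> a)) has_derivative
      (\<lambda>h. - of_real (x \<bullet> h) - \<i> * of_real (h \<bullet> a))) (at x)"
    by (auto intro!: derivative_eq_intros simp: inner_commute algebra_simps)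
  from has_derivative_compose[OF this DERIV_exp[unfolded has_field_derivative_def]] show ?thesis
    unfolding eq by (rule has_derivative_eq_rhs) (rule ext, rule mult.commute)
qed

lemma gauss_poly_derivative:
  "gauss_poly a f \<Longrightarrow> \<exists>f'. (\<forall>x. (f has_derivative f' x) (at x)) \<and> (\<forall>h. gauss_poly a (\<lambda>x. f' x h))"
proof (induction rule: gauss_poly.induct)
  case wave
  let ?f' = "\<lambda>x h. (- of_real (x \<bullet> h) - \<i> * of_real (h \<bullet> a)) * gauss_wave a x"
  have "gauss_poly a (\<lambda>x. ?f' x h)" for h
  proof -
    have "gauss_poly a (\<lambda>x. (-1) * (of_real (x \<bullet> h) * gauss_wave a x) + (- \<i> * of_real (h \<bullet> a)) * gauss_wave a x)"
      by (intro gauss_poly.intros)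
    then show ?thesis by (simp add: algebra_simps)
  qed
  then show ?case using has_derivative_gauss_wave by (intro exI[of _ ?f']) blast
next
  case (add f g)
  then obtain f' g' where *: "\<And>x. (f has_derivative f' x) (at x)" "\<And>x. (g has_derivative g' x) (at x)"
    "\<And>h. gauss_poly a (\<lambda>x. f' x h)" "\<And>h. gauss_poly a (\<lambda>x. g' x h)" by blast
  then show ?case
    by (intro exI[of _ "\<lambda>x h. f' x h + g' x h"]) (auto intro!: has_derivative_add gauss_poly.intros)
next
  case (cmult f c)
  then obtain f' where *: "\<And>x. (f has_derivative f' x) (at x)" "\<And>h. gauss_poly a (\<lambda>x. f' x h)" by blast
  then show ?case
    by (intro exI[of _ "\<lambda>x h. c * f' x h"]) (auto intro!: has_derivative_mult_right gauss_poly.intros)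
next
  case (coord f b)
  then obtain f' where *: "\<And>x. (f has_derivative f' x) (at x)" "\<And>h. gauss_poly a (\<lambda>x. f' x h)" by blast
  have "((\<lambda>x. of_real (x \<bullet> b) * f x) has_derivative (\<lambda>h. of_real (x \<bullet> b) * f' x h + of_real (h \<bullet> b) * f x)) (at x)" for x
    by (intro has_derivative_mult *) (auto intro!: derivative_eq_intros)
  moreover have "gauss_poly a (\<lambda>x. of_real (x \<bullet> b) * f' x h + of_real (h \<bullet> b) * f x)" for h
    by (intro gauss_poly.intros * coord)
  ultimately show ?case
    by (intro exI[of _ "\<lambda>x h. of_real (x \<bullet> b) * f' x h + of_real (h \<bullet> b) * f x"]) blast
qed

lemma power_le_fact_exp:
  assumes "y \<ge> (0::real)" shows "y ^ k \<le> fact k * exp y"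
proof -
  have "y ^ k /\<^sub>R fact k \<le> (\<Sum>n. y ^ n /\<^sub>R fact n)"
    using sum_le_suminf[of "\<lambda>n. y ^ n /\<^sub>R fact n" "{k}"] summable_exp_generic[of y] assms by simp
  then show ?thesis by (simp add: exp_def field_simps)
qed

text \<open>The power \<open>k\<close> is arbitrary in the induction because a coordinate factor is
  paid for with one more power of \<open>1 + norm x\<close>.\<close>

lemma gauss_poly_bound:
  "gauss_poly a f \<Longrightarrow> \<exists>C. \<forall>x. (1 + norm x) ^ k * cmod (f x) \<le> C"
proof (induction arbitrary: k rule: gauss_poly.induct)
  case wave
  \<comment> \<open>With y = (1 + r^2)/2 one has (1 + r)^2 <= 4 y and y^k <= k! e^y. The factor
    e^(r^2/2) cancels the Gaussian, and e^(1/2) remains.\<close>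
  have "(1 + norm x) ^ k * cmod (gauss_wave a x) \<le> 4 ^ k * (fact k * exp (1 / 2))" for x
  proof -
    let ?r = "norm x"
    have "(1 + ?r) ^ k \<le> (1 + ?r) ^ (2 * k)" by (intro power_increasing) auto
    also have "\<dots> = ((1 + ?r)\<^sup>2) ^ k" by (rule power_mult)
    also have "\<dots> \<le> (4 * ((1 + ?r\<^sup>2) / 2)) ^ k"
      using sum_squares_bound[of 1 ?r] by (intro power_mono) (simp_all add: power2_sum)
    also have "\<dots> = 4 ^ k * ((1 + ?r\<^sup>2) / 2) ^ k" by (rule power_mult_distrib)
    also have "\<dots> \<le> 4 ^ k * (fact k * exp ((1 + ?r\<^sup>2) / 2))"
      by (intro mult_left_mono power_le_fact_exp) simp_all
    finally have "(1 + ?r) ^ k * gauss 1 x \<le> 4 ^ k * (fact k * exp ((1 + ?r\<^sup>2) / 2)) * gauss 1 x"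
      by (intro mult_right_mono gauss_nonneg)
    also have "\<dots> = 4 ^ k * (fact k * exp (1 / 2))"
      by (simp add: gauss_def add_divide_distrib exp_add exp_minus)
    finally show ?thesis by (simp add: norm_gauss_wave)
  qed
  then show ?case by blast
next
  case (add f g)
  from add.IH(1)[of k] obtain C where C: "\<And>x. (1 + norm x) ^ k * cmod (f x) \<le> C" by blast
  from add.IH(2)[of k] obtain D where D: "\<And>x. (1 + norm x) ^ k * cmod (g x) \<le> D" by blast
  have "(1 + norm x) ^ k * cmod (f x + g x) \<le> C + D" for x
  proof -
    have "(1 + norm x) ^ k * cmod (f x + g x) \<le> (1 + norm x) ^ k * (cmod (f x) + cmod (g x))"
      by (intro mult_left_mono norm_triangle_ineq) simp
    then show ?thesis using C[of x] D[of x] by (simp add: distrib_left)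
  qed
  then show ?case by blast
next
  case (cmult f c)
  from cmult.IH[of k] obtain C where C: "\<And>x. (1 + norm x) ^ k * cmod (f x) \<le> C" by blast
  have "(1 + norm x) ^ k * cmod (c * f x) \<le> cmod c * C" for x
    using mult_left_mono[OF C[of x], of "cmod c"] by (simp add: norm_mult mult_ac)
  then show ?case by blast
next
  case (coord f b)
  from coord.IH[of "Suc k"] obtain C where C: "\<And>x. (1 + norm x) ^ Suc k * cmod (f x) \<le> C" by blast
  have "(1 + norm x) ^ k * cmod (of_real (x \<bullet> b) * f x) \<le> norm b * C" for x
  proof -
    have "\<bar>x \<bullet> b\<bar> \<le> norm x * norm b" by (rule Cauchy_Schwarz_ineq2)
    also have "\<dots> \<le> (1 + norm x) * norm b" by (intro mult_right_mono) auto
    finally have "(1 + norm x) ^ k * (\<bar>x \<bullet> b\<bar> * cmod (f x)) \<le> (1 + norm x) ^ k * ((1 + norm x) * norm b * cmod (f x))"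
      by (intro mult_left_mono mult_right_mono) auto
    also have "\<dots> = norm b * ((1 + norm x) ^ Suc k * cmod (f x))" by (simp add: mult_ac)
    also have "\<dots> \<le> norm b * C" by (intro mult_left_mono C) simp
    finally show ?thesis by (simp add: norm_mult)
  qed
  then show ?case by blast
qed

lemma gauss_poly_iterated_partial: "gauss_poly a f \<Longrightarrow> gauss_poly a (iterated_partial bs f)"
proof (induction bs)
  case (Cons b bs)
  then obtain f' where f': "\<And>x. (iterated_partial bs f has_derivative f' x) (at x)" "\<And>h. gauss_poly a (\<lambda>x. f' x h)"
    using gauss_poly_derivative by blast
  have "frechet_derivative (iterated_partial bs f) (at x) = f' x" for x
    using frechet_derivative_at[OF f'(1)] by simp
  then show ?case using f'(2) by simp
qed simp

lemma schwartz_gauss_wave: "schwartz (gauss_wave a)"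
  unfolding schwartz_def
proof (intro allI impI conjI)
  fix bs :: "'a list" and x :: 'a and k :: nat
  have g: "gauss_poly a (iterated_partial bs (gauss_wave a))"
    by (intro gauss_poly_iterated_partial gauss_poly.wave)
  then show "iterated_partial bs (gauss_wave a) differentiable at x"
    using gauss_poly_derivative differentiable_def by blast
  from gauss_poly_bound[OF g, of k]
  obtain C where "\<And>x. (1 + norm x) ^ k * cmod (iterated_partial bs (gauss_wave a) x) \<le> C" by blast
  then show "bounded (range (\<lambda>x. (1 + norm x) ^ k * cmod (iterated_partial bs (gauss_wave a) x)))"
    by (auto simp: bounded_iff)
qed

section \<open>Transforms of tempered functions and Fourier multipliers\<close>

lemma has_fourier_tempered: "has_fourier f g \<Longrightarrow> tempered_fun f" "has_fourier f g \<Longrightarrow> tempered_fun g"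
  by (simp_all add: has_fourier_def)

lemma tempered_funD:
  "tempered_fun f \<Longrightarrow> f \<in> borel_measurable borel"
  "tempered_fun f \<Longrightarrow> schwartz \<phi> \<Longrightarrow> integrable lborel (\<lambda>x. f x * \<phi> x)"
  by (simp_all add: tempered_fun_def)

lemma has_fourierD:
  "has_fourier f g \<Longrightarrow> schwartz \<phi> \<Longrightarrow>
    (\<integral>x. f x * fourier_integral \<phi> x \<partial>lborel) = (\<integral>\<xi>. g \<xi> * \<phi> \<xi> \<partial>lborel)"
  by (simp add: has_fourier_def)

lemma has_fourier_unique:
  fixes f :: "'a::euclidean_space \<Rightarrow> complex"
  assumes g: "has_fourier f g" and h: "has_fourier f h"
  shows "AE x in lborel. g x = h x"
proof (rule AE_eq_if_gauss_wave_eq)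
  fix a :: 'a
  show "integrable lborel (\<lambda>x. g x * gauss_wave a x)" "integrable lborel (\<lambda>x. h x * gauss_wave a x)"
    by (intro tempered_funD(2) has_fourier_tempered(2)[OF g] has_fourier_tempered(2)[OF h] schwartz_gauss_wave)+
  have "(\<integral>x. g x * gauss_wave a x \<partial>lborel) = (\<integral>x. f x * fourier_integral (gauss_wave a) x \<partial>lborel)"
    by (rule has_fourierD[OF g schwartz_gauss_wave, symmetric])
  also have "\<dots> = (\<integral>x. h x * gauss_wave a x \<partial>lborel)"
    by (rule has_fourierD[OF h schwartz_gauss_wave])
  finally show "(\<integral>x. g x * gauss_wave a x \<partial>lborel) = (\<integral>x. h x * gauss_wave a x \<partial>lborel)" .
qed

lemma in_L2_tempered: "in_L2 f \<Longrightarrow> tempered_fun f"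
  unfolding tempered_fun_def using in_L2_measurable[of f] L2_mult_integrable[OF _ schwartz_in_L2, of f] by simp

lemma l2fourier_has_fourier: "l2fourier f g \<Longrightarrow> has_fourier f g"
  unfolding has_fourier_def
  using l2fourierD[OF _ schwartz_integrable schwartz_in_L2] in_L2_tempered l2fourier_L2 by blast

text \<open>The step from Schwartz test functions to all of L1 intersected with L2: an L2 transform
  exists, it is also a tempered transform, and tempered transforms are unique.\<close>

lemma has_fourier_l2fourier:
  fixes f :: "'a::euclidean_space \<Rightarrow> complex"
  assumes f: "in_L2 f" and g: "has_fourier f g"
  shows "l2fourier f g"
proof -
  obtain g' where g': "l2fourier f g'" using l2fourier_exists_le[OF f] by blast
  have "AE x in lborel. g' x = g x" using has_fourier_unique[OF l2fourier_has_fourier[OF g'] g] .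
  moreover have "g \<in> borel_measurable borel" using g by (simp add: has_fourier_def tempered_fun_def)
  ultimately show ?thesis
    using l2fourier_cong[OF g' _ in_L2_measurable[OF f]] by simp
qed

lemma has_fourier_cong_AE:
  fixes f :: "'a::euclidean_space \<Rightarrow> complex"
  assumes f: "in_L2 f" and g: "has_fourier f g" and ae: "AE x in lborel. g x = h x" and h: "h \<in> borel_measurable borel"
  shows "has_fourier f h"
  by (rule l2fourier_has_fourier, rule l2fourier_cong[OF has_fourier_l2fourier[OF f g] _ in_L2_measurable[OF f] ae h]) simp

text \<open>The image picked by \<open>SOME\<close> comes with its own transform of
  \<open>f\<close>, which agrees with \<open>g\<close> almost everywhere by uniqueness. Plancherel
  therefore gives the same norm whichever image is picked.\<close>

lemma fourier_multiplier_L2: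
  fixes f :: "'a::euclidean_space \<Rightarrow> complex"
  assumes f: "has_fourier f g" and mg: "in_L2 (\<lambda>\<xi>. of_real (m \<xi>) * g \<xi>)"
  shows "in_multiplier_domain m f"
    and "(2 * pi) ^ DIM('a) * (L2_norm (fourier_multiplier m f))\<^sup>2 = L2_sq (\<lambda>\<xi>. of_real (m \<xi>) * g \<xi>)"
proof -
  obtain h where h: "l2fourier h (\<lambda>\<xi>. of_real (m \<xi>) * g \<xi>)" using l2fourier_surj[OF mg] .
  then have ex: "is_multiplier_image m f h"
    unfolding is_multiplier_image_def using f l2fourier_has_fourier l2fourier_L2 by blast
  then show "in_multiplier_domain m f" unfolding in_multiplier_domain_def by blast
  define k where "k = fourier_multiplier m f"
  have "is_multiplier_image m f k" unfolding k_def fourier_multiplier_def by (rule someI[of "is_multiplier_image m f", OF ex])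
  then obtain g' where k: "in_L2 k" "has_fourier f g'" "has_fourier k (\<lambda>\<xi>. of_real (m \<xi>) * g' \<xi>)"
    unfolding is_multiplier_image_def by blast
  have l: "l2fourier k (\<lambda>\<xi>. of_real (m \<xi>) * g' \<xi>)" by (rule has_fourier_l2fourier[OF k(1,3)])
  have "L2_sq (\<lambda>\<xi>. of_real (m \<xi>) * g' \<xi>) = L2_sq (\<lambda>\<xi>. of_real (m \<xi>) * g \<xi>)"
    by (rule L2_sq_cong_AE[OF l2fourier_L2(2)[OF l] in_L2_measurable[OF mg]])
       (use has_fourier_unique[OF k(2) f] in auto)
  then show "(2 * pi) ^ DIM('a) * (L2_norm (fourier_multiplier m f))\<^sup>2 = L2_sq (\<lambda>\<xi>. of_real (m \<xi>) * g \<xi>)"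
    using plancherel[OF l] by (simp add: L2_norm_def k_def)
qed

section \<open>The partial Fourier transform in time\<close>

text \<open>Integration by parts on the line: the derivative of \<open>g\<close> times the character
  integrates to 0 because the product vanishes at both ends.\<close>

lemma fourier_integral_derivative:
  fixes g g' :: "real \<Rightarrow> complex"
  assumes der: "\<And>s. (g has_vector_derivative g' s) (at s)" and g: "integrable lborel g" and g': "integrable lborel g'"
    and c: "continuous_on UNIV g'" and top: "(g \<longlongrightarrow> 0) at_top" and bot: "(g \<longlongrightarrow> 0) at_bot"
  shows "fourier_integral g' t = \<i> * of_real t * fourier_integral g t"
proof -
  let ?e = "\<lambda>s. exp (- (\<i> * of_real (s * t)))"
  define F where "F s = g s * ?e s" for s
  define f where "f s = g' s * ?e s + (- (\<i> * of_real t)) * (g s * ?e s)" for s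
  have e: "(?e has_vector_derivative - (\<i> * of_real t) * ?e s) (at s)" for s
  proof -
    have "((\<lambda>z. exp (- (\<i> * (z * of_real t)))) has_field_derivative - (\<i> * of_real t) * ?e s) (at (of_real s))"
      by (auto intro!: derivative_eq_intros)
    from has_vector_derivative_real_field[OF this] show ?thesis by simp
  qed
  have d: "(F has_vector_derivative f s) (at s)" for s
    unfolding F_def using has_vector_derivative_mult[OF der[of s] e[of s]] by (simp add: f_def algebra_simps)
  have cg: "continuous_on UNIV g"
    by (intro continuous_at_imp_continuous_on ballI has_vector_derivative_continuous[OF der])
  have cf: "isCont f s" for s
  proof -
    have "continuous_on UNIV f" unfolding f_def by (intro continuous_intros c cg)
    then show ?thesis by (simp add: continuous_on_eq_continuous_at)
  qed
  have ig: "integrable lborel (\<lambda>s. g s * ?e s)" "integrable lborel (\<lambda>s. g' s * ?e s)"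
    using integrable_fourier_kernel(2)[OF g, of t] integrable_fourier_kernel(2)[OF g', of t] by simp_all
  have i: "integrable lborel f" unfolding f_def by (intro Bochner_Integration.integrable_add integrable_mult_right ig)
  have lim: "(F \<longlongrightarrow> 0) net" if "(g \<longlongrightarrow> 0) net" for net
  proof -
    have "((\<lambda>s. cmod (F s)) \<longlongrightarrow> 0) net"
      using tendsto_norm[OF that] unfolding F_def by (simp only: norm_mult norm_exp_i mult_1_right norm_zero)
    then show ?thesis by (rule tendsto_norm_zero_cancel)
  qed
  have "(LBINT s=-\<infinity>..\<infinity>. f s) = 0 - 0"
  proof (rule interval_integral_FTC_integrable[where F=F])
    show "((F \<circ> real_of_ereal) \<longlongrightarrow> 0) (at_right (-\<infinity>))" "((F \<circ> real_of_ereal) \<longlongrightarrow> 0) (at_left \<infinity>)"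
      using lim[OF top] lim[OF bot] by (simp_all add: ereal_tendsto_simps)
  qed (use d cf i in \<open>auto simp: set_integrable_def\<close>)
  then have "(\<integral>s. f s \<partial>lborel) = 0"
    by (simp add: interval_lebesgue_integral_def set_lebesgue_integral_def)
  moreover have "(\<integral>s. f s \<partial>lborel) = (\<integral>s. g' s * ?e s \<partial>lborel) + (\<integral>s. (- (\<i> * of_real t)) * (g s * ?e s) \<partial>lborel)"
    unfolding f_def by (intro Bochner_Integration.integral_add integrable_mult_right ig)
  moreover have "(\<integral>s. (- (\<i> * of_real t)) * (g s * ?e s) \<partial>lborel) = - (\<i> * of_real t) * (\<integral>s. g s * ?e s \<partial>lborel)"
    by (rule integral_mult_right_zero)
  ultimately have "(\<integral>s. g' s * ?e s \<partial>lborel) = \<i> * of_real t * (\<integral>s. g s * ?e s \<partial>lborel)"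
    by (simp add: algebra_simps eq_neg_iff_add_eq_0)
  then show ?thesis by (simp add: fourier_integral_def)
qed

lemma time_in_Basis: "(1, 0) \<in> (Basis :: (real \<times> 'a::euclidean_space) set)"
  by (simp add: Basis_prod_def)

lemma time_partial_vector_derivative:
  fixes f :: "real \<times> 'a::euclidean_space \<Rightarrow> complex"
  assumes "f differentiable (at (s, z))"
  shows "((\<lambda>s. f (s, z)) has_vector_derivative frechet_derivative f (at (s, z)) (1, 0)) (at s)"
proof -
  let ?f' = "frechet_derivative f (at (s, z))"
  have f': "(f has_derivative ?f') (at (s, z))" using assms by (simp add: frechet_derivative_works)
  have "((\<lambda>s. (s, z)) has_derivative (\<lambda>h. (h, 0))) (at s)"
    by (auto intro!: derivative_eq_intros)
  from has_derivative_compose[OF this f'] have "((\<lambda>s. f (s, z)) has_derivative (\<lambda>h. ?f' (h, 0))) (at s)" .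
  moreover have "(\<lambda>h. ?f' (h, 0)) = (\<lambda>h. h *\<^sub>R ?f' (1, 0))"
  proof (rule ext)
    fix h :: real
    show "?f' (h, 0) = h *\<^sub>R ?f' (1, 0)"
      using linear_scale[OF has_derivative_linear[OF f'], of h "(1, 0)"] by simp
  qed
  ultimately show ?thesis by (simp only: has_vector_derivative_def)
qed

text \<open>The decay in the joint norm is shared out: two powers make the bound integrable in time,
  the other \<open>k\<close> are left for space.\<close>

lemma schwartz_slice_bound:
  fixes \<phi> :: "real \<times> 'a::euclidean_space \<Rightarrow> complex"
  assumes "schwartz \<phi>" "set bs \<subseteq> Basis"
  obtains C where "C \<ge> 0"
    "\<And>s z. cmod (iterated_partial bs \<phi> (s, z)) \<le> C * (1 / (1 + norm s) ^ 2) * (1 / (1 + norm z) ^ k)"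
proof -
  obtain C where C: "C \<ge> 0" "\<And>x. cmod (iterated_partial bs \<phi> x) \<le> C * (1 / (1 + norm x) ^ (2 + k))"
    by (rule schwartz_bound[OF assms, of "2 + k"], rule that)
  have "cmod (iterated_partial bs \<phi> (s, z)) \<le> C * (1 / (1 + norm s) ^ 2) * (1 / (1 + norm z) ^ k)" for s z
  proof -
    have "(1 + norm s) ^ 2 * (1 + norm z) ^ k \<le> (1 + norm (s, z)) ^ 2 * (1 + norm (s, z)) ^ k"
      using norm_fst_le[of s z] norm_snd_le[of z s] by (intro mult_mono power_mono) auto
    then have le: "1 / (1 + norm (s, z)) ^ (2 + k) \<le> 1 / ((1 + norm s) ^ 2 * (1 + norm z) ^ k)"
      unfolding power_add by (intro divide_left_mono mult_pos_pos zero_less_power add_pos_nonneg) auto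
    have "cmod (iterated_partial bs \<phi> (s, z)) \<le> C * (1 / (1 + norm (s, z)) ^ (2 + k))" by (rule C)
    also have "\<dots> \<le> C * (1 / ((1 + norm s) ^ 2 * (1 + norm z) ^ k))" by (intro mult_left_mono le C)
    finally show ?thesis by simp
  qed
  with C(1) show ?thesis by (rule that)
qed

lemma integrable_inverse_quadratic: "integrable lborel (\<lambda>s::real. C * (1 / (1 + norm s) ^ 2))"
  by (intro integrable_mult_right integrable_inverse_poly) simp

lemma tendsto_zero_inverse_quadratic:
  fixes g :: "real \<Rightarrow> complex"
  assumes "\<And>s. cmod (g s) \<le> C * (1 / (1 + norm s) ^ 2)"
  shows "(g \<longlongrightarrow> 0) at_top" "(g \<longlongrightarrow> 0) at_bot"
proof -
  have 0: "((\<lambda>s::real. C * (1 / (1 + norm s) ^ 2)) \<longlongrightarrow> 0) net" if "filterlim (\<lambda>s::real. norm s) at_top net" for net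
  proof -
    have "filterlim (\<lambda>s. (1 + norm s) ^ 2) at_top net"
      by (intro filterlim_pow_at_top filterlim_tendsto_add_at_top[OF tendsto_const that]) simp
    then have "((\<lambda>s::real. C * (1 / (1 + norm s) ^ 2)) \<longlongrightarrow> C * 0) net"
      by (intro tendsto_mult tendsto_const tendsto_divide_0[OF tendsto_const] filterlim_at_top_imp_at_infinity)
    then show ?thesis by simp
  qed
  have "filterlim (\<lambda>s::real. norm s) at_top at_top" "filterlim (\<lambda>s::real. norm s) at_top at_bot"
    by (simp_all add: filterlim_abs_real filterlim_at_bot_mirror)
  from this[THEN 0] show "(g \<longlongrightarrow> 0) at_top" "(g \<longlongrightarrow> 0) at_bot"
    by - (rule Lim_null_comparison[OF always_eventually[OF allI[OF assms]]], assumption)+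
qed

lemma schwartz_slice:
  fixes \<phi> :: "real \<times> 'a::euclidean_space \<Rightarrow> complex"
  assumes p: "schwartz \<phi>" "set bs \<subseteq> Basis"
  shows "integrable lborel (\<lambda>s. iterated_partial bs \<phi> (s, z))"
    "continuous_on UNIV (\<lambda>s. iterated_partial bs \<phi> (s, z))"
    "((\<lambda>s. iterated_partial bs \<phi> (s, z)) \<longlongrightarrow> 0) at_top"
    "((\<lambda>s. iterated_partial bs \<phi> (s, z)) \<longlongrightarrow> 0) at_bot"
    "((\<lambda>s. iterated_partial bs \<phi> (s, z)) has_vector_derivative iterated_partial ((1, 0) # bs) \<phi> (s, z)) (at s)"
proof -
  obtain C where C: "C \<ge> 0" "\<And>s z. cmod (iterated_partial bs \<phi> (s, z)) \<le> C * (1 / (1 + norm s) ^ 2) * (1 / (1 + norm z) ^ 0)"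
    by (rule schwartz_slice_bound[OF p, of 0], rule that)
  then have b: "cmod (iterated_partial bs \<phi> (s, z)) \<le> C * (1 / (1 + norm s) ^ 2)" for s by simp
  show c: "continuous_on UNIV (\<lambda>s. iterated_partial bs \<phi> (s, z))"
    by (rule continuous_on_compose2[OF schwartz_continuous[OF p]]) (auto intro!: continuous_intros)
  show "integrable lborel (\<lambda>s. iterated_partial bs \<phi> (s, z))"
  proof (rule Bochner_Integration.integrable_bound[OF integrable_inverse_quadratic[of C]])
    show "AE s in lborel. cmod (iterated_partial bs \<phi> (s, z)) \<le> norm (C * (1 / (1 + norm s) ^ 2))"
      by (intro AE_I2 le_norm_real b)
  qed (use borel_measurable_continuous_onI[OF c] in simp)
  show "((\<lambda>s. iterated_partial bs \<phi> (s, z)) \<longlongrightarrow> 0) at_top" "((\<lambda>s. iterated_partial bs \<phi> (s, z)) \<longlongrightarrow> 0) at_bot"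
    using tendsto_zero_inverse_quadratic[OF b] by auto
  show "((\<lambda>s. iterated_partial bs \<phi> (s, z)) has_vector_derivative iterated_partial ((1, 0) # bs) \<phi> (s, z)) (at s)"
    using time_partial_vector_derivative[OF schwartz_differentiable[OF p]] by simp
qed

text \<open>Test functions live on the frequency side, so the variable \<open>s\<close> that is
  integrated out is dual to time and \<open>t\<close> is time itself. In the mixed variables (t, z)
  the free evolution acts as multiplication by a phase.\<close>

definition time_transform :: "(real \<times> 'a::euclidean_space \<Rightarrow> complex) \<Rightarrow> real \<Rightarrow> 'a \<Rightarrow> complex" where
  "time_transform \<phi> t z = fourier_integral (\<lambda>s. \<phi> (s, z)) t"

lemma time_transform_measurable:
  fixes \<phi> :: "real \<times> 'a::euclidean_space \<Rightarrow> complex"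
  assumes \<phi>: "\<phi> \<in> borel_measurable borel"
  shows "(\<lambda>p. time_transform \<phi> (fst p) (snd p)) \<in> borel_measurable borel"
proof -
  have [measurable]: "\<phi> \<in> borel_measurable (borel \<Otimes>\<^sub>M borel)" using \<phi> by (simp add: borel_prod)
  have "(\<lambda>p. time_transform \<phi> (fst p) (snd p)) \<in> borel_measurable (borel \<Otimes>\<^sub>M borel)"
    unfolding time_transform_def fourier_integral_def by measurable
  then show ?thesis by (simp add: borel_prod)
qed

text \<open>Two integrations by parts bound t^2 times the transform, and the undifferentiated
  function bounds the transform itself; together they control \<open>(1 + norm t) ^ 2\<close>,
  enough for integrability in time.\<close>

lemma schwartz_time_transform_bound:
  fixes \<phi> :: "real \<times> 'a::euclidean_space \<Rightarrow> complex"
  assumes p: "schwartz \<phi>"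
  obtains C where "C \<ge> 0"
    "\<And>t z. cmod (time_transform \<phi> t z) \<le> C * (1 / (1 + norm t) ^ 2) * (1 / (1 + norm z) ^ k)"
proof -
  let ?e = "(1, 0) :: real \<times> 'a"
  let ?p = "\<lambda>n. iterated_partial (replicate n ?e) \<phi>"
  have bs: "set (replicate n ?e) \<subseteq> Basis" for n using time_in_Basis[where 'a='a] by (simp add: set_replicate_conv_if)
  define I where "I = integral\<^sup>L lborel (\<lambda>s::real. 1 / (1 + norm s) ^ 2)"
  have I: "I \<ge> 0" unfolding I_def by (intro Bochner_Integration.integral_nonneg) simp
  have est: "\<exists>C\<ge>0. \<forall>t z. cmod (fourier_integral (\<lambda>s. ?p n (s, z)) t) \<le> C * (1 / (1 + norm z) ^ k)" for n
  proof -
    obtain C where C: "C \<ge> 0" "\<And>s z. cmod (?p n (s, z)) \<le> C * (1 / (1 + norm s) ^ 2) * (1 / (1 + norm z) ^ k)"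
      by (rule schwartz_slice_bound[OF p bs, of n k], rule that)
    have "cmod (fourier_integral (\<lambda>s. ?p n (s, z)) t) \<le> (C * I) * (1 / (1 + norm z) ^ k)" for t z
    proof -
      have "cmod (fourier_integral (\<lambda>s. ?p n (s, z)) t) \<le> (\<integral>s. cmod (?p n (s, z)) \<partial>lborel)"
        by (rule fourier_integral_bound[OF schwartz_slice(1)[OF p bs]])
      also have "\<dots> \<le> (\<integral>s. C * (1 / (1 + norm (s::real)) ^ 2) * (1 / (1 + norm z) ^ k) \<partial>lborel)"
      proof (rule integral_mono)
        show "integrable lborel (\<lambda>s. cmod (?p n (s, z)))" by (rule integrable_norm[OF schwartz_slice(1)[OF p bs]])
        show "integrable lborel (\<lambda>s. C * (1 / (1 + norm (s::real)) ^ 2) * (1 / (1 + norm z) ^ k))"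
          by (intro integrable_mult_left integrable_inverse_quadratic)
      qed (rule C(2))
      also have "\<dots> = (C * I) * (1 / (1 + norm z) ^ k)"
        unfolding I_def by (simp only: integral_mult_left_zero integral_mult_right_zero)
      finally show ?thesis .
    qed
    moreover have "C * I \<ge> 0" using C(1) I by simp
    ultimately show ?thesis by blast
  qed
  obtain C0 where C0: "C0 \<ge> 0" "\<And>t z. cmod (fourier_integral (\<lambda>s. ?p 0 (s, z)) t) \<le> C0 * (1 / (1 + norm z) ^ k)"
    using est[of 0] by blast
  obtain C2 where C2: "C2 \<ge> 0" "\<And>t z. cmod (fourier_integral (\<lambda>s. ?p 2 (s, z)) t) \<le> C2 * (1 / (1 + norm z) ^ k)"
    using est[of 2] by blast
  have step: "fourier_integral (\<lambda>s. ?p (Suc n) (s, z)) t = \<i> * of_real t * fourier_integral (\<lambda>s. ?p n (s, z)) t" for n z t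
    by (intro fourier_integral_derivative schwartz_slice(1-4)[OF p bs])
       (use schwartz_slice(5)[OF p bs, of n] in simp)
  have two: "fourier_integral (\<lambda>s. ?p 2 (s, z)) t = - (of_real t)\<^sup>2 * fourier_integral (\<lambda>s. ?p 0 (s, z)) t" for z t
  proof -
    have "fourier_integral (\<lambda>s. ?p (Suc (Suc 0)) (s, z)) t = (\<i> * of_real t) * ((\<i> * of_real t) * fourier_integral (\<lambda>s. ?p 0 (s, z)) t)"
      by (simp only: step)
    also have "\<dots> = - (of_real t)\<^sup>2 * fourier_integral (\<lambda>s. ?p 0 (s, z)) t"
    proof -
      have "(\<i> * a) * ((\<i> * a) * X) = (\<i> * \<i>) * (a * a * X)" for a X :: complex by (simp only: mult_ac)
      then show ?thesis by (simp add: power2_eq_square)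
    qed
    finally show ?thesis by (simp only: numeral_2_eq_2)
  qed
  have "cmod (time_transform \<phi> t z) \<le> (2 * (C0 + C2)) * (1 / (1 + norm t) ^ 2) * (1 / (1 + norm z) ^ k)" for t z
  proof -
    let ?q = "1 / (1 + norm z) ^ k"
    have "of_real (1 + t\<^sup>2) * time_transform \<phi> t z = fourier_integral (\<lambda>s. ?p 0 (s, z)) t - fourier_integral (\<lambda>s. ?p 2 (s, z)) t"
      unfolding two by (simp add: time_transform_def algebra_simps)
    then have "cmod (of_real (1 + t\<^sup>2) * time_transform \<phi> t z) \<le> cmod (fourier_integral (\<lambda>s. ?p 0 (s, z)) t) + cmod (fourier_integral (\<lambda>s. ?p 2 (s, z)) t)"
      by (simp only: norm_triangle_ineq4)
    also have "\<dots> \<le> C0 * ?q + C2 * ?q" by (intro add_mono C0 C2)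
    finally have le: "cmod (of_real (1 + t\<^sup>2) * time_transform \<phi> t z) \<le> C0 * ?q + C2 * ?q" .
    have "cmod (of_real (1 + t\<^sup>2)) = 1 + t\<^sup>2" unfolding norm_of_real by (simp add: abs_of_nonneg)
    then have 1: "(1 + t\<^sup>2) * cmod (time_transform \<phi> t z) \<le> (C0 + C2) * ?q"
      using le by (simp only: norm_mult distrib_right[of C0 C2])
    have 2: "(1 + norm t) ^ 2 \<le> 2 * (1 + t\<^sup>2)"
      using sum_squares_bound[of 1 "\<bar>t\<bar>"] by (simp add: power2_sum)
    have "(1 + norm t) ^ 2 * cmod (time_transform \<phi> t z) \<le> 2 * (1 + t\<^sup>2) * cmod (time_transform \<phi> t z)"
      using 2 by (intro mult_right_mono) auto
    also have "\<dots> \<le> 2 * ((C0 + C2) * ?q)" unfolding mult.assoc[of 2] by (rule mult_left_mono[OF 1[unfolded mult.assoc]]) simp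
    finally have 3: "(1 + norm t) ^ 2 * cmod (time_transform \<phi> t z) \<le> 2 * ((C0 + C2) * ?q)" .
    have "(1 + norm t) ^ 2 > 0" by (simp add: add_pos_nonneg)
    then have "cmod (time_transform \<phi> t z) \<le> 2 * ((C0 + C2) * ?q) / (1 + norm t) ^ 2"
      using 3 by (simp only: pos_le_divide_eq mult.commute[of "cmod (time_transform \<phi> t z)"])
    then show ?thesis by (simp add: mult_ac)
  qed
  moreover have "2 * (C0 + C2) \<ge> 0" using C0 C2 by simp
  ultimately show ?thesis using that by blast
qed

lemma time_transform_inversion:
  fixes \<phi> :: "real \<times> 'a::euclidean_space \<Rightarrow> complex"
  assumes p: "schwartz \<phi>"
  shows "(\<integral>t. time_transform \<phi> t z * exp (\<i> * of_real (s * t)) \<partial>lborel) = of_real (2 * pi) * \<phi> (s, z)"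
proof -
  note sl = schwartz_slice[OF p, of "[]", simplified]
  obtain C where C: "C \<ge> 0" "\<And>t z. cmod (time_transform \<phi> t z) \<le> C * (1 / (1 + norm t) ^ 2) * (1 / (1 + norm z) ^ 0)"
    by (rule schwartz_time_transform_bound[OF p, of 0], rule that)
  obtain B where B: "B \<ge> 0" "\<And>x. cmod (iterated_partial [] \<phi> x) \<le> B * (1 / (1 + norm x) ^ 0)"
    by (rule schwartz_bound[OF p, of "[]" 0], simp, rule that)
  have [measurable]: "(\<lambda>s. \<phi> (s, z)) \<in> borel_measurable borel" by (rule borel_measurable_continuous_onI[OF sl(2)])
  have "integrable lborel (fourier_integral (\<lambda>s. \<phi> (s, z)))"
  proof (rule Bochner_Integration.integrable_bound[OF integrable_inverse_quadratic[of C]])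
    show "AE t in lborel. cmod (fourier_integral (\<lambda>s. \<phi> (s, z)) t) \<le> norm (C * (1 / (1 + norm t) ^ 2))"
      using C(2)[of _ z] by (intro AE_I2 le_norm_real) (simp add: time_transform_def)
  qed simp
  from fourier_inversion[OF sl(1) this sl(2), of B s] B(2) show ?thesis
    by (simp add: time_transform_def)
qed

lemma fourier_integral_time_transform:
  fixes \<phi> :: "real \<times> 'a::euclidean_space \<Rightarrow> complex"
  assumes i: "integrable lborel \<phi>"
  shows "fourier_integral \<phi> (t, x) = fourier_integral (time_transform \<phi> t) x"
proof -
  define f where "f s z = \<phi> (s, z) * exp (- \<i> * of_real ((s, z) \<bullet> (t, x)))" for s z
  have "integrable (lborel \<Otimes>\<^sub>M lborel) (case_prod f)"
    using integrable_fourier_kernel(1)[OF i, of "(t, x)"] by (simp add: lborel_prod f_def case_prod_unfold)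
  from lborel_pair.integral_snd[OF this]
  have "fourier_integral \<phi> (t, x) = (\<integral>z. (\<integral>s. f s z \<partial>lborel) \<partial>lborel)"
    by (simp add: lborel_prod f_def case_prod_unfold fourier_integral_def)
  also have "\<dots> = (\<integral>z. (\<integral>s. (\<phi> (s, z) * exp (- \<i> * of_real (s \<bullet> t))) * exp (- \<i> * of_real (z \<bullet> x)) \<partial>lborel) \<partial>lborel)"
    unfolding f_def by (intro Bochner_Integration.integral_cong) (simp_all add: algebra_simps flip: exp_add)
  also have "\<dots> = fourier_integral (time_transform \<phi> t) x"
    unfolding fourier_integral_def time_transform_def by (simp only: integral_mult_left_zero)
  finally show ?thesis .
qed

section \<open>The square of a free solution\<close>

lemma fst_snd_borel:
  "(fst :: 'a::euclidean_space \<times> 'b::euclidean_space \<Rightarrow> 'a) \<in> borel_measurable borel"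
  "(snd :: 'a::euclidean_space \<times> 'b::euclidean_space \<Rightarrow> 'b) \<in> borel_measurable borel"
  by (intro borel_measurable_continuous_onI continuous_intros)+

definition pair_product :: "('a::euclidean_space \<Rightarrow> complex) \<Rightarrow> 'a \<Rightarrow> 'a \<Rightarrow> complex" where
  "pair_product v z y = v (z /\<^sub>R 2 + y) * v (z /\<^sub>R 2 - y)"

lemma pair_product_measurable:
  fixes v :: "'a::euclidean_space \<Rightarrow> complex"
  assumes [measurable]: "v \<in> borel_measurable borel"
  shows "(\<lambda>p. pair_product v (fst p) (snd p)) \<in> borel_measurable borel"
    "(\<lambda>p. pair_product v (fst p) (snd p)) \<in> borel_measurable (borel \<Otimes>\<^sub>M borel)"
proof -
  show "(\<lambda>p. pair_product v (fst p) (snd p)) \<in> borel_measurable (borel \<Otimes>\<^sub>M borel)"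
    unfolding pair_product_def by measurable
  then show "(\<lambda>p. pair_product v (fst p) (snd p)) \<in> borel_measurable borel" by (simp add: borel_prod)
qed

text \<open>A form of the parallelogram law. Because of it the phase of a product of two free waves,
  and a centred Gaussian weight on the product, depend on \<open>y\<close> through
  \<open>norm y\<close> only.\<close>

lemma midpoint_norms:
  fixes z y :: "'a::real_inner"
  shows "(norm (z /\<^sub>R 2 + y))\<^sup>2 + (norm (z /\<^sub>R 2 - y))\<^sup>2 = (norm z)\<^sup>2 / 2 + 2 * (norm y)\<^sup>2"
  by (simp add: power2_norm_eq_inner inner_add inner_diff inner_commute algebra_simps)

text \<open>From 2ab <= a^2 + b^2: a translation and a reflection of the square of \<open>v\<close>
  each contribute half of the right-hand side.\<close>

lemma nn_integral_pair_product_le: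
  fixes v :: "'a::euclidean_space \<Rightarrow> complex"
  assumes v: "in_L2 v"
  shows "(\<integral>\<^sup>+y. ennreal (cmod (pair_product v z y)) \<partial>lborel) \<le> ennreal (L2_sq v)"
proof -
  have [measurable]: "v \<in> borel_measurable borel" by (rule in_L2_measurable[OF v])
  have nv: "(\<integral>\<^sup>+x. ennreal ((cmod (v x))\<^sup>2) \<partial>lborel) = ennreal (L2_sq v)"
    using in_L2_integrable[OF v] by (subst nn_integral_eq_integral) simp_all
  have "(\<integral>\<^sup>+y. ennreal (cmod (pair_product v z y)) \<partial>lborel)
    \<le> (\<integral>\<^sup>+y. ennreal (1/2) * ennreal ((cmod (v (z /\<^sub>R 2 + y)))\<^sup>2) + ennreal (1/2) * ennreal ((cmod (v (z /\<^sub>R 2 - y)))\<^sup>2) \<partial>lborel)"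
  proof (intro nn_integral_mono)
    fix y
    have "cmod (pair_product v z y) \<le> 1/2 * (cmod (v (z /\<^sub>R 2 + y)))\<^sup>2 + 1/2 * (cmod (v (z /\<^sub>R 2 - y)))\<^sup>2"
      using sum_squares_bound[of "cmod (v (z /\<^sub>R 2 + y))" "cmod (v (z /\<^sub>R 2 - y))"]
      by (simp add: pair_product_def norm_mult)
    then show "ennreal (cmod (pair_product v z y))
      \<le> ennreal (1/2) * ennreal ((cmod (v (z /\<^sub>R 2 + y)))\<^sup>2) + ennreal (1/2) * ennreal ((cmod (v (z /\<^sub>R 2 - y)))\<^sup>2)"
      by (subst (1 2) ennreal_mult[symmetric], simp_all add: ennreal_plus[symmetric] del: ennreal_plus)
  qed
  also have "\<dots> = ennreal (1/2) * (\<integral>\<^sup>+y. ennreal ((cmod (v (z /\<^sub>R 2 + y)))\<^sup>2) \<partial>lborel)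
      + ennreal (1/2) * (\<integral>\<^sup>+y. ennreal ((cmod (v (z /\<^sub>R 2 - y)))\<^sup>2) \<partial>lborel)"
    by (subst nn_integral_add) (simp_all add: nn_integral_cmult)
  also have "\<dots> = ennreal (1/2) * ennreal (L2_sq v) + ennreal (1/2) * ennreal (L2_sq v)"
    using nn_integral_translation[of "\<lambda>y. ennreal ((cmod (v y))\<^sup>2)" "z /\<^sub>R 2"]
      nn_integral_reflection[of "\<lambda>y. ennreal ((cmod (v y))\<^sup>2)" "z /\<^sub>R 2"] nv by simp
  also have "\<dots> = ennreal (L2_sq v)"
    by (subst (1 2) ennreal_mult[symmetric], simp_all add: ennreal_plus[symmetric] del: ennreal_plus)
  finally show ?thesis .
qed

text \<open>The pair product is integrable in \<open>y\<close> with a bound that does not depend on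
  \<open>z\<close>; the weight restores integrability in \<open>z\<close>.\<close>

lemma integrable_pair_product_weight:
  fixes v :: "'a::euclidean_space \<Rightarrow> complex"
  assumes v: "in_L2 v" and k: "k \<ge> 2 * DIM('a)"
  shows "integrable lborel (\<lambda>p. cmod (pair_product v (fst p) (snd p)) * (1 / (1 + norm (fst p)) ^ k))"
proof (rule integrableI_nonneg)
  have [measurable]: "v \<in> borel_measurable borel" by (rule in_L2_measurable[OF v])
  note [measurable] = pair_product_measurable(1)[OF this] fst_snd_borel
  show m: "(\<lambda>p. cmod (pair_product v (fst p) (snd p)) * (1 / (1 + norm (fst p)) ^ k)) \<in> borel_measurable lborel"
    by measurable
  show "AE p in lborel. 0 \<le> cmod (pair_product v (fst p) (snd p)) * (1 / (1 + norm (fst p)) ^ k)"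
    by (intro AE_I2) simp
  have m2: "(\<lambda>p. ennreal (cmod (pair_product v (fst p) (snd p)) * (1 / (1 + norm (fst p)) ^ k))) \<in> borel_measurable (lborel \<Otimes>\<^sub>M lborel)"
    using m by (simp add: lborel_prod)
  have "(\<integral>\<^sup>+p. ennreal (cmod (pair_product v (fst p) (snd p)) * (1 / (1 + norm (fst p)) ^ k)) \<partial>lborel)
      = (\<integral>\<^sup>+z. \<integral>\<^sup>+y. ennreal (cmod (pair_product v z y) * (1 / (1 + norm z) ^ k)) \<partial>lborel \<partial>lborel)"
    using lborel.nn_integral_fst[OF m2] by (simp add: lborel_prod)
  also have "\<dots> \<le> (\<integral>\<^sup>+z. ennreal (L2_sq v) * ennreal (1 / (1 + norm z) ^ k) \<partial>(lborel :: 'a measure))"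
  proof (intro nn_integral_mono)
    fix z :: 'a
    have [measurable]: "pair_product v z \<in> borel_measurable borel" unfolding pair_product_def[abs_def] by measurable
    have "(\<integral>\<^sup>+y. ennreal (cmod (pair_product v z y) * (1 / (1 + norm z) ^ k)) \<partial>lborel)
      = (\<integral>\<^sup>+y. ennreal (cmod (pair_product v z y)) \<partial>lborel) * ennreal (1 / (1 + norm z) ^ k)"
    proof -
      have "ennreal (cmod (pair_product v z y) * (1 / (1 + norm z) ^ k)) = ennreal (cmod (pair_product v z y)) * ennreal (1 / (1 + norm z) ^ k)" for y
        by (rule ennreal_mult) simp_all
      then show ?thesis by (simp only:) (rule nn_integral_multc, measurable)
    qed
    also have "\<dots> \<le> ennreal (L2_sq v) * ennreal (1 / (1 + norm z) ^ k)"
      by (intro mult_right_mono nn_integral_pair_product_le v) simp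
    finally show "(\<integral>\<^sup>+y. ennreal (cmod (pair_product v z y) * (1 / (1 + norm z) ^ k)) \<partial>lborel)
      \<le> ennreal (L2_sq v) * ennreal (1 / (1 + norm z) ^ k)" .
  qed
  also have "\<dots> = ennreal (L2_sq v) * ennreal (integral\<^sup>L lborel (\<lambda>z::'a. 1 / (1 + norm z) ^ k))"
    using integrable_inverse_poly[OF k] by (subst nn_integral_cmult) (simp_all add: nn_integral_eq_integral)
  also have "\<dots> < \<infinity>" by (simp add: ennreal_mult_less_top)
  finally show "(\<integral>\<^sup>+p. ennreal (cmod (pair_product v (fst p) (snd p)) * (1 / (1 + norm (fst p)) ^ k)) \<partial>lborel) < \<infinity>" .
qed

text \<open>Here \<open>v\<close> plays the part of the transform of the initial data. The slices
  are L2 transforms in the strong sense, which \<open>has_fourier_l2fourier\<close> supplies from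
  the tempered definition of a solution.\<close>

locale free_solution =
  fixes v :: "'a::euclidean_space \<Rightarrow> complex" and u :: "real \<times> 'a \<Rightarrow> complex"
  assumes u: "u \<in> borel_measurable borel" and v: "in_L2 v"
    and slice: "l2fourier (\<lambda>x. u (t, x)) (\<lambda>\<xi>. exp (- \<i> * of_real (t * (norm \<xi>)\<^sup>2)) * v \<xi>)"
begin

lemma v_meas[measurable]: "v \<in> borel_measurable borel" by (rule in_L2_measurable[OF v])

lemma slice_L2_sq: "(2 * pi) ^ DIM('a) * L2_sq (\<lambda>x. u (t, x)) = L2_sq v"
  using plancherel[OF slice[of t]] by (simp add: norm_mult norm_exp_eq_Re)

text \<open>By Plancherel on the slices, the L1 norm in space of \<open>u^2\<close> is the same at
  all times, so decay of \<open>F\<close> in time is enough.\<close>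

lemma square_times_integrable:
  assumes F: "F \<in> borel_measurable borel" and C: "\<And>t x. cmod (F (t, x)) \<le> C * (1 / (1 + norm t) ^ 2)"
  shows "integrable lborel (\<lambda>z. (u z)\<^sup>2 * F z)"
proof (rule integrableI_bounded)
  show m: "(\<lambda>z. (u z)\<^sup>2 * F z) \<in> borel_measurable lborel" using u F by simp
  then have m2: "(\<lambda>z. ennreal (norm ((u z)\<^sup>2 * F z))) \<in> borel_measurable (lborel \<Otimes>\<^sub>M lborel)"
    by (simp add: lborel_prod)
  have C0: "C \<ge> 0" using order_trans[OF norm_ge_zero C[of 0 undefined]] by simp
  let ?K = "L2_sq v / (2 * pi) ^ DIM('a)"
  have K: "L2_sq (\<lambda>x. u (t, x)) = ?K" for t using slice_L2_sq[of t] by (simp add: field_simps)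
  have um: "(\<lambda>x. u (t, x)) \<in> borel_measurable borel" for t
    by (rule in_L2_measurable[OF l2fourier_L2(1)[OF slice]])
  have "(\<integral>\<^sup>+z. ennreal (norm ((u z)\<^sup>2 * F z)) \<partial>lborel) = (\<integral>\<^sup>+t. \<integral>\<^sup>+x. ennreal (norm ((u (t, x))\<^sup>2 * F (t, x))) \<partial>lborel \<partial>lborel)"
    using lborel.nn_integral_fst[OF m2] by (simp add: lborel_prod)
  also have "\<dots> \<le> (\<integral>\<^sup>+t. ennreal ?K * ennreal (C * (1 / (1 + norm (t::real)) ^ 2)) \<partial>lborel)"
  proof (intro nn_integral_mono)
    fix t :: real
    have "(\<integral>\<^sup>+x. ennreal (norm ((u (t, x))\<^sup>2 * F (t, x))) \<partial>lborel)
      \<le> (\<integral>\<^sup>+x. ennreal ((cmod (u (t, x)))\<^sup>2) * ennreal (C * (1 / (1 + norm t) ^ 2)) \<partial>lborel)"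
    proof (intro nn_integral_mono)
      fix x
      have "norm ((u (t, x))\<^sup>2 * F (t, x)) \<le> (cmod (u (t, x)))\<^sup>2 * (C * (1 / (1 + norm t) ^ 2))"
        unfolding norm_mult norm_power by (intro mult_left_mono C) simp
      then show "ennreal (norm ((u (t, x))\<^sup>2 * F (t, x))) \<le> ennreal ((cmod (u (t, x)))\<^sup>2) * ennreal (C * (1 / (1 + norm t) ^ 2))"
        using C0 by (subst ennreal_mult[symmetric]) (auto intro!: ennreal_leI)
    qed
    also have "\<dots> = ennreal ?K * ennreal (C * (1 / (1 + norm t) ^ 2))"
      using um[of t] in_L2_integrable[OF l2fourier_L2(1)[OF slice], of t] K[of t]
      by (subst nn_integral_multc) (simp_all add: nn_integral_eq_integral)
    finally show "(\<integral>\<^sup>+x. ennreal (norm ((u (t, x))\<^sup>2 * F (t, x))) \<partial>lborel) \<le> ennreal ?K * ennreal (C * (1 / (1 + norm t) ^ 2))" .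
  qed
  also have "\<dots> = ennreal ?K * ennreal (integral\<^sup>L lborel (\<lambda>t::real. C * (1 / (1 + norm t) ^ 2)))"
    using integrable_inverse_quadratic[of C] C0
    by (subst nn_integral_cmult) (simp_all add: nn_integral_eq_integral)
  also have "\<dots> < \<infinity>" by (simp add: ennreal_mult_less_top)
  finally show "(\<integral>\<^sup>+z. ennreal (norm ((u z)\<^sup>2 * F z)) \<partial>lborel) < \<infinity>" .
qed

lemma square_tempered: "tempered_fun (\<lambda>z. (u z)\<^sup>2)"
  unfolding tempered_fun_def
proof (intro conjI allI impI)
  show "(\<lambda>z. (u z)\<^sup>2) \<in> borel_measurable lborel" using u by simp
  fix \<phi> :: "real \<times> 'a \<Rightarrow> complex" assume p: "schwartz \<phi>"
  obtain C where C: "C \<ge> 0" "\<And>s z. cmod (iterated_partial [] \<phi> (s, z)) \<le> C * (1 / (1 + norm s) ^ 2) * (1 / (1 + norm z) ^ 0)"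
    by (rule schwartz_slice_bound[OF p, of "[]" 0], simp, rule that)
  show "integrable lborel (\<lambda>z. (u z)\<^sup>2 * \<phi> z)"
    by (rule square_times_integrable[of _ C])
       (use C(2) schwartz_measurable[OF p, of "[]"] in simp_all)
qed

lemma slice_square_fourier:
  "of_real ((2 * pi) ^ DIM('a)) * fourier_integral (\<lambda>x. (u (t, x))\<^sup>2) z
    = (\<integral>y. exp (- \<i> * of_real (t * ((norm z)\<^sup>2 / 2 + 2 * (norm y)\<^sup>2))) * pair_product v z y \<partial>lborel)"
proof -
  let ?e = "\<lambda>\<xi>. exp (- \<i> * of_real (t * (norm \<xi>)\<^sup>2))"
  have "of_real ((2 * pi) ^ DIM('a)) * fourier_integral (\<lambda>x. (u (t, x))\<^sup>2) z = (\<integral>\<xi>. (?e \<xi> * v \<xi>) * (?e (z - \<xi>) * v (z - \<xi>)) \<partial>lborel)"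
    using fourier_integral_square[OF slice[of t], of z] by simp
  also have "\<dots> = (\<integral>y. (?e (z /\<^sub>R 2 + y) * v (z /\<^sub>R 2 + y)) * (?e (z - (z /\<^sub>R 2 + y)) * v (z - (z /\<^sub>R 2 + y))) \<partial>lborel)"
    by (subst integral_translation[where t="z /\<^sub>R 2", symmetric]) simp_all
  also have "\<dots> = (\<integral>y. exp (- \<i> * of_real (t * ((norm z)\<^sup>2 / 2 + 2 * (norm y)\<^sup>2))) * pair_product v z y \<partial>lborel)"
  proof (intro Bochner_Integration.integral_cong refl)
    fix y
    have half: "z - (z /\<^sub>R 2 + y) = z /\<^sub>R 2 - y"
      by (simp add: algebra_simps flip: scaleR_left_distrib)
    have "?e (z /\<^sub>R 2 + y) * ?e (z /\<^sub>R 2 - y) = exp (- \<i> * of_real (t * ((norm (z /\<^sub>R 2 + y))\<^sup>2 + (norm (z /\<^sub>R 2 - y))\<^sup>2)))"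
      by (simp add: algebra_simps flip: exp_add)
    then have e: "?e (z /\<^sub>R 2 + y) * ?e (z /\<^sub>R 2 - y) = exp (- \<i> * of_real (t * ((norm z)\<^sup>2 / 2 + 2 * (norm y)\<^sup>2)))"
      by (simp only: midpoint_norms)
    have swap: "(a * b) * (c * d) = (a * c) * (b * d)" for a b c d :: complex by (simp only: mult_ac)
    show "(?e (z /\<^sub>R 2 + y) * v (z /\<^sub>R 2 + y)) * (?e (z - (z /\<^sub>R 2 + y)) * v (z - (z /\<^sub>R 2 + y)))
       = exp (- \<i> * of_real (t * ((norm z)\<^sup>2 / 2 + 2 * (norm y)\<^sup>2))) * pair_product v z y"
      unfolding half pair_product_def by (subst swap, subst e) (rule refl)
  qed
  finally show ?thesis .
qed

text \<open>The central computation. At fixed \<open>t\<close> the multiplication formula in space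
  trades the transform of \<open>\<phi>\<close> for its time transform and \<open>u^2\<close> for
  the pair product with its phase; the integral over \<open>t\<close> then inverts the time
  transform at minus the phase. So, up to a constant, the transform of \<open>u^2\<close> is the
  image of the pair product under (z, y) -> (-(|z|^2/2 + 2|y|^2), z).\<close>

lemma square_pairing:
  assumes p: "schwartz \<phi>"
  shows "of_real ((2 * pi) ^ DIM('a)) * (\<integral>x. (u x)\<^sup>2 * fourier_integral \<phi> x \<partial>lborel)
     = of_real (2 * pi) * (\<integral>q. pair_product v (fst q) (snd q) * \<phi> (- ((norm (fst q))\<^sup>2 / 2 + 2 * (norm (snd q))\<^sup>2), fst q) \<partial>lborel)"
proof -
  let ?c = "complex_of_real ((2 * pi) ^ DIM('a))"
  let ?k = "2 * DIM('a)"
  let ?E = "\<lambda>t z y. exp (- \<i> * of_real (t * ((norm z)\<^sup>2 / 2 + 2 * (norm y)\<^sup>2)))"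
  have [measurable]: "\<phi> \<in> borel_measurable borel" using schwartz_measurable[OF p, of "[]"] by simp
  note ip = schwartz_integrable[OF p]
  obtain C where C: "C \<ge> 0" "\<And>t z. cmod (time_transform \<phi> t z) \<le> C * (1 / (1 + norm t) ^ 2) * (1 / (1 + norm z) ^ ?k)"
    by (rule schwartz_time_transform_bound[OF p, of ?k], rule that)
  have ttm: "(\<lambda>p. time_transform \<phi> (fst p) (snd p)) \<in> borel_measurable borel" by (rule time_transform_measurable) simp
  have ttm1: "time_transform \<phi> t \<in> borel_measurable borel" for t
    using measurable_compose[OF _ ttm, of "\<lambda>z. (t, z)" borel] by (simp add: borel_prod[symmetric])
  have tti: "integrable lborel (time_transform \<phi> t)" for t
  proof (rule Bochner_Integration.integrable_bound)
    show "integrable lborel (\<lambda>z::'a. C * (1 / (1 + norm t) ^ 2) * (1 / (1 + norm z) ^ ?k))"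
      by (intro integrable_mult_right integrable_inverse_poly) simp
    show "AE z in lborel. cmod (time_transform \<phi> t z) \<le> norm (C * (1 / (1 + norm t) ^ 2) * (1 / (1 + norm z) ^ ?k))"
      by (intro AE_I2 le_norm_real C)
  qed (use ttm1 in simp)
  let ?I = "integral\<^sup>L lborel (\<lambda>z::'a. 1 / (1 + norm z) ^ ?k)"
  have Fb: "cmod (fourier_integral \<phi> (t, x)) \<le> (C * ?I) * (1 / (1 + norm t) ^ 2)" for t x
  proof -
    have "cmod (fourier_integral \<phi> (t, x)) \<le> (\<integral>z. cmod (time_transform \<phi> t z) \<partial>lborel)"
      unfolding fourier_integral_time_transform[OF ip] by (rule fourier_integral_bound[OF tti])
    also have "\<dots> \<le> (\<integral>z. C * (1 / (1 + norm t) ^ 2) * (1 / (1 + norm (z::'a)) ^ ?k) \<partial>lborel)"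
    proof (rule integral_mono)
      show "integrable lborel (\<lambda>z. cmod (time_transform \<phi> t z))" by (rule integrable_norm[OF tti])
      show "integrable lborel (\<lambda>z::'a. C * (1 / (1 + norm t) ^ 2) * (1 / (1 + norm z) ^ ?k))"
        by (intro integrable_mult_right integrable_inverse_poly) simp
    qed (rule C(2))
    also have "\<dots> = C * (1 / (1 + norm t) ^ 2) * ?I" by (rule integral_mult_right_zero)
    finally show ?thesis by (simp add: mult_ac)
  qed
  have int: "integrable lborel (\<lambda>z. (u z)\<^sup>2 * fourier_integral \<phi> z)"
    by (rule square_times_integrable[OF _ Fb]) simp
  have usq: "integrable lborel (\<lambda>x. (u (t, x))\<^sup>2)" for t
    using L2_mult_integrable[OF l2fourier_L2(1)[OF slice] l2fourier_L2(1)[OF slice]] by (simp add: power2_eq_square)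
  have inner: "?c * (\<integral>x. (u (t, x))\<^sup>2 * fourier_integral \<phi> (t, x) \<partial>lborel)
     = (\<integral>z. \<integral>y. time_transform \<phi> t z * (?E t z y * pair_product v z y) \<partial>lborel \<partial>lborel)" for t
  proof -
    have "(\<integral>x. (u (t, x))\<^sup>2 * fourier_integral \<phi> (t, x) \<partial>lborel) = (\<integral>z. fourier_integral (\<lambda>x. (u (t, x))\<^sup>2) z * time_transform \<phi> t z \<partial>lborel)"
      unfolding fourier_integral_time_transform[OF ip] by (rule fourier_multiplication[OF usq tti])
    then have "?c * (\<integral>x. (u (t, x))\<^sup>2 * fourier_integral \<phi> (t, x) \<partial>lborel)
      = (\<integral>z. time_transform \<phi> t z * (?c * fourier_integral (\<lambda>x. (u (t, x))\<^sup>2) z) \<partial>lborel)"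
      by (simp only: integral_mult_right_zero[symmetric] mult_ac)
    then show ?thesis by (simp only: slice_square_fourier integral_mult_right_zero)
  qed
  define G where "G t q = time_transform \<phi> t (fst q) * (?E t (fst q) (snd q) * pair_product v (fst q) (snd q))" for t and q :: "'a \<times> 'a"
  have Gm: "(\<lambda>(t, q). G t q) \<in> borel_measurable borel"
  proof -
    have 1: "(\<lambda>x :: real \<times> ('a \<times> 'a). time_transform \<phi> (fst x) (fst (snd x))) \<in> borel_measurable borel"
      using measurable_compose[OF _ ttm, of "\<lambda>x :: real \<times> ('a \<times> 'a). (fst x, fst (snd x))" borel] by (simp add: borel_prod[symmetric])
    have 2: "(\<lambda>x :: real \<times> ('a \<times> 'a). pair_product v (fst (snd x)) (snd (snd x))) \<in> borel_measurable borel"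
      by (rule measurable_compose[OF fst_snd_borel(2) pair_product_measurable(1)[OF v_meas]])
    have 3: "(\<lambda>x :: real \<times> ('a \<times> 'a). ?E (fst x) (fst (snd x)) (snd (snd x))) \<in> borel_measurable borel"
      by (intro borel_measurable_continuous_onI continuous_intros) auto
    show ?thesis unfolding G_def case_prod_unfold by (intro borel_measurable_times 1 2 3)
  qed
  \<comment> \<open>Absolute convergence in all three variables together: \<open>t\<close> is
    handled by the test function, \<open>y\<close> by the pair product, and \<open>z\<close> by the
    \<open>?k\<close> further powers of decay.\<close>
  have Gi: "integrable (lborel \<Otimes>\<^sub>M lborel) (\<lambda>(t, q). G t q)"
  proof (rule integrable_pair_bound[OF Gm])
    show "integrable lborel (\<lambda>t::real. C * (1 / (1 + norm t) ^ 2))" by (rule integrable_inverse_quadratic)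
    show "integrable lborel (\<lambda>p. cmod (pair_product v (fst p) (snd p)) * (1 / (1 + norm (fst p)) ^ ?k))"
      by (rule integrable_pair_product_weight[OF v]) simp
    fix t :: real and q :: "'a \<times> 'a"
    have "cmod (G t q) = cmod (time_transform \<phi> t (fst q)) * cmod (pair_product v (fst q) (snd q))"
      by (simp add: G_def norm_mult norm_exp_eq_Re)
    also have "\<dots> \<le> (C * (1 / (1 + norm t) ^ 2) * (1 / (1 + norm (fst q)) ^ ?k)) * cmod (pair_product v (fst q) (snd q))"
      by (intro mult_right_mono C) simp
    finally show "norm (case (t, q) of (t, q) \<Rightarrow> G t q)
        \<le> C * (1 / (1 + norm t) ^ 2) * (cmod (pair_product v (fst q) (snd q)) * (1 / (1 + norm (fst q)) ^ ?k))"
      by (simp add: mult_ac)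
  qed
  have "(\<integral>x. (u x)\<^sup>2 * fourier_integral \<phi> x \<partial>lborel) = (\<integral>t. \<integral>x. (u (t, x))\<^sup>2 * fourier_integral \<phi> (t, x) \<partial>lborel \<partial>lborel)"
    using lborel_pair.integral_fst'[of "\<lambda>z. (u z)\<^sup>2 * fourier_integral \<phi> z"] int by (simp add: lborel_prod)
  then have "?c * (\<integral>x. (u x)\<^sup>2 * fourier_integral \<phi> x \<partial>lborel)
      = (\<integral>t. ?c * (\<integral>x. (u (t, x))\<^sup>2 * fourier_integral \<phi> (t, x) \<partial>lborel) \<partial>lborel)"
    by (simp only: integral_mult_right_zero)
  also have "\<dots> = (\<integral>t. \<integral>z. \<integral>y. time_transform \<phi> t z * (?E t z y * pair_product v z y) \<partial>lborel \<partial>lborel \<partial>lborel)"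
    by (simp only: inner)
  also have "\<dots> = (\<integral>t. \<integral>q. G t q \<partial>lborel \<partial>lborel)"
  proof (rule integral_cong_AE)
    have "AE t in lborel. integrable lborel (G t)"
      using lborel_pair.AE_integrable_fst'[OF Gi] by simp
    then show "AE t in lborel. (\<integral>z. \<integral>y. time_transform \<phi> t z * (?E t z y * pair_product v z y) \<partial>lborel \<partial>lborel) = (\<integral>q. G t q \<partial>lborel)"
    proof eventually_elim
      case (elim t)
      then have "(\<integral>z. \<integral>y. G t (z, y) \<partial>lborel \<partial>lborel) = (\<integral>q. G t q \<partial>lborel)"
        using lborel_pair.integral_fst'[of "G t"] by (simp only: lborel_prod)
      then show ?case by (simp only: G_def fst_conv snd_conv)
    qed
    show "(\<lambda>t. \<integral>q. G t q \<partial>lborel) \<in> borel_measurable lborel"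
      using lborel.borel_measurable_lebesgue_integral[of G lborel] borel_measurable_integrable[OF Gi] by simp
    show "(\<lambda>t. \<integral>z. \<integral>y. time_transform \<phi> t z * (?E t z y * pair_product v z y) \<partial>lborel \<partial>lborel) \<in> borel_measurable lborel"
      unfolding inner[symmetric]
      using borel_measurable_integrable[OF lborel_pair.integrable_fst'[of "\<lambda>z. (u z)\<^sup>2 * fourier_integral \<phi> z"]] int
      by (simp add: lborel_prod)
  qed
  also have "\<dots> = (\<integral>q. \<integral>t. G t q \<partial>lborel \<partial>lborel)"
    by (rule lborel_pair.Fubini_integral[OF Gi, symmetric])
  also have "\<dots> = (\<integral>q. of_real (2 * pi) * (pair_product v (fst q) (snd q) * \<phi> (- ((norm (fst q))\<^sup>2 / 2 + 2 * (norm (snd q))\<^sup>2), fst q)) \<partial>lborel)"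
  proof (intro Bochner_Integration.integral_cong refl)
    fix q :: "'a \<times> 'a"
    let ?s = "- ((norm (fst q))\<^sup>2 / 2 + 2 * (norm (snd q))\<^sup>2)"
    have "(\<integral>t. G t q \<partial>lborel) = (\<integral>t. pair_product v (fst q) (snd q) * (time_transform \<phi> t (fst q) * exp (\<i> * of_real (?s * t))) \<partial>lborel)"
    proof (intro Bochner_Integration.integral_cong refl)
      fix t
      have "?E t (fst q) (snd q) = exp (\<i> * of_real (?s * t))"
        by (rule arg_cong[where f=exp]) (simp add: algebra_simps)
      then show "G t q = pair_product v (fst q) (snd q) * (time_transform \<phi> t (fst q) * exp (\<i> * of_real (?s * t)))"
        by (simp only: G_def mult_ac)
    qed
    also have "\<dots> = pair_product v (fst q) (snd q) * (of_real (2 * pi) * \<phi> (?s, fst q))"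
      by (simp only: integral_mult_right_zero time_transform_inversion[OF p])
    finally show "(\<integral>t. G t q \<partial>lborel) = of_real (2 * pi) * (pair_product v (fst q) (snd q) * \<phi> (?s, fst q))"
      by (simp only: mult_ac)
  qed
  also have "\<dots> = of_real (2 * pi) * (\<integral>q. pair_product v (fst q) (snd q) * \<phi> (- ((norm (fst q))\<^sup>2 / 2 + 2 * (norm (snd q))\<^sup>2), fst q) \<partial>lborel)"
    by (rule integral_mult_right_zero)
  finally show ?thesis .
qed

end

section \<open>Disintegration into spheres\<close>

text \<open>Normalised surface measure, as the radial projection of the uniform measure on the ball.
  The convention \<open>sgn 0 = 0\<close> concerns only a null set.\<close>

definition unit_sphere_prob :: "'a::euclidean_space measure" where
  "unit_sphere_prob = distr (uniform_measure lborel (cball 0 1)) borel sgn"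

lemma sgn_measurable[measurable]: "(sgn :: 'a::euclidean_space \<Rightarrow> 'a) \<in> borel_measurable borel"
  unfolding sgn_div_norm[abs_def] by measurable

lemma emeasure_unit_ball: "emeasure lborel (cball (0::'a::euclidean_space) 1) = ennreal (unit_ball_vol (real DIM('a)))"
  by (simp add: emeasure_cball)

lemma unit_ball_vol_nonzero: "ennreal (unit_ball_vol (real n)) \<noteq> 0"
  using unit_ball_vol_pos[of "real n"] by (simp del: unit_ball_vol_pos)

lemma prob_space_unit_sphere_prob: "prob_space (unit_sphere_prob :: 'a::euclidean_space measure)"
proof -
  have "prob_space (uniform_measure lborel (cball (0::'a) 1))"
    by (rule prob_space_uniform_measure) (simp_all only: emeasure_unit_ball unit_ball_vol_nonzero, simp_all)
  then show ?thesis unfolding unit_sphere_prob_def by (rule prob_space.prob_space_distr) simp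
qed

interpretation unit_sphere_prob: prob_space unit_sphere_prob
  by (rule prob_space_unit_sphere_prob)

lemma sets_unit_sphere_prob[measurable_cong, simp]: "sets unit_sphere_prob = sets borel"
  and space_unit_sphere_prob[simp]: "space unit_sphere_prob = UNIV"
  by (simp_all add: unit_sphere_prob_def)

lemma AE_norm_unit_sphere_prob: "AE x in (unit_sphere_prob :: 'a::euclidean_space measure). norm x = 1"
  unfolding unit_sphere_prob_def
proof (subst AE_distr_iff)
  have "AE x::'a in lborel. x \<noteq> 0" using AE_lborel_singleton[of "0::'a"] by simp
  then show "AE x::'a in uniform_measure lborel (cball 0 1). norm (sgn x) = 1"
    by (intro AE_uniform_measureI) (auto simp: norm_sgn)
qed simp_all

lemma emeasure_unit_sphere_prob:
  assumes [measurable]: "B \<in> sets (borel :: 'a::euclidean_space measure)"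
  shows "emeasure lborel {y::'a. norm y \<le> 1 \<and> sgn y \<in> B}
    = ennreal (unit_ball_vol (real DIM('a))) * emeasure unit_sphere_prob B"
proof -
  have "{y::'a. norm y \<le> 1 \<and> sgn y \<in> B} = cball 0 1 \<inter> sgn -` B" by auto
  moreover have "emeasure unit_sphere_prob B = emeasure lborel (cball 0 1 \<inter> sgn -` B) / ennreal (unit_ball_vol (real DIM('a)))"
    unfolding unit_sphere_prob_def
    by (subst emeasure_distr) (simp_all add: emeasure_uniform_measure emeasure_unit_ball measurable_sets_borel[OF sgn_measurable])
  ultimately show ?thesis
    using unit_ball_vol_nonzero[of "DIM('a)"]
    by (simp add: ennreal_times_divide mult.commute[of "ennreal _"] ennreal_mult_divide_eq)
qed

text \<open>The derivative in s of the volume of the ball 2|y|^2 <= s, which is the volume of the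
  unit ball times (s/2)^(d/2). In other words, the density of the image of Lebesgue measure under y
  -> 2|y|^2.\<close>

definition shell_density :: "nat \<Rightarrow> real \<Rightarrow> real" where
  "shell_density d s = (if s > 0 then unit_ball_vol (real d) * (real d / 4) * (s / 2) powr (real d / 2 - 1) else 0)"

lemma shell_density_measurable[measurable]: "shell_density d \<in> borel_measurable borel"
  unfolding shell_density_def[abs_def] by measurable

lemma shell_density_nonneg: "shell_density d s \<ge> 0"
  by (simp add: shell_density_def)

lemma nn_integral_shell_density:
  assumes d: "d > 0" and a: "a \<ge> 0"
  shows "(\<integral>\<^sup>+s. ennreal (shell_density d s) * indicator {..a} s \<partial>lborel) = ennreal (unit_ball_vol (real d) * sqrt (a / 2) ^ d)"
proof -
  let ?c = "unit_ball_vol (real d) * (real d / 4) * (1 / 2) powr (real d / 2 - 1)"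
  have "((\<lambda>x. x powr (real d / 2 - 1)) has_integral (a powr (real d / 2 - 1 + 1) / (real d / 2 - 1 + 1))) {0..a}"
    using d a by (intro has_integral_powr_from_0) auto
  from has_integral_mult_right[OF this, of ?c]
  have I: "((\<lambda>x. ?c * x powr (real d / 2 - 1)) has_integral (?c * (a powr (real d / 2) / (real d / 2)))) {0..a}"
    by simp
  have "(\<integral>\<^sup>+s. ennreal (shell_density d s) * indicator {..a} s \<partial>lborel)
      = (\<integral>\<^sup>+s. ennreal (indicator {0..a} s * (?c * s powr (real d / 2 - 1))) \<partial>lborel)"
  proof (intro nn_integral_cong)
    fix s :: real
    show "ennreal (shell_density d s) * indicator {..a} s = ennreal (indicator {0..a} s * (?c * s powr (real d / 2 - 1)))"
    proof (cases "s > 0")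
      case True
      then have "(s / 2) powr (real d / 2 - 1) = (1 / 2) powr (real d / 2 - 1) * s powr (real d / 2 - 1)"
        using powr_mult[of "1/2" s "real d / 2 - 1"] by simp
      then show ?thesis using True by (auto simp: shell_density_def indicator_def mult_ac)
    next
      case False
      then show ?thesis by (cases "s = 0") (auto simp: shell_density_def indicator_def)
    qed
  qed
  also have "\<dots> = ennreal (?c * (a powr (real d / 2) / (real d / 2)))"
    using nn_integral_has_integral_lebesgue[OF _ I] by simp
  also have "?c * (a powr (real d / 2) / (real d / 2)) = unit_ball_vol (real d) * sqrt (a / 2) ^ d"
  proof (cases "a = 0")
    case False
    then have a: "a > 0" using a by simp
    have "sqrt (a / 2) ^ d = (a / 2) powr (real d / 2)"
      using a by (simp add: powr_half_sqrt[symmetric] powr_powr powr_realpow[symmetric])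
    also have "\<dots> = (1 / 2) powr (real d / 2) * a powr (real d / 2)"
      using a powr_mult[of "1/2" a "real d / 2"] by simp
    also have "(1 / 2) powr (real d / 2) = (1 / 2) powr (real d / 2 - 1) * (1 / 2 :: real)"
      by (subst powr_diff) simp
    finally show ?thesis using d by (simp add: field_simps)
  qed (use d in simp)
  finally show ?thesis .
qed

abbreviation shell_measure :: "'a::euclidean_space itself \<Rightarrow> real measure" where
  "shell_measure _ \<equiv> density lborel (\<lambda>s. ennreal (shell_density DIM('a) s))"

lemma sigma_finite_shell_measure: "sigma_finite_measure (shell_measure TYPE('a::euclidean_space))"
  by (rule sigma_finite_measure.sigma_finite_iff_density_finite[OF sigma_finite_lborel, THEN iffD2]) auto

text \<open>For positive \<open>a\<close> the part of the cone over \<open>B\<close> in a ball of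
  radius r is r^d times its part in the unit ball, and the latter measures \<open>B\<close> in
  \<open>unit_sphere_prob\<close>; the integral of \<open>shell_density\<close> carries the same
  power of r.\<close>

lemma shell_half_line:
  fixes B :: "'a::euclidean_space set"
  assumes [measurable]: "B \<in> sets borel"
  shows "emeasure (shell_measure TYPE('a)) {..a} * emeasure unit_sphere_prob B
    = emeasure lborel {y::'a. 2 * (norm y)\<^sup>2 \<le> a \<and> sgn y \<in> B}"
proof -
  let ?V = "unit_ball_vol (real DIM('a))"
  have S: "emeasure (shell_measure TYPE('a)) {..a} = (\<integral>\<^sup>+s. ennreal (shell_density DIM('a) s) * indicator {..a} s \<partial>lborel)"
    by (simp add: emeasure_density)
  consider "a < 0" | "a = 0" | "a > 0" by linarith
  then show ?thesis
  proof cases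
    case 1
    then have "(\<integral>\<^sup>+s. ennreal (shell_density DIM('a) s) * indicator {..a} s \<partial>lborel) = (\<integral>\<^sup>+s. 0 \<partial>(lborel :: real measure))"
      by (intro nn_integral_cong) (auto simp: shell_density_def indicator_def)
    then have z: "(\<integral>\<^sup>+s. ennreal (shell_density DIM('a) s) * indicator {..a} s \<partial>lborel) = 0" by simp
    have e: "{y::'a. 2 * (norm y)\<^sup>2 \<le> a \<and> sgn y \<in> B} = {}"
      using 1 by (auto simp: not_le intro: less_le_trans)
    show ?thesis unfolding S z e by simp
  next
    case 2
    have "{y::'a. 2 * (norm y)\<^sup>2 \<le> a \<and> sgn y \<in> B} \<subseteq> {0}" using 2 by (auto simp: power2_eq_square mult_le_0_iff)
    then have "emeasure lborel {y::'a. 2 * (norm y)\<^sup>2 \<le> a \<and> sgn y \<in> B} \<le> emeasure lborel {0::'a}"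
      by (rule emeasure_mono) simp
    then have "emeasure lborel {y::'a. 2 * (norm y)\<^sup>2 \<le> a \<and> sgn y \<in> B} = 0" by simp
    then show ?thesis unfolding S using nn_integral_shell_density[of "DIM('a)" a] 2 by simp
  next
    case 3
    define r where "r = sqrt (a / 2)"
    have r: "r > 0" using 3 by (simp add: r_def)
    have iff: "2 * (norm y)\<^sup>2 \<le> a \<longleftrightarrow> norm y \<le> r" for y :: 'a
    proof -
      have "a = 2 * r\<^sup>2" using 3 by (simp add: r_def)
      then show ?thesis using r by (simp add: abs_le_square_iff[symmetric])
    qed
    have m: "{y::'a. 2 * (norm y)\<^sup>2 \<le> a \<and> sgn y \<in> B} \<in> sets borel" by measurable
    have "emeasure lborel {y::'a. 2 * (norm y)\<^sup>2 \<le> a \<and> sgn y \<in> B}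
        = (\<integral>\<^sup>+y. indicator {y::'a. 2 * (norm y)\<^sup>2 \<le> a \<and> sgn y \<in> B} y \<partial>lborel)"
      using m by simp
    also have "\<dots> = ennreal (r ^ DIM('a)) * (\<integral>\<^sup>+y. indicator {y::'a. 2 * (norm y)\<^sup>2 \<le> a \<and> sgn y \<in> B} (r *\<^sub>R y) \<partial>lborel)"
      using m by (intro nn_integral_scale r) simp
    also have "(\<lambda>y. indicator {y::'a. 2 * (norm y)\<^sup>2 \<le> a \<and> sgn y \<in> B} (r *\<^sub>R y) :: ennreal) = indicator {y. norm y \<le> 1 \<and> sgn y \<in> B}"
      using r by (intro ext) (simp add: indicator_def iff sgn_scaleR)
    also have "(\<integral>\<^sup>+y. indicator {y::'a. norm y \<le> 1 \<and> sgn y \<in> B} y \<partial>lborel) = ennreal ?V * emeasure unit_sphere_prob B"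
      unfolding emeasure_unit_sphere_prob[OF assms, symmetric] by (rule nn_integral_indicator) measurable
    finally have "emeasure lborel {y::'a. 2 * (norm y)\<^sup>2 \<le> a \<and> sgn y \<in> B} = ennreal (r ^ DIM('a)) * (ennreal ?V * emeasure unit_sphere_prob B)" .
    moreover have "emeasure (shell_measure TYPE('a)) {..a} = ennreal ?V * ennreal (r ^ DIM('a))"
      unfolding S using nn_integral_shell_density[of "DIM('a)" a] 3 r by (simp add: r_def ennreal_mult[symmetric])
    ultimately show ?thesis by (simp add: mult_ac)
  qed
qed

text \<open>For fixed \<open>B\<close> both sides are measures in \<open>A\<close>. They agree on
  the half lines, which generate the Borel sets, are stable under intersection and have finite
  measure.\<close>

lemma shell_product:
  fixes B :: "'a::euclidean_space set"
  assumes B[measurable]: "B \<in> sets borel" and A: "A \<in> sets borel"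
  shows "emeasure (shell_measure TYPE('a)) A * emeasure unit_sphere_prob B
    = emeasure lborel {y::'a. 2 * (norm y)\<^sup>2 \<in> A \<and> sgn y \<in> B}"
proof -
  let ?c = "emeasure unit_sphere_prob B"
  define M1 where "M1 = density (shell_measure TYPE('a)) (\<lambda>_. ?c)"
  define M2 where "M2 = distr (density lborel (indicator {y::'a. sgn y \<in> B})) borel (\<lambda>y. 2 * (norm y)\<^sup>2)"
  have Bm[measurable]: "{y::'a. sgn y \<in> B} \<in> sets borel" by measurable
  have e1: "emeasure M1 A = emeasure (shell_measure TYPE('a)) A * ?c" if "A \<in> sets borel" for A
    unfolding M1_def using that by (subst emeasure_density_const) (simp_all add: mult.commute)
  have e2: "emeasure M2 A = emeasure lborel {y::'a. 2 * (norm y)\<^sup>2 \<in> A \<and> sgn y \<in> B}" if [measurable]: "A \<in> sets borel" for A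
  proof -
    have Am: "{y::'a. 2 * (norm y)\<^sup>2 \<in> A} \<in> sets borel" by measurable
    have "emeasure M2 A = emeasure (density lborel (indicator {y::'a. sgn y \<in> B})) {y. 2 * (norm y)\<^sup>2 \<in> A}"
      unfolding M2_def by (subst emeasure_distr) (simp_all add: vimage_def)
    also have "\<dots> = (\<integral>\<^sup>+y. indicator {y::'a. sgn y \<in> B} y * indicator {y. 2 * (norm y)\<^sup>2 \<in> A} y \<partial>lborel)"
      using Am by (subst emeasure_density) simp_all
    also have "\<dots> = (\<integral>\<^sup>+y. indicator {y::'a. 2 * (norm y)\<^sup>2 \<in> A \<and> sgn y \<in> B} y \<partial>lborel)"
      by (intro nn_integral_cong) (auto simp: indicator_def)
    also have "\<dots> = emeasure lborel {y::'a. 2 * (norm y)\<^sup>2 \<in> A \<and> sgn y \<in> B}"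
      by (rule nn_integral_indicator) measurable
    finally show ?thesis .
  qed
  have "M1 = M2"
  proof (rule measure_eqI_generator_eq[where E="range (\<lambda>a::real. {..a})" and \<Omega>=UNIV and A="\<lambda>i. {..real i}"])
    show "Int_stable (range (\<lambda>a::real. {..a}))" by (auto simp: Int_stable_def)
    show "emeasure M1 X = emeasure M2 X" if XE: "X \<in> range (\<lambda>a::real. {..a})" for X
    proof -
      obtain a where X: "X = {..a}" using XE by blast
      show ?thesis unfolding X using shell_half_line[OF B, of a] by (simp add: e1 e2)
    qed
    show "sets M1 = sigma_sets UNIV (range (\<lambda>a::real. {..a}))" "sets M2 = sigma_sets UNIV (range (\<lambda>a::real. {..a}))"
      by (simp_all add: M1_def M2_def borel_eq_atMost sets_measure_of)
    show "emeasure M1 {..real i} \<noteq> \<infinity>" for i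
    proof -
      have "emeasure M1 {..real i} = ennreal (unit_ball_vol (real DIM('a)) * sqrt (real i / 2) ^ DIM('a)) * ?c"
        using nn_integral_shell_density[of "DIM('a)" "real i"] by (simp add: e1 emeasure_density)
      also have "\<dots> < top"
      proof -
        have "?c < top" by (simp add: less_top[symmetric] unit_sphere_prob.emeasure_finite)
        then show ?thesis by (simp add: ennreal_mult_less_top)
      qed
      finally show ?thesis by simp
    qed
    show "(\<Union>i. {..real i}) = UNIV" by (auto intro: real_arch_simple)
  qed auto
  then show ?thesis using e1[OF A] e2[OF A] by simp
qed

text \<open>Polar coordinates in the variables 2|y|^2 and \<open>sgn y\<close>. By
  \<open>shell_product\<close> the product measure is the image of Lebesgue measure, and the map
  back inverts the coordinates at every point, 0 included.\<close>

lemma lborel_eq_shells: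
  "(lborel :: 'a::euclidean_space measure)
    = distr (shell_measure TYPE('a) \<Otimes>\<^sub>M unit_sphere_prob) borel (\<lambda>p. sqrt (fst p / 2) *\<^sub>R snd p)"
proof -
  let ?h = "\<lambda>y::'a. (2 * (norm y)\<^sup>2, sgn y)"
  have hm[measurable]: "?h \<in> borel \<rightarrow>\<^sub>M borel \<Otimes>\<^sub>M borel" by measurable
  have eq: "shell_measure TYPE('a) \<Otimes>\<^sub>M unit_sphere_prob = distr lborel (borel \<Otimes>\<^sub>M borel) ?h"
  proof (rule pair_measure_eqI)
    show "sigma_finite_measure (shell_measure TYPE('a))" by (rule sigma_finite_shell_measure)
    show "sigma_finite_measure (unit_sphere_prob :: 'a measure)" by unfold_locales
    show "sets (shell_measure TYPE('a) \<Otimes>\<^sub>M unit_sphere_prob) = sets (distr lborel (borel \<Otimes>\<^sub>M borel) ?h)"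
      by (simp cong: sets_pair_measure_cong)
    fix A B assume "A \<in> sets (shell_measure TYPE('a))" "B \<in> sets (unit_sphere_prob :: 'a measure)"
    then have [measurable]: "A \<in> sets borel" "B \<in> sets borel" by simp_all
    have "emeasure (distr lborel (borel \<Otimes>\<^sub>M borel) ?h) (A \<times> B) = emeasure lborel (?h -` (A \<times> B))"
      by (subst emeasure_distr) simp_all
    also have "?h -` (A \<times> B) = {y. 2 * (norm y)\<^sup>2 \<in> A \<and> sgn y \<in> B}" by auto
    finally show "emeasure (shell_measure TYPE('a)) A * emeasure unit_sphere_prob B = emeasure (distr lborel (borel \<Otimes>\<^sub>M borel) ?h) (A \<times> B)"
      by (simp add: shell_product)
  qed
  have "distr (shell_measure TYPE('a) \<Otimes>\<^sub>M unit_sphere_prob) borel (\<lambda>p. sqrt (fst p / 2) *\<^sub>R snd p)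
     = distr lborel borel ((\<lambda>p. sqrt (fst p / 2) *\<^sub>R snd p) \<circ> ?h)"
    unfolding eq by (rule distr_distr) measurable
  also have "(\<lambda>p. sqrt (fst p / 2) *\<^sub>R snd p) \<circ> ?h = (\<lambda>y. y)"
  proof (rule ext)
    fix y :: 'a
    show "((\<lambda>p. sqrt (fst p / 2) *\<^sub>R snd p) \<circ> ?h) y = y"
      by (cases "y = 0") (simp_all add: sgn_div_norm)
  qed
  also have "distr lborel borel (\<lambda>y::'a. y) = lborel"
    by (rule distr_id2) simp
  finally show ?thesis by simp
qed

lemma nn_integral_shells:
  fixes F :: "'a::euclidean_space \<Rightarrow> ennreal"
  assumes [measurable]: "F \<in> borel_measurable borel"
  shows "(\<integral>\<^sup>+y. F y \<partial>lborel) = (\<integral>\<^sup>+s. ennreal (shell_density DIM('a) s) * (\<integral>\<^sup>+x. F (sqrt (s / 2) *\<^sub>R x) \<partial>unit_sphere_prob) \<partial>lborel)"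
proof -
  have "(\<integral>\<^sup>+y. F y \<partial>lborel) = (\<integral>\<^sup>+p. F (sqrt (fst p / 2) *\<^sub>R snd p) \<partial>(shell_measure TYPE('a) \<Otimes>\<^sub>M unit_sphere_prob))"
    by (subst lborel_eq_shells, subst nn_integral_distr) simp_all
  also have "\<dots> = (\<integral>\<^sup>+s. (\<integral>\<^sup>+x. F (sqrt (s / 2) *\<^sub>R x) \<partial>unit_sphere_prob) \<partial>shell_measure TYPE('a))"
    by (subst unit_sphere_prob.nn_integral_fst[symmetric]) simp_all
  also have "\<dots> = (\<integral>\<^sup>+s. ennreal (shell_density DIM('a) s) * (\<integral>\<^sup>+x. F (sqrt (s / 2) *\<^sub>R x) \<partial>unit_sphere_prob) \<partial>lborel)"
    by (rule nn_integral_density) measurable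
  finally show ?thesis .
qed

lemma integral_shells:
  fixes F :: "'a::euclidean_space \<Rightarrow> complex"
  assumes F: "integrable lborel F"
  shows "(\<integral>y. F y \<partial>lborel) = (\<integral>s. shell_density DIM('a) s *\<^sub>R (\<integral>x. F (sqrt (s / 2) *\<^sub>R x) \<partial>unit_sphere_prob) \<partial>lborel)"
proof -
  have [measurable]: "F \<in> borel_measurable borel" using borel_measurable_integrable[OF F] by simp
  interpret S: sigma_finite_measure "shell_measure TYPE('a)" by (rule sigma_finite_shell_measure)
  interpret P: pair_sigma_finite "shell_measure TYPE('a)" "unit_sphere_prob :: 'a measure" ..
  have i: "integrable (shell_measure TYPE('a) \<Otimes>\<^sub>M unit_sphere_prob) (\<lambda>p. F (sqrt (fst p / 2) *\<^sub>R snd p))"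
    using F by (subst (asm) lborel_eq_shells, subst (asm) integrable_distr_eq) simp_all
  have "(\<integral>y. F y \<partial>lborel) = (\<integral>p. F (sqrt (fst p / 2) *\<^sub>R snd p) \<partial>(shell_measure TYPE('a) \<Otimes>\<^sub>M unit_sphere_prob))"
    by (subst lborel_eq_shells, subst integral_distr) simp_all
  also have "\<dots> = (\<integral>s. (\<integral>x. F (sqrt (s / 2) *\<^sub>R x) \<partial>unit_sphere_prob) \<partial>shell_measure TYPE('a))"
    using P.integral_fst'[OF i] by simp
  also have "\<dots> = (\<integral>s. shell_density DIM('a) s *\<^sub>R (\<integral>x. F (sqrt (s / 2) *\<^sub>R x) \<partial>unit_sphere_prob) \<partial>lborel)"
    by (rule integral_density) (simp_all add: shell_density_nonneg)
  finally show ?thesis .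
qed

text \<open>A linear substitution of determinant 1 in modulus, carried out by translating one
  variable at a time and exchanging the order of integration.\<close>

lemma nn_integral_midpoint:
  fixes F :: "'a::euclidean_space \<Rightarrow> 'a \<Rightarrow> ennreal"
  assumes F: "(\<lambda>(x, y). F x y) \<in> borel_measurable (borel \<Otimes>\<^sub>M borel)"
  shows "(\<integral>\<^sup>+z. \<integral>\<^sup>+y. F (z /\<^sub>R 2 + y) (z /\<^sub>R 2 - y) \<partial>lborel \<partial>lborel) = (\<integral>\<^sup>+x. \<integral>\<^sup>+y. F x y \<partial>lborel \<partial>lborel)"
proof -
  note [measurable] = F
  have half: "z - (z /\<^sub>R 2 + y) = z /\<^sub>R 2 - y" for z y :: 'a
    by (simp add: algebra_simps flip: scaleR_left_distrib)
  have "(\<integral>\<^sup>+z. \<integral>\<^sup>+y. F (z /\<^sub>R 2 + y) (z /\<^sub>R 2 - y) \<partial>lborel \<partial>lborel) = (\<integral>\<^sup>+z. \<integral>\<^sup>+x. F x (z - x) \<partial>lborel \<partial>lborel)"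
  proof (rule nn_integral_cong)
    fix z :: 'a
    show "(\<integral>\<^sup>+y. F (z /\<^sub>R 2 + y) (z /\<^sub>R 2 - y) \<partial>lborel) = (\<integral>\<^sup>+x. F x (z - x) \<partial>lborel)"
    proof -
      have "(\<integral>\<^sup>+y. F (z /\<^sub>R 2 + y) (z - (z /\<^sub>R 2 + y)) \<partial>lborel) = (\<integral>\<^sup>+x. F x (z - x) \<partial>lborel)"
        by (rule nn_integral_translation[of "\<lambda>x. F x (z - x)" "z /\<^sub>R 2"]) measurable
      then show ?thesis by (simp only: half)
    qed
  qed
  also have "\<dots> = (\<integral>\<^sup>+x. \<integral>\<^sup>+z. F x (z - x) \<partial>lborel \<partial>lborel)"
    by (rule lborel_pair.Fubini') measurable
  also have "\<dots> = (\<integral>\<^sup>+x. \<integral>\<^sup>+y. F x y \<partial>lborel \<partial>lborel)"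
  proof (rule nn_integral_cong)
    fix x :: 'a
    show "(\<integral>\<^sup>+z. F x (z - x) \<partial>lborel) = (\<integral>\<^sup>+y. F x y \<partial>lborel)"
      using nn_integral_translation[of "\<lambda>y. F x y" "- x"] by simp
  qed
  finally show ?thesis .
qed

text \<open>The variance identity also holds when the second moment is infinite.\<close>

lemma (in prob_space) nn_integral_norm_sq_variance:
  fixes f :: "'a \<Rightarrow> complex"
  assumes [measurable]: "f \<in> borel_measurable M"
  shows "(\<integral>\<^sup>+x. ennreal ((cmod (f x))\<^sup>2) \<partial>M)
    = ennreal ((cmod (integral\<^sup>L M f))\<^sup>2) + (\<integral>\<^sup>+x. ennreal ((cmod (f x - integral\<^sup>L M f))\<^sup>2) \<partial>M)"
proof -
  let ?m = "integral\<^sup>L M f"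
  have fin: "integrable M (\<lambda>x. (cmod (f x))\<^sup>2)" if "(\<integral>\<^sup>+x. ennreal ((cmod (f x))\<^sup>2) \<partial>M) < \<infinity>"
    using that by (intro integrableI_nonneg) auto
  show ?thesis
  proof (cases "(\<integral>\<^sup>+x. ennreal ((cmod (f x))\<^sup>2) \<partial>M) < \<infinity>")
    case True
    note i2 = fin[OF True]
    have i: "integrable M f"
    proof (rule Bochner_Integration.integrable_bound)
      show "integrable M (\<lambda>x. 1 + (cmod (f x))\<^sup>2)" using i2 by simp
      have "cmod (f x) \<le> 1 + (cmod (f x))\<^sup>2" for x
        using sum_squares_bound[of 1 "cmod (f x)"] norm_ge_zero[of "f x"] by (simp del: norm_ge_zero)
      then show "AE x in M. norm (f x) \<le> norm (1 + (cmod (f x))\<^sup>2)" by (intro AE_I2 le_norm_real)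
    qed simp
    define R where "R x = Re (f x * cnj ?m)" for x
    have eq: "(cmod (f x - ?m))\<^sup>2 = (cmod (f x))\<^sup>2 - 2 * R x + (cmod ?m)\<^sup>2" for x
      unfolding R_def by (simp add: cmod_power2) (simp add: power2_eq_square algebra_simps)
    have ir: "integrable M R" unfolding R_def using i by (intro integrable_Re integrable_mult_left) simp
    have iv: "integrable M (\<lambda>x. (cmod (f x - ?m))\<^sup>2)" unfolding eq using i2 ir by simp
    have "(\<integral>x. R x \<partial>M) = Re (\<integral>x. f x * cnj ?m \<partial>M)"
      unfolding R_def using i by (intro integral_Re integrable_mult_left) simp
    also have "\<dots> = Re (?m * cnj ?m)" by (simp only: integral_mult_left_zero)
    also have "\<dots> = (cmod ?m)\<^sup>2" by (metis Re_complex_of_real complex_norm_square)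
    finally have "(\<integral>x. (cmod (f x - ?m))\<^sup>2 \<partial>M) = (\<integral>x. (cmod (f x))\<^sup>2 \<partial>M) - (cmod ?m)\<^sup>2"
      unfolding eq using i2 ir by (simp add: prob_space)
    then have s: "(\<integral>x. (cmod (f x))\<^sup>2 \<partial>M) = (cmod ?m)\<^sup>2 + (\<integral>x. (cmod (f x - ?m))\<^sup>2 \<partial>M)" by simp
    have "(\<integral>\<^sup>+x. ennreal ((cmod (f x))\<^sup>2) \<partial>M) = ennreal (\<integral>x. (cmod (f x))\<^sup>2 \<partial>M)"
      by (rule nn_integral_eq_integral[OF i2]) simp
    also have "\<dots> = ennreal ((cmod ?m)\<^sup>2) + ennreal (\<integral>x. (cmod (f x - ?m))\<^sup>2 \<partial>M)"
      unfolding s by (rule ennreal_plus) simp_all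
    also have "ennreal (\<integral>x. (cmod (f x - ?m))\<^sup>2 \<partial>M) = (\<integral>\<^sup>+x. ennreal ((cmod (f x - ?m))\<^sup>2) \<partial>M)"
      by (rule nn_integral_eq_integral[OF iv, symmetric]) simp
    finally show ?thesis .
  next
    \<comment> \<open>If the centred function had a finite second moment, adding the constant back
      would give \<open>f\<close> one as well, the measure being a probability. This includes a
      non-integrable \<open>f\<close>, whose mean is 0 by convention.\<close>
    case False
    have "(\<integral>\<^sup>+x. ennreal ((cmod (f x - ?m))\<^sup>2) \<partial>M) = \<infinity>"
    proof (rule ccontr)
      assume "(\<integral>\<^sup>+x. ennreal ((cmod (f x - ?m))\<^sup>2) \<partial>M) \<noteq> \<infinity>"
      then have "integrable M (\<lambda>x. (cmod (f x - ?m))\<^sup>2)"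
        by (intro integrableI_nonneg) (auto simp: less_top)
      then have j: "integrable M (\<lambda>x. 2 * (cmod (f x - ?m))\<^sup>2 + 2 * (cmod ?m)\<^sup>2)" by simp
      have "integrable M (\<lambda>x. (cmod (f x))\<^sup>2)"
      proof (rule Bochner_Integration.integrable_bound[OF j])
        show "AE x in M. norm ((cmod (f x))\<^sup>2) \<le> norm (2 * (cmod (f x - ?m))\<^sup>2 + 2 * (cmod ?m)\<^sup>2)"
          using norm_add_sq_le[of "f x - ?m" ?m for x] by (intro AE_I2 le_norm_real) simp
      qed simp
      then show False using False by (simp add: nn_integral_eq_integral)
    qed
    then show ?thesis using False by (simp add: less_top[symmetric])
  qed
qed

section \<open>The space-time Fourier transform of the square\<close>

lemma pair_product_measurable_compose[measurable (raw)]: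
  assumes "v \<in> borel_measurable borel" "f \<in> borel_measurable M" "g \<in> borel_measurable M"
  shows "(\<lambda>x. pair_product v (f x) (g x)) \<in> borel_measurable M"
  using assms unfolding pair_product_def by measurable

text \<open>Where the pair product is not integrable over the sphere the value is 0 by convention;
  \<open>nn_integral_norm_sq_variance\<close> is valid there too.\<close>

definition shell_mean :: "('a::euclidean_space \<Rightarrow> complex) \<Rightarrow> 'a \<Rightarrow> real \<Rightarrow> complex" where
  "shell_mean v z s = (\<integral>x. pair_product v z (sqrt (s / 2) *\<^sub>R x) \<partial>unit_sphere_prob)"

lemma shell_mean_measurable:
  fixes v :: "'a::euclidean_space \<Rightarrow> complex"
  assumes [measurable]: "v \<in> borel_measurable borel"
  shows "(\<lambda>p. shell_mean v (fst p) (snd p)) \<in> borel_measurable (borel \<Otimes>\<^sub>M borel)"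
  unfolding shell_mean_def by measurable

lemma shell_mean_measurable_compose[measurable (raw)]:
  fixes v :: "'a::euclidean_space \<Rightarrow> complex"
  assumes v: "v \<in> borel_measurable borel" and f: "f \<in> borel_measurable M" and g: "g \<in> borel_measurable M"
  shows "(\<lambda>x. shell_mean v (f x) (g x)) \<in> borel_measurable M"
  using measurable_compose[OF measurable_Pair[OF f g] shell_mean_measurable[OF v]] by simp

text \<open>The numerator comes from inversion in time, the denominator from the convolution formula
  in space.\<close>

definition square_transform_const :: "nat \<Rightarrow> real" where
  "square_transform_const d = 2 * pi / (2 * pi) ^ d"

lemma square_transform_const_pos: "square_transform_const d > 0"
  by (simp add: square_transform_const_def)

definition square_transform :: "('a::euclidean_space \<Rightarrow> complex) \<Rightarrow> real \<times> 'a \<Rightarrow> complex" where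
  "square_transform v p = of_real (square_transform_const DIM('a) * shell_density DIM('a) (- ((norm (snd p))\<^sup>2 / 2) - fst p))
     * shell_mean v (snd p) (- ((norm (snd p))\<^sup>2 / 2) - fst p)"

lemma square_transform_shift:
  "square_transform v (- ((norm z)\<^sup>2 / 2) - s, z)
    = of_real (square_transform_const DIM('a) * shell_density DIM('a) s) * shell_mean v (z::'a::euclidean_space) s"
  by (simp add: square_transform_def)

lemma square_transform_measurable:
  fixes v :: "'a::euclidean_space \<Rightarrow> complex"
  assumes [measurable]: "v \<in> borel_measurable borel"
  shows "square_transform v \<in> borel_measurable borel"
proof -
  have "square_transform v \<in> borel_measurable (borel \<Otimes>\<^sub>M borel)"
    unfolding square_transform_def[abs_def] by measurable
  then show ?thesis by (simp add: borel_prod)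
qed

lemma nn_integral_paraboloid:
  fixes F :: "real \<times> 'a::euclidean_space \<Rightarrow> ennreal"
  assumes F: "F \<in> borel_measurable borel"
  shows "(\<integral>\<^sup>+p. F p \<partial>lborel) = (\<integral>\<^sup>+z. \<integral>\<^sup>+s. F (- ((norm z)\<^sup>2 / 2) - s, z) \<partial>lborel \<partial>lborel)"
proof -
  have F2: "F \<in> borel_measurable (lborel \<Otimes>\<^sub>M lborel)" using F by (simp add: lborel_prod)
  have F3: "(\<lambda>t. F (t, z)) \<in> borel_measurable borel" for z
    using measurable_compose[OF _ F, of "\<lambda>t. (t, z)" borel] by (simp add: borel_prod[symmetric])
  have "(\<integral>\<^sup>+p. F p \<partial>lborel) = (\<integral>\<^sup>+z. \<integral>\<^sup>+t. F (t, z) \<partial>lborel \<partial>lborel)"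
    using lborel_pair.nn_integral_snd[of F] F2 by (simp add: lborel_prod)
  then show ?thesis by (simp only: nn_integral_reflection[OF F3])
qed

lemma norm_shell_mean_le:
  "ennreal (cmod (shell_mean v z s)) \<le> (\<integral>\<^sup>+x. ennreal (cmod (pair_product v z (sqrt (s / 2) *\<^sub>R x))) \<partial>unit_sphere_prob)"
  unfolding shell_mean_def by (rule norm_integral_le_nn_integral)

text \<open>The average is at most the average of the modulus, and summing over the shells returns
  the L1 norm of the pair product at fixed \<open>z\<close>.\<close>

lemma square_transform_abs_bound:
  fixes v :: "'a::euclidean_space \<Rightarrow> complex"
  assumes v: "in_L2 v" and B: "\<And>t. cmod (\<phi> (t, z)) \<le> B"
  shows "(\<integral>\<^sup>+s. ennreal (cmod (square_transform v (- ((norm z)\<^sup>2 / 2) - s, z) * \<phi> (- ((norm z)\<^sup>2 / 2) - s, z))) \<partial>lborel)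
    \<le> ennreal (square_transform_const DIM('a) * B) * ennreal (L2_sq v)"
proof -
  let ?c = "square_transform_const DIM('a)"
  have [measurable]: "v \<in> borel_measurable borel" by (rule in_L2_measurable[OF v])
  have B0: "B \<ge> 0" using order_trans[OF norm_ge_zero B[of 0]] .
  have c0: "?c \<ge> 0" using square_transform_const_pos[of "DIM('a)"] by simp
  have "(\<integral>\<^sup>+s. ennreal (cmod (square_transform v (- ((norm z)\<^sup>2 / 2) - s, z) * \<phi> (- ((norm z)\<^sup>2 / 2) - s, z))) \<partial>lborel)
     \<le> (\<integral>\<^sup>+s. ennreal (?c * B) * (ennreal (shell_density DIM('a) s) * (\<integral>\<^sup>+x. ennreal (cmod (pair_product v z (sqrt (s / 2) *\<^sub>R x))) \<partial>unit_sphere_prob)) \<partial>lborel)"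
  proof (rule nn_integral_mono)
    fix s :: real
    let ?r = "shell_density DIM('a) s"
    have "cmod (square_transform v (- ((norm z)\<^sup>2 / 2) - s, z) * \<phi> (- ((norm z)\<^sup>2 / 2) - s, z))
       \<le> (?c * ?r * cmod (shell_mean v z s)) * B"
      unfolding norm_mult square_transform_shift norm_of_real
      using c0 shell_density_nonneg[of "DIM('a)" s] by (intro mult_mono B) simp_all
    then have "ennreal (cmod (square_transform v (- ((norm z)\<^sup>2 / 2) - s, z) * \<phi> (- ((norm z)\<^sup>2 / 2) - s, z)))
       \<le> ennreal ((?c * B) * (?r * cmod (shell_mean v z s)))"
      by (intro ennreal_leI) (simp add: mult_ac)
    also have "\<dots> = ennreal (?c * B) * (ennreal ?r * ennreal (cmod (shell_mean v z s)))"
      using c0 B0 by (simp add: ennreal_mult shell_density_nonneg)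
    also have "\<dots> \<le> ennreal (?c * B) * (ennreal ?r * (\<integral>\<^sup>+x. ennreal (cmod (pair_product v z (sqrt (s / 2) *\<^sub>R x))) \<partial>unit_sphere_prob))"
      by (intro mult_left_mono norm_shell_mean_le) simp_all
    finally show "ennreal (cmod (square_transform v (- ((norm z)\<^sup>2 / 2) - s, z) * \<phi> (- ((norm z)\<^sup>2 / 2) - s, z)))
       \<le> ennreal (?c * B) * (ennreal ?r * (\<integral>\<^sup>+x. ennreal (cmod (pair_product v z (sqrt (s / 2) *\<^sub>R x))) \<partial>unit_sphere_prob))" .
  qed
  also have "\<dots> = ennreal (?c * B) * (\<integral>\<^sup>+s. ennreal (shell_density DIM('a) s) * (\<integral>\<^sup>+x. ennreal (cmod (pair_product v z (sqrt (s / 2) *\<^sub>R x))) \<partial>unit_sphere_prob) \<partial>lborel)"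
    by (rule nn_integral_cmult) measurable
  also have "\<dots> = ennreal (?c * B) * (\<integral>\<^sup>+y. ennreal (cmod (pair_product v z y)) \<partial>lborel)"
    by (subst nn_integral_shells) simp_all
  also have "\<dots> \<le> ennreal (?c * B) * ennreal (L2_sq v)"
    by (intro mult_left_mono nn_integral_pair_product_le v) simp
  finally show ?thesis .
qed

lemma square_transform_integrable:
  fixes v :: "'a::euclidean_space \<Rightarrow> complex"
  assumes v: "in_L2 v" and p: "schwartz \<phi>"
  shows "integrable lborel (\<lambda>q. square_transform v q * \<phi> q)"
proof (rule integrableI_bounded)
  let ?c = "square_transform_const DIM('a)"
  let ?k = "2 * DIM('a)"
  have [measurable]: "\<phi> \<in> borel_measurable borel" using schwartz_measurable[OF p, of "[]"] by simp
  have [measurable]: "square_transform v \<in> borel_measurable borel" by (rule square_transform_measurable[OF in_L2_measurable[OF v]])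
  show "(\<lambda>q. square_transform v q * \<phi> q) \<in> borel_measurable lborel" by measurable
  obtain C where C: "C \<ge> 0" "\<And>s z. cmod (iterated_partial [] \<phi> (s, z)) \<le> C * (1 / (1 + norm s) ^ 2) * (1 / (1 + norm z) ^ ?k)"
    by (rule schwartz_slice_bound[OF p, of "[]" ?k], simp, rule that)
  have b: "cmod (\<phi> (t, z)) \<le> C * (1 / (1 + norm z) ^ ?k)" for t z
  proof -
    have "(1::real) \<le> (1 + norm t) ^ 2" by (rule one_le_power) simp
    then have "1 / (1 + norm t) ^ 2 \<le> 1" by simp
    then have "C * (1 / (1 + norm t) ^ 2) * (1 / (1 + norm z) ^ ?k) \<le> C * 1 * (1 / (1 + norm z) ^ ?k)"
      by (intro mult_right_mono mult_left_mono C) simp_all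
    then show ?thesis using C(2)[of t z] by simp
  qed
  have "(\<integral>\<^sup>+q. ennreal (norm (square_transform v q * \<phi> q)) \<partial>lborel)
    \<le> (\<integral>\<^sup>+z. ennreal (?c * (C * (1 / (1 + norm (z::'a)) ^ ?k))) * ennreal (L2_sq v) \<partial>lborel)"
    by (subst nn_integral_paraboloid) (simp, intro nn_integral_mono square_transform_abs_bound v b)
  also have "\<dots> = (\<integral>\<^sup>+z. ennreal (?c * (C * (1 / (1 + norm (z::'a)) ^ ?k))) \<partial>lborel) * ennreal (L2_sq v)"
    by (rule nn_integral_multc) measurable
  also have "(\<integral>\<^sup>+z. ennreal (?c * (C * (1 / (1 + norm (z::'a)) ^ ?k))) \<partial>lborel) = ennreal (integral\<^sup>L lborel (\<lambda>z::'a. ?c * (C * (1 / (1 + norm z) ^ ?k))))"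
  proof (rule nn_integral_eq_integral)
    show "integrable lborel (\<lambda>z::'a. ?c * (C * (1 / (1 + norm z) ^ ?k)))"
      by (intro integrable_mult_right integrable_inverse_poly) simp
  qed (use C(1) square_transform_const_pos[of "DIM('a)"] in simp)
  also have "\<dots> * ennreal (L2_sq v) < \<infinity>" by (simp add: ennreal_mult_less_top)
  finally show "(\<integral>\<^sup>+q. ennreal (norm (square_transform v q * \<phi> q)) \<partial>lborel) < \<infinity>" .
qed

text \<open>At fixed \<open>z\<close> the test function is constant on each sphere, so it leaves the
  spherical integral and the pair product enters through its average only.\<close>

lemma square_transform_pairing:
  fixes v :: "'a::euclidean_space \<Rightarrow> complex"
  assumes v: "in_L2 v" and p: "schwartz \<phi>"
  shows "(\<integral>q. square_transform v q * \<phi> q \<partial>lborel) = of_real (square_transform_const DIM('a))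
     * (\<integral>q. pair_product v (fst q) (snd q) * \<phi> (- ((norm (fst q))\<^sup>2 / 2 + 2 * (norm (snd q))\<^sup>2), fst q) \<partial>lborel)"
proof -
  let ?c = "complex_of_real (square_transform_const DIM('a))"
  let ?k = "2 * DIM('a)"
  have vm[measurable]: "v \<in> borel_measurable borel" by (rule in_L2_measurable[OF v])
  have pm: "\<phi> \<in> borel_measurable borel" using schwartz_measurable[OF p, of "[]"] by simp
  then have pm2[measurable]: "\<phi> \<in> borel_measurable (borel \<Otimes>\<^sub>M borel)" by (simp add: borel_prod)
  obtain C where C: "C \<ge> 0" "\<And>x. cmod (iterated_partial [] \<phi> x) \<le> C * (1 / (1 + norm x) ^ ?k)"
    by (rule schwartz_bound[OF p, of "[]" ?k], simp, rule that)
  have b: "cmod (\<phi> (t, z)) \<le> C * (1 / (1 + norm z) ^ ?k)" for t z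
  proof -
    have "(1 + norm z) ^ ?k \<le> (1 + norm (t, z)) ^ ?k" using norm_snd_le[of z t] by (intro power_mono) auto
    then have "1 / (1 + norm (t, z)) ^ ?k \<le> 1 / (1 + norm z) ^ ?k"
      by (intro divide_left_mono mult_pos_pos zero_less_power add_pos_nonneg) auto
    then have "C * (1 / (1 + norm (t, z)) ^ ?k) \<le> C * (1 / (1 + norm z) ^ ?k)" by (intro mult_left_mono C)
    then show ?thesis using C(2)[of "(t, z)"] by simp
  qed
  define G where "G z y = pair_product v z y * \<phi> (- ((norm z)\<^sup>2 / 2 + 2 * (norm y)\<^sup>2), z)" for z y
  have Gm: "(\<lambda>q. G (fst q) (snd q)) \<in> borel_measurable (borel \<Otimes>\<^sub>M borel)"
    unfolding G_def by measurable
  have Gi: "integrable lborel (\<lambda>q. G (fst q) (snd q))"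
  proof (rule Bochner_Integration.integrable_bound)
    show "integrable lborel (\<lambda>q. C * (cmod (pair_product v (fst q) (snd q)) * (1 / (1 + norm (fst q)) ^ ?k)))"
      by (intro integrable_mult_right integrable_pair_product_weight v) simp
    show "(\<lambda>q. G (fst q) (snd q)) \<in> borel_measurable lborel" using Gm by (simp add: borel_prod)
    have "cmod (G (fst q) (snd q)) \<le> C * (cmod (pair_product v (fst q) (snd q)) * (1 / (1 + norm (fst q)) ^ ?k))" for q
      using mult_left_mono[OF b[of "- ((norm (fst q))\<^sup>2 / 2 + 2 * (norm (snd q))\<^sup>2)" "fst q"], of "cmod (pair_product v (fst q) (snd q))"]
      by (simp only: G_def norm_mult mult_ac) simp
    then show "AE q in lborel. norm (G (fst q) (snd q)) \<le> norm (C * (cmod (pair_product v (fst q) (snd q)) * (1 / (1 + norm (fst q)) ^ ?k)))"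
      by (intro AE_I2 le_norm_real)
  qed
  \<comment> \<open>Every slice is integrable, not just almost every one, because the bound for the
    pair product holds at each \<open>z\<close>; so \<open>inner\<close> below is a pointwise
    identity.\<close>
  have slice: "integrable lborel (G z)" for z
  proof (rule integrableI_bounded)
    show [measurable]: "G z \<in> borel_measurable lborel" unfolding G_def[abs_def] by measurable
    have "(\<integral>\<^sup>+y. ennreal (norm (G z y)) \<partial>lborel) \<le> (\<integral>\<^sup>+y. ennreal (cmod (pair_product v z y)) * ennreal (C * (1 / (1 + norm z) ^ ?k)) \<partial>lborel)"
    proof (rule nn_integral_mono)
      fix y
      have "norm (G z y) \<le> cmod (pair_product v z y) * (C * (1 / (1 + norm z) ^ ?k))"
        unfolding G_def norm_mult by (intro mult_left_mono b) simp
      then have "ennreal (norm (G z y)) \<le> ennreal (cmod (pair_product v z y) * (C * (1 / (1 + norm z) ^ ?k)))"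
        by (rule ennreal_leI)
      then show "ennreal (norm (G z y)) \<le> ennreal (cmod (pair_product v z y)) * ennreal (C * (1 / (1 + norm z) ^ ?k))"
        using C(1) by (simp add: ennreal_mult[symmetric])
    qed
    also have "\<dots> = (\<integral>\<^sup>+y. ennreal (cmod (pair_product v z y)) \<partial>lborel) * ennreal (C * (1 / (1 + norm z) ^ ?k))"
      by (rule nn_integral_multc) measurable
    also have "\<dots> \<le> ennreal (L2_sq v) * ennreal (C * (1 / (1 + norm z) ^ ?k))"
      by (intro mult_right_mono nn_integral_pair_product_le v) simp
    also have "\<dots> < \<infinity>" by (simp add: ennreal_mult_less_top)
    finally show "(\<integral>\<^sup>+y. ennreal (norm (G z y)) \<partial>lborel) < \<infinity>" .
  qed
  have inner: "?c * (\<integral>y. G z y \<partial>lborel) = (\<integral>t. square_transform v (t, z) * \<phi> (t, z) \<partial>lborel)" for z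
  proof -
    let ?a = "- ((norm z)\<^sup>2 / 2)"
    have shell: "shell_density DIM('a) s *\<^sub>R (\<integral>x. G z (sqrt (s / 2) *\<^sub>R x) \<partial>unit_sphere_prob)
        = of_real (shell_density DIM('a) s) * shell_mean v z s * \<phi> (?a - s, z)" for s
    proof (cases "s > 0")
      case True
      have "(\<integral>x. G z (sqrt (s / 2) *\<^sub>R x) \<partial>unit_sphere_prob) = (\<integral>x. pair_product v z (sqrt (s / 2) *\<^sub>R x) * \<phi> (?a - s, z) \<partial>unit_sphere_prob)"
      proof (rule integral_cong_AE)
        show "AE x in unit_sphere_prob. G z (sqrt (s / 2) *\<^sub>R x) = pair_product v z (sqrt (s / 2) *\<^sub>R x) * \<phi> (?a - s, z)"
          using AE_norm_unit_sphere_prob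
        proof eventually_elim
          case (elim x)
          have "2 * (norm (sqrt (s / 2) *\<^sub>R x))\<^sup>2 = s" using True elim by (simp add: power_mult_distrib)
          then have "- ((norm z)\<^sup>2 / 2 + 2 * (norm (sqrt (s / 2) *\<^sub>R x))\<^sup>2) = ?a - s" by simp
          then show ?case unfolding G_def by (simp only:)
        qed
        show "(\<lambda>x. G z (sqrt (s / 2) *\<^sub>R x)) \<in> borel_measurable unit_sphere_prob" unfolding G_def by measurable
      qed measurable
      also have "\<dots> = shell_mean v z s * \<phi> (?a - s, z)"
        unfolding shell_mean_def by (rule integral_mult_left_zero)
      finally show ?thesis by (simp add: scaleR_conv_of_real mult_ac)
    qed (simp add: shell_density_def)
    have "(\<lambda>t. square_transform v (t, z)) \<in> borel_measurable borel" "(\<lambda>t. \<phi> (t, z)) \<in> borel_measurable borel"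
      using measurable_compose[OF _ square_transform_measurable[OF vm], of "\<lambda>t. (t, z)" borel]
        measurable_compose[OF _ pm, of "\<lambda>t. (t, z)" borel] by (simp_all add: borel_prod[symmetric])
    then have [measurable]: "(\<lambda>t. square_transform v (t, z) * \<phi> (t, z)) \<in> borel_measurable borel"
      by (rule borel_measurable_times)
    have "(\<integral>t. square_transform v (t, z) * \<phi> (t, z) \<partial>lborel) = (\<integral>s. square_transform v (?a - s, z) * \<phi> (?a - s, z) \<partial>lborel)"
      by (rule integral_reflection[of "\<lambda>t. square_transform v (t, z) * \<phi> (t, z)" ?a, symmetric]) measurable
    also have "\<dots> = (\<integral>s. ?c * (shell_density DIM('a) s *\<^sub>R (\<integral>x. G z (sqrt (s / 2) *\<^sub>R x) \<partial>unit_sphere_prob)) \<partial>lborel)"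
      unfolding shell square_transform_shift by (simp add: mult_ac)
    also have "\<dots> = ?c * (\<integral>s. shell_density DIM('a) s *\<^sub>R (\<integral>x. G z (sqrt (s / 2) *\<^sub>R x) \<partial>unit_sphere_prob) \<partial>lborel)"
      by (rule integral_mult_right_zero)
    also have "(\<integral>s. shell_density DIM('a) s *\<^sub>R (\<integral>x. G z (sqrt (s / 2) *\<^sub>R x) \<partial>unit_sphere_prob) \<partial>lborel) = (\<integral>y. G z y \<partial>lborel)"
      by (rule integral_shells[OF slice, symmetric])
    finally show ?thesis by simp
  qed
  have "(\<integral>q. square_transform v q * \<phi> q \<partial>lborel) = (\<integral>z. \<integral>t. square_transform v (t, z) * \<phi> (t, z) \<partial>lborel \<partial>lborel)"
    using lborel_pair.integral_snd[of "\<lambda>t z. square_transform v (t, z) * \<phi> (t, z)"] square_transform_integrable[OF v p]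
    by (simp add: lborel_prod case_prod_unfold)
  also have "\<dots> = (\<integral>z. ?c * (\<integral>y. G z y \<partial>lborel) \<partial>lborel)" by (simp only: inner)
  also have "\<dots> = ?c * (\<integral>z. \<integral>y. G z y \<partial>lborel \<partial>lborel)" by (rule integral_mult_right_zero)
  also have "(\<integral>z. \<integral>y. G z y \<partial>lborel \<partial>lborel) = (\<integral>q. G (fst q) (snd q) \<partial>lborel)"
    using lborel_pair.integral_fst'[of "\<lambda>q. G (fst q) (snd q)"] Gi by (simp add: lborel_prod)
  finally show ?thesis by (simp only: G_def)
qed

lemma (in free_solution) square_has_fourier: "has_fourier (\<lambda>z. (u z)\<^sup>2) (square_transform v)"
  unfolding has_fourier_def
proof (intro conjI allI impI)
  show "tempered_fun (\<lambda>z. (u z)\<^sup>2)" by (rule square_tempered)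
  show "tempered_fun (square_transform v)"
    unfolding tempered_fun_def using square_transform_measurable[OF v_meas] square_transform_integrable[OF v] by simp
  fix \<phi> :: "real \<times> 'a \<Rightarrow> complex" assume p: "schwartz \<phi>"
  have "complex_of_real ((2 * pi) ^ DIM('a)) \<noteq> 0" by simp
  moreover have "of_real ((2 * pi) ^ DIM('a)) * (\<integral>x. (u x)\<^sup>2 * fourier_integral \<phi> x \<partial>lborel)
     = of_real ((2 * pi) ^ DIM('a)) * (\<integral>q. square_transform v q * \<phi> q \<partial>lborel)"
    unfolding square_pairing[OF p] square_transform_pairing[OF v p] mult.assoc[symmetric] of_real_mult[symmetric]
    by (simp add: square_transform_const_def)
  ultimately show "(\<integral>x. (u x)\<^sup>2 * fourier_integral \<phi> x \<partial>lborel) = (\<integral>q. square_transform v q * \<phi> q \<partial>lborel)"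
    using mult_left_cancel by blast
qed

section \<open>Energies\<close>

text \<open>The three energies are extended nonnegative integrals, so that they add up without any
  assumption of finiteness; finiteness enters with the explicit values of
  \<open>pair_energy\<close>.\<close>

definition pair_energy :: "nat \<Rightarrow> ('a::euclidean_space \<Rightarrow> complex) \<Rightarrow> ennreal" where
  "pair_energy j v = (\<integral>\<^sup>+z. \<integral>\<^sup>+y. ennreal ((2 * (norm y)\<^sup>2) ^ j * (cmod (pair_product v z y))\<^sup>2) \<partial>lborel \<partial>lborel)"

definition mean_energy :: "nat \<Rightarrow> ('a::euclidean_space \<Rightarrow> complex) \<Rightarrow> ennreal" where
  "mean_energy j v = (\<integral>\<^sup>+z. \<integral>\<^sup>+s. ennreal (shell_density DIM('a) s) * (ennreal (s ^ j) * ennreal ((cmod (shell_mean v z s))\<^sup>2)) \<partial>lborel \<partial>lborel)"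

definition variance_energy :: "nat \<Rightarrow> ('a::euclidean_space \<Rightarrow> complex) \<Rightarrow> ennreal" where
  "variance_energy j v = (\<integral>\<^sup>+z. \<integral>\<^sup>+y. ennreal ((2 * (norm y)\<^sup>2) ^ j * (cmod (pair_product v z y - shell_mean v z (2 * (norm y)\<^sup>2)))\<^sup>2) \<partial>lborel \<partial>lborel)"

text \<open>\<open>H\<close> receives \<open>2 * (norm y)^2\<close> as an argument of its own so
  that it can involve the average over the shell, which depends on the radius alone. On the sphere
  of parameter \<open>s\<close> this argument is \<open>s\<close> almost everywhere.\<close>

lemma nn_integral_shells_weighted:
  fixes H :: "real \<Rightarrow> 'a::euclidean_space \<Rightarrow> real"
  assumes H[measurable]: "(\<lambda>(s, x). H s x) \<in> borel_measurable (borel \<Otimes>\<^sub>M borel)" and nn: "\<And>s x. H s x \<ge> 0"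
  shows "(\<integral>\<^sup>+y. ennreal ((2 * (norm y)\<^sup>2) ^ j * H (2 * (norm y)\<^sup>2) y) \<partial>lborel)
    = (\<integral>\<^sup>+s. ennreal (shell_density DIM('a) s) * (ennreal (s ^ j) * (\<integral>\<^sup>+x. ennreal (H s (sqrt (s / 2) *\<^sub>R x)) \<partial>unit_sphere_prob)) \<partial>lborel)"
proof -
  have "(\<integral>\<^sup>+y. ennreal ((2 * (norm y)\<^sup>2) ^ j * H (2 * (norm y)\<^sup>2) y) \<partial>lborel)
    = (\<integral>\<^sup>+s. ennreal (shell_density DIM('a) s) * (\<integral>\<^sup>+x. ennreal ((2 * (norm (sqrt (s / 2) *\<^sub>R x))\<^sup>2) ^ j * H (2 * (norm (sqrt (s / 2) *\<^sub>R x))\<^sup>2) (sqrt (s / 2) *\<^sub>R x)) \<partial>unit_sphere_prob) \<partial>lborel)"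
    by (rule nn_integral_shells) measurable
  also have "\<dots> = (\<integral>\<^sup>+s. ennreal (shell_density DIM('a) s) * (ennreal (s ^ j) * (\<integral>\<^sup>+x. ennreal (H s (sqrt (s / 2) *\<^sub>R x)) \<partial>unit_sphere_prob)) \<partial>lborel)"
  proof (rule nn_integral_cong)
    fix s :: real
    show "ennreal (shell_density DIM('a) s) * (\<integral>\<^sup>+x. ennreal ((2 * (norm (sqrt (s / 2) *\<^sub>R x))\<^sup>2) ^ j * H (2 * (norm (sqrt (s / 2) *\<^sub>R x))\<^sup>2) (sqrt (s / 2) *\<^sub>R x)) \<partial>unit_sphere_prob)
      = ennreal (shell_density DIM('a) s) * (ennreal (s ^ j) * (\<integral>\<^sup>+x. ennreal (H s (sqrt (s / 2) *\<^sub>R x)) \<partial>unit_sphere_prob))"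
    proof (cases "s > 0")
      case True
      have "(\<integral>\<^sup>+x. ennreal ((2 * (norm (sqrt (s / 2) *\<^sub>R x))\<^sup>2) ^ j * H (2 * (norm (sqrt (s / 2) *\<^sub>R x))\<^sup>2) (sqrt (s / 2) *\<^sub>R x)) \<partial>unit_sphere_prob)
         = (\<integral>\<^sup>+x. ennreal (s ^ j) * ennreal (H s (sqrt (s / 2) *\<^sub>R x)) \<partial>unit_sphere_prob)"
      proof (rule nn_integral_cong_AE)
        show "AE x::'a in unit_sphere_prob. ennreal ((2 * (norm (sqrt (s / 2) *\<^sub>R x))\<^sup>2) ^ j * H (2 * (norm (sqrt (s / 2) *\<^sub>R x))\<^sup>2) (sqrt (s / 2) *\<^sub>R x))
           = ennreal (s ^ j) * ennreal (H s (sqrt (s / 2) *\<^sub>R x))"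
          using AE_norm_unit_sphere_prob
        proof eventually_elim
          case (elim x)
          have "2 * (norm (sqrt (s / 2) *\<^sub>R x))\<^sup>2 = s" using True elim by (simp add: power_mult_distrib)
          then show ?case using True nn by (simp only: ennreal_mult zero_le_power less_imp_le)
        qed
      qed
      also have "\<dots> = ennreal (s ^ j) * (\<integral>\<^sup>+x. ennreal (H s (sqrt (s / 2) *\<^sub>R x)) \<partial>unit_sphere_prob)"
        by (rule nn_integral_cmult) measurable
      finally show ?thesis by simp
    qed (simp add: shell_density_def)
  qed
  finally show ?thesis .
qed

lemma pair_energy_split:
  fixes v :: "'a::euclidean_space \<Rightarrow> complex"
  assumes [measurable]: "v \<in> borel_measurable borel"
  shows "pair_energy j v = mean_energy j v + variance_energy j v"
proof -
  let ?r = "\<lambda>s. ennreal (shell_density DIM('a) s)"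
  let ?V = "\<lambda>z s. \<integral>\<^sup>+x. ennreal ((cmod (pair_product v z (sqrt (s / 2) *\<^sub>R x) - shell_mean v z s))\<^sup>2) \<partial>unit_sphere_prob"
  have "(\<integral>\<^sup>+y. ennreal ((2 * (norm y)\<^sup>2) ^ j * (cmod (pair_product v z y))\<^sup>2) \<partial>lborel)
    = (\<integral>\<^sup>+s. ?r s * (ennreal (s ^ j) * ennreal ((cmod (shell_mean v z s))\<^sup>2)) \<partial>lborel)
    + (\<integral>\<^sup>+y. ennreal ((2 * (norm y)\<^sup>2) ^ j * (cmod (pair_product v z y - shell_mean v z (2 * (norm y)\<^sup>2)))\<^sup>2) \<partial>lborel)" for z
  proof -
    have "(\<integral>\<^sup>+y. ennreal ((2 * (norm y)\<^sup>2) ^ j * (cmod (pair_product v z y))\<^sup>2) \<partial>lborel)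
      = (\<integral>\<^sup>+s. ?r s * (ennreal (s ^ j) * (\<integral>\<^sup>+x. ennreal ((cmod (pair_product v z (sqrt (s / 2) *\<^sub>R x)))\<^sup>2) \<partial>unit_sphere_prob)) \<partial>lborel)"
      by (rule nn_integral_shells_weighted[where H="\<lambda>s y. (cmod (pair_product v z y))\<^sup>2"]) simp_all
    also have "\<dots> = (\<integral>\<^sup>+s. ?r s * (ennreal (s ^ j) * ennreal ((cmod (shell_mean v z s))\<^sup>2)) + ?r s * (ennreal (s ^ j) * ?V z s) \<partial>lborel)"
    proof (rule nn_integral_cong)
      fix s :: real
      have "(\<lambda>x. pair_product v z (sqrt (s / 2) *\<^sub>R x)) \<in> borel_measurable unit_sphere_prob" by measurable
      from unit_sphere_prob.nn_integral_norm_sq_variance[OF this]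
      have "(\<integral>\<^sup>+x. ennreal ((cmod (pair_product v z (sqrt (s / 2) *\<^sub>R x)))\<^sup>2) \<partial>unit_sphere_prob)
        = ennreal ((cmod (shell_mean v z s))\<^sup>2) + ?V z s" by (simp only: shell_mean_def)
      then show "?r s * (ennreal (s ^ j) * (\<integral>\<^sup>+x. ennreal ((cmod (pair_product v z (sqrt (s / 2) *\<^sub>R x)))\<^sup>2) \<partial>unit_sphere_prob))
        = ?r s * (ennreal (s ^ j) * ennreal ((cmod (shell_mean v z s))\<^sup>2)) + ?r s * (ennreal (s ^ j) * ?V z s)"
        by (simp only: distrib_left)
    qed
    also have "\<dots> = (\<integral>\<^sup>+s. ?r s * (ennreal (s ^ j) * ennreal ((cmod (shell_mean v z s))\<^sup>2)) \<partial>lborel) + (\<integral>\<^sup>+s. ?r s * (ennreal (s ^ j) * ?V z s) \<partial>lborel)"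
      by (rule nn_integral_add) measurable
    also have "(\<integral>\<^sup>+s. ?r s * (ennreal (s ^ j) * ?V z s) \<partial>lborel)
      = (\<integral>\<^sup>+y. ennreal ((2 * (norm y)\<^sup>2) ^ j * (cmod (pair_product v z y - shell_mean v z (2 * (norm y)\<^sup>2)))\<^sup>2) \<partial>lborel)"
      by (rule nn_integral_shells_weighted[where H="\<lambda>s y. (cmod (pair_product v z y - shell_mean v z s))\<^sup>2", symmetric]) simp_all
    finally show ?thesis .
  qed
  then show ?thesis
    unfolding pair_energy_def mean_energy_def variance_energy_def
    by (simp only:) (rule nn_integral_add, measurable)
qed

lemma pair_energy_coordinates:
  fixes v :: "'a::euclidean_space \<Rightarrow> complex"
  assumes [measurable]: "v \<in> borel_measurable borel"
  shows "pair_energy j v = (\<integral>\<^sup>+x. \<integral>\<^sup>+y. ennreal (((norm (x - y))\<^sup>2 / 2) ^ j * ((cmod (v x))\<^sup>2 * (cmod (v y))\<^sup>2)) \<partial>lborel \<partial>lborel)"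
proof -
  have "pair_energy j v = (\<integral>\<^sup>+z. \<integral>\<^sup>+y. ennreal (((norm ((z /\<^sub>R 2 + y) - (z /\<^sub>R 2 - y)))\<^sup>2 / 2) ^ j * ((cmod (v (z /\<^sub>R 2 + y)))\<^sup>2 * (cmod (v (z /\<^sub>R 2 - y)))\<^sup>2)) \<partial>lborel \<partial>lborel)"
  proof -
    have "(norm ((z /\<^sub>R 2 + y) - (z /\<^sub>R 2 - y)))\<^sup>2 / 2 = 2 * (norm y)\<^sup>2" for z y :: 'a
    proof -
      have "(z /\<^sub>R 2 + y) - (z /\<^sub>R 2 - y) = 2 *\<^sub>R y" by (simp add: scaleR_2)
      then show ?thesis by (simp add: power_mult_distrib)
    qed
    then show ?thesis unfolding pair_energy_def pair_product_def by (simp only: norm_mult power_mult_distrib)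
  qed
  also have "\<dots> = (\<integral>\<^sup>+x. \<integral>\<^sup>+y. ennreal (((norm (x - y))\<^sup>2 / 2) ^ j * ((cmod (v x))\<^sup>2 * (cmod (v y))\<^sup>2)) \<partial>lborel \<partial>lborel)"
    by (rule nn_integral_midpoint[where F="\<lambda>x y. ennreal (((norm (x - y))\<^sup>2 / 2) ^ j * ((cmod (v x))\<^sup>2 * (cmod (v y))\<^sup>2))"]) measurable
  finally show ?thesis .
qed

lemma nn_integral_iterated_eq:
  fixes f :: "'a::euclidean_space \<Rightarrow> 'a \<Rightarrow> real"
  assumes "\<And>x. integrable lborel (f x)" "integrable lborel (\<lambda>x. \<integral>y. f x y \<partial>lborel)" "\<And>x y. f x y \<ge> 0"
  shows "(\<integral>\<^sup>+x. \<integral>\<^sup>+y. ennreal (f x y) \<partial>lborel \<partial>lborel) = ennreal (\<integral>x. \<integral>y. f x y \<partial>lborel \<partial>lborel)"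
  using assms by (simp add: nn_integral_eq_integral)

lemma pair_energy_0:
  fixes v :: "'a::euclidean_space \<Rightarrow> complex"
  assumes v: "in_L2 v"
  shows "pair_energy 0 v = ennreal ((L2_sq v)\<^sup>2)"
proof -
  note i = in_L2_integrable[OF v]
  have "pair_energy 0 v = ennreal (\<integral>x. \<integral>y. (cmod (v x))\<^sup>2 * (cmod (v y))\<^sup>2 \<partial>lborel \<partial>lborel)"
    unfolding pair_energy_coordinates[OF in_L2_measurable[OF v]] using i
    by (subst nn_integral_iterated_eq[symmetric]) simp_all
  then show ?thesis by (simp add: power2_eq_square)
qed

text \<open>Up to a constant, the momentum of the solution, computed on the frequency side.\<close>

definition mass_moment :: "('a::euclidean_space \<Rightarrow> complex) \<Rightarrow> 'a" where
  "mass_moment v = (\<integral>x. (cmod (v x))\<^sup>2 *\<^sub>R x \<partial>lborel)"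

lemma integrable_mass_moment:
  fixes v :: "'a::euclidean_space \<Rightarrow> complex"
  assumes v: "in_L2 v" and w: "in_L2 (\<lambda>x. of_real (norm x) * v x)"
  shows "integrable lborel (\<lambda>x. (cmod (v x))\<^sup>2 *\<^sub>R x)" "integrable lborel (\<lambda>x. (norm x)\<^sup>2 * (cmod (v x))\<^sup>2)"
proof -
  have [measurable]: "v \<in> borel_measurable borel" by (rule in_L2_measurable[OF v])
  show m2: "integrable lborel (\<lambda>x. (norm x)\<^sup>2 * (cmod (v x))\<^sup>2)"
    using in_L2_integrable[OF w] by (simp add: norm_mult power_mult_distrib)
  show "integrable lborel (\<lambda>x. (cmod (v x))\<^sup>2 *\<^sub>R x)"
  proof (rule Bochner_Integration.integrable_bound)
    show "integrable lborel (\<lambda>x. (norm x)\<^sup>2 * (cmod (v x))\<^sup>2 + (cmod (v x))\<^sup>2)"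
      using m2 in_L2_integrable[OF v] by (rule Bochner_Integration.integrable_add)
    have "norm ((cmod (v x))\<^sup>2 *\<^sub>R x) \<le> (norm x)\<^sup>2 * (cmod (v x))\<^sup>2 + (cmod (v x))\<^sup>2" for x
    proof -
      have "2 * norm x \<le> (norm x)\<^sup>2 + 1" using sum_squares_bound[of "norm x" 1] by simp
      then have "norm x \<le> (norm x)\<^sup>2 + 1" using norm_ge_zero[of x] by linarith
      from mult_right_mono[OF this, of "(cmod (v x))\<^sup>2"] show ?thesis by (simp add: algebra_simps)
    qed
    then show "AE x in lborel. norm ((cmod (v x))\<^sup>2 *\<^sub>R x) \<le> norm ((norm x)\<^sup>2 * (cmod (v x))\<^sup>2 + (cmod (v x))\<^sup>2)"
      by (intro AE_I2 le_norm_real)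
  qed measurable
qed

text \<open>Half of |x - y|^2 is |x|^2/2 + |y|^2/2 minus the inner product. The two squares give the
  same product of integrals, each with the factor 1/2; the inner product integrates to the square of
  the moment.\<close>

lemma pair_energy_1:
  fixes v :: "'a::euclidean_space \<Rightarrow> complex"
  assumes v: "in_L2 v" and w: "in_L2 (\<lambda>x. of_real (norm x) * v x)"
  shows "pair_energy 1 v = ennreal (L2_sq (\<lambda>x. of_real (norm x) * v x) * L2_sq v - (norm (mass_moment v))\<^sup>2)"
proof -
  let ?N = "L2_sq v" let ?K = "\<integral>x. (norm x)\<^sup>2 * (cmod (v x))\<^sup>2 \<partial>lborel" let ?m = "mass_moment v"
  note i0 = in_L2_integrable[OF v] and i1 = integrable_mass_moment(1)[OF v w] and i2 = integrable_mass_moment(2)[OF v w]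
  have K: "L2_sq (\<lambda>x. of_real (norm x) * v x) = ?K" by (simp add: norm_mult power_mult_distrib)
  define f where "f x y = ((norm (x - y))\<^sup>2 / 2) ^ 1 * ((cmod (v x))\<^sup>2 * (cmod (v y))\<^sup>2)" for x y
  have f: "f x y = (cmod (v x))\<^sup>2 * ((norm x)\<^sup>2 / 2 * (cmod (v y))\<^sup>2 + (1/2) * ((norm y)\<^sup>2 * (cmod (v y))\<^sup>2) - ((cmod (v y))\<^sup>2 *\<^sub>R y) \<bullet> x)" for x y
  proof -
    have "(norm (x - y))\<^sup>2 / 2 = (norm x)\<^sup>2 / 2 + (norm y)\<^sup>2 / 2 - y \<bullet> x"
      unfolding power2_norm_eq_inner inner_diff_left inner_diff_right by (simp add: inner_commute field_simps)
    then have "f x y = ((norm x)\<^sup>2 / 2 + (norm y)\<^sup>2 / 2 - y \<bullet> x) * ((cmod (v x))\<^sup>2 * (cmod (v y))\<^sup>2)" by (simp add: f_def)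
    then show ?thesis by (simp add: algebra_simps)
  qed
  have fi: "integrable lborel (f x)" for x
    unfolding f[abs_def] using i0 i1 i2
    by (intro integrable_mult_right Bochner_Integration.integrable_diff Bochner_Integration.integrable_add integrable_inner_left) simp_all
  have fint: "(\<integral>y. f x y \<partial>lborel) = ?N / 2 * ((norm x)\<^sup>2 * (cmod (v x))\<^sup>2) + ?K / 2 * (cmod (v x))\<^sup>2 - ((cmod (v x))\<^sup>2 *\<^sub>R x) \<bullet> ?m" for x
  proof -
    have "(\<integral>y. f x y \<partial>lborel) = (cmod (v x))\<^sup>2 * ((norm x)\<^sup>2 / 2 * ?N + (1/2) * ?K - ?m \<bullet> x)"
    proof -
      have "(\<integral>y. ((cmod (v y))\<^sup>2 *\<^sub>R y) \<bullet> x \<partial>lborel) = ?m \<bullet> x"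
        unfolding mass_moment_def by (rule integral_inner_left) (rule i1)
      moreover have "integrable lborel (\<lambda>y. ((cmod (v y))\<^sup>2 *\<^sub>R y) \<bullet> x)" by (rule integrable_inner_left) (rule i1)
      ultimately show ?thesis
        unfolding f using i0 i2
        by (simp only: integral_mult_right_zero Bochner_Integration.integral_diff Bochner_Integration.integral_add
            integrable_mult_right Bochner_Integration.integrable_add)
    qed
    then show ?thesis by (simp add: algebra_simps inner_commute)
  qed
  have oi: "integrable lborel (\<lambda>x. \<integral>y. f x y \<partial>lborel)"
    unfolding fint using i0 i1 i2
    by (intro integrable_mult_right Bochner_Integration.integrable_diff Bochner_Integration.integrable_add integrable_inner_left)
  have nn: "f x y \<ge> 0" for x y unfolding f_def by simp
  have "pair_energy 1 v = (\<integral>\<^sup>+x. \<integral>\<^sup>+y. ennreal (f x y) \<partial>lborel \<partial>lborel)"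
    unfolding pair_energy_coordinates[OF in_L2_measurable[OF v]] f_def ..
  also have "\<dots> = ennreal (\<integral>x. \<integral>y. f x y \<partial>lborel \<partial>lborel)"
    by (rule nn_integral_iterated_eq[OF fi oi nn])
  also have "(\<integral>x. \<integral>y. f x y \<partial>lborel \<partial>lborel) = ?N / 2 * ?K + ?K / 2 * ?N - ?m \<bullet> ?m"
  proof -
    have "(\<integral>x. ((cmod (v x))\<^sup>2 *\<^sub>R x) \<bullet> c \<partial>lborel) = ?m \<bullet> c" for c
      unfolding mass_moment_def by (rule integral_inner_left) (rule i1)
    moreover have "integrable lborel (\<lambda>y. ((cmod (v y))\<^sup>2 *\<^sub>R y) \<bullet> ?m)" by (rule integrable_inner_left) (rule i1)
    ultimately show ?thesis
      unfolding fint using i0 i2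
      by (simp only: integral_mult_right_zero Bochner_Integration.integral_diff Bochner_Integration.integral_add
          integrable_mult_right Bochner_Integration.integrable_add)
  qed
  also have "?N / 2 * ?K + ?K / 2 * ?N - ?m \<bullet> ?m = ?K * ?N - (norm ?m)\<^sup>2"
    by (simp add: power2_norm_eq_inner)
  finally show ?thesis unfolding K .
qed

text \<open>What remains when the squared symbol cancels one of the two densities: the squared
  constant of \<open>square_transform\<close> times the coefficient of s^(d/2 - 1) in
  \<open>shell_density\<close>.\<close>

definition energy_const :: "nat \<Rightarrow> real" where
  "energy_const d = (square_transform_const d)\<^sup>2 * (unit_ball_vol (real d) * (real d / 4) * (1 / 2) powr (real d / 2 - 1))"

lemma energy_const_nonneg: "energy_const d \<ge> 0"
  by (simp add: energy_const_def)

text \<open>The divisor on the left is the Plancherel factor of space-time, of dimension d + 1; the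
  one on the right is the product of two spatial Plancherel factors, which appear when norms of
  \<open>v\<close> are turned into norms of the data.\<close>

lemma energy_const_sharp:
  assumes d: "d > 0"
  shows "energy_const d / (2 * pi) ^ (d + 1) = sharp_constant (real d) / (2 * pi) ^ (2 * d)"
proof -
  have G: "Gamma (real d / 2 + 1) = real d / 2 * Gamma (real d / 2)"
    using Gamma_plus1[of "real d / 2"] d by (auto simp: nonpos_Ints_def)
  have Gp: "Gamma (real d / 2) > 0" using d by (intro Gamma_real_pos) simp
  have V: "unit_ball_vol (real d) * (real d / 4) = pi powr (real d / 2) / (2 * Gamma (real d / 2))"
    using d Gp unfolding unit_ball_vol_def G by (simp add: field_simps)
  have e: "(2 * pi) ^ n = 2 powr real n * pi powr real n" for n
    by (simp add: power_mult_distrib powr_realpow)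
  have h: "(1 / 2) powr (real d / 2 - 1) = (2::real) powr (1 - real d / 2)"
  proof -
    have "(1 / 2 :: real) = 2 powr (- 1)" by (simp add: powr_minus)
    then have "(1 / 2 :: real) powr (real d / 2 - 1) = (2 powr (- 1)) powr (real d / 2 - 1)" by (rule arg_cong)
    also have "\<dots> = 2 powr (1 - real d / 2)" by (simp only: powr_powr) simp
    finally show ?thesis .
  qed
  have sq: "(square_transform_const d)\<^sup>2 = (2 * pi) ^ 2 / (2 * pi) ^ (2 * d)"
    unfolding square_transform_const_def power_divide power_mult[symmetric] by (simp only: mult.commute[of d])
  have "energy_const d = (2 powr 2 * pi powr 2) / (2 powr (2 * real d) * pi powr (2 * real d)) * (pi powr (real d / 2) / (2 * Gamma (real d / 2)) * 2 powr (1 - real d / 2))"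
    unfolding energy_const_def V h sq e by simp
  then have "energy_const d / (2 * pi) ^ (d + 1) = (2 powr 2 * pi powr 2) / (2 powr (2 * real d) * pi powr (2 * real d)) * (pi powr (real d / 2) / (2 * Gamma (real d / 2)) * 2 powr (1 - real d / 2)) / (2 powr (real d + 1) * pi powr (real d + 1))"
    unfolding e by (simp add: add.commute)
  also have "\<dots> = (2 powr 2 * 2 powr (1 - real d / 2) / 2 powr 1 / 2 powr (real d + 1)) * (pi powr 2 * pi powr (real d / 2) / pi powr (real d + 1)) / Gamma (real d / 2) / (2 powr (2 * real d) * pi powr (2 * real d))"
    by (simp add: mult_ac)
  also have "2 powr 2 * 2 powr (1 - real d / 2) / 2 powr 1 / 2 powr (real d + 1) = (2::real) powr ((2 - 3 * real d) / 2)"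
    unfolding powr_add[symmetric] powr_diff[symmetric] by (rule arg_cong[where f="\<lambda>x. 2 powr x"]) (simp add: field_simps)
  also have "pi powr 2 * pi powr (real d / 2) / pi powr (real d + 1) = pi powr ((2 - real d) / 2)"
    unfolding powr_add[symmetric] powr_diff[symmetric] by (rule arg_cong[where f="\<lambda>x. pi powr x"]) (simp add: field_simps)
  finally show ?thesis unfolding e[of "2 * d"] sharp_constant_def by simp
qed

text \<open>The condition on \<open>\<beta>\<close> reads 2 \<open>\<beta>\<close> + d/2 - 1 = j,
  which turns the squared symbol times one \<open>shell_density\<close> into a constant times
  \<open>s ^ j\<close>. The exponents (2 - d)/4 and (4 - d)/4 are the cases j = 0 and j = 1.\<close>

lemma nn_integral_square_transform:
  fixes v :: "'a::euclidean_space \<Rightarrow> complex"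
  assumes v[measurable]: "v \<in> borel_measurable borel" and b: "2 * \<beta> = real j + 1 - real DIM('a) / 2"
  shows "(\<integral>\<^sup>+p. ennreal ((cmod (of_real (D_symbol \<beta> p) * square_transform v p))\<^sup>2) \<partial>lborel) = ennreal (energy_const DIM('a)) * mean_energy j v"
proof -
  let ?r = "shell_density DIM('a)" let ?c = "square_transform_const DIM('a)"
  let ?k = "unit_ball_vol (real DIM('a)) * (real DIM('a) / 4) * (1 / 2) powr (real DIM('a) / 2 - 1)"
  have m: "(\<lambda>p. ennreal ((cmod (of_real (D_symbol \<beta> p) * square_transform v p))\<^sup>2)) \<in> borel_measurable borel"
  proof -
    have [measurable]: "(D_symbol \<beta> :: real \<times> 'a \<Rightarrow> real) \<in> borel_measurable borel"
      unfolding D_symbol_def case_prod_unfold using fst_snd_borel by measurable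
    have [measurable]: "square_transform v \<in> borel_measurable borel" by (rule square_transform_measurable[OF v])
    show ?thesis by measurable
  qed
  have point: "ennreal ((cmod (of_real (D_symbol \<beta> (- ((norm z)\<^sup>2 / 2) - s, z)) * square_transform v (- ((norm z)\<^sup>2 / 2) - s, z)))\<^sup>2)
     = ennreal (energy_const DIM('a)) * (ennreal (?r s) * (ennreal (s ^ j) * ennreal ((cmod (shell_mean v z s))\<^sup>2)))" for z s
  proof (cases "s > 0")
    case True
    have D: "D_symbol \<beta> (- ((norm z)\<^sup>2 / 2) - s, z) = s powr \<beta>" using True by (simp add: D_symbol_def)
    have "(s powr \<beta>)\<^sup>2 * ?r s = ?k * s ^ j"
    proof -
      have "(s powr \<beta>)\<^sup>2 = s powr (2 * \<beta>)" using True by (simp add: power2_eq_square powr_add[symmetric])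
      moreover have "(s / 2) powr (real DIM('a) / 2 - 1) = (1 / 2) powr (real DIM('a) / 2 - 1) * s powr (real DIM('a) / 2 - 1)"
        using True powr_mult[of "1/2" s "real DIM('a) / 2 - 1"] by simp
      moreover have "s powr (2 * \<beta>) * s powr (real DIM('a) / 2 - 1) = s ^ j"
        unfolding powr_add[symmetric] b using True by (simp add: powr_realpow)
      ultimately show ?thesis using True by (simp add: shell_density_def mult_ac)
    qed
    then have eq: "(s powr \<beta>)\<^sup>2 * (?r s)\<^sup>2 = ?k * s ^ j * ?r s" by (simp only: power2_eq_square mult.assoc[symmetric]) 
    have "(cmod (of_real (D_symbol \<beta> (- ((norm z)\<^sup>2 / 2) - s, z)) * square_transform v (- ((norm z)\<^sup>2 / 2) - s, z)))\<^sup>2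
       = ?c\<^sup>2 * ((s powr \<beta>)\<^sup>2 * (?r s)\<^sup>2) * (cmod (shell_mean v z s))\<^sup>2"
      unfolding D square_transform_shift by (simp add: norm_mult power_mult_distrib)
    also have "\<dots> = energy_const DIM('a) * (?r s * (s ^ j * (cmod (shell_mean v z s))\<^sup>2))"
      unfolding eq energy_const_def by (simp only: mult_ac)
    finally have "ennreal ((cmod (of_real (D_symbol \<beta> (- ((norm z)\<^sup>2 / 2) - s, z)) * square_transform v (- ((norm z)\<^sup>2 / 2) - s, z)))\<^sup>2)
       = ennreal (energy_const DIM('a) * (?r s * (s ^ j * (cmod (shell_mean v z s))\<^sup>2)))" by (rule arg_cong)
    also have "\<dots> = ennreal (energy_const DIM('a)) * (ennreal (?r s) * (ennreal (s ^ j) * ennreal ((cmod (shell_mean v z s))\<^sup>2)))"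
      using True energy_const_nonneg by (simp add: ennreal_mult shell_density_nonneg)
    finally show ?thesis .
  next
    case False
    then show ?thesis by (simp add: square_transform_shift shell_density_def)
  qed
  have "(\<integral>\<^sup>+p. ennreal ((cmod (of_real (D_symbol \<beta> p) * square_transform v p))\<^sup>2) \<partial>lborel)
    = (\<integral>\<^sup>+z. \<integral>\<^sup>+s. ennreal (energy_const DIM('a)) * (ennreal (?r s) * (ennreal (s ^ j) * ennreal ((cmod (shell_mean v z s))\<^sup>2))) \<partial>lborel \<partial>lborel)"
    unfolding nn_integral_paraboloid[OF m] point ..
  also have "\<dots> = (\<integral>\<^sup>+z. ennreal (energy_const DIM('a)) * (\<integral>\<^sup>+s. ennreal (?r s) * (ennreal (s ^ j) * ennreal ((cmod (shell_mean v z s))\<^sup>2)) \<partial>lborel) \<partial>lborel)"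
    by (intro nn_integral_cong nn_integral_cmult) measurable
  also have "\<dots> = ennreal (energy_const DIM('a)) * mean_energy j v"
    unfolding mean_energy_def by (rule nn_integral_cmult) measurable
  finally show ?thesis .
qed

lemma (in free_solution) D_power_square:
  assumes b: "2 * \<beta> = real j + 1 - real DIM('a) / 2" and fin: "mean_energy j v < \<infinity>"
  shows "in_multiplier_domain (D_symbol \<beta>) (\<lambda>z. (u z)\<^sup>2)"
    and "(L2_norm (D_power \<beta> (\<lambda>z. (u z)\<^sup>2)))\<^sup>2 = sharp_constant (real DIM('a)) / (2 * pi) ^ (2 * DIM('a)) * enn2real (mean_energy j v)"
proof -
  let ?h = "\<lambda>p. of_real (D_symbol \<beta> p) * square_transform v p"
  have [measurable]: "(D_symbol \<beta> :: real \<times> 'a \<Rightarrow> real) \<in> borel_measurable borel"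
    unfolding D_symbol_def case_prod_unfold using fst_snd_borel by measurable
  have [measurable]: "square_transform v \<in> borel_measurable borel" by (rule square_transform_measurable[OF v_meas])
  obtain E where E: "mean_energy j v = ennreal E" "E \<ge> 0" using fin by (cases "mean_energy j v") auto
  have c: "energy_const DIM('a) \<ge> 0" by (simp add: energy_const_def)
  have nn: "(\<integral>\<^sup>+p. ennreal ((cmod (?h p))\<^sup>2) \<partial>lborel) = ennreal (energy_const DIM('a) * E)"
    unfolding nn_integral_square_transform[OF v_meas b] E(1) using c E(2) by (simp add: ennreal_mult)
  have i: "integrable lborel (\<lambda>p. (cmod (?h p))\<^sup>2)"
    by (rule integrableI_nonneg) (simp_all add: nn)
  have L: "in_L2 ?h" by (rule in_L2I[OF _ i]) measurable
  show "in_multiplier_domain (D_symbol \<beta>) (\<lambda>z. (u z)\<^sup>2)"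
    by (rule fourier_multiplier_L2(1)[OF square_has_fourier L])
  have "ennreal (L2_sq ?h) = ennreal (energy_const DIM('a) * E)"
    unfolding nn[symmetric] by (rule nn_integral_eq_integral[OF i, symmetric]) simp
  then have "L2_sq ?h = energy_const DIM('a) * E" using c E(2) by (subst (asm) ennreal_inj) simp_all
  then have "(2 * pi) ^ (DIM('a) + 1) * (L2_norm (D_power \<beta> (\<lambda>z. (u z)\<^sup>2)))\<^sup>2 = energy_const DIM('a) * E"
    using fourier_multiplier_L2(2)[OF square_has_fourier L] by (simp add: D_power_def)
  then have "(L2_norm (D_power \<beta> (\<lambda>z. (u z)\<^sup>2)))\<^sup>2 = energy_const DIM('a) / (2 * pi) ^ (DIM('a) + 1) * E"
    by (simp add: field_simps)
  then show "(L2_norm (D_power \<beta> (\<lambda>z. (u z)\<^sup>2)))\<^sup>2 = sharp_constant (real DIM('a)) / (2 * pi) ^ (2 * DIM('a)) * enn2real (mean_energy j v)"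
    using E by (simp only: energy_const_sharp DIM_positive enn2real_ennreal)
qed

section \<open>Pair products that are radial in the difference\<close>

lemma continuous_fourier_integral:
  fixes f :: "'a::euclidean_space \<Rightarrow> complex"
  assumes f: "integrable lborel f"
  shows "continuous_on UNIV (fourier_integral f)"
proof (rule continuous_on_sequentiallyI)
  fix X :: "nat \<Rightarrow> 'a" and l assume X: "X \<longlonglongrightarrow> l"
  have [measurable]: "f \<in> borel_measurable borel" using borel_measurable_integrable[OF f] by simp
  show "(\<lambda>n. fourier_integral f (X n)) \<longlonglongrightarrow> fourier_integral f l"
    unfolding fourier_integral_def
  proof (rule integral_dominated_convergence[where w="\<lambda>x. cmod (f x)"])
    show "AE x in lborel. (\<lambda>n. f x * exp (- \<i> * of_real (x \<bullet> X n))) \<longlonglongrightarrow> f x * exp (- \<i> * of_real (x \<bullet> l))"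
      by (intro AE_I2 tendsto_intros X)
  qed (use f in \<open>simp_all add: norm_mult\<close>)
qed

lemma integral_mult_midpoint:
  fixes a b :: "'a::euclidean_space \<Rightarrow> complex"
  assumes a: "integrable lborel a" and b: "integrable lborel b"
  shows "(\<integral>x. a x \<partial>lborel) * (\<integral>x. b x \<partial>lborel) = (\<integral>z. \<integral>y. a (z /\<^sub>R 2 + y) * b (z /\<^sub>R 2 - y) \<partial>lborel \<partial>lborel)"
proof -
  have [measurable]: "a \<in> borel_measurable borel" "b \<in> borel_measurable borel"
    using borel_measurable_integrable[OF a] borel_measurable_integrable[OF b] by simp_all
  have shift: "(\<integral>z. g (z - x) \<partial>lborel) = (\<integral>z. g z \<partial>lborel)" if "g \<in> borel_measurable borel" for g :: "'a \<Rightarrow> complex" and x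
    using integral_translation[OF that, of "- x"] by simp
  have shiftr: "(\<integral>z. g (z - x) \<partial>lborel) = (\<integral>z. g z \<partial>lborel)" if "g \<in> borel_measurable borel" for g :: "'a \<Rightarrow> real" and x
    using integral_translation[OF that, of "- x"] by simp
  have bs: "integrable lborel (\<lambda>z. b (z - x))" for x
    using integrable_translation[of b "- x"] b by simp
  have i: "integrable (lborel \<Otimes>\<^sub>M lborel) (\<lambda>(x, z). a x * b (z - x))"
  proof (rule lborel_pair.Fubini_integrable)
    show "integrable lborel (\<lambda>x. \<integral>z. norm (case (x, z) of (x, z) \<Rightarrow> a x * b (z - x)) \<partial>lborel)"
      using a shiftr[of "\<lambda>z. cmod (b z)"] by (simp add: norm_mult)
    show "AE x in lborel. integrable lborel (\<lambda>z. case (x, z) of (x, z) \<Rightarrow> a x * b (z - x))"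
      using bs by (intro AE_I2) simp
  qed measurable
  have half: "z - (z /\<^sub>R 2 + y) = z /\<^sub>R 2 - y" for z y :: 'a
    by (simp add: algebra_simps flip: scaleR_left_distrib)
  have "(\<integral>x. a x \<partial>lborel) * (\<integral>x. b x \<partial>lborel) = (\<integral>x. a x * (\<integral>z. b (z - x) \<partial>lborel) \<partial>lborel)"
    by (simp add: shift)
  also have "\<dots> = (\<integral>x. \<integral>z. a x * b (z - x) \<partial>lborel \<partial>lborel)" by (simp only: integral_mult_right_zero)
  also have "\<dots> = (\<integral>z. \<integral>x. a x * b (z - x) \<partial>lborel \<partial>lborel)"
    by (rule lborel_pair.Fubini_integral[OF i, symmetric])
  also have "\<dots> = (\<integral>z. \<integral>y. a (z /\<^sub>R 2 + y) * b (z /\<^sub>R 2 - y) \<partial>lborel \<partial>lborel)"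
  proof (rule Bochner_Integration.integral_cong[OF refl])
    fix z :: 'a
    have "(\<integral>y. a (z /\<^sub>R 2 + y) * b (z - (z /\<^sub>R 2 + y)) \<partial>lborel) = (\<integral>x. a x * b (z - x) \<partial>lborel)"
      by (rule integral_translation[of "\<lambda>x. a x * b (z - x)" "z /\<^sub>R 2"]) measurable
    then show "(\<integral>x. a x * b (z - x) \<partial>lborel) = (\<integral>y. a (z /\<^sub>R 2 + y) * b (z /\<^sub>R 2 - y) \<partial>lborel)"
      by (simp only: half)
  qed
  finally show ?thesis .
qed

text \<open>Fubini against a Gaussian weight, which is rotation invariant.\<close>

lemma nn_integral_orthogonal:
  fixes R :: "'a::euclidean_space \<Rightarrow> 'a" and g :: "'a \<Rightarrow> ennreal"
  assumes R: "orthogonal_transformation R" and g[measurable]: "g \<in> borel_measurable borel"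
  shows "(\<integral>\<^sup>+x. g (R x) \<partial>lborel) = (\<integral>\<^sup>+x. g x \<partial>lborel)"
proof -
  have lin: "linear R" using R by (rule orthogonal_transformation_linear)
  have Rm[measurable]: "R \<in> borel_measurable borel"
    using lin by (intro borel_measurable_continuous_onI linear_continuous_on linear_conv_bounded_linear[THEN iffD1])
  \<comment> \<open>A right inverse of \<open>R\<close> turns a translation by \<open>x\<close>
    after \<open>R\<close> into a translation by \<open>S x\<close> before it, so translation
    invariance can be used.\<close>
  obtain S where S: "\<And>x. R (S x) = x"
    using orthogonal_transformation_surj[OF R] by (metis surj_f_inv_f)
  let ?f = "\<lambda>x::'a. ennreal (gauss 1 x)"
  define I where "I = (\<integral>\<^sup>+x. ?f x \<partial>lborel)"
  have fR: "?f (R x) = ?f x" for x using orthogonal_transformation_norm[OF R] by (simp add: gauss_def)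
  have Ival: "I = ennreal (sqrt (2 * pi) ^ DIM('a))"
    unfolding I_def using integrable_gauss[of 1] integral_gauss[of 1, where 'a='a]
    by (subst nn_integral_eq_integral) (simp_all add: gauss_nonneg)
  have "I * (\<integral>\<^sup>+y. g (R y) \<partial>lborel) = (\<integral>\<^sup>+x. ?f x * (\<integral>\<^sup>+y. g (R y) \<partial>lborel) \<partial>lborel)"
    unfolding I_def by (rule nn_integral_multc[symmetric]) measurable
  also have "\<dots> = (\<integral>\<^sup>+x. \<integral>\<^sup>+y. ?f x * g (R y + x) \<partial>lborel \<partial>lborel)"
  proof (rule nn_integral_cong)
    fix x
    have "(\<integral>\<^sup>+y. g (R (S x + y)) \<partial>lborel) = (\<integral>\<^sup>+y. g (R y) \<partial>lborel)"
      by (rule nn_integral_translation[of "\<lambda>y. g (R y)" "S x"]) measurable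
    then have "(\<integral>\<^sup>+y. g (R y) \<partial>lborel) = (\<integral>\<^sup>+y. g (R y + x) \<partial>lborel)"
      by (simp only: linear_add[OF lin] S add.commute)
    then show "?f x * (\<integral>\<^sup>+y. g (R y) \<partial>lborel) = (\<integral>\<^sup>+y. ?f x * g (R y + x) \<partial>lborel)"
      by (simp add: nn_integral_cmult)
  qed
  also have "\<dots> = (\<integral>\<^sup>+y. \<integral>\<^sup>+x. ?f x * g (R y + x) \<partial>lborel \<partial>lborel)"
    by (rule lborel_pair.Fubini') measurable
  also have "\<dots> = (\<integral>\<^sup>+y. \<integral>\<^sup>+x. ?f (x - R y) * g x \<partial>lborel \<partial>lborel)"
  proof (rule nn_integral_cong)
    fix y
    have "(\<integral>\<^sup>+x. ?f ((R y + x) - R y) * g (R y + x) \<partial>lborel) = (\<integral>\<^sup>+x. ?f (x - R y) * g x \<partial>lborel)"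
      by (rule nn_integral_translation[of "\<lambda>x. ?f (x - R y) * g x" "R y"]) measurable
    then show "(\<integral>\<^sup>+x. ?f x * g (R y + x) \<partial>lborel) = (\<integral>\<^sup>+x. ?f (x - R y) * g x \<partial>lborel)" by simp
  qed
  also have "\<dots> = (\<integral>\<^sup>+x. \<integral>\<^sup>+y. ?f (x - R y) * g x \<partial>lborel \<partial>lborel)"
    by (rule lborel_pair.Fubini') measurable
  also have "\<dots> = (\<integral>\<^sup>+x. I * g x \<partial>lborel)"
  proof (rule nn_integral_cong)
    fix x
    have "x - R y = R (S x - y)" for y by (simp only: linear_diff[OF lin] S)
    then have "(\<integral>\<^sup>+y. ?f (x - R y) \<partial>lborel) = (\<integral>\<^sup>+y. ?f (S x - y) \<partial>lborel)" by (simp only: fR)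
    also have "\<dots> = I" unfolding I_def by (rule nn_integral_reflection) measurable
    finally show "(\<integral>\<^sup>+y. ?f (x - R y) * g x \<partial>lborel) = I * g x"
      by (simp add: nn_integral_multc)
  qed
  also have "\<dots> = I * (\<integral>\<^sup>+x. g x \<partial>lborel)" by (rule nn_integral_cmult) measurable
  \<comment> \<open>The Gaussian mass is neither 0 nor infinite, so it cancels.\<close>
  finally show ?thesis unfolding Ival by (subst (asm) ennreal_mult_cancel_left) simp
qed

lemma distr_lborel_orthogonal:
  fixes R :: "'a::euclidean_space \<Rightarrow> 'a"
  assumes R: "orthogonal_transformation R"
  shows "distr lborel borel R = lborel"
proof (rule measure_eqI)
  have Rm: "R \<in> borel_measurable borel"
    using orthogonal_transformation_linear[OF R]
    by (intro borel_measurable_continuous_onI linear_continuous_on linear_conv_bounded_linear[THEN iffD1])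
  fix A assume "A \<in> sets (distr lborel borel R)"
  then have A: "A \<in> sets borel" by simp
  have "emeasure (distr lborel borel R) A = (\<integral>\<^sup>+x. indicator A x \<partial>distr lborel borel R)" using A by simp
  also have "\<dots> = (\<integral>\<^sup>+x. indicator A (R x) \<partial>lborel)" using A Rm by (intro nn_integral_distr) simp_all
  also have "\<dots> = (\<integral>\<^sup>+x. indicator A x \<partial>lborel)" using A by (intro nn_integral_orthogonal[OF R]) simp
  also have "\<dots> = emeasure lborel A" using A by simp
  finally show "emeasure (distr lborel borel R) A = emeasure lborel A" .
qed simp

text \<open>Vanishing variance, phrased without measures on spheres. The quantifiers are nested so
  that each fibre over \<open>z\<close> can be treated by itself.\<close>

definition radial_pairs :: "(real^'n \<Rightarrow> complex) \<Rightarrow> bool" where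
  "radial_pairs v \<longleftrightarrow> (\<exists>W. AE z in lborel. AE y in lborel. pair_product v z y = W z (norm y))"

text \<open>The product of two values of the transform is the transform of the pair product at the
  frequencies (x + y)/2 and x - y. A rotation taking x - y to x' - y' preserves Lebesgue measure and
  the pair product, hence the value. The hypothesis holds almost everywhere, the conclusion at every
  point.\<close>

lemma fourier_product_invariant:
  fixes w :: "real^'n \<Rightarrow> complex"
  assumes w: "integrable lborel w" and rad: "radial_pairs w"
    and s: "x + y = x' + y'" and d: "norm (x - y) = norm (x' - y')"
  shows "fourier_integral w x * fourier_integral w y = fourier_integral w x' * fourier_integral w y'"
proof -
  have [measurable]: "w \<in> borel_measurable borel" using borel_measurable_integrable[OF w] by simp
  obtain W where W: "AE z in lborel. AE y in lborel. pair_product w z y = W z (norm y)"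
    using rad unfolding radial_pairs_def by blast
  obtain R where R: "orthogonal_transformation R" "R (x - y) = x' - y'"
    using orthogonal_transformation_exists[OF d] .
  have Rm[measurable]: "R \<in> borel_measurable borel"
    using orthogonal_transformation_linear[OF R(1)]
    by (intro borel_measurable_continuous_onI linear_continuous_on linear_conv_bounded_linear[THEN iffD1])
  have expand: "fourier_integral w a * fourier_integral w b
    = (\<integral>z. \<integral>\<eta>. exp (- \<i> * of_real (z \<bullet> (a + b) / 2)) * (pair_product w z \<eta> * exp (- \<i> * of_real (\<eta> \<bullet> (a - b)))) \<partial>lborel \<partial>lborel)" for a b
  proof -
    have e: "exp (- \<i> * of_real ((z /\<^sub>R 2 + \<eta>) \<bullet> a)) * exp (- \<i> * of_real ((z /\<^sub>R 2 - \<eta>) \<bullet> b))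
        = exp (- \<i> * of_real (z \<bullet> (a + b) / 2)) * exp (- \<i> * of_real (\<eta> \<bullet> (a - b)))" for z \<eta> :: "real^'n"
      unfolding exp_add[symmetric] by (rule arg_cong[where f=exp]) (simp add: inner_simps field_simps)
    have "(w (z /\<^sub>R 2 + \<eta>) * exp (- \<i> * of_real ((z /\<^sub>R 2 + \<eta>) \<bullet> a))) * (w (z /\<^sub>R 2 - \<eta>) * exp (- \<i> * of_real ((z /\<^sub>R 2 - \<eta>) \<bullet> b)))
       = exp (- \<i> * of_real (z \<bullet> (a + b) / 2)) * (pair_product w z \<eta> * exp (- \<i> * of_real (\<eta> \<bullet> (a - b))))" for z \<eta>
    proof -
      have g1: "(p * q) * (r * t) = (q * t) * (p * r)" and g2: "c * (d * q) = (c * q) * d"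
        for p q r t c d :: complex by (simp_all only: mult_ac)
      show ?thesis unfolding pair_product_def by (rule trans[OF g1], subst e, rule g2[symmetric])
    qed
    then show ?thesis
      using integral_mult_midpoint[OF integrable_fourier_kernel(1)[OF w, of a] integrable_fourier_kernel(1)[OF w, of b]]
      unfolding fourier_integral_def by (simp only:)
  qed
  show ?thesis
    unfolding expand s
  proof (rule integral_cong_AE)
    show "AE z in lborel. (\<integral>\<eta>. exp (- \<i> * of_real (z \<bullet> (x' + y') / 2)) * (pair_product w z \<eta> * exp (- \<i> * of_real (\<eta> \<bullet> (x - y)))) \<partial>lborel)
      = (\<integral>\<eta>. exp (- \<i> * of_real (z \<bullet> (x' + y') / 2)) * (pair_product w z \<eta> * exp (- \<i> * of_real (\<eta> \<bullet> (x' - y')))) \<partial>lborel)"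
      using W
    proof eventually_elim
      case (elim z)
      let ?c = "exp (- \<i> * of_real (z \<bullet> (x' + y') / 2))"
      let ?G = "\<lambda>\<eta>. ?c * (pair_product w z \<eta> * exp (- \<i> * of_real (\<eta> \<bullet> (x' - y'))))"
      have "(\<integral>\<eta>. ?G \<eta> \<partial>lborel) = (\<integral>\<eta>. ?G (R \<eta>) \<partial>lborel)"
        by (subst distr_lborel_orthogonal[OF R(1), symmetric], subst integral_distr) simp_all
      also have "\<dots> = (\<integral>\<eta>. ?c * (pair_product w z \<eta> * exp (- \<i> * of_real (\<eta> \<bullet> (x - y)))) \<partial>lborel)"
      proof (rule integral_cong_AE)
        \<comment> \<open>Since \<open>R\<close> preserves Lebesgue measure, the exceptional null
          set can be pulled back along \<open>R\<close>.\<close>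
        have "AE \<eta> in distr lborel lborel R. pair_product w z \<eta> = W z (norm \<eta>)"
        proof -
          have "distr lborel lborel R = distr lborel borel R" by (rule distr_cong) simp_all
          then show ?thesis using elim by (simp only: distr_lborel_orthogonal[OF R(1)])
        qed
        then have "AE \<eta> in lborel. pair_product w z (R \<eta>) = W z (norm (R \<eta>))"
          by (rule AE_distrD[rotated]) simp
        then show "AE \<eta> in lborel. ?G (R \<eta>) = ?c * (pair_product w z \<eta> * exp (- \<i> * of_real (\<eta> \<bullet> (x - y))))"
          using elim
        proof eventually_elim
          case (elim \<eta>)
          have "R \<eta> \<bullet> (x' - y') = \<eta> \<bullet> (x - y)"
            using R by (metis orthogonal_transformation_def)
          moreover have "norm (R \<eta>) = norm \<eta>" using R(1) by (rule orthogonal_transformation_norm)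
          ultimately show ?case using elim by (simp only:)
        qed
      qed measurable
      finally show ?case by simp
    qed
  qed measurable
qed

text \<open>The values lie in 2 pi i times the integers, a set with gaps of length 2 pi, so a
  continuous function on the connected line is constant.\<close>

lemma continuous_exp_eq_1_imp_0:
  fixes g :: "real \<Rightarrow> complex"
  assumes c: "continuous_on UNIV g" and e: "\<And>t. exp (g t) = 1" and 0: "g 0 = 0"
  shows "g t = 0"
proof -
  have "g constant_on UNIV"
  proof (rule continuous_discrete_range_constant[OF connected_UNIV c])
    fix t :: real
    show "\<exists>\<epsilon>>0. \<forall>y. y \<in> UNIV \<and> g y \<noteq> g t \<longrightarrow> \<epsilon> \<le> norm (g y - g t)"
    proof (intro exI[of _ "2 * pi"] conjI allI impI)
      fix y assume "y \<in> UNIV \<and> g y \<noteq> g t"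
      moreover have "exp (g y - g t) = 1" by (simp add: exp_diff e)
      then obtain n :: int where "Re (g y - g t) = 0" "Im (g y - g t) = of_int (2 * n) * pi"
        unfolding exp_eq_1 by blast
      moreover from this have n: "g y - g t = \<i> * of_real (of_int (2 * n) * pi)" by (intro complex_eqI) simp_all
      ultimately have "n \<noteq> 0" by auto
      then have "\<bar>n\<bar> \<ge> 1" by simp
      then have "\<bar>real_of_int n\<bar> \<ge> 1" by linarith
      moreover have "norm (g y - g t) = 2 * \<bar>real_of_int n\<bar> * pi" unfolding n by (simp add: norm_mult abs_mult)
      ultimately show "2 * pi \<le> norm (g y - g t)" by simp
    qed simp
  qed
  then show ?thesis using 0 unfolding constant_on_def by (metis UNIV_I)
qed

lemma continuous_log_real:
  fixes f :: "real \<Rightarrow> complex"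
  assumes c: "continuous_on UNIV f" and nz: "\<And>t. f t \<noteq> 0" and 1: "f 0 = 1"
  obtains L where "continuous_on UNIV L" "\<And>t. f t = exp (L t)" "L 0 = 0"
proof -
  obtain g where g: "continuous_on UNIV g" "\<And>t. t \<in> UNIV \<Longrightarrow> f t = exp (g t)"
    using continuous_logarithm_on_contractible[OF c] nz convex_imp_contractible[OF convex_UNIV] by metis
  have "exp (g 0) = 1" using g(2)[of 0] 1 by simp
  then have "f t = exp (g t - g 0)" for t using g(2)[of t] by (simp add: exp_diff)
  moreover have "continuous_on UNIV (\<lambda>t. g t - g 0)" by (intro continuous_intros g)
  ultimately show ?thesis using that[of "\<lambda>t. g t - g 0"] by simp
qed

section \<open>The functional equation of quadratic functions\<close>

lemma dyadic_floor_tendsto: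
  fixes x :: real
  shows "(\<lambda>k. of_int \<lfloor>2 ^ k * x\<rfloor> / 2 ^ k) \<longlonglongrightarrow> x"
proof -
  have "(\<lambda>k. of_int \<lfloor>2 ^ k * x\<rfloor> / 2 ^ k - x) \<longlonglongrightarrow> 0"
  proof (rule Lim_null_comparison)
    show "\<forall>\<^sub>F k in sequentially. norm (of_int \<lfloor>2 ^ k * x\<rfloor> / 2 ^ k - x) \<le> (1 / 2) ^ k"
    proof (intro always_eventually allI)
      fix k :: nat
      have "\<bar>of_int \<lfloor>2 ^ k * x\<rfloor> - 2 ^ k * x\<bar> \<le> 1" by linarith
      then have "\<bar>of_int \<lfloor>2 ^ k * x\<rfloor> - 2 ^ k * x\<bar> / 2 ^ k \<le> 1 / 2 ^ k" by (intro divide_right_mono) simp_all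
      moreover have "of_int \<lfloor>2 ^ k * x\<rfloor> / 2 ^ k - x = (of_int \<lfloor>2 ^ k * x\<rfloor> - 2 ^ k * x) / 2 ^ k"
        by (simp add: diff_divide_distrib)
      ultimately show "norm (of_int \<lfloor>2 ^ k * x\<rfloor> / 2 ^ k - x) \<le> (1 / 2) ^ k"
        by (simp add: power_one_over)
    qed
  qed (rule LIMSEQ_power_zero, simp)
  then show ?thesis by (rule LIM_zero_cancel)
qed

text \<open>Subtracting the quadratic interpolating at \<open>-1, 0, 1\<close> leaves a solution that vanishes at
  the integers and then, by halving the step, at all dyadic rationals.\<close>

lemma quadratic_functional_equation:
  fixes L :: "real \<Rightarrow> complex"
  assumes c: "continuous_on UNIV L" and eq: "\<And>m r. L (m + r) + L (m - r) = 2 * L m + (L r + L (- r))" and L0: "L 0 = 0"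
  obtains a b where "\<And>t. L t = a * of_real (t\<^sup>2) + b * of_real t"
proof -
  define a where "a = (L 1 + L (- 1)) / 2"
  define b where "b = (L 1 - L (- 1)) / 2"
  define G where "G t = L t - (a * of_real (t\<^sup>2) + b * of_real t)" for t
  have Gc: "continuous_on UNIV G" unfolding G_def by (intro continuous_intros c)
  have Geq: "G (m + r) + G (m - r) = 2 * G m + (G r + G (- r))" for m r
  proof -
    have "G (m + r) + G (m - r) - (2 * G m + (G r + G (- r))) = (L (m + r) + L (m - r)) - (2 * L m + (L r + L (- r)))"
      unfolding G_def by (simp add: power2_sum power2_diff algebra_simps)
    then show ?thesis using eq[of m r] by simp
  qed
  have G0: "G 0 = 0" using L0 by (simp add: G_def)
  have G1: "G 1 = 0" "G (- 1) = 0" by (simp_all add: G_def a_def b_def field_simps)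
  have dy: "G ((1 / 2) ^ k) = 0 \<and> G (- ((1 / 2) ^ k)) = 0" for k
  proof (induction k)
    case (Suc k)
    let ?r = "(1 / 2 :: real) ^ Suc k"
    have r2: "?r + ?r = (1 / 2) ^ k" by simp
    \<comment> \<open>The equation at (r, r) and at (-r, r) gives 3 G(r) + G(-r) = 0 and G(r) + 3
      G(-r) = 0.\<close>
    have 1: "0 = 2 * G ?r + (G ?r + G (- ?r))" using Geq[of ?r ?r] Suc G0 unfolding r2 by simp
    have 2: "0 = 2 * G (- ?r) + (G ?r + G (- ?r))"
    proof -
      have "- ?r - ?r = - ((1 / 2) ^ k)" using r2 by linarith
      then show ?thesis using Geq[of "- ?r" ?r] Suc G0 by simp
    qed
    have "2 * G ?r + (G ?r + G (- ?r)) = 2 * G (- ?r) + (G ?r + G (- ?r))" using 1 2 by (rule trans[OF sym])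
    then have "G ?r = G (- ?r)" by (simp only: add_right_cancel) simp
    with 1 show ?case by simp
  qed (simp add: G1)
  \<comment> \<open>With step r the right-hand side of the equation is now 0, so two consecutive
    zeros determine the next one; both signs are carried along.\<close>
  have nat: "G (real n * (1 / 2) ^ k) = 0 \<and> G (- (real n * (1 / 2) ^ k)) = 0" for n k
  proof (induction n rule: induct_nat_012)
    case (ge2 n)
    define r where "r = (1 / 2 :: real) ^ k"
    define a where "a = real (Suc n) * r"
    have a: "a + r = real (Suc (Suc n)) * r" "a - r = real n * r"
      "- a + r = - (real n * r)" "- a - r = - (real (Suc (Suc n)) * r)"
      by (simp_all add: a_def algebra_simps)
    have IH: "G a = 0" "G (- a) = 0" "G (real n * r) = 0" "G (- (real n * r)) = 0" "G r = 0" "G (- r) = 0"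
      using ge2 dy[of k] by (simp_all only: a_def r_def)
    have "G (a + r) + G (a - r) = 0" "G (- a + r) + G (- a - r) = 0"
      unfolding Geq IH by simp_all
    then have "G (real (Suc (Suc n)) * r) = 0 \<and> G (- (real (Suc (Suc n)) * r)) = 0"
      unfolding a IH by simp
    then show ?case by (simp only: r_def)
  qed (use G0 dy[of k] in simp_all)
  have int: "G (of_int i / 2 ^ k) = 0" for i k
  proof (cases "i \<ge> 0")
    case True
    then have "real_of_int i / 2 ^ k = real (nat i) * (1 / 2) ^ k" by (simp add: power_one_over)
    then show ?thesis using nat by simp
  next
    case False
    then have "real_of_int i / 2 ^ k = - (real (nat (- i)) * (1 / 2) ^ k)" by (simp add: power_one_over)
    then show ?thesis using nat by simp
  qed
  have "G x = 0" for x
  proof -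
    have "isCont G x" using Gc by (simp add: continuous_on_eq_continuous_at)
    from isCont_tendsto_compose[OF this dyadic_floor_tendsto]
    have "(\<lambda>k. G (of_int \<lfloor>2 ^ k * x\<rfloor> / 2 ^ k)) \<longlonglongrightarrow> G x" .
    then have "(\<lambda>k::nat. 0) \<longlonglongrightarrow> G x" by (simp only: int)
    then show ?thesis by (simp add: LIMSEQ_const_iff)
  qed
  then have "L t = a * of_real (t\<^sup>2) + b * of_real t" for t by (simp add: G_def)
  then show ?thesis by (rule that)
qed

text \<open>The common form of both Gaussian classes, with no sign imposed on the real part of
  \<open>a\<close>: functions are first shown to have this form, and decay is then read off from
  square integrability.\<close>

definition gauss_exp :: "complex \<Rightarrow> complex^'n \<Rightarrow> complex \<Rightarrow> real^'n \<Rightarrow> complex" where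
  "gauss_exp a b c x = exp (a * of_real ((norm x)\<^sup>2) + (\<Sum>j\<in>UNIV. b $ j * of_real (x $ j)) + c)"

text \<open>Turning the difference of a pair from one coordinate axis to another yields a functional
  equation along each axis, and orthogonal vectors give multiplicativity across the axes. Both rely
  on a second direction.\<close>

lemma pair_invariant_imp_gauss_exp:
  fixes f :: "real^'n \<Rightarrow> complex"
  assumes n: "CARD('n) \<ge> 2" and c: "continuous_on UNIV f" and p: "f p \<noteq> 0"
    and inv: "\<And>x y x' y'. x + y = x' + y' \<Longrightarrow> norm (x - y) = norm (x' - y') \<Longrightarrow> f x * f y = f x' * f y'"
  obtains A b k where "f = gauss_exp A b k"
proof -
  have nz: "f x \<noteq> 0" for x
  proof (rule ccontr)
    assume "\<not> f x \<noteq> 0"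
    then have ne: "{x. f x = 0} \<noteq> {}" by auto
    have cl: "closed {x. f x = 0}" using closed_Collect_eq[OF c continuous_on_const[of UNIV 0]] by simp
    \<comment> \<open>A zero nearest to \<open>p\<close>. On the sphere with diameter from
      \<open>p\<close> to \<open>x0\<close>, the ends of a perpendicular diameter have the same
      product of values, namely 0; so one of them is a zero, at distance |h| / sqrt 2 from
      \<open>p\<close>, which is too close.\<close>
    obtain x0 where x0: "f x0 = 0" "\<And>y. f y = 0 \<Longrightarrow> dist p x0 \<le> dist p y"
      using distance_attains_inf[OF cl ne, of p] by auto
    define h where "h = x0 - p"
    have h: "norm h > 0" using x0 p by (auto simp: h_def)
    obtain e0 where e0: "e0 \<noteq> 0" "orthogonal h e0"
      using orthogonal_to_vector_exists[of h] n by auto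
    define e where "e = (norm h / (2 * norm e0)) *\<^sub>R e0"
    have e: "norm e = norm h / 2" "h \<bullet> e = 0" using e0 by (simp_all add: e_def orthogonal_def)
    have eq: "f x0 * f p = f (p + h /\<^sub>R 2 + e) * f (p + h /\<^sub>R 2 - e)"
    proof (rule inv)
      have hh: "h /\<^sub>R 2 + h /\<^sub>R 2 = h" by (simp flip: scaleR_left_distrib)
      have "(p + h /\<^sub>R 2 + e) + (p + h /\<^sub>R 2 - e) = p + p + (h /\<^sub>R 2 + h /\<^sub>R 2)" by (simp add: algebra_simps)
      then show "x0 + p = (p + h /\<^sub>R 2 + e) + (p + h /\<^sub>R 2 - e)" unfolding hh by (simp add: h_def)
      have "(p + h /\<^sub>R 2 + e) - (p + h /\<^sub>R 2 - e) = 2 *\<^sub>R e" by (simp add: scaleR_2)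
      then show "norm (x0 - p) = norm ((p + h /\<^sub>R 2 + e) - (p + h /\<^sub>R 2 - e))" using e(1) by (simp add: h_def)
    qed
    have close: "f (p + h /\<^sub>R 2 + s *\<^sub>R e) \<noteq> 0" if s: "s\<^sup>2 = 1" for s
    proof
      assume z: "f (p + h /\<^sub>R 2 + s *\<^sub>R e) = 0"
      have "(dist p (p + h /\<^sub>R 2 + s *\<^sub>R e))\<^sup>2 = (norm (h /\<^sub>R 2 + s *\<^sub>R e))\<^sup>2"
      proof -
        have "p - (p + h /\<^sub>R 2 + s *\<^sub>R e) = - (h /\<^sub>R 2 + s *\<^sub>R e)" by simp
        then show ?thesis unfolding dist_norm by (simp only: norm_minus_cancel)
      qed
      also have "\<dots> = (norm h)\<^sup>2 / 4 + s\<^sup>2 * (norm e)\<^sup>2"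
        unfolding power2_norm_eq_inner inner_add_left inner_add_right inner_scaleR_left inner_scaleR_right
        using e(2) by (simp add: inner_commute power2_eq_square)
      also have "\<dots> = (norm h)\<^sup>2 / 2" unfolding e(1) s power_divide by simp
      also have "\<dots> < (norm h)\<^sup>2" using h by simp
      finally have "dist p (p + h /\<^sub>R 2 + s *\<^sub>R e) < norm h" by (rule power2_less_imp_less) simp
      moreover have "norm h = dist p x0" by (simp add: h_def dist_norm norm_minus_commute)
      ultimately show False using x0(2)[OF z] by simp
    qed
    show False using eq x0(1) close[of 1] close[of "-1"] by simp
  qed
  define F where "F x = f x / f 0" for x
  have Fnz: "F x \<noteq> 0" for x using nz by (simp add: F_def)
  have F0: "F 0 = 1" using nz by (simp add: F_def)
  have Fc: "continuous_on UNIV F" unfolding F_def by (intro continuous_intros c) (use nz in auto)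
  have Finv: "F x * F y = F x' * F y'" if "x + y = x' + y'" "norm (x - y) = norm (x' - y')" for x y x' y'
    using inv[OF that] by (simp add: F_def)
  \<comment> \<open>For orthogonal vectors the pairs (x, y) and (x + y, 0) have the same sum and the
    same distance.\<close>
  have Forth: "F (x + y) = F x * F y" if "x \<bullet> y = 0" for x y
  proof -
    have "(norm (x - y))\<^sup>2 = (norm (x + y))\<^sup>2"
      using that by (simp add: power2_norm_eq_inner inner_simps inner_commute)
    then have "norm (x - y) = norm (x + y - 0)" by (simp add: power2_eq_iff_nonneg)
    from Finv[OF _ this] show ?thesis using F0 by simp
  qed
  define ph where "ph j t = F (t *\<^sub>R axis j 1)" for j :: 'n and t :: real
  have ax: "axis i (1::real) \<bullet> axis j 1 = (if i = j then 1 else 0)" for i j :: 'n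
    by (simp add: inner_axis_axis)
  have phc: "continuous_on UNIV (ph j)" for j
    unfolding ph_def by (rule continuous_on_compose2[OF Fc]) (auto intro!: continuous_intros)
  have phnz: "ph j t \<noteq> 0" for j t by (simp add: ph_def Fnz)
  have ph0: "ph j 0 = 1" for j by (simp add: ph_def F0)
  \<comment> \<open>The points m + r and m - r on axis i are traded for m e_i + r e_j and m e_i - r
    e_j, where the values factorise by orthogonality.\<close>
  have cross: "ph i (m + r) * ph i (m - r) = (ph i m)\<^sup>2 * (ph j r * ph j (- r))" if ij: "i \<noteq> j" for i j m r
  proof -
    have "ph i (m + r) * ph i (m - r) = F (m *\<^sub>R axis i 1 + r *\<^sub>R axis j 1) * F (m *\<^sub>R axis i 1 + (- r) *\<^sub>R axis j 1)"
      unfolding ph_def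
    proof (rule Finv)
      show "(m + r) *\<^sub>R axis i 1 + (m - r) *\<^sub>R axis i 1 = (m *\<^sub>R axis i 1 + r *\<^sub>R axis j 1) + (m *\<^sub>R axis i 1 + (- r) *\<^sub>R axis j (1::real))"
        by (simp add: algebra_simps)
      have "(m + r) *\<^sub>R axis i 1 - (m - r) *\<^sub>R axis i (1::real) = (2 * r) *\<^sub>R axis i 1"
        "(m *\<^sub>R axis i 1 + r *\<^sub>R axis j 1) - (m *\<^sub>R axis i 1 + (- r) *\<^sub>R axis j (1::real)) = (2 * r) *\<^sub>R axis j 1"
        by (simp_all only: add_diff_cancel_left scaleR_left_diff_distrib[symmetric]) simp_all
      then show "norm ((m + r) *\<^sub>R axis i 1 - (m - r) *\<^sub>R axis i (1::real))
          = norm ((m *\<^sub>R axis i 1 + r *\<^sub>R axis j 1) - (m *\<^sub>R axis i 1 + (- r) *\<^sub>R axis j (1::real)))"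
        by (simp only: norm_scaleR norm_axis_1)
    qed
    also have "\<dots> = (ph i m * ph j r) * (ph i m * ph j (- r))"
      unfolding ph_def using ax[of i j] ij by (simp only: Forth inner_scaleR_left inner_scaleR_right if_False mult_zero_right)
    finally show ?thesis by (simp add: power2_eq_square)
  qed
  have other: "\<exists>j. i \<noteq> j" for i :: 'n
  proof (rule ccontr)
    assume "\<not> (\<exists>j. i \<noteq> j)"
    then have "UNIV = {i}" by auto
    then have "CARD('n) = 1" by (metis card.empty card_insert_disjoint One_nat_def finite.emptyI empty_iff)
    then show False using n by simp
  qed
  have k: "ph i r * ph i (- r) = ph j r * ph j (- r)" for i j r
    using cross[of i j 0 r] ph0 by (cases "i = j") simp_all
  have step: "ph i (m + r) * ph i (m - r) = (ph i m)\<^sup>2 * (ph i r * ph i (- r))" for i m r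
    using other[of i] cross[of i] k by metis
  have "\<exists>a b. \<forall>t. ph i t = exp (a * of_real (t\<^sup>2) + b * of_real t)" for i
  proof -
    obtain L where L: "continuous_on UNIV L" "\<And>t. ph i t = exp (L t)" "L 0 = 0"
      by (rule continuous_log_real[OF phc[of i] phnz ph0], rule that)
    have "L (m + r) + L (m - r) = 2 * L m + (L r + L (- r))" for m r
    proof -
      \<comment> \<open>The equation for the logarithm is known only modulo 2 pi i. Its defect is
        continuous in \<open>r\<close> and is 0 at \<open>r = 0\<close>, hence vanishes.\<close>
      define E where "E r = L (m + r) + L (m - r) - (2 * L m + (L r + L (- r)))" for r
      have "E r = 0"
      proof (rule continuous_exp_eq_1_imp_0)
        have c1: "continuous_on UNIV (\<lambda>r. L (g r))" if "continuous_on UNIV g" for g :: "real \<Rightarrow> real"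
          by (rule continuous_on_compose2[OF L(1) that]) simp
        show "continuous_on UNIV E" unfolding E_def by (intro continuous_intros c1)
        show "E 0 = 0" using L(3) by (simp add: E_def)
        fix r
        have "exp (E r) = (exp (L (m + r)) * exp (L (m - r))) / ((exp (L m))\<^sup>2 * (exp (L r) * exp (L (- r))))"
          unfolding E_def exp_diff exp_add exp_double ..
        also have "\<dots> = 1" unfolding L(2)[symmetric] step[of i m r] using phnz by simp
        finally show "exp (E r) = 1" .
      qed
      then show ?thesis by (simp add: E_def)
    qed
    from quadratic_functional_equation[OF L(1) this L(3)]
    obtain a b where "\<And>t. L t = a * of_real (t\<^sup>2) + b * of_real t" by blast
    then show ?thesis using L(2) by auto
  qed
  then obtain a b where ab: "\<And>i t. ph i t = exp (a i * of_real (t\<^sup>2) + b i * of_real t)" by metis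
  \<comment> \<open>By \<open>k\<close> the products \<open>ph i t * ph i (- t)\<close> agree on all
    axes, which fixes the quadratic coefficients modulo 2 pi i for every \<open>t\<close>;
    continuity in \<open>t\<close> removes the ambiguity.\<close>
  have same: "a i = a j" for i j
  proof -
    have "2 * (a i - a j) * of_real (1\<^sup>2) = 0"
    proof (rule continuous_exp_eq_1_imp_0[where g="\<lambda>t. 2 * (a i - a j) * of_real (t\<^sup>2)"])
      show "continuous_on UNIV (\<lambda>t. 2 * (a i - a j) * of_real (t\<^sup>2))" by (intro continuous_intros)
      fix t
      have kk: "ph l t * ph l (- t) = exp (2 * a l * of_real (t\<^sup>2))" for l
        unfolding ab exp_add[symmetric] by (rule arg_cong[where f=exp]) (simp add: algebra_simps)
      have "exp (2 * (a i - a j) * of_real (t\<^sup>2)) = exp (2 * a i * of_real (t\<^sup>2)) / exp (2 * a j * of_real (t\<^sup>2))"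
        unfolding exp_diff[symmetric] by (rule arg_cong[where f=exp]) (simp add: algebra_simps)
      then show "exp (2 * (a i - a j) * of_real (t\<^sup>2)) = 1"
        unfolding kk[symmetric] k[of i t j] using phnz by simp
    qed simp
    then show ?thesis by simp
  qed
  obtain A where A: "\<And>i. a i = A" using same by metis
  have prod: "F (\<Sum>j\<in>S. x $ j *\<^sub>R axis j 1) = (\<Prod>j\<in>S. ph j (x $ j))" if "finite S" for S x
    using that
  proof induction
    case (insert i S)
    have "(x $ i *\<^sub>R axis i (1::real)) \<bullet> (\<Sum>j\<in>S. x $ j *\<^sub>R axis j 1) = (\<Sum>j\<in>S. x $ i * (x $ j * (axis i (1::real) \<bullet> axis j 1)))"
      by (simp add: inner_sum_right sum_distrib_left mult_ac)
    also have "\<dots> = 0" using insert by (intro sum.neutral) (auto simp: ax)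
    finally show ?case using insert by (simp add: Forth ph_def)
  qed (simp add: F0)
  obtain k where k: "f 0 = exp k" using nz[of 0] exp_Ln by metis
  have "f x = gauss_exp A (\<chi> j. b j) k x" for x
  proof -
    have "x = (\<Sum>j\<in>UNIV. x $ j *\<^sub>R axis j 1)"
      using basis_expansion[of x] by (simp add: scalar_mult_eq_scaleR)
    then have "F x = (\<Prod>j\<in>UNIV. ph j (x $ j))" using prod[of UNIV x] by simp
    also have "\<dots> = exp (\<Sum>j\<in>UNIV. A * of_real ((x $ j)\<^sup>2) + b j * of_real (x $ j))"
      by (simp add: ab A exp_sum)
    also have "(\<Sum>j\<in>UNIV. A * of_real ((x $ j)\<^sup>2) + b j * of_real (x $ j)) = A * of_real ((norm x)\<^sup>2) + (\<Sum>j\<in>UNIV. b j * of_real (x $ j))"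
    proof -
      have "(norm x)\<^sup>2 = (\<Sum>j\<in>UNIV. (x $ j)\<^sup>2)"
        unfolding power2_norm_eq_inner inner_vec_def by (simp add: power2_eq_square)
      then show ?thesis by (simp add: sum.distrib sum_distrib_left)
    qed
    finally have "F x = exp (A * of_real ((norm x)\<^sup>2) + (\<Sum>j\<in>UNIV. b j * of_real (x $ j)))" .
    moreover have "f x = F x * f 0" using nz by (simp add: F_def)
    ultimately show ?thesis by (simp add: gauss_exp_def k exp_add)
  qed
  then show ?thesis using that by blast
qed

section \<open>Complex Gaussians and the rigidity of radial pair products\<close>

lemma not_AE_False_lborel: "\<not> (AE x in (lborel :: 'a::euclidean_space measure). False)"
  unfolding eventually_False trivial_limit_def[symmetric] ae_filter_eq_bot_iff by simp

lemma norm_gauss_exp: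
  "cmod (gauss_exp a b c x) = exp (Re a * (norm x)\<^sup>2 + (\<chi> j. Re (b $ j)) \<bullet> x + Re c)"
  by (simp add: gauss_exp_def norm_exp_eq_Re inner_vec_def)

lemma gauss_exp_nonzero: "gauss_exp a b c x \<noteq> 0"
  by (simp add: gauss_exp_def)

lemma continuous_gauss_exp: "continuous_on UNIV (gauss_exp a b c)"
  unfolding gauss_exp_def[abs_def] by (intro continuous_intros)

lemma gauss_exp_measurable[measurable]: "gauss_exp a b c \<in> borel_measurable borel"
  by (rule borel_measurable_continuous_onI[OF continuous_gauss_exp])

lemma gauss_exp_minus: "gauss_exp a b c (- x) = gauss_exp a (- b) c x"
  by (simp add: gauss_exp_def)

lemma pair_product_gauss_exp:
  "pair_product (gauss_exp a b c) z y
    = exp (a * of_real ((norm z)\<^sup>2 / 2 + 2 * (norm y)\<^sup>2) + (\<Sum>j\<in>UNIV. b $ j * of_real (z $ j)) + 2 * c)"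
proof -
  have s: "(\<Sum>j\<in>UNIV. b $ j * of_real ((z /\<^sub>R 2 + y) $ j)) + (\<Sum>j\<in>UNIV. b $ j * of_real ((z /\<^sub>R 2 - y) $ j))
      = (\<Sum>j\<in>UNIV. b $ j * of_real (z $ j))"
    unfolding sum.distrib[symmetric] by (intro sum.cong) (simp_all add: field_simps)
  have "pair_product (gauss_exp a b c) z y = exp (a * of_real ((norm (z /\<^sub>R 2 + y))\<^sup>2 + (norm (z /\<^sub>R 2 - y))\<^sup>2)
     + ((\<Sum>j\<in>UNIV. b $ j * of_real ((z /\<^sub>R 2 + y) $ j)) + (\<Sum>j\<in>UNIV. b $ j * of_real ((z /\<^sub>R 2 - y) $ j))) + 2 * c)"
    unfolding pair_product_def gauss_exp_def exp_add[symmetric] by (rule arg_cong[where f=exp]) (simp add: algebra_simps)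
  then show ?thesis unfolding s midpoint_norms .
qed

lemma radial_pairs_gauss_exp: "radial_pairs (gauss_exp a b c)"
  unfolding radial_pairs_def pair_product_gauss_exp
  by (intro exI[of _ "\<lambda>z r. exp (a * of_real ((norm z)\<^sup>2 / 2 + 2 * r\<^sup>2) + (\<Sum>j\<in>UNIV. b $ j * of_real (z $ j)) + 2 * c)"]) simp

lemma variance_energy_gauss_exp: "variance_energy j (gauss_exp a b c :: real^'n \<Rightarrow> complex) = 0"
proof -
  let ?v = "gauss_exp a b c :: real^'n \<Rightarrow> complex"
  have "shell_mean ?v z (2 * (norm y)\<^sup>2) = pair_product ?v z y" for z y
  proof -
    have "shell_mean ?v z (2 * (norm y)\<^sup>2) = (\<integral>x. pair_product ?v z y \<partial>(unit_sphere_prob :: (real^'n) measure))"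
      unfolding shell_mean_def
    proof (rule integral_cong_AE)
      show "AE x in unit_sphere_prob. pair_product ?v z (sqrt (2 * (norm y)\<^sup>2 / 2) *\<^sub>R x) = pair_product ?v z y"
        using AE_norm_unit_sphere_prob
        by eventually_elim (simp add: pair_product_gauss_exp)
    qed measurable
    moreover have "measure (unit_sphere_prob :: (real^'n) measure) UNIV = 1"
      using unit_sphere_prob.prob_space by (simp only: space_unit_sphere_prob)
    ultimately show ?thesis by simp
  qed
  then show ?thesis by (simp add: variance_energy_def)
qed

lemma gauss_exp_L1_L2:
  assumes a: "Re a < 0"
  shows "integrable lborel (gauss_exp a b c :: real^'n \<Rightarrow> complex)" "in_L2 (gauss_exp a b c :: real^'n \<Rightarrow> complex)"
proof -
  let ?b = "(\<chi> j. Re (b $ j)) :: real^'n"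
  define s where "s = - Re a"
  have s: "s > 0" using a by (simp add: s_def)
  \<comment> \<open>Young's inequality spends half of the quadratic decay on the linear term;
    \<open>K\<close> collects what is left over.\<close>
  define K where "K = exp ((norm ?b)\<^sup>2 / (2 * s) + Re c)"
  have bd: "cmod (gauss_exp a b c x) \<le> K * gauss s x" for x
  proof -
    have "?b \<bullet> x \<le> norm ?b * norm x" by (rule norm_cauchy_schwarz)
    also have "\<dots> \<le> (norm ?b)\<^sup>2 / (2 * s) + s * (norm x)\<^sup>2 / 2"
    proof -
      have "0 \<le> (norm ?b - s * norm x)\<^sup>2" by simp
      then show ?thesis using s by (simp add: field_simps power2_eq_square)
    qed
    finally show ?thesis
      unfolding norm_gauss_exp K_def gauss_def exp_add[symmetric] by (simp add: s_def field_simps)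
  qed
  have K: "K > 0" by (simp add: K_def)
  show "integrable lborel (gauss_exp a b c :: real^'n \<Rightarrow> complex)"
  proof (rule Bochner_Integration.integrable_bound)
    show "integrable lborel (\<lambda>x::real^'n. K * gauss s x)" by (intro integrable_mult_right integrable_gauss s)
    show "AE x in lborel. norm (gauss_exp a b c x) \<le> norm (K * gauss s (x :: real^'n))"
      by (intro AE_I2 le_norm_real bd)
  qed measurable
  show "in_L2 (gauss_exp a b c :: real^'n \<Rightarrow> complex)"
  proof (rule in_L2_bound)
    show "integrable lborel (\<lambda>x::real^'n. K\<^sup>2 * gauss (2 * s) x)" using s by (intro integrable_mult_right integrable_gauss) simp
    show "(cmod (gauss_exp a b c x))\<^sup>2 \<le> K\<^sup>2 * gauss (2 * s) x" for x :: "real^'n"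
      using power_mono[OF bd[of x], of 2] by (simp add: power_mult_distrib gauss_sq)
  qed measurable
qed

text \<open>In |g(x)| |g(-x)| the linear terms cancel. With a nonnegative real part of
  \<open>a\<close> this product would be bounded below by a positive constant, which is not
  integrable over the whole space.\<close>

lemma gauss_exp_L2_imp_neg:
  assumes L: "in_L2 (gauss_exp a b c :: real^'n \<Rightarrow> complex)"
  shows "Re a < 0"
proof (rule ccontr)
  assume n: "\<not> Re a < 0"
  let ?g = "gauss_exp a b c :: real^'n \<Rightarrow> complex"
  have i: "integrable lborel (\<lambda>x. (cmod (?g x))\<^sup>2 + (cmod (?g (- x)))\<^sup>2)"
    by (intro Bochner_Integration.integrable_add in_L2_integrable in_L2_reflect L)
  have b: "norm (exp (2 * Re c)) \<le> norm ((cmod (?g x))\<^sup>2 + (cmod (?g (- x)))\<^sup>2)" for x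
  proof -
    have "exp (2 * Re c) \<le> 2 * exp (2 * Re c)" by simp
    also have "\<dots> \<le> 2 * exp (2 * Re a * (norm x)\<^sup>2 + 2 * Re c)" using n by simp
    also have "\<dots> = 2 * cmod (?g x) * cmod (?g (- x))"
      unfolding norm_gauss_exp by (simp add: algebra_simps flip: exp_add)
    also have "\<dots> \<le> (cmod (?g x))\<^sup>2 + (cmod (?g (- x)))\<^sup>2" by (rule sum_squares_bound)
    finally show ?thesis by simp
  qed
  have "integrable lborel (\<lambda>x::real^'n. exp (2 * Re c))"
    by (rule Bochner_Integration.integrable_bound[OF i _ AE_I2[OF b]]) simp
  then have "integral\<^sup>N lborel (\<lambda>x::real^'n. ennreal (norm (exp (2 * Re c)))) < \<infinity>" unfolding integrable_iff_bounded by blast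
  then show False by (simp add: ennreal_mult_less_top)
qed

text \<open>After multiplication by a Gaussian, \<open>v\<close> has a continuous transform, which
  is a \<open>gauss_exp\<close>. Inversion makes the product itself the transform of such a
  function; since that function has radial pair products too, its transform is again a
  \<open>gauss_exp\<close>.\<close>

lemma radial_pairs_imp_gauss_exp:
  fixes v :: "real^'n \<Rightarrow> complex"
  assumes n: "CARD('n) \<ge> 2" and v: "in_L2 v" and nz: "\<not> (AE x in lborel. v x = 0)" and rad: "radial_pairs v"
  obtains a b c where "Re a < 0" "AE x in lborel. v x = gauss_exp a b c x"
proof -
  let ?d = "DIM(real^'n)"
  let ?p = "complex_of_real ((2 * pi) ^ ?d)"
  have [measurable]: "v \<in> borel_measurable borel" by (rule in_L2_measurable[OF v])
  \<comment> \<open>Used twice: for \<open>w\<close>, and for the reflected transform of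
    \<open>w\<close> on the way back.\<close>
  have fourier_exp: "\<exists>a b c. fourier_integral w = gauss_exp a b c"
    if w1: "integrable lborel w" and w2: "\<not> (AE x in lborel. w x = 0)" and w3: "radial_pairs w" for w :: "real^'n \<Rightarrow> complex"
  proof -
    obtain p where p: "fourier_integral w p \<noteq> 0" using fourier_integral_unique[OF w1] w2 by blast
    show ?thesis
      using pair_invariant_imp_gauss_exp[OF n continuous_fourier_integral[OF w1] p fourier_product_invariant[OF w1 w3]] by metis
  qed
  define w where "w x = of_real (gauss 1 x) * v x" for x
  have w1: "integrable lborel w" unfolding w_def by (intro L2_mult_integrable in_L2_gauss v) simp
  have w2: "in_L2 w"
  proof (rule in_L2_bound[OF _ in_L2_integrable[OF v]])
    show "w \<in> borel_measurable borel" unfolding w_def by measurable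
    show "(cmod (w x))\<^sup>2 \<le> (cmod (v x))\<^sup>2" for x
      by (intro power_mono) (auto simp: w_def norm_mult gauss_nonneg intro!: mult_left_le_one_le gauss_le_1)
  qed
  have wv: "w x = 0 \<longleftrightarrow> v x = 0" for x by (simp add: w_def gauss_def)
  have w3: "radial_pairs w"
  proof -
    obtain W where W: "AE z in lborel. AE y in lborel. pair_product v z y = W z (norm y)"
      using rad unfolding radial_pairs_def by blast
    have pp: "pair_product w z y = of_real (exp (- (((norm z)\<^sup>2 / 2 + 2 * (norm y)\<^sup>2) / 2))) * pair_product v z y" for z y
    proof -
      have "gauss 1 (z /\<^sub>R 2 + y) * gauss 1 (z /\<^sub>R 2 - y) = exp (- (((norm (z /\<^sub>R 2 + y))\<^sup>2 + (norm (z /\<^sub>R 2 - y))\<^sup>2) / 2))"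
        unfolding gauss_def exp_add[symmetric] by (simp add: field_simps)
      then have g1: "of_real (gauss 1 (z /\<^sub>R 2 + y)) * of_real (gauss 1 (z /\<^sub>R 2 - y)) = complex_of_real (exp (- (((norm z)\<^sup>2 / 2 + 2 * (norm y)\<^sup>2) / 2)))"
        unfolding midpoint_norms of_real_mult[symmetric] by (rule arg_cong)
      have swap: "(p * q) * (r * t) = (p * r) * (q * t)" for p q r t :: complex by (simp only: mult_ac)
      show ?thesis unfolding pair_product_def w_def by (subst swap, subst g1) (rule refl)
    qed
    have "AE z in lborel. AE y in lborel. pair_product w z y = of_real (exp (- (((norm z)\<^sup>2 / 2 + 2 * (norm y)\<^sup>2) / 2))) * W z (norm y)"
      using W
    proof eventually_elim
      case (elim z)
      then show ?case by eventually_elim (simp only: pp)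
    qed
    then show ?thesis
      unfolding radial_pairs_def
      by (intro exI[of _ "\<lambda>z r. of_real (exp (- (((norm z)\<^sup>2 / 2 + 2 * r\<^sup>2) / 2))) * W z r"])
  qed
  obtain a1 b1 c1 where f: "fourier_integral w = gauss_exp a1 b1 c1"
    using fourier_exp[OF w1 _ w3] nz unfolding wv by blast
  have L: "l2fourier w (gauss_exp a1 b1 c1)" using l2fourier_L1[OF w1 w2] f by simp
  \<comment> \<open>Decay of the transform comes from Plancherel, as \<open>w\<close> is square
    integrable.\<close>
  have a1: "Re a1 < 0" by (rule gauss_exp_L2_imp_neg[OF l2fourier_L2(2)[OF L]])
  let ?f = "gauss_exp a1 (- b1) c1 :: real^'n \<Rightarrow> complex"
  have "l2fourier ?f (\<lambda>x. ?p * w x)"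
    using l2fourier_reflect[OF l2fourier_inverse[OF L]] by (simp add: gauss_exp_minus)
  moreover have "l2fourier ?f (fourier_integral ?f)" by (intro l2fourier_L1 gauss_exp_L1_L2 a1)
  ultimately have ae: "AE x in lborel. ?p * w x = fourier_integral ?f x" by (rule l2fourier_unique)
  have "\<not> (AE x in lborel. ?f x = 0)" using not_AE_False_lborel by (simp add: gauss_exp_nonzero)
  then obtain a2 b2 c2 where g: "fourier_integral ?f = gauss_exp a2 b2 c2"
    using fourier_exp[OF gauss_exp_L1_L2(1)[OF a1] _ radial_pairs_gauss_exp] by blast
  define k where "k = ln ((2 * pi) ^ ?d :: real)"
  have k: "?p = exp (of_real k)" unfolding k_def exp_of_real by (subst exp_ln) simp_all
  \<comment> \<open>The summand 1/2 undoes the factor \<open>gauss 1\<close>, and \<open>k\<close>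
    undoes the factor (2 pi)^d of the inversion.\<close>
  have "AE x in lborel. v x = gauss_exp (a2 + 1 / 2) b2 (c2 - of_real k) x"
    using ae
  proof eventually_elim
    case (elim x)
    then have e: "exp (of_real k) * (of_real (gauss 1 x) * v x) = gauss_exp a2 b2 c2 x" by (simp only: g k w_def)
    have gx: "complex_of_real (gauss 1 x) = exp (- (of_real ((norm x)\<^sup>2) / 2))"
      unfolding gauss_def exp_of_real[symmetric] by simp
    have "v x = exp (- of_real k) * (exp (of_real ((norm x)\<^sup>2) / 2) * (exp (of_real k) * (of_real (gauss 1 x) * v x)))"
    proof -
      have "exp K * exp (- K) = 1" for K :: complex by (simp flip: exp_add)
      from this[of "of_real k"] this[of "of_real ((norm x)\<^sup>2) / 2"] show ?thesis
        unfolding gx by (metis (no_types) mult.assoc mult.commute mult_1)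
    qed
    also have "\<dots> = gauss_exp (a2 + 1 / 2) b2 (c2 - of_real k) x"
      unfolding e gauss_exp_def exp_add[symmetric] by (rule arg_cong[where f=exp]) (simp add: field_simps)
    finally show ?case .
  qed
  moreover from this have "Re (a2 + 1 / 2) < 0"
    by (intro gauss_exp_L2_imp_neg[OF in_L2_cong_AE[OF v]]) (auto simp: gauss_exp_measurable)
  ultimately show ?thesis using that by blast
qed

text \<open>The weight vanishes at most at \<open>y = 0\<close>, so almost everywhere the pair
  product equals its average, which depends on \<open>y\<close> through the norm.\<close>

lemma variance_energy_zero_imp_radial_pairs:
  fixes v :: "real^'n \<Rightarrow> complex"
  assumes [measurable]: "v \<in> borel_measurable borel" and 0: "variance_energy j v = 0"
  shows "radial_pairs v"
proof -
  let ?F = "\<lambda>z y. ennreal ((2 * (norm y)\<^sup>2) ^ j * (cmod (pair_product v z y - shell_mean v z (2 * (norm y)\<^sup>2)))\<^sup>2)"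
  have "AE z in lborel. (\<integral>\<^sup>+y. ?F z y \<partial>lborel) = 0"
    using 0 unfolding variance_energy_def by (subst (asm) nn_integral_0_iff_AE) simp_all
  then have "AE z in lborel. AE y in lborel. pair_product v z y = shell_mean v z (2 * (norm y)\<^sup>2)"
  proof eventually_elim
    case (elim z)
    then have "AE y in lborel. ?F z y = 0" by (subst (asm) nn_integral_0_iff_AE) simp_all
    moreover have "AE y::real^'n in lborel. y \<noteq> 0" using AE_lborel_singleton[of "0::real^'n"] by simp
    ultimately show ?case
    proof eventually_elim
      case (elim y)
      have "(2 * (norm y)\<^sup>2) ^ j > 0" using elim(2) by simp
      moreover have "(2 * (norm y)\<^sup>2) ^ j * (cmod (pair_product v z y - shell_mean v z (2 * (norm y)\<^sup>2)))\<^sup>2 \<le> 0"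
        using elim(1) by (simp only: ennreal_eq_0_iff)
      ultimately have "(cmod (pair_product v z y - shell_mean v z (2 * (norm y)\<^sup>2)))\<^sup>2 \<le> 0"
        by (simp only: mult_le_0_iff) linarith
      then show ?case by simp
    qed
  qed
  then show ?thesis unfolding radial_pairs_def by (intro exI[of _ "\<lambda>z r. shell_mean v z (2 * r\<^sup>2)"])
qed

text \<open>Let b be the real part of the linear coefficient and t = b . x. Symmetrised under x ->
  -x and paired with b, the integrand is a positive factor times (e^(2t) - e^(-2t)) t, which is
  nonnegative and vanishes only for t = 0, a null set unless b = 0.\<close>

lemma mass_moment_gauss_exp:
  fixes b :: "complex^'n"
  assumes a: "Re a < 0" and w: "in_L2 (\<lambda>x. of_real (norm x) * gauss_exp a b c x)"
  shows "mass_moment (gauss_exp a b c) = 0 \<longleftrightarrow> (\<forall>j. Re (b $ j) = 0)"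
proof -
  let ?g = "gauss_exp a b c :: real^'n \<Rightarrow> complex"
  let ?b = "(\<chi> j. Re (b $ j)) :: real^'n"
  define q where "q x = (cmod (?g x))\<^sup>2" for x
  have qm[measurable]: "q \<in> borel_measurable borel" unfolding q_def by measurable
  have q: "q x = exp (2 * Re a * (norm x)\<^sup>2 + 2 * Re c) * exp (2 * (?b \<bullet> x))" for x
    unfolding q_def norm_gauss_exp power2_eq_square exp_add[symmetric] by (rule arg_cong[where f=exp]) (simp add: algebra_simps)
  have i: "integrable lborel (\<lambda>x. q x *\<^sub>R x)" unfolding q_def by (rule integrable_mass_moment(1)[OF gauss_exp_L1_L2(2)[OF a] w])
  have m: "mass_moment ?g = (\<integral>x. q x *\<^sub>R x \<partial>lborel)" by (simp add: mass_moment_def q_def)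
  have r: "(\<integral>x. q (- x) *\<^sub>R (- x) \<partial>lborel) = (\<integral>x. q x *\<^sub>R x \<partial>lborel)"
    using integral_reflection[of "\<lambda>x. q x *\<^sub>R x" 0] by simp
  have ir: "integrable lborel (\<lambda>x. q (- x) *\<^sub>R (- x))"
    using integrable_reflection[of "\<lambda>x. q x *\<^sub>R x" 0] i by simp
  have b0: "?b = 0 \<longleftrightarrow> (\<forall>j. Re (b $ j) = 0)" by (simp add: vec_eq_iff)
  show ?thesis
  proof
    assume "\<forall>j. Re (b $ j) = 0"
    then have "q (- x) = q x" for x unfolding q using b0 by simp
    then have "- (\<integral>x. q x *\<^sub>R x \<partial>lborel) = (\<integral>x. q x *\<^sub>R x \<partial>lborel)" using r by simp
    then have "2 *\<^sub>R (\<integral>x. q x *\<^sub>R x \<partial>lborel) = 0" by (simp add: scaleR_2 neg_eq_iff_add_eq_0)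
    then show "mass_moment ?g = 0" using m by simp
  next
    assume z: "mass_moment ?g = 0"
    define h where "h x = (q x *\<^sub>R x + q (- x) *\<^sub>R (- x)) \<bullet> ?b" for x
    have hi: "integrable lborel h" unfolding h_def using i ir by (intro integrable_inner_left Bochner_Integration.integrable_add)
    have "(\<integral>x. h x \<partial>lborel) = (\<integral>x. q x *\<^sub>R x + q (- x) *\<^sub>R (- x) \<partial>lborel) \<bullet> ?b"
      unfolding h_def by (rule integral_inner_left) (use i ir in \<open>intro Bochner_Integration.integrable_add\<close>)
    also have "(\<integral>x. q x *\<^sub>R x + q (- x) *\<^sub>R (- x) \<partial>lborel) = 0"
      using i ir r z m by (subst Bochner_Integration.integral_add) simp_all
    finally have h0: "(\<integral>x. h x \<partial>lborel) = 0" by simp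
    have hx: "h x = exp (2 * Re a * (norm x)\<^sup>2 + 2 * Re c) * ((exp (2 * (?b \<bullet> x)) - exp (- (2 * (?b \<bullet> x)))) * (?b \<bullet> x))" for x
      unfolding h_def q by (simp add: inner_commute algebra_simps)
    have hnn: "(exp (2 * t) - exp (- (2 * t))) * t \<ge> 0" for t :: real
      by (cases "t \<ge> 0") (auto intro!: mult_nonneg_nonneg mult_nonpos_nonpos)
    have "AE x in lborel. h x = 0"
    proof -
      have "AE x in lborel. 0 \<le> h x" unfolding hx by (rule AE_I2, rule mult_nonneg_nonneg[OF exp_ge_zero hnn])
      from integral_nonneg_eq_0_iff_AE[OF hi this] h0 show ?thesis by simp
    qed
    then have ae: "AE x in lborel. ?b \<bullet> x = 0"
      by eventually_elim (auto simp: hx)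
    show "\<forall>j. Re (b $ j) = 0"
    proof (rule ccontr)
      assume "\<not> (\<forall>j. Re (b $ j) = 0)"
      then have "?b \<noteq> 0" using b0 by blast
      then have "negligible {x. ?b \<bullet> x = 0}" by (intro negligible_hyperplane) simp
      then have "{x. ?b \<bullet> x = 0} \<in> null_sets lebesgue" by (simp add: negligible_iff_null_sets)
      then have "AE x in lebesgue. x \<notin> {x. ?b \<bullet> x = 0}" by (rule AE_not_in)
      then have "AE x in lborel. ?b \<bullet> x \<noteq> 0" by (simp add: AE_completion_iff)
      with ae have "AE x::real^'n in lborel. False" by eventually_elim simp
      then show False using not_AE_False_lborel by blast
    qed
  qed
qed

section \<open>The sharp estimates\<close>

lemma gaussians_iff: "g \<in> gaussians \<longleftrightarrow> (\<exists>a b c. Re a < 0 \<and> g = gauss_exp a b c)"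
  unfolding gaussians_def gauss_exp_def[abs_def] by simp

lemma gaussians_r_iff: "g \<in> gaussians_r \<longleftrightarrow> (\<exists>a b c. Re a < 0 \<and> (\<forall>j. Re (b $ j) = 0) \<and> g = gauss_exp a b c)"
proof
  assume "g \<in> gaussians_r"
  then obtain a b c where *: "Re a < 0" "g = (\<lambda>\<eta>. exp (a * of_real ((norm \<eta>)\<^sup>2) + \<i> * of_real (b \<bullet> \<eta>) + c))"
    unfolding gaussians_r_def by blast
  have "g = gauss_exp a (\<chi> j. \<i> * of_real (b $ j)) c"
    unfolding *(2) gauss_exp_def[abs_def] by (simp add: inner_vec_def sum_distrib_left mult.assoc)
  then show "\<exists>a b c. Re a < 0 \<and> (\<forall>j. Re (b $ j) = 0) \<and> g = gauss_exp a b c"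
    using *(1) by (intro exI[of _ a] exI[of _ "\<chi> j. \<i> * of_real (b $ j)"] exI[of _ c]) simp
next
  assume "\<exists>a b c. Re a < 0 \<and> (\<forall>j. Re (b $ j) = 0) \<and> g = gauss_exp a b c"
  then obtain a b c where *: "Re a < 0" "\<And>j. Re (b $ j) = 0" "g = gauss_exp a b c" by blast
  have bj: "b $ j = \<i> * of_real (Im (b $ j))" for j using *(2)[of j] by (intro complex_eqI) simp_all
  have "(\<Sum>j\<in>UNIV. b $ j * of_real (\<eta> $ j)) = \<i> * of_real ((\<chi> j. Im (b $ j)) \<bullet> \<eta>)" for \<eta>
    by (subst bj) (simp add: inner_vec_def sum_distrib_left mult.assoc)
  then have "g = (\<lambda>\<eta>. exp (a * of_real ((norm \<eta>)\<^sup>2) + \<i> * of_real ((\<chi> j. Im (b $ j)) \<bullet> \<eta>) + c))"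
    unfolding *(3) gauss_exp_def[abs_def] by simp
  then show "g \<in> gaussians_r" unfolding gaussians_r_def using *(1) by blast
qed

section \<open>From initial data to solutions and the deficit identities\<close>

lemma l2fourier_cmult:
  fixes f :: "'a::euclidean_space \<Rightarrow> complex"
  assumes "l2fourier f g" shows "l2fourier (\<lambda>x. c * f x) (\<lambda>x. c * g x)"
  using l2fourier_linear[OF assms assms, of "c - 1"] by (simp add: algebra_simps)

lemma schroedinger_solution_free_solution:
  fixes u0 :: "'a::euclidean_space \<Rightarrow> complex"
  assumes u0: "in_L2 u0" and s: "schroedinger_solution u0 u"
  obtains v where "has_fourier u0 v" "l2fourier u0 v" "free_solution v u"
proof -
  obtain v where v: "has_fourier u0 v" and u: "u \<in> borel_measurable lborel"
    and sl: "\<And>t. in_L2 (\<lambda>x. u (t, x))" "\<And>t. has_fourier (\<lambda>x. u (t, x)) (\<lambda>\<xi>. exp (- \<i> * of_real (t * (norm \<xi>)\<^sup>2)) * v \<xi>)"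
    using s unfolding schroedinger_solution_def by blast
  have l: "l2fourier u0 v" by (rule has_fourier_l2fourier[OF u0 v])
  have "free_solution v u"
  proof
    show "u \<in> borel_measurable borel" using u by simp
    show "in_L2 v" by (rule l2fourier_L2(2)[OF l])
    show "l2fourier (\<lambda>x. u (t, x)) (\<lambda>\<xi>. exp (- \<i> * of_real (t * (norm \<xi>)\<^sup>2)) * v \<xi>)" for t
      by (rule has_fourier_l2fourier[OF sl])
  qed
  with v l show ?thesis by (rule that)
qed

lemma free_solution_schroedinger:
  assumes "free_solution v u" "has_fourier u0 v"
  shows "schroedinger_solution u0 u"
proof -
  interpret free_solution v u by fact
  show ?thesis
    unfolding schroedinger_solution_def
    using u assms(2) l2fourier_L2(1)[OF slice] l2fourier_has_fourier[OF slice] by auto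
qed

text \<open>For integrable \<open>v\<close> each slice is given by an integral, which makes
  \<open>u\<close> jointly measurable. Solutions have to be produced for Gaussian \<open>v\<close>,
  and those are integrable.\<close>

lemma free_solution_exists:
  fixes v :: "'a::euclidean_space \<Rightarrow> complex"
  assumes v1: "integrable lborel v" and v2: "in_L2 v"
  obtains u where "free_solution v u"
proof -
  let ?p = "complex_of_real ((2 * pi) ^ DIM('a))"
  let ?V = "\<lambda>t \<xi>. exp (- \<i> * of_real (t * (norm \<xi>)\<^sup>2)) * v \<xi>"
  define u where "u q = inverse ?p * fourier_integral (?V (fst q)) (- snd q)" for q
  have vm[measurable]: "v \<in> borel_measurable borel" by (rule in_L2_measurable[OF v2])
  have "free_solution v u"
  proof
    have "u \<in> borel_measurable (borel \<Otimes>\<^sub>M borel)"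
      unfolding u_def[abs_def] fourier_integral_def by measurable
    then show "u \<in> borel_measurable borel" by (simp add: borel_prod)
    show "in_L2 v" by fact
    fix t
    have V1: "integrable lborel (?V t)"
      by (rule Bochner_Integration.integrable_bound[OF v1]) (simp_all add: norm_mult norm_exp_eq_Re)
    have V2: "in_L2 (?V t)" by (intro in_L2_mult_unimodular v2) (simp_all add: norm_exp_eq_Re)
    have "l2fourier (\<lambda>x. fourier_integral (?V t) (- x)) (\<lambda>\<xi>. ?p * ?V t \<xi>)"
      using l2fourier_reflect[OF l2fourier_inverse[OF l2fourier_L1[OF V1 V2]]] by simp
    from l2fourier_cmult[OF this, of "inverse ?p"]
    moreover have "inverse ?p * (?p * z) = z" for z by (simp only: mult.assoc[symmetric], subst left_inverse) simp_all
    ultimately show "l2fourier (\<lambda>x. u (t, x)) (?V t)" by (simp only: u_def fst_conv snd_conv)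
  qed
  then show ?thesis by (rule that)
qed

lemma L2_norm_sq: "(L2_norm f)\<^sup>2 = L2_sq f"
  by (simp add: L2_norm_def)

lemma L2_sq_pos:
  assumes f: "in_L2 f" and nz: "\<not> (AE x in lborel. f x = 0)"
  shows "L2_sq f > 0"
proof -
  have "L2_sq f \<noteq> 0"
    using nz integral_nonneg_eq_0_iff_AE[OF in_L2_integrable[OF f]] by simp
  then show ?thesis by (simp add: less_le)
qed

lemma l2fourier_nonzero:
  fixes f :: "'a::euclidean_space \<Rightarrow> complex"
  assumes l: "l2fourier f g" and nz: "\<not> (AE x in lborel. f x = 0)"
  shows "\<not> (AE x in lborel. g x = 0)"
proof
  assume "AE x in lborel. g x = 0"
  then have "AE x in lborel. (cmod (g x))\<^sup>2 = 0" by eventually_elim simp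
  then have "L2_sq g = 0" by (rule integral_eq_zero_AE)
  then show False using plancherel[OF l] L2_sq_pos[OF l2fourier_L2(1)[OF l] nz] by simp
qed

lemma sharp_constant_pos: "d > 0 \<Longrightarrow> sharp_constant d > 0"
  by (simp add: sharp_constant_def)

text \<open>The two parts add up to a finite value, so the splitting can be subtracted in the reals.
  The last equivalence rules out infinity, which \<open>enn2real\<close> sends to 0.\<close>

lemma mean_energy_finite:
  fixes v :: "'a::euclidean_space \<Rightarrow> complex"
  assumes v: "v \<in> borel_measurable borel" and E: "pair_energy j v = ennreal E" "E \<ge> 0"
  shows "mean_energy j v < \<infinity>" "enn2real (mean_energy j v) = E - enn2real (variance_energy j v)"
    "enn2real (variance_energy j v) = 0 \<longleftrightarrow> variance_energy j v = 0"
proof -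
  have s: "mean_energy j v + variance_energy j v = ennreal E" using pair_energy_split[OF v, of j] E by simp
  obtain m w where mw: "mean_energy j v = ennreal m" "m \<ge> 0" "variance_energy j v = ennreal w" "w \<ge> 0"
    using s by (cases "mean_energy j v"; cases "variance_energy j v") auto
  have "m + w = E" using s mw E(2) by (simp add: ennreal_plus[symmetric] del: ennreal_plus)
  with mw show "mean_energy j v < \<infinity>" "enn2real (mean_energy j v) = E - enn2real (variance_energy j v)"
    "enn2real (variance_energy j v) = 0 \<longleftrightarrow> variance_energy j v = 0" by auto
qed

text \<open>An exact formula: the inequality, the optimal constant and the extremisers of the first
  estimate are all read off from its last term.\<close>

lemma D_power_square_deficit_0:
  fixes u0 :: "real^'n \<Rightarrow> complex"
  assumes u0: "l2fourier u0 v" and u: "free_solution v u"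
  defines "\<beta> \<equiv> (2 - real CARD('n)) / 4"
  shows "in_multiplier_domain (D_symbol \<beta>) (\<lambda>z. (u z)\<^sup>2)"
    and "(L2_norm (D_power \<beta> (\<lambda>z. (u z)\<^sup>2)))\<^sup>2 = sharp_constant (real CARD('n)) * L2_norm u0 ^ 4
      - sharp_constant (real CARD('n)) / (2 * pi) ^ (2 * CARD('n)) * enn2real (variance_energy 0 v)"
    and "enn2real (variance_energy 0 v) = 0 \<longleftrightarrow> variance_energy 0 v = 0"
proof -
  interpret free_solution v u by (rule u)
  have b: "2 * \<beta> = real 0 + 1 - real DIM(real^'n) / 2" by (simp add: \<beta>_def field_simps)
  have "L2_norm u0 ^ 4 = ((L2_norm u0)\<^sup>2)\<^sup>2" by (simp flip: power_mult)
  then have N: "(L2_sq v)\<^sup>2 = (2 * pi) ^ (2 * CARD('n)) * L2_norm u0 ^ 4"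
    using plancherel[OF u0] by (simp add: L2_norm_sq power_mult_distrib power_mult[symmetric] mult.commute[of 2])
  note E = mean_energy_finite[OF v_meas pair_energy_0[OF v] zero_le_power2]
  show "in_multiplier_domain (D_symbol \<beta>) (\<lambda>z. (u z)\<^sup>2)" by (rule D_power_square(1)[OF b E(1)])
  show "(L2_norm (D_power \<beta> (\<lambda>z. (u z)\<^sup>2)))\<^sup>2 = sharp_constant (real CARD('n)) * L2_norm u0 ^ 4
      - sharp_constant (real CARD('n)) / (2 * pi) ^ (2 * CARD('n)) * enn2real (variance_energy 0 v)"
    unfolding D_power_square(2)[OF b E(1)] E(2) N by (simp add: right_diff_distrib)
  show "enn2real (variance_energy 0 v) = 0 \<longleftrightarrow> variance_energy 0 v = 0" by (rule E(3))
qed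

lemma in_H_1_fourier:
  fixes u0 :: "'a::euclidean_space \<Rightarrow> complex"
  assumes h: "in_H 1 u0" and v: "has_fourier u0 v"
  shows "in_L2 (\<lambda>x. of_real (norm x) * v x)"
    and "(2 * pi) ^ DIM('a) * (Hdot_norm 1 u0)\<^sup>2 = L2_sq (\<lambda>x. of_real (norm x) * v x)"
proof -
  have vm: "v \<in> borel_measurable borel" by (rule tempered_funD(1)[OF has_fourier_tempered(2)[OF v]])
  have r: "riesz_symbol 1 x = norm x" for x :: 'a by (simp add: riesz_symbol_def)
  obtain k g where k: "in_L2 k" "has_fourier u0 g" "has_fourier k (\<lambda>\<xi>. of_real (riesz_symbol 1 \<xi>) * g \<xi>)"
    using h unfolding in_H_def in_multiplier_domain_def is_multiplier_image_def by blast
  have "AE x in lborel. of_real (riesz_symbol 1 x) * g x = of_real (norm x) * v x"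
    using has_fourier_unique[OF k(2) v] by eventually_elim (simp add: r)
  then show L: "in_L2 (\<lambda>x. of_real (norm x) * v x)"
    by (rule in_L2_cong_AE[OF l2fourier_L2(2)[OF has_fourier_l2fourier[OF k(1,3)]], rotated]) (use vm in simp)
  then show "(2 * pi) ^ DIM('a) * (Hdot_norm 1 u0)\<^sup>2 = L2_sq (\<lambda>x. of_real (norm x) * v x)"
    using fourier_multiplier_L2(2)[OF v, of "riesz_symbol 1"] by (simp add: r Hdot_norm_def)
qed

lemma D_power_square_deficit_1:
  fixes u0 :: "real^'n \<Rightarrow> complex"
  assumes h: "in_H 1 u0" and hf: "has_fourier u0 v" and u: "free_solution v u"
  defines "\<beta> \<equiv> (4 - real CARD('n)) / 4"
  shows "in_multiplier_domain (D_symbol \<beta>) (\<lambda>z. (u z)\<^sup>2)"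
    and "(L2_norm (D_power \<beta> (\<lambda>z. (u z)\<^sup>2)))\<^sup>2 = sharp_constant (real CARD('n)) * (Hdot_norm 1 u0)\<^sup>2 * (L2_norm u0)\<^sup>2
      - sharp_constant (real CARD('n)) / (2 * pi) ^ (2 * CARD('n)) * ((norm (mass_moment v))\<^sup>2 + enn2real (variance_energy 1 v))"
    and "enn2real (variance_energy 1 v) = 0 \<longleftrightarrow> variance_energy 1 v = 0"
proof -
  interpret free_solution v u by (rule u)
  have u0: "l2fourier u0 v" using h hf by (intro has_fourier_l2fourier) (simp_all add: in_H_def)
  have b: "2 * \<beta> = real 1 + 1 - real DIM(real^'n) / 2" by (simp add: \<beta>_def field_simps)
  note w = in_H_1_fourier(1)[OF h hf]
  let ?N = "L2_sq (\<lambda>x. of_real (norm x) * v x) * L2_sq v"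
  have N: "?N = (2 * pi) ^ (2 * CARD('n)) * ((Hdot_norm 1 u0)\<^sup>2 * (L2_norm u0)\<^sup>2)"
    unfolding in_H_1_fourier(2)[OF h hf, symmetric] plancherel[OF u0] L2_norm_sq mult_2 power_add by simp
  \<comment> \<open>\<open>pair_energy_1\<close> has an \<open>ennreal\<close> on the right, which
    would truncate a negative number to 0. Cauchy-Schwarz shows that nothing is truncated.\<close>
  have nn: "?N - (norm (mass_moment v))\<^sup>2 \<ge> 0"
  proof -
    have "norm (mass_moment v) \<le> (\<integral>x. norm ((cmod (v x))\<^sup>2 *\<^sub>R x) \<partial>lborel)"
      unfolding mass_moment_def by (rule integral_norm_bound)
    also have "\<dots> = cmod (\<integral>x. of_real (norm ((cmod (v x))\<^sup>2 *\<^sub>R x)) \<partial>lborel)"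
      by (simp only: integral_complex_of_real norm_of_real, rule abs_of_nonneg[symmetric]) simp
    also have "(\<integral>x. of_real (norm ((cmod (v x))\<^sup>2 *\<^sub>R x)) \<partial>lborel) = (\<integral>x. (of_real (norm x) * v x) * cnj (v x) \<partial>lborel)"
      by (rule Bochner_Integration.integral_cong[OF refl], unfold mult.assoc complex_norm_square[symmetric]) simp
    finally have "(norm (mass_moment v))\<^sup>2 \<le> (cmod (\<integral>x. (of_real (norm x) * v x) * cnj (v x) \<partial>lborel))\<^sup>2"
      by (rule power_mono) simp
    also have "\<dots> \<le> ?N" using L2_Cauchy_Schwarz[OF w in_L2_cnj[OF v]] by simp
    finally show ?thesis by simp
  qed
  note E = mean_energy_finite[OF v_meas pair_energy_1[OF v w] nn]
  show "in_multiplier_domain (D_symbol \<beta>) (\<lambda>z. (u z)\<^sup>2)" by (rule D_power_square(1)[OF b E(1)])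
  show "(L2_norm (D_power \<beta> (\<lambda>z. (u z)\<^sup>2)))\<^sup>2 = sharp_constant (real CARD('n)) * (Hdot_norm 1 u0)\<^sup>2 * (L2_norm u0)\<^sup>2
      - sharp_constant (real CARD('n)) / (2 * pi) ^ (2 * CARD('n)) * ((norm (mass_moment v))\<^sup>2 + enn2real (variance_energy 1 v))"
    unfolding D_power_square(2)[OF b E(1)] E(2) N by (simp add: right_diff_distrib distrib_left)
  show "enn2real (variance_energy 1 v) = 0 \<longleftrightarrow> variance_energy 1 v = 0" by (rule E(3))
qed

text \<open>The inequality t <= e^t for t = |x|^2/2 spends half of the decay of the squared Gaussian
  on the factor |x|^2.\<close>

lemma in_L2_norm_mult_gauss: "in_L2 (\<lambda>x::real^'n. of_real (norm x) * gauss_exp (- (1 / 2)) 0 0 x)"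
proof (rule in_L2_bound)
  show "integrable lborel (\<lambda>x::real^'n. 2 * gauss 1 x)" by (intro integrable_mult_right integrable_gauss) simp
  fix x :: "real^'n"
  have "(norm x)\<^sup>2 / 2 \<le> exp ((norm x)\<^sup>2 / 2)" using exp_ge_add_one_self[of "(norm x)\<^sup>2 / 2"] by linarith
  then have "(norm x)\<^sup>2 * exp (- (norm x)\<^sup>2) \<le> 2 * exp ((norm x)\<^sup>2 / 2) * exp (- (norm x)\<^sup>2)" by (intro mult_right_mono) simp_all
  also have "\<dots> = 2 * gauss 1 x" by (simp add: gauss_def flip: exp_add)
  finally have "(norm x)\<^sup>2 * exp (- (norm x)\<^sup>2) \<le> 2 * gauss 1 x" .
  moreover have z: "(\<chi> j. Re ((0::complex^'n) $ j)) = (0 :: real^'n)" by (simp add: vec_eq_iff)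
  have "(cmod (gauss_exp (- (1 / 2)) 0 0 x))\<^sup>2 = exp (- (norm x)\<^sup>2)"
    unfolding norm_gauss_exp z by (simp add: power2_eq_square flip: exp_add)
  ultimately show "(cmod (of_real (norm x) * gauss_exp (- (1 / 2)) 0 0 x))\<^sup>2 \<le> 2 * gauss 1 x"
    by (simp add: norm_mult power_mult_distrib)
qed measurable

theorem corollary1p5:
  assumes "CARD('n::finite) \<ge> 2"
  shows "
    (\<forall>(u0 :: real^'n \<Rightarrow> complex) u. in_L2 u0 \<and> schroedinger_solution u0 u \<longrightarrow>
       in_multiplier_domain (D_symbol ((2 - real CARD('n)) / 4)) (\<lambda>z. (u z)\<^sup>2) \<and>
       (L2_norm (D_power ((2 - real CARD('n)) / 4) (\<lambda>z. (u z)\<^sup>2)))\<^sup>2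
         \<le> sharp_constant (real CARD('n)) * L2_norm u0 ^ 4) \<and>
    (\<forall>(u0 :: real^'n \<Rightarrow> complex) u. in_H 1 u0 \<and> schroedinger_solution u0 u \<longrightarrow>
       in_multiplier_domain (D_symbol ((4 - real CARD('n)) / 4)) (\<lambda>z. (u z)\<^sup>2) \<and>
       (L2_norm (D_power ((4 - real CARD('n)) / 4) (\<lambda>z. (u z)\<^sup>2)))\<^sup>2
         \<le> sharp_constant (real CARD('n)) * (Hdot_norm 1 u0)\<^sup>2 * (L2_norm u0)\<^sup>2) \<and>
    (\<forall>C. (\<forall>(u0 :: real^'n \<Rightarrow> complex) u. in_L2 u0 \<and> schroedinger_solution u0 u \<longrightarrow>
       (L2_norm (D_power ((2 - real CARD('n)) / 4) (\<lambda>z. (u z)\<^sup>2)))\<^sup>2 \<le> C * L2_norm u0 ^ 4)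
       \<longrightarrow> sharp_constant (real CARD('n)) \<le> C) \<and>
    (\<forall>C. (\<forall>(u0 :: real^'n \<Rightarrow> complex) u. in_H 1 u0 \<and> schroedinger_solution u0 u \<longrightarrow>
       (L2_norm (D_power ((4 - real CARD('n)) / 4) (\<lambda>z. (u z)\<^sup>2)))\<^sup>2
         \<le> C * (Hdot_norm 1 u0)\<^sup>2 * (L2_norm u0)\<^sup>2)
       \<longrightarrow> sharp_constant (real CARD('n)) \<le> C) \<and>
    (\<forall>u0 :: real^'n \<Rightarrow> complex. in_L2 u0 \<and> \<not> (AE x in lborel. u0 x = 0) \<longrightarrow>
       (extremiser1 u0 \<longleftrightarrow> (\<exists>g\<in>gaussians. has_fourier u0 g))) \<and>
    (\<forall>u0 :: real^'n \<Rightarrow> complex. in_H 1 u0 \<and> \<not> (AE x in lborel. u0 x = 0) \<longrightarrow>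
       (extremiser2 u0 \<longleftrightarrow> (\<exists>g\<in>gaussians_r. has_fourier u0 g)))"
proof -
  let ?S = "sharp_constant (real CARD('n))"
  let ?q = "?S / (2 * pi) ^ (2 * CARD('n))"
  let ?T1 = "\<lambda>u :: real \<times> (real^'n) \<Rightarrow> complex. (L2_norm (D_power ((2 - real CARD('n)) / 4) (\<lambda>z. (u z)\<^sup>2)))\<^sup>2"
  let ?T2 = "\<lambda>u :: real \<times> (real^'n) \<Rightarrow> complex. (L2_norm (D_power ((4 - real CARD('n)) / 4) (\<lambda>z. (u z)\<^sup>2)))\<^sup>2"
  have S: "?S > 0" by (rule sharp_constant_pos) simp
  have q: "?q > 0" using S by simp
  have H2: "in_L2 u0" if "in_H 1 u0" for u0 :: "real^'n \<Rightarrow> complex" using that by (simp add: in_H_def)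
  have gauss_solution: "\<exists>u. free_solution (gauss_exp a b c) u" if a: "Re a < 0" for a c and b :: "complex^'n"
    using free_solution_exists[OF gauss_exp_L1_L2[OF a]] by blast
  \<comment> \<open>One Gaussian serves both optimality claims: its pair product has no variance on
    spheres, and without a linear term it has no first moment.\<close>
  let ?G = "gauss_exp (- (1 / 2)) 0 0 :: real^'n \<Rightarrow> complex"
  have G: "Re (- (1 / 2)) < 0" by simp
  obtain U0 where U0: "l2fourier U0 ?G" by (rule l2fourier_surj[OF gauss_exp_L1_L2(2)[OF G, of 0 0]])
  obtain U where U: "free_solution ?G U" using gauss_solution[OF G] by blast
  have UL: "in_L2 U0" by (rule l2fourier_L2(1)[OF U0])
  have UF: "has_fourier U0 ?G" by (rule l2fourier_has_fourier[OF U0])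
  have US: "schroedinger_solution U0 U" by (rule free_solution_schroedinger[OF U UF])
  have r: "riesz_symbol 1 x = norm x" for x :: "real^'n" by (simp add: riesz_symbol_def)
  have UH: "in_H 1 U0"
    using fourier_multiplier_L2(1)[OF UF, of "riesz_symbol 1"] in_L2_norm_mult_gauss UL by (simp add: r in_H_def)
  have pos1: "L2_norm U0 > 0"
  proof -
    have "\<not> (AE x in lborel. ?G x = 0)" using not_AE_False_lborel by (simp add: gauss_exp_nonzero)
    then have "L2_sq ?G > 0" by (rule L2_sq_pos[OF gauss_exp_L1_L2(2)[OF G]])
    then have "(L2_norm U0)\<^sup>2 \<noteq> 0" using plancherel[OF U0] by (auto simp: L2_norm_sq)
    moreover have "L2_norm U0 \<ge> 0" by (simp add: L2_norm_def)
    ultimately show ?thesis by simp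
  qed
  have pos2: "(Hdot_norm 1 U0)\<^sup>2 > 0"
  proof -
    have "\<not> (AE x in lborel. of_real (norm x) * ?G x = 0)"
    proof
      assume "AE x in lborel. of_real (norm x) * ?G x = 0"
      moreover have "AE x::real^'n in lborel. x \<noteq> 0" using AE_lborel_singleton[of "0::real^'n"] by simp
      ultimately have "AE x::real^'n in lborel. False" by eventually_elim (simp add: gauss_exp_nonzero)
      then show False using not_AE_False_lborel by blast
    qed
    then have "L2_sq (\<lambda>x. of_real (norm x) * ?G x) > 0" by (rule L2_sq_pos[OF in_L2_norm_mult_gauss])
    then show ?thesis unfolding in_H_1_fourier(2)[OF UH UF, symmetric] by (simp add: zero_less_mult_iff)
  qed
  \<comment> \<open>The transform of an extremiser is a Gaussian only up to a null set, so the
    criterion is carried over to \<open>v\<close>.\<close>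
  have moment: "mass_moment v = 0 \<longleftrightarrow> (\<forall>j. Re (b $ j) = 0)"
    if v: "in_L2 v" "in_L2 (\<lambda>x. of_real (norm x) * v x)" and a: "Re a < 0"
      and ae: "AE x in lborel. v x = gauss_exp a b c x" for v a c and b :: "complex^'n"
  proof -
    note [measurable] = in_L2_measurable[OF v(1)]
    have "mass_moment v = mass_moment (gauss_exp a b c)"
      unfolding mass_moment_def by (rule integral_cong_AE) (use ae in \<open>auto elim: eventually_mono\<close>)
    moreover have "in_L2 (\<lambda>x. of_real (norm x) * gauss_exp a b c x)"
      by (rule in_L2_cong_AE[OF v(2)]) (use ae in \<open>auto elim: eventually_mono\<close>)
    ultimately show ?thesis using mass_moment_gauss_exp[OF a] by simp
  qed
  show ?thesis
  proof (intro conjI allI impI; (elim conjE)?)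
    fix u0 :: "real^'n \<Rightarrow> complex" and u assume u0: "in_L2 u0" and s: "schroedinger_solution u0 u"
    obtain v where v: "l2fourier u0 v" "free_solution v u" by (rule schroedinger_solution_free_solution[OF u0 s])
    show "in_multiplier_domain (D_symbol ((2 - real CARD('n)) / 4)) (\<lambda>z. (u z)\<^sup>2)" by (rule D_power_square_deficit_0(1)[OF v])
    have "?q * enn2real (variance_energy 0 v) \<ge> 0" using q by (intro mult_nonneg_nonneg) simp_all
    then show "?T1 u \<le> ?S * L2_norm u0 ^ 4" unfolding D_power_square_deficit_0(2)[OF v] by linarith
  next
    fix u0 :: "real^'n \<Rightarrow> complex" and u assume u0: "in_H 1 u0" and s: "schroedinger_solution u0 u"
    obtain v where v: "has_fourier u0 v" "free_solution v u" by (rule schroedinger_solution_free_solution[OF H2[OF u0] s])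
    show "in_multiplier_domain (D_symbol ((4 - real CARD('n)) / 4)) (\<lambda>z. (u z)\<^sup>2)" by (rule D_power_square_deficit_1(1)[OF u0 v])
    have "?q * ((norm (mass_moment v))\<^sup>2 + enn2real (variance_energy 1 v)) \<ge> 0"
      using q by (intro mult_nonneg_nonneg add_nonneg_nonneg) simp_all
    then show "?T2 u \<le> ?S * (Hdot_norm 1 u0)\<^sup>2 * (L2_norm u0)\<^sup>2" unfolding D_power_square_deficit_1(2)[OF u0 v] by linarith
  next
    fix C assume *: "\<forall>(u0 :: real^'n \<Rightarrow> complex) u. in_L2 u0 \<and> schroedinger_solution u0 u \<longrightarrow> ?T1 u \<le> C * L2_norm u0 ^ 4"
    have "?T1 U = ?S * L2_norm U0 ^ 4" unfolding D_power_square_deficit_0(2)[OF U0 U] variance_energy_gauss_exp by simp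
    moreover have "?T1 U \<le> C * L2_norm U0 ^ 4" using * UL US by blast
    ultimately have "?S * L2_norm U0 ^ 4 \<le> C * L2_norm U0 ^ 4" by simp
    then show "?S \<le> C" by (rule mult_right_le_imp_le) (use pos1 in simp)
  next
    fix C assume *: "\<forall>(u0 :: real^'n \<Rightarrow> complex) u. in_H 1 u0 \<and> schroedinger_solution u0 u \<longrightarrow>
      ?T2 u \<le> C * (Hdot_norm 1 u0)\<^sup>2 * (L2_norm u0)\<^sup>2"
    have "mass_moment ?G = 0" using mass_moment_gauss_exp[OF G in_L2_norm_mult_gauss] by simp
    then have "?T2 U = ?S * (Hdot_norm 1 U0)\<^sup>2 * (L2_norm U0)\<^sup>2"
      unfolding D_power_square_deficit_1(2)[OF UH UF U] variance_energy_gauss_exp by simp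
    moreover have "?T2 U \<le> C * (Hdot_norm 1 U0)\<^sup>2 * (L2_norm U0)\<^sup>2" using * UH US by blast
    ultimately have "?S * ((Hdot_norm 1 U0)\<^sup>2 * (L2_norm U0)\<^sup>2) \<le> C * ((Hdot_norm 1 U0)\<^sup>2 * (L2_norm U0)\<^sup>2)"
      by (simp add: mult.assoc)
    then show "?S \<le> C" by (rule mult_right_le_imp_le) (rule mult_pos_pos[OF pos2 zero_less_power[OF pos1]])
  next
    fix u0 :: "real^'n \<Rightarrow> complex" assume u0: "in_L2 u0" and nz: "\<not> (AE x in lborel. u0 x = 0)"
    show "extremiser1 u0 \<longleftrightarrow> (\<exists>g\<in>gaussians. has_fourier u0 g)"
    proof
      assume "extremiser1 u0"
      then obtain u where s: "schroedinger_solution u0 u" and eq: "?T1 u = ?S * L2_norm u0 ^ 4"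
        unfolding extremiser1_def by blast
      obtain v where hf: "has_fourier u0 v" and v: "l2fourier u0 v" "free_solution v u"
        by (rule schroedinger_solution_free_solution[OF u0 s])
      interpret sol: free_solution v u by (rule v(2))
      have "?q * enn2real (variance_energy 0 v) = 0" using eq unfolding D_power_square_deficit_0(2)[OF v] by linarith
      then have "variance_energy 0 v = 0" using q S D_power_square_deficit_0(3)[OF v] by simp
      then have "radial_pairs v" by (rule variance_energy_zero_imp_radial_pairs[OF sol.v_meas])
      then obtain a b c where a: "Re a < 0" and ae: "AE x in lborel. v x = gauss_exp a b c x"
        by (rule radial_pairs_imp_gauss_exp[OF assms sol.v l2fourier_nonzero[OF v(1) nz]])
      have "has_fourier u0 (gauss_exp a b c)" by (rule has_fourier_cong_AE[OF u0 hf ae gauss_exp_measurable])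
      then show "\<exists>g\<in>gaussians. has_fourier u0 g" using a gaussians_iff by blast
    next
      assume "\<exists>g\<in>gaussians. has_fourier u0 g"
      then obtain a b c where a: "Re a < 0" and hf: "has_fourier u0 (gauss_exp a b c)"
        unfolding Bex_def gaussians_iff by blast
      obtain u where u: "free_solution (gauss_exp a b c) u" using gauss_solution[OF a] by blast
      have "?T1 u = ?S * L2_norm u0 ^ 4"
        unfolding D_power_square_deficit_0(2)[OF has_fourier_l2fourier[OF u0 hf] u] variance_energy_gauss_exp by simp
      with free_solution_schroedinger[OF u hf] show "extremiser1 u0" unfolding extremiser1_def by blast
    qed
  next
    fix u0 :: "real^'n \<Rightarrow> complex" assume u0: "in_H 1 u0" and nz: "\<not> (AE x in lborel. u0 x = 0)"
    note L = H2[OF u0]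
    show "extremiser2 u0 \<longleftrightarrow> (\<exists>g\<in>gaussians_r. has_fourier u0 g)"
    proof
      assume "extremiser2 u0"
      then obtain u where s: "schroedinger_solution u0 u" and eq: "?T2 u = ?S * (Hdot_norm 1 u0)\<^sup>2 * (L2_norm u0)\<^sup>2"
        unfolding extremiser2_def by blast
      obtain v where l: "l2fourier u0 v" and v: "has_fourier u0 v" "free_solution v u"
        by (rule schroedinger_solution_free_solution[OF L s])
      interpret sol: free_solution v u by (rule v(2))
      have "?q * ((norm (mass_moment v))\<^sup>2 + enn2real (variance_energy 1 v)) = 0"
        using eq unfolding D_power_square_deficit_1(2)[OF u0 v] by linarith
      then have "(norm (mass_moment v))\<^sup>2 + enn2real (variance_energy 1 v) = 0" using q S by simp
      then have "(norm (mass_moment v))\<^sup>2 = 0 \<and> enn2real (variance_energy 1 v) = 0"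
        by (subst (asm) add_nonneg_eq_0_iff) simp_all
      then have m: "mass_moment v = 0" and "variance_energy 1 v = 0" using D_power_square_deficit_1(3)[OF u0 v] by auto
      from this(2) have "radial_pairs v" by (rule variance_energy_zero_imp_radial_pairs[OF sol.v_meas])
      then obtain a b c where a: "Re a < 0" and ae: "AE x in lborel. v x = gauss_exp a b c x"
        by (rule radial_pairs_imp_gauss_exp[OF assms sol.v l2fourier_nonzero[OF l nz]])
      have "\<forall>j. Re (b $ j) = 0" using moment[OF sol.v in_H_1_fourier(1)[OF u0 v(1)] a ae] m by simp
      moreover have "has_fourier u0 (gauss_exp a b c)" by (rule has_fourier_cong_AE[OF L v(1) ae gauss_exp_measurable])
      ultimately show "\<exists>g\<in>gaussians_r. has_fourier u0 g" using a gaussians_r_iff by blast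
    next
      assume "\<exists>g\<in>gaussians_r. has_fourier u0 g"
      then obtain a b c where a: "Re a < 0" and b: "\<forall>j. Re (b $ j) = 0" and hf: "has_fourier u0 (gauss_exp a b c)"
        unfolding Bex_def gaussians_r_iff by blast
      obtain u where u: "free_solution (gauss_exp a b c) u" using gauss_solution[OF a] by blast
      have "mass_moment (gauss_exp a b c) = 0" using mass_moment_gauss_exp[OF a in_H_1_fourier(1)[OF u0 hf]] b by simp
      then have "?T2 u = ?S * (Hdot_norm 1 u0)\<^sup>2 * (L2_norm u0)\<^sup>2"
        unfolding D_power_square_deficit_1(2)[OF u0 hf u] variance_energy_gauss_exp by simp
      with free_solution_schroedinger[OF u hf] show "extremiser2 u0" unfolding extremiser2_def by blast
    qed
  qed
qed

end
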